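(* Let $(A,\mathfrak{m})$ be a hypersurface ring with $\dim A>0$, and let $M$ be a maximal Cohen–Macaulay $A$-module. Then the Hilbert function $n\mapsto H(M,n)$ of $M$ (with respect to $\mathfrak{m}$) is non-decreasing.
   Context: All rings are Noetherian, all modules finitely generated. For a local ring $(A,\mathfrak{m})$ and a finite $A$-module $M$, $\lambda(\cdot)$ denotes length and the Hilbert function of $M$ is $H(M,n)=\lambda(\mathfrak{m}^nM/\mathfrak{m}^{n+1}M)$ for $n\ge 0$. A local ring $A$ is a hypersurface ring if its $\mathfrak{m}$-adic completion is isomorphic to $Q/(f)$ for a regular local ring $(Q,\mathfrak{n})$ and a nonzero $f\in\mathfrak{n}^2$. A maximal Cohen–Macaulay (MCM) module is a finite module $M$ with $\operatorname{depth}M=\dim A$. *)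

theory Defs
  imports "HOL-Algebra.QuotRing" "HOL-Algebra.Ideal_Product" "HOL-Algebra.Module" "HOL-Algebra.Ring_Divisibility" "HOL-Library.Extended_Nat"
begin

primrec ideal_pow :: "('a, 'e) ring_scheme \<Rightarrow> 'a set \<Rightarrow> nat \<Rightarrow> 'a set" where
  "ideal_pow R I 0 = carrier R"
| "ideal_pow R I (Suc n) = ideal_prod R I (ideal_pow R I n)"

definition local_ring :: "('a, 'e) ring_scheme \<Rightarrow> 'a set \<Rightarrow> bool" where
  "local_ring R m \<longleftrightarrow> cring R \<and> noetherian_ring R \<and> maximalideal m R
     \<and> (\<forall>I. maximalideal I R \<longrightarrow> I = m)"

definition prime_chain :: "('a, 'e) ring_scheme \<Rightarrow> 'a set list \<Rightarrow> bool" where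
  "prime_chain R Ps \<longleftrightarrow> Ps \<noteq> [] \<and> (\<forall>P\<in>set Ps. primeideal P R) \<and> sorted_wrt (\<subset>) Ps"

definition krull_dim :: "('a, 'e) ring_scheme \<Rightarrow> enat" where
  "krull_dim R = (SUP Ps \<in> {Ps. prime_chain R Ps}. enat (length Ps - 1))"

definition regular_local_ring :: "('a, 'e) ring_scheme \<Rightarrow> 'a set \<Rightarrow> bool" where
  "regular_local_ring Q n \<longleftrightarrow> local_ring Q n \<and>
     krull_dim Q = enat (LEAST k. \<exists>S. finite S \<and> S \<subseteq> carrier Q \<and> card S = k \<and> genideal Q S = n)"

text \<open>The m-adic completion, as the inverse limit of the rings A / m^k
  (compatible sequences of cosets), with componentwise operations.\<close>
definition compl_carrier :: "('a, 'e) ring_scheme \<Rightarrow> 'a set \<Rightarrow> (nat \<Rightarrow> 'a set) set" where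
  "compl_carrier A m = {x. (\<forall>k. x k \<in> carrier (A Quot ideal_pow A m k)) \<and> (\<forall>k. x (Suc k) \<subseteq> x k)}"

definition compl_mult :: "('a, 'e) ring_scheme \<Rightarrow> 'a set \<Rightarrow> (nat \<Rightarrow> 'a set) \<Rightarrow> (nat \<Rightarrow> 'a set) \<Rightarrow> nat \<Rightarrow> 'a set" where
  "compl_mult A m x y k = x k \<otimes>\<^bsub>A Quot ideal_pow A m k\<^esub> y k"

definition compl_add :: "('a, 'e) ring_scheme \<Rightarrow> 'a set \<Rightarrow> (nat \<Rightarrow> 'a set) \<Rightarrow> (nat \<Rightarrow> 'a set) \<Rightarrow> nat \<Rightarrow> 'a set" where
  "compl_add A m x y k = x k \<oplus>\<^bsub>A Quot ideal_pow A m k\<^esub> y k"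

definition compl_one :: "('a, 'e) ring_scheme \<Rightarrow> 'a set \<Rightarrow> nat \<Rightarrow> 'a set" where
  "compl_one A m k = \<one>\<^bsub>A Quot ideal_pow A m k\<^esub>"

definition compl_zero :: "('a, 'e) ring_scheme \<Rightarrow> 'a set \<Rightarrow> nat \<Rightarrow> 'a set" where
  "compl_zero A m k = \<zero>\<^bsub>A Quot ideal_pow A m k\<^esub>"

definition completion :: "('a, 'e) ring_scheme \<Rightarrow> 'a set \<Rightarrow> (nat \<Rightarrow> 'a set) ring" where
  "completion A m = \<lparr>carrier = compl_carrier A m, monoid.mult = compl_mult A m,
     monoid.one = compl_one A m, ring.zero = compl_zero A m, ring.add = compl_add A m\<rparr>"

definition hypersurface_presentation ::
  "('a, 'e) ring_scheme \<Rightarrow> 'a set \<Rightarrow> ('c, 'd) ring_scheme \<Rightarrow> 'c set \<Rightarrow> 'c \<Rightarrow> bool" where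
  "hypersurface_presentation A m Q n f \<longleftrightarrow>
     local_ring A m \<and> regular_local_ring Q n \<and> f \<in> ideal_pow Q n 2 \<and> f \<noteq> \<zero>\<^bsub>Q\<^esub>
     \<and> completion A m \<simeq> (Q Quot (PIdl\<^bsub>Q\<^esub> f))"

definition gen_submodule :: "('a, 'e) ring_scheme \<Rightarrow> ('a, 'b) module \<Rightarrow> 'b set \<Rightarrow> 'b set" where
  "gen_submodule R M S = \<Inter>{N. submodule N R M \<and> S \<subseteq> N}"

definition fin_gen_module :: "('a, 'e) ring_scheme \<Rightarrow> ('a, 'b) module \<Rightarrow> bool" where
  "fin_gen_module R M \<longleftrightarrow> (\<exists>S. finite S \<and> S \<subseteq> carrier M \<and> gen_submodule R M S = carrier M)"

definition ideal_smult :: "('a, 'e) ring_scheme \<Rightarrow> ('a, 'b) module \<Rightarrow> 'a set \<Rightarrow> 'b set \<Rightarrow> 'b set" where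
  "ideal_smult R M I N = gen_submodule R M {a \<odot>\<^bsub>M\<^esub> x | a x. a \<in> I \<and> x \<in> N}"

definition submodule_chain ::
  "('a, 'e) ring_scheme \<Rightarrow> ('a, 'b) module \<Rightarrow> 'b set \<Rightarrow> 'b set \<Rightarrow> 'b set list \<Rightarrow> bool" where
  "submodule_chain R M N' N Ns \<longleftrightarrow> Ns \<noteq> [] \<and> hd Ns = N' \<and> last Ns = N
     \<and> (\<forall>L\<in>set Ns. submodule L R M) \<and> sorted_wrt (\<subset>) Ns"

definition quotient_length ::
  "('a, 'e) ring_scheme \<Rightarrow> ('a, 'b) module \<Rightarrow> 'b set \<Rightarrow> 'b set \<Rightarrow> enat" where
  "quotient_length R M N' N = (SUP Ns \<in> {Ns. submodule_chain R M N' N Ns}. enat (length Ns - 1))"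

definition hilbert_fn :: "('a, 'e) ring_scheme \<Rightarrow> 'a set \<Rightarrow> ('a, 'b) module \<Rightarrow> nat \<Rightarrow> enat" where
  "hilbert_fn R m M n = quotient_length R M
     (ideal_smult R M (ideal_pow R m (Suc n)) (carrier M))
     (ideal_smult R M (ideal_pow R m n) (carrier M))"

definition regular_sequence :: "('a, 'e) ring_scheme \<Rightarrow> 'a set \<Rightarrow> ('a, 'b) module \<Rightarrow> 'a list \<Rightarrow> bool" where
  "regular_sequence R m M xs \<longleftrightarrow> set xs \<subseteq> m
     \<and> (\<forall>i < length xs. \<forall>v \<in> carrier M.
          (xs ! i) \<odot>\<^bsub>M\<^esub> v \<in> ideal_smult R M (genideal R (set (take i xs))) (carrier M)
          \<longrightarrow> v \<in> ideal_smult R M (genideal R (set (take i xs))) (carrier M))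
     \<and> ideal_smult R M (genideal R (set xs)) (carrier M) \<noteq> carrier M"

definition depth :: "('a, 'e) ring_scheme \<Rightarrow> 'a set \<Rightarrow> ('a, 'b) module \<Rightarrow> enat" where
  "depth R m M = (SUP xs \<in> {xs. regular_sequence R m M xs}. enat (length xs))"

definition maximal_CM :: "('a, 'e) ring_scheme \<Rightarrow> 'a set \<Rightarrow> ('a, 'b) module \<Rightarrow> bool" where
  "maximal_CM R m M \<longleftrightarrow> module R M \<and> fin_gen_module R M \<and> depth R m M = krull_dim R"

end

theory Submission
  imports Defs
begin

text \<open>
  Write \<open>Q\<close> with maximal ideal \<open>n\<close> for the regular local ring and \<open>e\<close> for its dimension. The completion of
  \<open>M\<close> is a \<open>Q\<close>-module of depth at least \<open>e - 1\<close>, hence the cokernel of a square matrix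
  \<open>\<phi>\<close> acting on \<open>F = Q\<^sup>r\<close>. Let \<open>V k\<close> be the preimage of \<open>n\<^sup>k F\<close> under \<open>\<phi>\<close>. Kernel and cokernel of the
  endomorphism induced by \<open>\<phi>\<close> on \<open>F / n\<^sup>k F\<close> have the same length, so
  \<open>M / m\<^sup>k M\<close> and \<open>V k / n\<^sup>k F\<close> do. Pick \<open>x\<close> and \<open>y\<close> in a regular system of parameters; this needs \<open>e \<ge> 2\<close>.
  Since \<open>x\<close> is regular on the associated graded ring, multiplication by \<open>x\<close> embeds \<open>V k / n\<^sup>k F\<close> into
  \<open>V (k + 1) / n\<^sup>k\<^sup>+\<^sup>1 F\<close>, and the cokernel has length \<open>H(M, k)\<close>. Since \<open>y\<close> is regular on the
  associated graded ring of \<open>Q / (x)\<close>, multiplication by \<open>y\<close> embeds each of these cokernels into the next.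

  No localization, no associated graded ring and no Koszul complex is needed: localization at a prime is replaced
  by saturation, a dimension is bounded from above by the principal ideal theorem and from below by the growth
  of lengths, and regularity of a parameter on the associated graded ring by an induction over colon ideals.
\<close>

section \<open>Submodules\<close>

text \<open>The condition e \<ge> 2 is where dim A > 0 and f \<noteq> 0 enter: if e \<le> 1, then n
  is the only prime over f, so some n^l lies in (f), hence m^l = 0 and A has no chain of two primes.
  The depth e - 1 rests on dim A \<ge> e - 1, which is read off from growth: the length of A/m^k is
  at least that of Q/((f) + n^k), and the latter is not O(k^(e-2)). The completion of M is never
  formed. After r generators of M are fixed, it is represented by a submodule N of F generated by
  lifts of the relations over A: for every k, N + n^k F is the kernel of F -> M/m^k M. Lengths and
  regular elements are transported through these kernels. The matrix is square because the induction
  on depth yields r generators of N, as many as the chosen generators of M; zero columns are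
  allowed. Quotients are not formed either: a statement on M/N is one on submodules of M above N,
  and a length inequality is a strictly increasing map between intervals of submodules.\<close>

definition sat :: "('a, 'e) ring_scheme \<Rightarrow> ('a, 'b) module \<Rightarrow> 'a set \<Rightarrow> 'b set \<Rightarrow> 'b set" where
  "sat R M P N = {v \<in> carrier M. \<exists>s \<in> carrier R - P. s \<odot>\<^bsub>M\<^esub> v \<in> N}"

text \<open>With the ring as a module over itself, ideals are submodules; facts on sums, saturation,
  length and Nakayama are then proved once, for modules.\<close>

definition ring_mod :: "('a, 'e) ring_scheme \<Rightarrow> ('a, 'a) module" where
  "ring_mod R = \<lparr>carrier = carrier R, monoid.mult = monoid.mult R, one = one R, zero = zero R, add = add R, smult = monoid.mult R\<rparr>"

locale rmodule = module R M for R :: "('a, 'e) ring_scheme" (structure) and M :: "('a, 'b) module" (structure)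
begin

abbreviation sub :: "'b set \<Rightarrow> bool" where "sub N \<equiv> submodule N R M"
abbreviation madd (infixl "+\<^sub>m" 65) where "x +\<^sub>m y \<equiv> x \<oplus>\<^bsub>M\<^esub> y"
abbreviation msum (infixl "\<uplus>" 65) where "N \<uplus> L \<equiv> N <+>\<^bsub>M\<^esub> L"
abbreviation msmult (infixr "\<bullet>" 72) where "a \<bullet> x \<equiv> a \<odot>\<^bsub>M\<^esub> x"
abbreviation scl (infixr "\<bullet>\<bullet>" 72) where "a \<bullet>\<bullet> N \<equiv> (\<lambda>v. a \<odot>\<^bsub>M\<^esub> v) ` N"
abbreviation ism (infixr "\<star>" 72) where "I \<star> N \<equiv> ideal_smult R M I N"

lemma subI:
  assumes "N \<subseteq> carrier M" "\<zero>\<^bsub>M\<^esub> \<in> N" "\<And>x y. x \<in> N \<Longrightarrow> y \<in> N \<Longrightarrow> x +\<^sub>m y \<in> N"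
    "\<And>a x. a \<in> carrier R \<Longrightarrow> x \<in> N \<Longrightarrow> a \<bullet> x \<in> N"
  shows "sub N"
proof (rule submoduleI)
  fix a assume a: "a \<in> N"
  have "(\<ominus> \<one>) \<bullet> a \<in> N" using a assms(4) by blast
  moreover have "(\<ominus> \<one>) \<bullet> a = \<ominus>\<^bsub>M\<^esub> a"
    using a assms(1) by (simp add: smult_l_minus subset_iff)
  ultimately show "\<ominus>\<^bsub>M\<^esub> a \<in> N" by simp
qed (use assms in auto)

lemma sub_carr: "sub N \<Longrightarrow> x \<in> N \<Longrightarrow> x \<in> carrier M"
  using submoduleE(1) by blast
lemma sub_subset: "sub N \<Longrightarrow> N \<subseteq> carrier M"
  using submoduleE(1) by blast
lemma sub_add: "sub N \<Longrightarrow> x \<in> N \<Longrightarrow> y \<in> N \<Longrightarrow> x +\<^sub>m y \<in> N"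
  using submoduleE(5) by blast
lemma sub_smult: "sub N \<Longrightarrow> a \<in> carrier R \<Longrightarrow> x \<in> N \<Longrightarrow> a \<bullet> x \<in> N"
  using submoduleE(4) by blast
lemma sub_neg: "sub N \<Longrightarrow> x \<in> N \<Longrightarrow> \<ominus>\<^bsub>M\<^esub> x \<in> N"
  using submoduleE(3) by blast
lemma sub_zero: "sub N \<Longrightarrow> \<zero>\<^bsub>M\<^esub> \<in> N"
  using submoduleE(2) sub_smult[of N \<zero>] sub_carr by fastforce
lemma sub_minus: "sub N \<Longrightarrow> x \<in> N \<Longrightarrow> y \<in> N \<Longrightarrow> x \<ominus>\<^bsub>M\<^esub> y \<in> N"
  by (simp add: a_minus_def sub_add sub_neg)

lemma sub_cancel:
  assumes "sub N" "a \<in> N" "a +\<^sub>m b \<in> N" "b \<in> carrier M"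
  shows "b \<in> N"
proof -
  have a: "a \<in> carrier M" using assms sub_carr by blast
  have "\<ominus>\<^bsub>M\<^esub> a +\<^sub>m (a +\<^sub>m b) \<in> N" using assms sub_add sub_neg by blast
  moreover have "\<ominus>\<^bsub>M\<^esub> a +\<^sub>m (a +\<^sub>m b) = b" using a assms(4) by (simp add: M.r_neg1)
  ultimately show ?thesis by simp
qed

lemma sub_cancel':
  assumes "sub N" "b \<in> N" "a +\<^sub>m b \<in> N" "a \<in> carrier M"
  shows "a \<in> N"
  using sub_cancel[of N b a] assms sub_carr[of N b] by (simp add: M.a_comm)

lemma sub_minus_cancel:
  assumes "sub N" "x \<ominus>\<^bsub>M\<^esub> y \<in> N" "y \<in> N" "x \<in> carrier M"
  shows "x \<in> N"
proof -
  have "y \<in> carrier M" using assms sub_carr by blast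
  hence "x = (x \<ominus>\<^bsub>M\<^esub> y) +\<^sub>m y" using assms(4) by (simp add: a_minus_def M.a_assoc M.l_neg)
  thus ?thesis using assms sub_add by metis
qed

lemma sub_Int: "sub N \<Longrightarrow> sub L \<Longrightarrow> sub (N \<inter> L)"
  by (rule subI) (auto intro: sub_carr sub_zero sub_add sub_smult)

lemma sub_Inter: "F \<noteq> {} \<Longrightarrow> (\<And>N. N \<in> F \<Longrightarrow> sub N) \<Longrightarrow> sub (\<Inter>F)"
  by (rule subI) (auto intro: sub_zero sub_add sub_smult dest: sub_carr)

lemma sum_memI: "a \<in> N \<Longrightarrow> b \<in> L \<Longrightarrow> a +\<^sub>m b \<in> N \<uplus> L"
  by (auto simp: set_add_def')
lemma sum_memE:
  assumes "v \<in> N \<uplus> L" obtains a b where "a \<in> N" "b \<in> L" "v = a +\<^sub>m b"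
  using assms by (auto simp: set_add_def')

lemma sum_ub1: "sub N \<Longrightarrow> sub L \<Longrightarrow> N \<subseteq> N \<uplus> L"
proof
  fix v assume "sub N" "sub L" "v \<in> N"
  thus "v \<in> N \<uplus> L" using sum_memI[of v N "\<zero>\<^bsub>M\<^esub>" L] sub_zero sub_carr by simp
qed
lemma sum_ub2: "sub N \<Longrightarrow> sub L \<Longrightarrow> L \<subseteq> N \<uplus> L"
proof
  fix v assume "sub N" "sub L" "v \<in> L"
  thus "v \<in> N \<uplus> L" using sum_memI[of "\<zero>\<^bsub>M\<^esub>" N v L] sub_zero sub_carr by simp
qed
lemma sum_least: "sub K \<Longrightarrow> N \<subseteq> K \<Longrightarrow> L \<subseteq> K \<Longrightarrow> N \<uplus> L \<subseteq> K"
  by (auto elim!: sum_memE intro: sub_add)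

lemma sum_mono: "N \<subseteq> N' \<Longrightarrow> L \<subseteq> L' \<Longrightarrow> N \<uplus> L \<subseteq> N' \<uplus> L'"
  by (auto elim!: sum_memE intro: sum_memI)

lemma sub_sum: assumes "sub N" "sub L" shows "sub (N \<uplus> L)"
proof (rule subI)
  show "N \<uplus> L \<subseteq> carrier M" using assms sub_carr by (auto elim!: sum_memE)
  show "\<zero>\<^bsub>M\<^esub> \<in> N \<uplus> L" using sum_ub1 sub_zero assms by blast
next
  fix x y assume "x \<in> N \<uplus> L" "y \<in> N \<uplus> L"
  then obtain a b c d where h: "a \<in> N" "b \<in> L" "x = a +\<^sub>m b" "c \<in> N" "d \<in> L" "y = c +\<^sub>m d"
    by (meson sum_memE)
  have c: "a \<in> carrier M" "b \<in> carrier M" "c \<in> carrier M" "d \<in> carrier M"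
    using h assms sub_carr by blast+
  have "x +\<^sub>m y = (a +\<^sub>m c) +\<^sub>m (b +\<^sub>m d)" using c h by (simp add: M.a_ac)
  thus "x +\<^sub>m y \<in> N \<uplus> L" using h assms sum_memI sub_add by metis
next
  fix r x assume r: "r \<in> carrier R" and "x \<in> N \<uplus> L"
  then obtain a b where h: "a \<in> N" "b \<in> L" "x = a +\<^sub>m b" by (meson sum_memE)
  have c: "a \<in> carrier M" "b \<in> carrier M" using h assms sub_carr by blast+
  have "r \<bullet> x = r \<bullet> a +\<^sub>m r \<bullet> b" using c h r by (simp add: smult_r_distr)
  thus "r \<bullet> x \<in> N \<uplus> L" using h r assms sum_memI sub_smult by metis
qed

lemma sum_comm: assumes "sub N" "sub L" shows "N \<uplus> L = L \<uplus> N"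
  by (intro equalityI sum_least sub_sum assms sum_ub1 sum_ub2)

lemma sum_assoc: assumes "sub N" "sub L" "sub K" shows "(N \<uplus> L) \<uplus> K = N \<uplus> (L \<uplus> K)"
proof (intro equalityI sum_least sub_sum assms)
  show "N \<subseteq> N \<uplus> (L \<uplus> K)" "K \<subseteq> N \<uplus> L \<uplus> K" using sum_ub1[of N "L \<uplus> K"] sum_ub2[of "N \<uplus> L" K] sub_sum assms by simp_all
  show "L \<subseteq> N \<uplus> (L \<uplus> K)" "K \<subseteq> N \<uplus> (L \<uplus> K)" using sum_ub1[of L K] sum_ub2[of L K] sum_ub2[of N "L \<uplus> K"] sub_sum[of L K] assms by auto
  show "N \<subseteq> N \<uplus> L \<uplus> K" "L \<subseteq> N \<uplus> L \<uplus> K" using sum_ub1[of N L] sum_ub2[of N L] sum_ub1[of "N \<uplus> L" K] sub_sum[of N L] assms by auto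
qed

lemma sub_scl: assumes "a \<in> carrier R" "sub N" shows "sub (a \<bullet>\<bullet> N)"
proof (rule subI)
  show "a \<bullet>\<bullet> N \<subseteq> carrier M" using assms sub_carr by auto
  show "\<zero>\<^bsub>M\<^esub> \<in> a \<bullet>\<bullet> N" using assms sub_zero by (metis image_eqI smult_r_null)
next
  fix x y assume "x \<in> a \<bullet>\<bullet> N" "y \<in> a \<bullet>\<bullet> N"
  then obtain u v where h: "u \<in> N" "v \<in> N" "x = a \<bullet> u" "y = a \<bullet> v" by auto
  hence "x +\<^sub>m y = a \<bullet> (u +\<^sub>m v)" using assms sub_carr by (simp add: smult_r_distr)
  thus "x +\<^sub>m y \<in> a \<bullet>\<bullet> N" using h assms sub_add by blast
next
  fix r x assume r: "r \<in> carrier R" and "x \<in> a \<bullet>\<bullet> N"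
  then obtain u where h: "u \<in> N" "x = a \<bullet> u" by auto
  hence "r \<bullet> x = a \<bullet> (r \<bullet> u)" using assms sub_carr r smult_assoc1 R.m_comm by metis
  thus "r \<bullet> x \<in> a \<bullet>\<bullet> N" using h assms sub_smult r by blast
qed

lemma sub_zero_set: "sub {\<zero>\<^bsub>M\<^esub>}"
  by (rule subI) auto

lemma sub_colon: assumes "a \<in> carrier R" "sub N" shows "sub {v \<in> carrier M. a \<bullet> v \<in> N}"
proof (rule subI)
  fix x y assume h: "x \<in> {v \<in> carrier M. a \<bullet> v \<in> N}" "y \<in> {v \<in> carrier M. a \<bullet> v \<in> N}"
  thus "x +\<^sub>m y \<in> {v \<in> carrier M. a \<bullet> v \<in> N}" using assms sub_add by (auto simp: smult_r_distr)
next
  fix r x assume r: "r \<in> carrier R" and x: "x \<in> {v \<in> carrier M. a \<bullet> v \<in> N}"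
  have "a \<bullet> (r \<bullet> x) = r \<bullet> (a \<bullet> x)" using r x assms smult_assoc1 R.m_comm by (metis (no_types, lifting) mem_Collect_eq)
  thus "r \<bullet> x \<in> {v \<in> carrier M. a \<bullet> v \<in> N}" using r x assms sub_smult by auto
qed (use assms sub_zero in auto)

abbreviation cyc :: "'b \<Rightarrow> 'b set" where "cyc v \<equiv> (\<lambda>a. a \<odot>\<^bsub>M\<^esub> v) ` carrier R"

lemma sub_cyc: assumes "v \<in> carrier M" shows "sub (cyc v)"
proof (rule subI)
  show "\<zero>\<^bsub>M\<^esub> \<in> cyc v" using assms by (metis R.zero_closed image_eqI smult_l_null)
next
  fix x y assume "x \<in> cyc v" "y \<in> cyc v"
  then obtain a b where "a \<in> carrier R" "b \<in> carrier R" "x = a \<bullet> v" "y = b \<bullet> v" by auto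
  hence "x +\<^sub>m y = (a \<oplus> b) \<bullet> v" "a \<oplus> b \<in> carrier R" using assms smult_l_distr by auto
  thus "x +\<^sub>m y \<in> cyc v" by blast
next
  fix r x assume "r \<in> carrier R" "x \<in> cyc v"
  then obtain a where "r \<in> carrier R" "a \<in> carrier R" "x = a \<bullet> v" by auto
  hence "r \<bullet> x = (r \<otimes> a) \<bullet> v" "r \<otimes> a \<in> carrier R" using assms smult_assoc1 by auto
  thus "r \<bullet> x \<in> cyc v" by blast
qed (use assms in auto)

lemma cyc_self: "v \<in> carrier M \<Longrightarrow> v \<in> cyc v"
  by (metis R.one_closed image_eqI smult_one)
lemma cyc_least: "sub N \<Longrightarrow> v \<in> N \<Longrightarrow> cyc v \<subseteq> N"
  using sub_smult by auto

lemma gen_sub: "S \<subseteq> carrier M \<Longrightarrow> sub (gen_submodule R M S)"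
  unfolding gen_submodule_def using carrier_is_submodule by (intro sub_Inter) auto
lemma gen_self: "S \<subseteq> gen_submodule R M S"
  unfolding gen_submodule_def by auto
lemma gen_least: "sub N \<Longrightarrow> S \<subseteq> N \<Longrightarrow> gen_submodule R M S \<subseteq> N"
  unfolding gen_submodule_def by auto

lemma gen_empty: "gen_submodule R M {} = {\<zero>\<^bsub>M\<^esub>}"
  using gen_least[OF sub_zero_set, of "{}"] sub_zero[OF gen_sub[of "{}"]] by auto

lemma gen_insert: assumes "v \<in> carrier M" "S \<subseteq> carrier M"
  shows "gen_submodule R M (insert v S) = gen_submodule R M S \<uplus> cyc v"
proof
  note s = gen_sub[OF assms(2)] sub_cyc[OF assms(1)]
  show "gen_submodule R M (insert v S) \<subseteq> gen_submodule R M S \<uplus> cyc v"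
    using s sum_ub1[OF s] sum_ub2[OF s] gen_self cyc_self[OF assms(1)] by (intro gen_least sub_sum) blast+
  have "sub (gen_submodule R M (insert v S))" using gen_sub assms by simp
  thus "gen_submodule R M S \<uplus> cyc v \<subseteq> gen_submodule R M (insert v S)"
    using gen_self[of "insert v S"] by (intro sum_least gen_least cyc_least) auto
qed

lemma sub_ism: "I \<subseteq> carrier R \<Longrightarrow> sub N \<Longrightarrow> sub (I \<star> N)"
  unfolding ideal_smult_def using sub_carr by (intro gen_sub) fastforce
lemma ism_memI: "a \<in> I \<Longrightarrow> x \<in> N \<Longrightarrow> a \<bullet> x \<in> I \<star> N"
  unfolding ideal_smult_def using gen_self by fastforce
lemma ism_least: "sub L \<Longrightarrow> (\<And>a x. a \<in> I \<Longrightarrow> x \<in> N \<Longrightarrow> a \<bullet> x \<in> L) \<Longrightarrow> I \<star> N \<subseteq> L"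
  unfolding ideal_smult_def by (intro gen_least) auto
lemma ism_mono: "I \<subseteq> carrier R \<Longrightarrow> sub N \<Longrightarrow> sub N' \<Longrightarrow> J \<subseteq> I \<Longrightarrow> N' \<subseteq> N \<Longrightarrow> J \<star> N' \<subseteq> I \<star> N"
  by (intro ism_least sub_ism) (auto intro: ism_memI)
lemma ism_subset: "I \<subseteq> carrier R \<Longrightarrow> sub N \<Longrightarrow> I \<star> N \<subseteq> N"
  by (intro ism_least) (auto intro: sub_smult)

lemma ism_carrier: "sub N \<Longrightarrow> carrier R \<star> N = N"
  using ism_subset[of "carrier R" N] ism_memI[of \<one> "carrier R" _ N] sub_carr by fastforce

lemma ism_prod:
  assumes I: "ideal I R" and J: "ideal J R" and N: "sub N"
  shows "ideal_prod R I J \<star> N = I \<star> (J \<star> N)"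
proof
  note c = ideal.Icarr[OF I] ideal.Icarr[OF J]
  have Ic: "I \<subseteq> carrier R" and Jc: "J \<subseteq> carrier R" using c by auto
  have s: "sub (J \<star> N)" "sub (I \<star> (J \<star> N))" using sub_ism Ic Jc N by auto
  show "ideal_prod R I J \<star> N \<subseteq> I \<star> (J \<star> N)"
  proof (rule ism_least[OF s(2)])
    fix a x assume "a \<in> ideal_prod R I J" and x: "x \<in> N"
    thus "a \<bullet> x \<in> I \<star> (J \<star> N)"
    proof (induction a rule: ideal_prod.induct)
      case (prod i j)
      thus ?case using smult_assoc1[of i j x] c sub_carr[OF N] by (simp add: ism_memI)
    next
      case (sum a b)
      have "a \<in> carrier R" "b \<in> carrier R" using sum ideal_prod_in_carrier[OF I J] by auto
      thus ?case using sum smult_l_distr[of a b x] sub_carr[OF N] sub_add[OF s(2)] by simp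
    qed
  qed
  have p: "sub (ideal_prod R I J \<star> N)" using ideal_prod_in_carrier[OF I J] N sub_ism by blast
  show "I \<star> (J \<star> N) \<subseteq> ideal_prod R I J \<star> N"
  proof (rule ism_least[OF p])
    fix a x assume a: "a \<in> I" and x: "x \<in> J \<star> N"
    \<comment> \<open>For fixed a, the v with a v in (IJ)N form a submodule, so it is enough to look
      at the generators j y of JN.\<close>
    have "J \<star> N \<subseteq> {v \<in> carrier M. a \<bullet> v \<in> ideal_prod R I J \<star> N}"
    proof (rule ism_least)
      show "sub {v \<in> carrier M. a \<bullet> v \<in> ideal_prod R I J \<star> N}" using sub_colon p a c by blast
      fix j y assume jy: "j \<in> J" "y \<in> N"
      have "a \<bullet> j \<bullet> y = (a \<otimes> j) \<bullet> y" using jy a c sub_carr[OF N] smult_assoc1 by auto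
      thus "j \<bullet> y \<in> {v \<in> carrier M. a \<bullet> v \<in> ideal_prod R I J \<star> N}"
        using ism_memI[OF ideal_prod.prod[OF a jy(1)] jy(2)] jy c sub_carr[OF N] by auto
    qed
    thus "a \<bullet> x \<in> ideal_prod R I J \<star> N" using x by auto
  qed
qed

lemma ideal_pow_ideal: "ideal I R \<Longrightarrow> ideal (ideal_pow R I k) R"
  by (induction k) (auto intro: oneideal ideal_prod_is_ideal)

lemma ideal_pow_carr: "ideal I R \<Longrightarrow> ideal_pow R I k \<subseteq> carrier R"
  using ideal.Icarr[OF ideal_pow_ideal] by auto

lemma ism_pow_Suc: "ideal I R \<Longrightarrow> sub N \<Longrightarrow> ideal_pow R I (Suc k) \<star> N = I \<star> (ideal_pow R I k \<star> N)"
  using ism_prod ideal_pow_ideal by simp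

end

section \<open>Noetherian modules, Nakayama, Artin-Rees and Krull\<close>

abbreviation (in cring) isum (infixl "+\<^sub>i" 65) where "I +\<^sub>i J \<equiv> I <+>\<^bsub>R\<^esub> J"

locale nring = cring R + noetherian_ring R for R :: "('a, 'e) ring_scheme" (structure)
begin

text \<open>Zorn's lemma applies because a nonempty chain of ideals in a Noetherian ring contains
  its own union.\<close>

lemma ideal_max:
  assumes "F \<noteq> {}" "\<And>I. I \<in> F \<Longrightarrow> ideal I R"
  shows "\<exists>W\<in>F. \<forall>V\<in>F. W \<subseteq> V \<longrightarrow> V = W"
proof (rule subset_Zorn)
  fix C assume C: "subset.chain F C"
  show "\<exists>U\<in>F. \<forall>X\<in>C. X \<subseteq> U"
  proof (cases "C = {}")
    case False
    have "subset.chain {I. ideal I R} C" using C assms(2) unfolding subset.chain_def by blast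
    hence "\<Union>C \<in> C" using ideal_chain_is_trivial False by blast
    moreover have "C \<subseteq> F" using C by (simp add: subset.chain_def)
    ultimately show ?thesis by blast
  qed (use assms in auto)
qed

text \<open>Noetherian induction in its most used form. Several primes below are found as ideals
  that are maximal with a suitable property.\<close>

lemma ideal_maxE:
  assumes "ideal I R" "Q I"
  obtains W where "ideal W R" "Q W" "\<And>V. ideal V R \<Longrightarrow> Q V \<Longrightarrow> W \<subseteq> V \<Longrightarrow> V = W"
proof -
  have "\<exists>W\<in>{W. ideal W R \<and> Q W}. \<forall>V\<in>{W. ideal W R \<and> Q W}. W \<subseteq> V \<longrightarrow> V = W"
    by (rule ideal_max) (use assms in auto)
  thus ?thesis using that by auto
qed

lemma ideal_acc:
  assumes "\<And>k. ideal (f k) R" "\<And>k. f k \<subseteq> f (Suc k)"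
  shows "\<exists>k::nat. \<forall>j\<ge>k. f j = f k"
proof -
  obtain W where "W \<in> range f" "\<forall>V\<in>range f. W \<subseteq> V \<longrightarrow> V = W"
    using ideal_max[of "range f"] assms(1) by blast
  thus ?thesis using lift_Suc_mono_le[of f, OF assms(2)] by (metis rangeE rangeI)
qed

end

context cring
begin

lemma primeideal_criterion:
  assumes "ideal J R" "J \<noteq> carrier R"
    "\<And>a b. a \<in> carrier R - J \<Longrightarrow> b \<in> carrier R - J \<Longrightarrow> a \<otimes> b \<notin> J"
  shows "primeideal J R"
  using assms by (intro primeidealI is_cring) auto

lemma rmodule_ring_mod: "rmodule R (ring_mod R)"
proof -
  have "abelian_group (ring_mod R)"
    by (rule abelian_groupI) (auto simp: ring_mod_def a_ac intro: bexI[of _ "\<ominus> _"] l_neg)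
  thus ?thesis unfolding rmodule_def
    by (intro moduleI is_cring) (auto simp: ring_mod_def l_distr r_distr m_assoc)
qed

lemma ring_mod_simps [simp]:
  "carrier (ring_mod R) = carrier R" "add (ring_mod R) = add R" "smult (ring_mod R) = monoid.mult R"
  "zero (ring_mod R) = zero R"
  by (auto simp: ring_mod_def)

lemma set_add_ring_mod [simp]: "I <+>\<^bsub>ring_mod R\<^esub> J = I +\<^sub>i J"
  by (auto simp: set_add_def')

lemma submodule_ring_mod [simp]: "submodule I R (ring_mod R) \<longleftrightarrow> ideal I R"
proof
  interpret rm: rmodule R "ring_mod R" by (rule rmodule_ring_mod)
  assume s: "submodule I R (ring_mod R)"
  show "ideal I R"
  proof (rule idealI[OF ring_axioms])
    show "subgroup I (add_monoid R)"
    proof (rule group.subgroupI[OF a_group])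
      show "I \<subseteq> carrier (add_monoid R)" "I \<noteq> {}" using rm.sub_subset[OF s] rm.sub_zero[OF s] by auto
      show "inv\<^bsub>add_monoid R\<^esub> a \<in> I" if "a \<in> I" for a
      proof -
        have "\<ominus> \<one> \<otimes> a \<in> I" using rm.sub_smult[OF s _ that, of "\<ominus> \<one>"] by simp
        thus ?thesis using rm.sub_carr[OF s that] l_minus[of \<one> a] by (simp add: a_inv_def)
      qed
      show "a \<otimes>\<^bsub>add_monoid R\<^esub> b \<in> I" if "a \<in> I" "b \<in> I" for a b
        using rm.sub_add[OF s that] by simp
    qed
    show "x \<otimes> a \<in> I" "a \<otimes> x \<in> I" if "a \<in> I" "x \<in> carrier R" for a x
      using rm.sub_smult[OF s that(2,1)] rm.sub_carr[OF s that(1)] that m_comm by auto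
  qed
next
  interpret rm: rmodule R "ring_mod R" by (rule rmodule_ring_mod)
  assume "ideal I R"
  then interpret ideal I R .
  show "submodule I R (ring_mod R)"
    by (rule rm.subI) (auto simp: I_l_closed)
qed

lemma PIdl_eq_cyc: "PIdl a = (\<lambda>r. r \<otimes> a) ` carrier R"
  unfolding cgenideal_def by auto

lemma pow_ideal: "ideal I R \<Longrightarrow> ideal (ideal_pow R I k) R"
  by (induction k) (auto intro: oneideal ideal_prod_is_ideal)

lemma pow_add: "ideal I R \<Longrightarrow> ideal_pow R I (j + k) = ideal_prod R (ideal_pow R I j) (ideal_pow R I k)"
proof (induction j)
  case 0
  thus ?case using ideal_prod_commute[OF oneideal pow_ideal, of I k] ideal_prod_one[OF pow_ideal, of I k] by simp
next
  case (Suc j)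
  thus ?case using ideal_prod_assoc[of I "ideal_pow R I j" "ideal_pow R I k"] pow_ideal by simp
qed

lemma ideal_prod_least:
  assumes "ideal K R" "\<And>a b. a \<in> I \<Longrightarrow> b \<in> J \<Longrightarrow> a \<otimes> b \<in> K"
  shows "ideal_prod R I J \<subseteq> K"
proof
  fix x assume "x \<in> ideal_prod R I J"
  thus "x \<in> K" using assms(2)
    by induction (auto intro: additive_subgroup.a_closed ideal.axioms(1) assms(1))
qed

lemma pow_one: "ideal I R \<Longrightarrow> ideal_pow R I (Suc 0) = I"
  using ideal_prod_one by simp

lemma pow_Suc_subset: "ideal I R \<Longrightarrow> ideal_pow R I (Suc k) \<subseteq> ideal_pow R I k"
  using ideal_prod_inter[OF _ pow_ideal, of I I k] by auto

lemma pow_antimono: "ideal I R \<Longrightarrow> j \<le> k \<Longrightarrow> ideal_pow R I k \<subseteq> ideal_pow R I j"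
  using lift_Suc_antimono_le[of "ideal_pow R I" j k] pow_Suc_subset by blast

lemma pow_mem: "ideal I R \<Longrightarrow> a \<in> I \<Longrightarrow> a [^] k \<in> ideal_pow R I k"
proof (induction k)
  case (Suc k)
  have "a \<in> carrier R" using Suc ideal.Icarr by metis
  thus ?case using ideal_prod.prod[of a I "a [^] k" "ideal_pow R I k" R] Suc
    by (simp add: m_comm)
qed simp

text \<open>Each of the four products obtained by expanding has a factor in K or is a multiple of a
  b. This is the core of the primality proofs: a property gained by K + (a) and by K + (b) is
  multiplied back into K.\<close>

lemma prod_sum_PIdl:
  assumes K: "ideal K R" and c: "a \<in> carrier R" "b \<in> carrier R" and ab: "a \<otimes> b \<in> K"
    and x: "x \<in> K +\<^sub>i PIdl a" and y: "y \<in> K +\<^sub>i PIdl b"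
  shows "x \<otimes> y \<in> K"
proof -
  obtain k r k' r' where h: "x = k \<oplus> r \<otimes> a" "k \<in> K" "r \<in> carrier R"
    "y = k' \<oplus> r' \<otimes> b" "k' \<in> K" "r' \<in> carrier R"
    using x y unfolding set_add_def' PIdl_eq_cyc by blast
  have c': "k \<in> carrier R" "k' \<in> carrier R" using h ideal.Icarr[OF K] by auto
  have "x \<otimes> y = y \<otimes> k \<oplus> ((r \<otimes> a) \<otimes> k' \<oplus> (r \<otimes> r') \<otimes> (a \<otimes> b))"
    using h c c' by (simp add: l_distr r_distr m_ac a_ac)
  thus ?thesis using h c c' ab ideal.I_l_closed[OF K]
      additive_subgroup.a_closed[OF ideal.axioms(1)[OF K]] by auto
qed

end

context nring
begin

text \<open>An ideal K over J that is maximal among those containing no power of m is prime: powers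
  of m inside K + (a) and K + (b) multiply into K. Being prime, K contains each a in m along with a
  power of it, and so contains m, a contradiction.\<close>

lemma rad_pow:
  assumes m: "ideal m R" and J: "ideal J R" and rad: "\<And>a. a \<in> m \<Longrightarrow> \<exists>j::nat. a [^] j \<in> J"
  shows "\<exists>l. ideal_pow R m l \<subseteq> J"
proof (rule ccontr)
  assume no: "\<nexists>l. ideal_pow R m l \<subseteq> J"
  obtain K where Ki: "ideal K R" and K: "J \<subseteq> K \<and> (\<nexists>l. ideal_pow R m l \<subseteq> K)"
    and mx: "\<And>V. ideal V R \<Longrightarrow> J \<subseteq> V \<and> (\<nexists>l. ideal_pow R m l \<subseteq> V) \<Longrightarrow> K \<subseteq> V \<Longrightarrow> V = K"
    by (rule ideal_maxE[of J "\<lambda>K. J \<subseteq> K \<and> (\<nexists>l. ideal_pow R m l \<subseteq> K)"]) (use J no in auto)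
  interpret rm: rmodule R "ring_mod R" by (rule rmodule_ring_mod)
  have "primeideal K R"
  proof (rule primeideal_criterion[OF Ki])
    have "ideal_pow R m 0 \<subseteq> carrier R" by simp
    thus "K \<noteq> carrier R" using K by blast
  next
    fix a b assume a: "a \<in> carrier R - K" and b: "b \<in> carrier R - K"
    have *: "\<exists>l. ideal_pow R m l \<subseteq> K +\<^sub>i PIdl c" if c: "c \<in> carrier R - K" for c
    proof -
      have i: "ideal (K +\<^sub>i PIdl c) R" "ideal (PIdl c) R" using c Ki cgenideal_ideal add_ideals by auto
      have "K \<subseteq> K +\<^sub>i PIdl c" "PIdl c \<subseteq> K +\<^sub>i PIdl c"
        using rm.sum_ub1[of K "PIdl c"] rm.sum_ub2[of K "PIdl c"] i Ki by auto
      moreover have "c \<in> PIdl c" using c cgenideal_self by blast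
      ultimately show ?thesis using mx[OF i(1)] K c by blast
    qed
    obtain l where l: "ideal_pow R m l \<subseteq> K +\<^sub>i PIdl a" using *[OF a] by blast
    obtain l' where l': "ideal_pow R m l' \<subseteq> K +\<^sub>i PIdl b" using *[OF b] by blast
    show "a \<otimes> b \<notin> K"
    proof
      assume ab: "a \<otimes> b \<in> K"
      have "ideal_prod R (ideal_pow R m l) (ideal_pow R m l') \<subseteq> K"
      proof (rule ideal_prod_least[OF Ki])
        fix x y assume "x \<in> ideal_pow R m l" "y \<in> ideal_pow R m l'"
        thus "x \<otimes> y \<in> K" using prod_sum_PIdl[OF Ki _ _ ab] l l' a b by blast
      qed
      hence "ideal_pow R m (l + l') \<subseteq> K" using pow_add[OF m, of l l'] by simp
      thus False using K by blast
    qed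
  qed
  then interpret K: primeideal K R .
  have "m \<subseteq> K"
  proof
    fix a assume a: "a \<in> m"
    have ac: "a \<in> carrier R" using a m ideal.Icarr by metis
    obtain j where "a [^] (j::nat) \<in> K" using rad[OF a] K by blast
    thus "a \<in> K"
    proof (induction j)
      case 0
      thus ?case using K.I_notcarr K.one_imp_carrier by auto
    next
      case (Suc j)
      thus ?case using K.I_prime[of "a [^] j" a] ac by auto
    qed
  qed
  hence "ideal_pow R m (Suc 0) \<subseteq> K" using pow_one[OF m] by simp
  thus False using K by blast
qed

text \<open>Induction on the generators. In the span of S and v a chain is controlled by its traces
  on the span G of S and by the ideals of those a with a v in f k + G. The traces stabilize by
  induction, the ideals because the ring is Noetherian.\<close>

lemma fg_mod_acc:
  assumes M: "rmodule R M" and "finite S" "S \<subseteq> carrier M"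
    and "\<And>k. submodule (f k) R M" "\<And>k. f k \<subseteq> f (Suc k)" "\<And>k. f k \<subseteq> gen_submodule R M S"
  shows "\<exists>k::nat. \<forall>j\<ge>k. f j = f k"
  using assms(2-)
proof (induction S arbitrary: f rule: finite_induct)
  case empty
  interpret rmodule R M by fact
  have "f k = {\<zero>\<^bsub>M\<^esub>}" for k using empty(4)[of k] gen_empty sub_zero[OF empty(2)[of k]] by auto
  thus ?case by auto
next
  case (insert v S)
  interpret rmodule R M by fact
  let ?G = "gen_submodule R M S"
  have v: "v \<in> carrier M" and G: "sub ?G" using insert gen_sub by auto
  have mono: "f i \<subseteq> f j" if "i \<le> j" for i j using lift_Suc_mono_le[of f, OF insert(6) that] .
  obtain k1 where k1: "\<forall>j\<ge>k1. f j \<inter> ?G = f k1 \<inter> ?G"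
    using insert(3)[of "\<lambda>k. f k \<inter> ?G"] insert(4-6) sub_Int G by fastforce
  define I where "I k = {a \<in> carrier R. a \<bullet> v \<in> f k \<uplus> ?G}" for k
  have fG: "sub (f k \<uplus> ?G)" for k using sub_sum insert(5) G by blast
  have "ideal (I k) R" for k
  proof -
    interpret rm: rmodule R "ring_mod R" by (rule rmodule_ring_mod)
    have "rm.sub (I k)"
      by (rule rm.subI) (auto simp: I_def smult_l_distr smult_assoc1 v sub_add[OF fG] sub_smult[OF fG] sub_zero[OF fG])
    thus ?thesis by simp
  qed
  moreover have "I k \<subseteq> I (Suc k)" for k
    unfolding I_def using sum_mono[OF insert(6)[of k] order_refl[of ?G]] by blast
  ultimately obtain k2 where k2: "\<forall>j\<ge>k2. I j = I k2" using ideal_acc by blast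
  define k where "k = max k1 k2"
  have "f j \<subseteq> f k" if j: "j \<ge> k" for j
  proof
    fix w assume w: "w \<in> f j"
    hence "w \<in> ?G \<uplus> cyc v" using insert(7)[of j] gen_insert[of v S] insert(4) by auto
    then obtain g a where h: "g \<in> ?G" "a \<in> carrier R" "w = g +\<^sub>m a \<bullet> v" by (auto elim!: sum_memE)
    have c: "g \<in> carrier M" "a \<bullet> v \<in> carrier M" "w \<in> carrier M" using h v sub_carr G insert(5) w by blast+
    have "a \<bullet> v \<in> f j \<uplus> ?G"
      using sub_cancel[OF fG[of j], of g "a \<bullet> v"] h c w sum_ub1[OF insert(5) G, of j] sum_ub2[OF insert(5) G, of j] by blast
    hence "a \<in> I j" using h I_def by auto
    hence "a \<in> I k" using k2 j k_def by (metis max.cobounded2 order_trans)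
    \<comment> \<open>The coefficient a of v already occurs in f k, so w differs from w' in f k by
      an element of both f j and G, where the traces agree.\<close>
    then obtain w' g' where h': "w' \<in> f k" "g' \<in> ?G" "a \<bullet> v = w' +\<^sub>m g'" unfolding I_def by (auto elim!: sum_memE)
    have c': "w' \<in> carrier M" "g' \<in> carrier M" using h' sub_carr G insert(5) by blast+
    have e: "w = w' +\<^sub>m (g +\<^sub>m g')" using h h' c c' by (simp add: M.a_ac)
    have "g +\<^sub>m g' \<in> f j" using sub_cancel[OF insert(5)[of j], of w' "g +\<^sub>m g'"] e w h' mono[OF j] c c' by auto
    moreover have "g +\<^sub>m g' \<in> ?G" using h h' G sub_add by blast
    ultimately have "g +\<^sub>m g' \<in> f k \<inter> ?G" using k1 j k_def by (metis IntI max.bounded_iff max.cobounded1)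
    thus "w \<in> f k" using e h' sub_add[OF insert(5)] by blast
  qed
  thus ?case using mono by (metis subset_antisym)
qed

end

section \<open>Finite modules over a Noetherian ring\<close>

locale noeth_rmodule = rmodule R M + nring R for R :: "('a, 'e) ring_scheme" (structure) and M :: "('a, 'b) module" (structure) +
  assumes fg: "fin_gen_module R M"
begin

lemma sub_max:
  assumes "F \<noteq> {}" "\<And>N. N \<in> F \<Longrightarrow> sub N"
  shows "\<exists>W\<in>F. \<forall>V\<in>F. W \<subseteq> V \<longrightarrow> V = W"
proof (rule ccontr)
  assume "\<not> ?thesis"
  then obtain h where h: "\<And>W. W \<in> F \<Longrightarrow> h W \<in> F \<and> W \<subset> h W" by (metis psubsetI)
  obtain W0 where W0: "W0 \<in> F" using assms by blast
  define f where "f k = (h ^^ k) W0" for k :: nat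
  have F: "f k \<in> F" for k by (induction k) (auto simp: f_def W0 h)
  have st: "f k \<subset> f (Suc k)" for k using h[OF F[of k]] by (simp add: f_def)
  obtain S where S: "finite S" "S \<subseteq> carrier M" "gen_submodule R M S = carrier M"
    using fg unfolding fin_gen_module_def by blast
  have "\<exists>k. \<forall>j\<ge>k. f j = f k"
    using fg_mod_acc[OF rmodule_axioms S(1,2), of f] F assms(2) st S(3) sub_subset by blast
  thus False using st by (metis le_Suc_eq psubset_eq order_refl)
qed

lemma sub_maxE:
  assumes "sub N" "Q N"
  obtains W where "sub W" "Q W" "\<And>V. sub V \<Longrightarrow> Q V \<Longrightarrow> W \<subseteq> V \<Longrightarrow> V = W"
proof -
  have "\<exists>W\<in>{W. sub W \<and> Q W}. \<forall>V\<in>{W. sub W \<and> Q W}. W \<subseteq> V \<longrightarrow> V = W"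
    by (rule sub_max) (use assms in auto)
  thus ?thesis using that by auto
qed

lemma sub_fg: assumes "sub N" shows "\<exists>S. finite S \<and> S \<subseteq> N \<and> gen_submodule R M S = N"
proof -
  let ?F = "{gen_submodule R M S |S. finite S \<and> S \<subseteq> N}"
  have c: "S \<subseteq> N \<Longrightarrow> S \<subseteq> carrier M" for S using sub_subset[OF assms] by blast
  have "\<exists>W\<in>?F. \<forall>V\<in>?F. W \<subseteq> V \<longrightarrow> V = W"
    by (rule sub_max) (use gen_sub c in blast)+
  then obtain S where S: "finite S" "S \<subseteq> N" and mx: "\<forall>V\<in>?F. gen_submodule R M S \<subseteq> V \<longrightarrow> V = gen_submodule R M S"
    by blast
  have "N \<subseteq> gen_submodule R M S"
  proof
    fix v assume v: "v \<in> N"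
    have i: "gen_submodule R M (insert v S) \<in> ?F" using S v by blast
    have "sub (gen_submodule R M (insert v S))" using gen_sub[OF c, of "insert v S"] S v by auto
    hence "gen_submodule R M S \<subseteq> gen_submodule R M (insert v S)"
      using gen_least[of "gen_submodule R M (insert v S)" S] gen_self[of "insert v S"] by blast
    hence "gen_submodule R M (insert v S) = gen_submodule R M S" using mx i by blast
    thus "v \<in> gen_submodule R M S" using gen_self[of "insert v S"] by blast
  qed
  thus ?thesis using S gen_least[OF assms S(2)] by blast
qed

end

lemma (in nring) noeth_rmodule_ring_mod: "noeth_rmodule R (ring_mod R)"
proof -
  interpret rm: rmodule R "ring_mod R" by (rule rmodule_ring_mod)
  have "gen_submodule R (ring_mod R) {\<one>} = carrier R"
    using rm.gen_sub[of "{\<one>}"] rm.gen_self[of "{\<one>}"] ideal.one_imp_carrier by auto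
  hence "fin_gen_module R (ring_mod R)" unfolding fin_gen_module_def by (intro exI[of _ "{\<one>}"]) auto
  thus ?thesis by unfold_locales
qed

section \<open>Saturation at a prime: the preimage in M of a localized submodule\<close>

context rmodule
begin

abbreviation sa :: "'a set \<Rightarrow> 'b set \<Rightarrow> 'b set" where "sa P N \<equiv> sat R M P N"

lemma compl_prime:
  assumes "primeideal P R" shows "\<one> \<in> carrier R - P"
    "s \<in> carrier R - P \<Longrightarrow> t \<in> carrier R - P \<Longrightarrow> s \<otimes> t \<in> carrier R - P"
proof -
  interpret primeideal P R by fact
  show "\<one> \<in> carrier R - P" using I_notcarr one_imp_carrier by auto
  show "s \<in> carrier R - P \<Longrightarrow> t \<in> carrier R - P \<Longrightarrow> s \<otimes> t \<in> carrier R - P" using I_prime by auto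
qed

lemma sat_memI: "v \<in> carrier M \<Longrightarrow> s \<in> carrier R - P \<Longrightarrow> s \<bullet> v \<in> N \<Longrightarrow> v \<in> sa P N"
  unfolding sat_def by blast

lemma sat_ub: "primeideal P R \<Longrightarrow> sub N \<Longrightarrow> N \<subseteq> sa P N"
  using compl_prime(1)[of P] sub_carr[of N] by (auto intro!: sat_memI[of _ "\<one>"])

lemma sat_mono: "N \<subseteq> L \<Longrightarrow> sa P N \<subseteq> sa P L"
  unfolding sat_def by blast

lemma sub_sat: assumes P: "primeideal P R" and N: "sub N" shows "sub (sa P N)"
proof (rule subI)
  fix x y assume "x \<in> sa P N" "y \<in> sa P N"
  then obtain s t where h: "x \<in> carrier M" "y \<in> carrier M" "s \<in> carrier R - P" "t \<in> carrier R - P" "s \<bullet> x \<in> N" "t \<bullet> y \<in> N"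
    unfolding sat_def by blast
  have "(s \<otimes> t) \<bullet> (x +\<^sub>m y) = t \<bullet> (s \<bullet> x) +\<^sub>m s \<bullet> (t \<bullet> y)"
    using h smult_assoc1[of t s x] smult_assoc1[of s t y] R.m_comm[of s t] by (simp add: smult_r_distr)
  thus "x +\<^sub>m y \<in> sa P N" using h N sub_add sub_smult compl_prime(2)[OF P, of s t] by (intro sat_memI[of _ "s \<otimes> t"]) auto
next
  fix a x assume a: "a \<in> carrier R" and "x \<in> sa P N"
  then obtain s where h: "x \<in> carrier M" "s \<in> carrier R - P" "s \<bullet> x \<in> N" unfolding sat_def by blast
  have "s \<bullet> (a \<bullet> x) = a \<bullet> (s \<bullet> x)"
    using h a smult_assoc1[of s a x] smult_assoc1[of a s x] R.m_comm[of s a] by simp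
  thus "a \<bullet> x \<in> sa P N" using h a N sub_smult by (intro sat_memI[of _ s]) auto
qed (use sat_ub[OF P N] sub_zero[OF N] in \<open>auto simp: sat_def\<close>)

lemma sat_idem: assumes P: "primeideal P R" and N: "sub N" shows "sa P (sa P N) = sa P N"
proof
  show "sa P (sa P N) \<subseteq> sa P N"
  proof
    fix v assume "v \<in> sa P (sa P N)"
    then obtain s t where h: "v \<in> carrier M" "s \<in> carrier R - P" "t \<in> carrier R - P" "t \<bullet> s \<bullet> v \<in> N"
      unfolding sat_def by blast
    thus "v \<in> sa P N" using compl_prime(2)[OF P, of t s] smult_assoc1[of t s v] by (intro sat_memI[of _ "t \<otimes> s"]) auto
  qed
  show "sa P N \<subseteq> sa P (sa P N)" using sat_ub[OF P sub_sat[OF P N]] .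
qed

end

context noeth_rmodule
begin

text \<open>Nakayama's lemma at the prime \<open>P\<close>, phrased without localization.\<close>
lemma nakayama_sat:
  assumes P: "primeideal P R" and U: "sub U" and L: "sub L" and sub: "U \<subseteq> sa P (L \<uplus> P \<star> U)"
  shows "U \<subseteq> sa P L"
proof (rule ccontr)
  assume no: "\<not> U \<subseteq> sa P L"
  interpret P: primeideal P R by fact
  \<comment> \<open>W plays the part of a maximal proper submodule of the localization: it is
    saturated, lies above L, and is maximal among those that miss part of U.\<close>
  obtain W where Ws: "sub W" and W: "L \<subseteq> W \<and> sa P W = W \<and> \<not> U \<subseteq> W"
    and mx: "\<And>V. sub V \<Longrightarrow> L \<subseteq> V \<and> sa P V = V \<and> \<not> U \<subseteq> V \<Longrightarrow> W \<subseteq> V \<Longrightarrow> V = W"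
    by (rule sub_maxE[of "sa P L" "\<lambda>W. L \<subseteq> W \<and> sa P W = W \<and> \<not> U \<subseteq> W"])
      (use no sub_sat[OF P L] sat_ub[OF P L] sat_idem[OF P L] in auto)
  have "P \<star> U \<subseteq> W"
  proof (rule ism_least[OF Ws], rule ccontr)
    fix p u assume p: "p \<in> P" and u: "u \<in> U" and n: "p \<bullet> u \<notin> W"
    have c: "p \<in> carrier R" "u \<in> carrier M" using p u U sub_carr P.Icarr by blast+
    let ?V = "W \<uplus> cyc (p \<bullet> u)"
    have V: "sub ?V" using Ws c sub_sum sub_cyc by blast
    have WV: "W \<subseteq> sa P ?V" "p \<bullet> u \<in> sa P ?V"
      using sum_ub1[OF Ws sub_cyc, of "p \<bullet> u"] sum_ub2[OF Ws sub_cyc, of "p \<bullet> u"] cyc_self[of "p \<bullet> u"] c sat_ub[OF P V] by auto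
    \<comment> \<open>By maximality the saturation of W + R p u contains U. So s u = w + r p u for
      some s outside P; then s - r p is outside P as well and moves u into W.\<close>
    hence "U \<subseteq> sa P ?V" using mx[OF sub_sat[OF P V]] n W sat_idem[OF P V] by blast
    then obtain s w r where h: "s \<in> carrier R - P" "w \<in> W" "r \<in> carrier R" "s \<bullet> u = w +\<^sub>m r \<bullet> p \<bullet> u"
      using u unfolding sat_def by (auto elim!: sum_memE)
    have wc: "w \<in> carrier M" using h sub_carr Ws by blast
    have rp: "r \<otimes> p \<in> P" using h p P.I_l_closed by blast
    have "s \<ominus> r \<otimes> p \<notin> P"
    proof
      assume "s \<ominus> r \<otimes> p \<in> P"
      hence "(s \<ominus> r \<otimes> p) \<oplus> r \<otimes> p \<in> P" using rp by blast
      moreover have "(s \<ominus> r \<otimes> p) \<oplus> r \<otimes> p = s" using h(1,3) c(1) by (simp add: a_minus_def R.a_assoc R.l_neg)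
      ultimately show False using h by simp
    qed
    moreover have "(s \<ominus> r \<otimes> p) \<bullet> u = w"
    proof -
      have "(s \<ominus> r \<otimes> p) \<bullet> u = s \<bullet> u \<ominus>\<^bsub>M\<^esub> r \<bullet> p \<bullet> u"
        using h c by (simp add: a_minus_def smult_l_distr smult_l_minus smult_assoc1)
      also have "\<dots> = w" using h c wc by (simp add: a_minus_def M.a_assoc M.r_neg)
      finally show ?thesis .
    qed
    ultimately have "u \<in> sa P W" using h c by (intro sat_memI[of _ "s \<ominus> r \<otimes> p"]) auto
    hence "u \<in> W" using W by blast
    thus False using n sub_smult[OF Ws c(1)] by blast
  qed
  hence "L \<uplus> P \<star> U \<subseteq> W" using W by (intro sum_least[OF Ws]) auto
  hence "U \<subseteq> sa P W" using sub sat_mono by blast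
  thus False using W by blast
qed

text \<open>For K maximal with K \<inter> U = L it is enough that some power of m maps M into K, and
  by \<open>rad_pow\<close> this can be checked for one a in m at a time. If j is such that the set
  of v with a^j v in K no longer grows, then K + a^j M still meets U in L, because m^k U lies in L;
  maximality of K gives a^j M \<subseteq> K.\<close>

lemma artin_rees:
  assumes m: "ideal m R" and U: "sub U" and L: "sub L" and LU: "L \<subseteq> U" and k: "ideal_pow R m k \<star> U \<subseteq> L"
  shows "\<exists>l. (ideal_pow R m l \<star> carrier M) \<inter> U \<subseteq> L"
proof -
  obtain K where Ks: "sub K" and K: "K \<inter> U = L" and mx: "\<And>V. sub V \<Longrightarrow> V \<inter> U = L \<Longrightarrow> K \<subseteq> V \<Longrightarrow> V = K"
    by (rule sub_maxE[of L "\<lambda>K. K \<inter> U = L"]) (use L LU in auto)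
  define J where "J = {a \<in> carrier R. a \<bullet>\<bullet> carrier M \<subseteq> K}"
  have J: "ideal J R"
  proof -
    interpret rm: rmodule R "ring_mod R" by (rule rmodule_ring_mod)
    have "rm.sub J"
      by (rule rm.subI) (auto simp: J_def smult_l_distr smult_assoc1 image_subset_iff sub_add[OF Ks] sub_smult[OF Ks] sub_zero[OF Ks])
    thus ?thesis by simp
  qed
  have "\<exists>j::nat. a [^] j \<in> J" if a: "a \<in> m" for a
  proof -
    have ac: "a \<in> carrier R" using a m ideal.Icarr by metis
    let ?C = "\<lambda>j::nat. {v \<in> carrier M. a [^] j \<bullet> v \<in> K}"
    have "\<exists>W\<in>range ?C. \<forall>V\<in>range ?C. W \<subseteq> V \<longrightarrow> V = W"
      by (rule sub_max) (use sub_colon Ks ac in auto)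
    then obtain j where j: "\<forall>V\<in>range ?C. ?C j \<subseteq> V \<longrightarrow> V = ?C j" by auto
    let ?V = "K \<uplus> (a [^] j) \<bullet>\<bullet> carrier M"
    have s2: "sub ((a [^] j) \<bullet>\<bullet> carrier M)" using sub_scl[OF _ carrier_is_submodule] ac by simp
    have V: "sub ?V" using sub_sum Ks s2 by blast
    have "?V \<inter> U \<subseteq> L"
    proof
      fix z assume z: "z \<in> ?V \<inter> U"
      then obtain \<kappa> v where h: "\<kappa> \<in> K" "v \<in> carrier M" "z = \<kappa> +\<^sub>m a [^] j \<bullet> v" by (auto elim!: sum_memE)
      have \<kappa>: "\<kappa> \<in> carrier M" using h Ks sub_carr by blast
      have zU: "z \<in> U" using z by blast
      have "a [^] k \<bullet> z \<in> L" using subsetD[OF k ism_memI[OF pow_mem[OF m a, of k] zU]] .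
      hence "a [^] k \<bullet> \<kappa> +\<^sub>m a [^] k \<bullet> a [^] j \<bullet> v \<in> K" using h \<kappa> ac K by (auto simp: smult_r_distr)
      moreover have "a [^] k \<bullet> \<kappa> \<in> K" using sub_smult[OF Ks _ h(1)] ac by simp
      moreover have "a [^] k \<bullet> a [^] j \<bullet> v \<in> carrier M" using h(2) ac by simp
      ultimately have "a [^] k \<bullet> a [^] j \<bullet> v \<in> K" using sub_cancel[OF Ks] by blast
      hence "v \<in> ?C (k + j)" using h ac by (simp add: smult_assoc1 nat_pow_mult[symmetric])
      moreover have "?C j \<subseteq> ?C (k + j)"
        using ac sub_smult[OF Ks, of "a [^] k"] by (auto simp: smult_assoc1 nat_pow_mult[symmetric])
      ultimately have "a [^] j \<bullet> v \<in> K" using j by blast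
      thus "z \<in> L" using h K z sub_add[OF Ks] by blast
    qed
    moreover have "L \<subseteq> ?V \<inter> U" using K LU sum_ub1[OF Ks s2] by blast
    ultimately have "?V = K" using mx[OF V] sum_ub1[OF Ks s2] by blast
    hence "a [^] j \<in> J" unfolding J_def using sum_ub2[OF Ks s2] ac by auto
    thus ?thesis by blast
  qed
  then obtain l where l: "ideal_pow R m l \<subseteq> J" using rad_pow[OF m J] by blast
  have "ideal_pow R m l \<star> carrier M \<subseteq> K"
    using l by (intro ism_least[OF Ks]) (auto simp: J_def)
  thus ?thesis using K by blast
qed

end

lemma (in nring) local_unit:
  assumes "local_ring R m" "a \<in> carrier R - m" shows "a \<in> Units R"
proof (rule ccontr)
  assume n: "a \<notin> Units R"
  have a: "a \<in> carrier R" using assms by blast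
  have pa: "PIdl a \<noteq> carrier R"
  proof
    assume "PIdl a = carrier R"
    then obtain b where "b \<in> carrier R" "\<one> = b \<otimes> a" unfolding PIdl_eq_cyc using one_closed by (metis (no_types, lifting) imageE)
    thus False using n a m_comm unfolding Units_def by auto
  qed
  obtain W where W: "ideal W R" "W \<noteq> carrier R \<and> a \<in> W"
    and mx: "\<And>V. ideal V R \<Longrightarrow> V \<noteq> carrier R \<and> a \<in> V \<Longrightarrow> W \<subseteq> V \<Longrightarrow> V = W"
    by (rule ideal_maxE[of "PIdl a" "\<lambda>W. W \<noteq> carrier R \<and> a \<in> W"]) (use pa a cgenideal_ideal cgenideal_self in auto)
  have "maximalideal W R"
    by (rule maximalidealI) (use W mx in \<open>auto simp: subset_iff\<close>)
  thus False using assms W unfolding local_ring_def by blast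
qed

section \<open>Finite modules over a Noetherian local ring\<close>

locale local_rmodule = noeth_rmodule R M for R :: "('a, 'e) ring_scheme" (structure) and M :: "('a, 'b) module" (structure) +
  fixes m assumes loc: "local_ring R m"
begin

lemma m_prime: "primeideal m R"
  using loc unfolding local_ring_def by (simp add: maximalideal_prime)
lemma m_ideal: "ideal m R"
  using m_prime primeideal.axioms(1) by blast
lemma m_carr: "a \<in> m \<Longrightarrow> a \<in> carrier R"
  using m_ideal by (rule ideal.Icarr)
lemma m_subset: "m \<subseteq> carrier R"
  using m_carr by blast

lemma unit_cancel: assumes "sub N" "s \<in> carrier R - m" "v \<in> carrier M" "s \<bullet> v \<in> N" shows "v \<in> N"
proof -
  have u: "s \<in> Units R" using local_unit[OF loc assms(2)] .
  have "inv s \<bullet> s \<bullet> v \<in> N" using sub_smult assms u by blast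
  moreover have "inv s \<bullet> s \<bullet> v = v" using u assms by (simp add: smult_assoc1[symmetric])
  ultimately show ?thesis by simp
qed

text \<open>Elements outside m are units, so saturation at m changes nothing and
  \<open>nakayama_sat\<close> at m is the usual lemma of Nakayama.\<close>

lemma sat_m: "sub N \<Longrightarrow> sa m N = N"
  using sat_ub[OF m_prime, of N] unit_cancel[of N] unfolding sat_def by blast

lemma nakayama: assumes "sub U" "sub L" "U \<subseteq> L \<uplus> m \<star> U" shows "U \<subseteq> L"
  using nakayama_sat[OF m_prime assms(1,2)] assms sat_m sub_sum sub_ism[OF m_subset] by metis

abbreviation fil :: "nat \<Rightarrow> 'b set" where "fil k \<equiv> ideal_pow R m k \<star> carrier M"

lemma sub_fil: "sub (fil k)"
  using sub_ism[OF ideal_pow_carr[OF m_ideal] carrier_is_submodule] .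

lemma fil_Suc: "fil (Suc k) = m \<star> fil k"
  using ism_pow_Suc[OF m_ideal carrier_is_submodule] .

lemma fil_antimono: "i \<le> j \<Longrightarrow> fil j \<subseteq> fil i"
  using ism_mono[OF ideal_pow_carr[OF m_ideal] carrier_is_submodule carrier_is_submodule pow_antimono[OF m_ideal]] by blast

text \<open>The intersection U of all L + m^k M satisfies U \<subseteq> L + m U, by
  \<open>artin_rees\<close> applied to L + m U inside U. Nakayama then gives U \<subseteq>
  L.\<close>

lemma krull_intersection:
  assumes L: "sub L" and v: "\<And>k. v \<in> L \<uplus> fil k"
  shows "v \<in> L"
proof -
  define U where "U = (\<Inter>k. L \<uplus> fil k)"
  have s: "sub (L \<uplus> fil k)" for k using L sub_fil sub_sum by blast
  have U: "sub U" unfolding U_def by (rule sub_Inter) (use s in auto)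
  have LU: "L \<subseteq> U" unfolding U_def using sum_ub1[OF L sub_fil] by blast
  have mU: "sub (m \<star> U)" using sub_ism[OF m_subset U] .
  let ?L = "L \<uplus> m \<star> U"
  have L': "sub ?L" using sub_sum L mU by blast
  have "?L \<subseteq> U" using sum_least[OF U LU] ism_subset[OF m_subset U] by blast
  moreover have "ideal_pow R m 1 \<star> U \<subseteq> ?L" using sum_ub2[OF L mU] pow_one[OF m_ideal] by simp
  ultimately obtain l where l: "fil l \<inter> U \<subseteq> ?L" using artin_rees[OF m_ideal U L'] by blast
  have "U \<subseteq> ?L"
  proof
    fix u assume u: "u \<in> U"
    hence "u \<in> L \<uplus> fil l" unfolding U_def by blast
    then obtain a b where h: "a \<in> L" "b \<in> fil l" "u = a +\<^sub>m b" by (meson sum_memE)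
    have "b \<in> U" using sub_cancel[OF U, of a b] h u LU sub_carr[OF sub_fil] by blast
    thus "u \<in> ?L" using h l sum_ub1[OF L mU] sub_add[OF L'] by blast
  qed
  hence "U \<subseteq> L" using nakayama U L by blast
  thus ?thesis using v unfolding U_def by blast
qed

end

section \<open>Length\<close>

lemma enat_le_ext: "(\<And>i. enat i \<le> a \<Longrightarrow> enat i \<le> b) \<Longrightarrow> a \<le> b"
  by (cases a; cases b) (auto, metis Suc_n_not_le_n enat_ord_simps(1))

lemma enat_add_le_ext:
  assumes "\<And>i j. enat i \<le> a \<Longrightarrow> enat j \<le> b \<Longrightarrow> enat (i + j) \<le> c" shows "a + b \<le> c"
proof -
  consider i j where "a = enat i" "b = enat j" | "a = \<infinity>" | "b = \<infinity>" by (cases a; cases b) auto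
  thus ?thesis
  proof cases
    case 1
    thus ?thesis using assms by auto
  next
    case 2
    hence "enat i \<le> c" for i using assms[of i 0] by (simp add: zero_enat_def[symmetric])
    thus ?thesis by (auto intro: enat_le_ext)
  next
    case 3
    hence "enat i \<le> c" for i using assms[of 0 i] by (simp add: zero_enat_def[symmetric])
    thus ?thesis by (auto intro: enat_le_ext)
  qed
qed

text \<open>Unlike in \<open>submodule_chain\<close>, the ends A and B need not occur in the chain,
  so prefixes and images of such chains are again of this kind.\<close>

definition ichain :: "('a, 'e) ring_scheme \<Rightarrow> ('a, 'b) module \<Rightarrow> 'b set \<Rightarrow> 'b set \<Rightarrow> 'b set list \<Rightarrow> bool" where
  "ichain R M A B Ns \<longleftrightarrow> sorted_wrt (\<subset>) Ns \<and> (\<forall>X\<in>set Ns. submodule X R M \<and> A \<subseteq> X \<and> X \<subseteq> B)"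

lemma sorted_hd_least: "sorted_wrt (\<subset>) Ns \<Longrightarrow> X \<in> set Ns \<Longrightarrow> hd Ns \<subseteq> X"
  by (cases Ns) auto
lemma sorted_last_greatest: "sorted_wrt (\<subset>) Ns \<Longrightarrow> X \<in> set Ns \<Longrightarrow> X \<subseteq> last Ns"
  by (induction Ns) auto

lemma ichain_Cons:
  assumes "ichain R M A B Xs" "Xs \<noteq> []" "X \<subset> hd Xs" "submodule X R M" "A \<subseteq> X"
  shows "ichain R M A B (X # Xs)"
proof -
  have "X \<subset> Y" if "Y \<in> set Xs" for Y
    using sorted_hd_least[of Xs Y] that assms(1,3) unfolding ichain_def by blast
  moreover have "X \<subseteq> B" using assms unfolding ichain_def by (metis hd_in_set psubset_imp_subset subset_trans)
  ultimately show ?thesis using assms unfolding ichain_def by auto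
qed

lemma ichain_append:
  assumes "ichain R M A B Xs" "ichain R M A' B' Ys" "A'' \<subseteq> A" "A'' \<subseteq> A'" "B \<subseteq> B''" "B' \<subseteq> B''"
    "\<And>X Y. X \<in> set Xs \<Longrightarrow> Y \<in> set Ys \<Longrightarrow> X \<subset> Y"
  shows "ichain R M A'' B'' (Xs @ Ys)"
proof -
  have "submodule X R M \<and> A'' \<subseteq> X \<and> X \<subseteq> B''" if "X \<in> set (Xs @ Ys)" for X
  proof -
    have "submodule X R M \<and> (A \<subseteq> X \<and> X \<subseteq> B \<or> A' \<subseteq> X \<and> X \<subseteq> B')"
      using that assms(1,2) unfolding ichain_def by auto
    thus ?thesis using assms(3-6) by (elim conjE disjE) auto
  qed
  moreover have "sorted_wrt (\<subset>) (Xs @ Ys)" using assms(1,2,7) by (simp add: ichain_def sorted_wrt_append)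
  ultimately show ?thesis unfolding ichain_def by simp
qed

context rmodule
begin

abbreviation ql :: "'b set \<Rightarrow> 'b set \<Rightarrow> enat" where "ql A B \<equiv> quotient_length R M A B"
abbreviation ic :: "'b set \<Rightarrow> 'b set \<Rightarrow> 'b set list \<Rightarrow> bool" where "ic A B Ns \<equiv> ichain R M A B Ns"

text \<open>Adding the missing ends to a chain inside the interval can only lengthen it, and a chain
  that is too long can be cut. Lengths are compared below through this criterion instead of through
  suprema.\<close>

lemma ql_ge_iff:
  assumes A: "sub A" and B: "sub B" and AB: "A \<subseteq> B"
  shows "enat n \<le> ql A B \<longleftrightarrow> (\<exists>Ns. length Ns = Suc n \<and> ic A B Ns)"
proof
  assume le: "enat n \<le> ql A B"
  show "\<exists>Ns. length Ns = Suc n \<and> ic A B Ns"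
  proof (cases n)
    case 0
    thus ?thesis using A AB by (intro exI[of _ "[A]"]) (simp add: ichain_def)
  next
    case (Suc n')
    \<comment> \<open>Only a strict lower bound picks a chain out of the supremum, hence the
      predecessor of n.\<close>
    hence "enat n' < ql A B" using le by (metis Suc_ile_eq)
    then obtain Ns where Ns: "submodule_chain R M A B Ns" "enat n' < enat (length Ns - 1)"
      unfolding quotient_length_def less_SUP_iff by blast
    hence l: "length Ns \<ge> Suc n" using Suc by simp
    have "ic A B Ns" using Ns(1) sorted_hd_least[of Ns] sorted_last_greatest[of Ns]
      unfolding submodule_chain_def ichain_def by blast
    hence "ic A B (take (Suc n) Ns)" unfolding ichain_def using sorted_wrt_take[of "(\<subset>)" Ns] by (auto dest: in_set_takeD)
    thus ?thesis using l by (intro exI[of _ "take (Suc n) Ns"]) auto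
  qed
next
  assume "\<exists>Ns. length Ns = Suc n \<and> ic A B Ns"
  then obtain Ns where l: "length Ns = Suc n" and ic: "ic A B Ns" by blast
  define Xs where "Xs = (if hd Ns = A then Ns else A # Ns)"
  have ne: "Ns \<noteq> []" using l by auto
  have "A \<subseteq> hd Ns" using ic ne unfolding ichain_def by simp
  hence X: "ic A B Xs" "hd Xs = A" "Xs \<noteq> []" "length Xs \<ge> Suc n"
    using ichain_Cons[OF ic ne, of A] A ic l ne unfolding Xs_def by auto
  define Ys where "Ys = (if last Xs = B then Xs else Xs @ [B])"
  have "\<forall>Z\<in>set Xs. last Xs \<noteq> B \<longrightarrow> Z \<subset> B"
    using X(1) sorted_last_greatest[of Xs] ichain_def by (metis X(3) last_in_set psubsetI psubset_subset_trans subset_antisym)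
  hence "submodule_chain R M A B Ys"
    using X B AB unfolding Ys_def submodule_chain_def ichain_def by (auto simp: sorted_wrt_append)
  moreover have "enat n \<le> enat (length Ys - 1)" using X(4) unfolding Ys_def by auto
  ultimately show "enat n \<le> ql A B" unfolding quotient_length_def by (meson SUP_upper2 mem_Collect_eq)
qed

text \<open>The chain is intersected with B and also added to B, and repetitions are dropped. By the
  modular law at least one of the two sides grows at every step. The heads are recorded so that the
  induction can tell whether a new entry has to be prepended.\<close>

lemma ic_split:
  assumes s: "sub A" "sub B" "sub C" and AB: "A \<subseteq> B" and BC: "B \<subseteq> C" and "ic A C Ns" "Ns \<noteq> []"
  shows "\<exists>Xs Ys. ic A B Xs \<and> ic B C Ys \<and> Xs \<noteq> [] \<and> Ys \<noteq> [] \<and> length Ns + 1 \<le> length Xs + length Ys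
    \<and> hd Xs = hd Ns \<inter> B \<and> hd Ys = hd Ns \<uplus> B"
  using assms(6,7)
proof (induction Ns)
  case (Cons N Ns)
  have N: "sub N" "A \<subseteq> N" "N \<subseteq> C" using Cons(2) by (auto simp: ichain_def)
  have N': "sub (N \<inter> B)" "sub (N \<uplus> B)" "A \<subseteq> N \<inter> B" "B \<subseteq> N \<uplus> B" "N \<uplus> B \<subseteq> C"
    using N s AB BC sub_Int sub_sum sum_ub2[of N B] sum_least by auto
  show ?case
  proof (cases "Ns = []")
    case True
    thus ?thesis using N N' by (intro exI[of _ "[N \<inter> B]"] exI[of _ "[N \<uplus> B]"]) (auto simp: ichain_def)
  next
    case False
    have "ic A C Ns" using Cons(2) by (auto simp: ichain_def)
    then obtain Xs Ys where h: "ic A B Xs" "ic B C Ys" "Xs \<noteq> []" "Ys \<noteq> []" "length Ns + 1 \<le> length Xs + length Ys"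
      "hd Xs = hd Ns \<inter> B" "hd Ys = hd Ns \<uplus> B" using Cons(1) False by blast
    let ?N2 = "hd Ns"
    have N2: "sub ?N2" "N \<subset> ?N2" using Cons(2) False by (auto simp: ichain_def)
    have le: "N \<inter> B \<subseteq> hd Xs" "N \<uplus> B \<subseteq> hd Ys" using h N2 sum_mono[of N ?N2 B B] by auto
    have ne: "N \<inter> B \<noteq> hd Xs \<or> N \<uplus> B \<noteq> hd Ys"
    proof (rule ccontr)
      assume "\<not> ?thesis"
      hence e: "N \<inter> B = ?N2 \<inter> B" "N \<uplus> B = ?N2 \<uplus> B" using h by auto
      have "?N2 \<subseteq> N"
      proof
        fix v assume v: "v \<in> ?N2"
        hence "v \<in> N \<uplus> B" using e sum_ub1[OF N2(1) s(2)] by blast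
        then obtain a b where ab: "a \<in> N" "b \<in> B" "v = a +\<^sub>m b" by (meson sum_memE)
        have "b \<in> ?N2" using sub_cancel[OF N2(1), of a b] ab N2 v sub_carr[OF s(2)] by blast
        thus "v \<in> N" using e ab sub_add[OF N(1)] by blast
      qed
      thus False using N2 by blast
    qed
    define Xs' where "Xs' = (if N \<inter> B = hd Xs then Xs else (N \<inter> B) # Xs)"
    define Ys' where "Ys' = (if N \<uplus> B = hd Ys then Ys else (N \<uplus> B) # Ys)"
    have "ic A B Xs'" "hd Xs' = N \<inter> B" "Xs' \<noteq> []"
      using ichain_Cons[OF h(1,3), of "N \<inter> B"] le N' h unfolding Xs'_def by auto
    moreover have "ic B C Ys'" "hd Ys' = N \<uplus> B" "Ys' \<noteq> []"
      using ichain_Cons[OF h(2,4), of "N \<uplus> B"] le N' h unfolding Ys'_def by auto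
    moreover have "length (N # Ns) + 1 \<le> length Xs' + length Ys'"
      using ne h(5) unfolding Xs'_def Ys'_def by auto
    ultimately show ?thesis by (intro exI[of _ Xs'] exI[of _ Ys']) auto
  qed
qed simp

text \<open>The chains can collide only at B. If the second one starts with B, that entry is
  dropped; otherwise the last entry of the first one is. Exactly one entry is lost either
  way.\<close>

lemma ic_append:
  assumes "ic A B Xs" "ic B C Ys" "A \<subseteq> B" "B \<subseteq> C" "Xs \<noteq> []" "Ys \<noteq> []"
  shows "\<exists>Zs. ic A C Zs \<and> Suc (length Zs) = length Xs + length Ys"
proof (cases "hd Ys = B")
  case True
  then obtain Ys' where Y: "Ys = B # Ys'" using assms by (cases Ys) auto
  have "Z \<subset> Y" if "Z \<in> set Xs" "Y \<in> set Ys'" for Z Y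
  proof -
    have "Z \<subseteq> B" "B \<subset> Y" using that assms(1,2) unfolding ichain_def Y by auto
    thus ?thesis by blast
  qed
  moreover have "ic B C Ys'" using assms(2) unfolding Y ichain_def by simp
  ultimately have "ic A C (Xs @ Ys')" using ichain_append[OF assms(1), of B C Ys' A C] assms(3,4) by blast
  thus ?thesis using Y by (intro exI[of _ "Xs @ Ys'"]) auto
next
  case False
  have st: "B \<subset> Y" if "Y \<in> set Ys" for Y
    using that assms(2,6) False sorted_hd_least[of Ys Y] unfolding ichain_def by (metis hd_in_set order_neq_le_trans psubset_subset_trans)
  obtain Xs' L where X: "Xs = Xs' @ [L]" using assms(5) by (metis append_butlast_last_id)
  have "Z \<subset> Y" if "Z \<in> set Xs'" "Y \<in> set Ys" for Z Y
  proof -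
    have "Z \<subseteq> B" using assms(1) that(1) unfolding ichain_def X by auto
    thus ?thesis using st[OF that(2)] by blast
  qed
  moreover have "ic A B Xs'" using assms(1) unfolding X ichain_def sorted_wrt_append by simp
  ultimately have "ic A C (Xs' @ Ys)" using ichain_append[OF _ assms(2), of A B Xs' A C] assms(3,4) by blast
  thus ?thesis using X by (intro exI[of _ "Xs' @ Ys"]) auto
qed

lemma ql_add:
  assumes s: "sub A" "sub B" "sub C" and AB: "A \<subseteq> B" and BC: "B \<subseteq> C"
  shows "ql A C = ql A B + ql B C"
proof (rule antisym)
  have AC: "A \<subseteq> C" using AB BC by blast
  show "ql A C \<le> ql A B + ql B C"
  proof (rule enat_le_ext)
    fix i assume "enat i \<le> ql A C"
    then obtain Ns where Ns: "length Ns = Suc i" "ic A C Ns" using ql_ge_iff[OF s(1,3) AC] by blast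
    then obtain Xs Ys where h: "ic A B Xs" "ic B C Ys" "Xs \<noteq> []" "Ys \<noteq> []" "length Ns + 1 \<le> length Xs + length Ys"
      using ic_split[OF s AB BC, of Ns] by fastforce
    obtain a b where ab: "length Xs = Suc a" "length Ys = Suc b" using h by (metis length_greater_0_conv gr0_implies_Suc)
    hence "enat a \<le> ql A B" "enat b \<le> ql B C" using ql_ge_iff[OF s(1,2) AB] ql_ge_iff[OF s(2,3) BC] h by blast+
    hence "enat (a + b) \<le> ql A B + ql B C" by (metis add_mono plus_enat_simps(1))
    moreover have "i \<le> a + b" using h ab Ns by simp
    ultimately show "enat i \<le> ql A B + ql B C" using order_trans enat_ord_simps(1) by metis
  qed
  show "ql A B + ql B C \<le> ql A C"
  proof (rule enat_add_le_ext)
    fix i j assume "enat i \<le> ql A B" "enat j \<le> ql B C"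
    then obtain Xs Ys where h: "length Xs = Suc i" "ic A B Xs" "length Ys = Suc j" "ic B C Ys"
      using ql_ge_iff[OF s(1,2) AB] ql_ge_iff[OF s(2,3) BC] by blast
    then obtain Zs where "ic A C Zs" "Suc (length Zs) = length Xs + length Ys"
      using ic_append[OF h(2,4) AB BC] by force
    thus "enat (i + j) \<le> ql A C" using ql_ge_iff[OF s(1,3) AC] h by auto
  qed
qed

text \<open>The source of all length inequalities between different intervals. The map h only has to
  preserve strict inclusions, so it may relate modules over different rings.\<close>

lemma ql_transfer:
  assumes M': "rmodule R' M'" and s: "sub A" "sub B" "A \<subseteq> B"
    and s': "submodule A' R' M'" "submodule B' R' M'" "A' \<subseteq> B'"
    and h: "\<And>X. sub X \<Longrightarrow> A \<subseteq> X \<Longrightarrow> X \<subseteq> B \<Longrightarrow> submodule (h X) R' M' \<and> A' \<subseteq> h X \<and> h X \<subseteq> B'"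
    and st: "\<And>X Y. sub X \<Longrightarrow> A \<subseteq> X \<Longrightarrow> sub Y \<Longrightarrow> Y \<subseteq> B \<Longrightarrow> X \<subset> Y \<Longrightarrow> h X \<subset> h Y"
  shows "ql A B \<le> quotient_length R' M' A' B'"
proof (rule enat_le_ext)
  interpret m': rmodule R' M' by fact
  fix i assume "enat i \<le> ql A B"
  then obtain Ns where Ns: "length Ns = Suc i" "ic A B Ns" using ql_ge_iff[OF s] by blast
  have "sorted_wrt (\<subset>) (map h Ns)"
    unfolding sorted_wrt_map
    by (rule sorted_wrt_mono_rel[of Ns "(\<subset>)"]) (use Ns(2) st in \<open>auto simp: ichain_def\<close>)
  hence "ichain R' M' A' B' (map h Ns)" using Ns(2) h unfolding ichain_def by auto
  thus "enat i \<le> quotient_length R' M' A' B'" using m'.ql_ge_iff[OF s'] Ns(1) by (metis length_map)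
qed

lemma ql_mono:
  assumes "sub A" "sub B" "A \<subseteq> B" "sub A'" "sub B'" "A' \<subseteq> A" "B \<subseteq> B'"
  shows "ql A B \<le> ql A' B'"
  by (rule ql_transfer[where h = "\<lambda>X. X", OF rmodule_axioms]) (use assms in auto)

text \<open>Endomorphisms are enough: the maps that occur are multiplication by a ring element and a
  square matrix.\<close>

definition lin :: "('b \<Rightarrow> 'b) \<Rightarrow> bool" where
  "lin g \<longleftrightarrow> (\<forall>u\<in>carrier M. g u \<in> carrier M) \<and> (\<forall>u\<in>carrier M. \<forall>v\<in>carrier M. g (u +\<^sub>m v) = g u +\<^sub>m g v)
    \<and> (\<forall>a\<in>carrier R. \<forall>u\<in>carrier M. g (a \<bullet> u) = a \<bullet> g u)"

lemma lin_smult: "a \<in> carrier R \<Longrightarrow> lin (\<lambda>v. a \<bullet> v)"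
  unfolding lin_def by (auto simp: smult_r_distr smult_assoc1[symmetric] R.m_comm)

lemma lin_zero: "lin g \<Longrightarrow> g \<zero>\<^bsub>M\<^esub> = \<zero>\<^bsub>M\<^esub>"
  unfolding lin_def by (metis M.zero_closed R.zero_closed smult_l_null)

lemma sub_image: assumes g: "lin g" and N: "sub N" shows "sub (g ` N)"
proof (rule subI)
  show "g ` N \<subseteq> carrier M" using assms sub_carr unfolding lin_def by blast
  show "\<zero>\<^bsub>M\<^esub> \<in> g ` N" using lin_zero[OF g] sub_zero[OF N] by force
next
  fix x y assume "x \<in> g ` N" "y \<in> g ` N"
  then obtain u v where "u \<in> N" "v \<in> N" "x = g u" "y = g v" by blast
  thus "x +\<^sub>m y \<in> g ` N" using g sub_carr[OF N] sub_add[OF N] unfolding lin_def by (intro image_eqI[of _ _ "u +\<^sub>m v"]) auto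
next
  fix a x assume "a \<in> carrier R" "x \<in> g ` N"
  then obtain u where "a \<in> carrier R" "u \<in> N" "x = g u" by blast
  thus "a \<bullet> x \<in> g ` N" using g sub_carr[OF N] sub_smult[OF N] unfolding lin_def by (intro image_eqI[of _ _ "a \<bullet> u"]) auto
qed

lemma sub_vimage: assumes g: "lin g" and N: "sub N" shows "sub {u \<in> carrier M. g u \<in> N}"
  by (rule subI) (use g lin_zero[OF g] sub_zero[OF N] sub_add[OF N] sub_smult[OF N] in \<open>auto simp: lin_def\<close>)

text \<open>The induced map B/A -> D/C is injective, and X corresponds to g(X) + C.\<close>

lemma ql_inj:
  assumes g: "lin g" and s: "sub A" "sub B" "A \<subseteq> B" "sub C" "sub D" "C \<subseteq> D"
    and gB: "\<And>u. u \<in> B \<Longrightarrow> g u \<in> D" and gA: "\<And>u. u \<in> A \<Longrightarrow> g u \<in> C"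
    and inj: "\<And>u. u \<in> B \<Longrightarrow> g u \<in> C \<Longrightarrow> u \<in> A"
  shows "ql A B \<le> ql C D"
proof (rule ql_transfer[where h = "\<lambda>X. g ` X \<uplus> C", OF rmodule_axioms s])
  fix X assume X: "sub X" "A \<subseteq> X" "X \<subseteq> B"
  show "sub (g ` X \<uplus> C) \<and> C \<subseteq> g ` X \<uplus> C \<and> g ` X \<uplus> C \<subseteq> D"
    using sub_sum[OF sub_image[OF g X(1)] s(4)] sum_ub2[OF sub_image[OF g X(1)] s(4)]
      sum_least[OF s(5), of "g ` X" C] gB X s(6) by blast
next
  fix X Y assume X: "sub X" "A \<subseteq> X" and Y: "sub Y" "Y \<subseteq> B" and XY: "X \<subset> Y"
  have "\<not> g ` Y \<uplus> C \<subseteq> g ` X \<uplus> C"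
  proof
    assume le: "g ` Y \<uplus> C \<subseteq> g ` X \<uplus> C"
    have "Y \<subseteq> X"
    proof
      fix y assume y: "y \<in> Y"
      hence "g y \<in> g ` X \<uplus> C" using le sum_ub1[OF sub_image[OF g Y(1)] s(4)] by blast
      then obtain x c where h: "x \<in> X" "c \<in> C" "g y = g x +\<^sub>m c" by (auto elim!: sum_memE)
      have c: "x \<in> carrier M" "y \<in> carrier M" "c \<in> carrier M" "g x \<in> carrier M"
        using h y X Y s sub_carr g unfolding lin_def by blast+
      have "y \<ominus>\<^bsub>M\<^esub> x \<in> B" using y h X Y XY sub_minus[OF Y(1)] by blast
      moreover have "g (y \<ominus>\<^bsub>M\<^esub> x) = c"
      proof -
        have e: "y = x +\<^sub>m (y \<ominus>\<^bsub>M\<^esub> x)" using c M.a_lcomm[of x y "\<ominus>\<^bsub>M\<^esub> x"] by (simp add: a_minus_def M.r_neg)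
        have yx: "y \<ominus>\<^bsub>M\<^esub> x \<in> carrier M" using c by simp
        have "g x +\<^sub>m g (y \<ominus>\<^bsub>M\<^esub> x) = g x +\<^sub>m c" using g c yx h(3) e unfolding lin_def by metis
        thus ?thesis using c g yx unfolding lin_def by (metis M.add.l_cancel)
      qed
      ultimately have "y \<ominus>\<^bsub>M\<^esub> x \<in> X" using inj h X(2) by blast
      thus "y \<in> X" using sub_minus_cancel[OF X(1)] h c by blast
    qed
    thus False using XY by blast
  qed
  moreover have "g ` X \<uplus> C \<subseteq> g ` Y \<uplus> C" using XY by (intro sum_mono) auto
  ultimately show "g ` X \<uplus> C \<subset> g ` Y \<uplus> C" by blast
qed

text \<open>Each class of D/C is represented by some g b with b in B. So taking preimages inside B
  is strictly increasing.\<close>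

lemma ql_surj:
  assumes g: "lin g" and s: "sub A" "sub B" "A \<subseteq> B" "sub C" "sub D" "C \<subseteq> D"
    and gA: "\<And>u. u \<in> A \<Longrightarrow> g u \<in> C"
    and surj: "D \<subseteq> g ` B \<uplus> C"
  shows "ql C D \<le> ql A B"
proof (rule ql_transfer[where h = "\<lambda>X. {u \<in> carrier M. g u \<in> X} \<inter> B", OF rmodule_axioms s(4-6) s(1-3)])
  fix X assume X: "sub X" "C \<subseteq> X" "X \<subseteq> D"
  show "sub ({u \<in> carrier M. g u \<in> X} \<inter> B) \<and> A \<subseteq> {u \<in> carrier M. g u \<in> X} \<inter> B \<and> {u \<in> carrier M. g u \<in> X} \<inter> B \<subseteq> B"
    using sub_Int[OF sub_vimage[OF g X(1)] s(2)] gA X s(3) sub_carr[OF s(1)] by blast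
next
  fix X Y assume X: "sub X" "C \<subseteq> X" and Y: "sub Y" "Y \<subseteq> D" and XY: "X \<subset> Y"
  obtain y where y: "y \<in> Y" "y \<notin> X" using XY by blast
  then obtain b c where h: "b \<in> B" "c \<in> C" "y = g b +\<^sub>m c" using surj Y by (auto elim!: sum_memE)
  have b: "b \<in> carrier M" using h s sub_carr by blast
  have gb: "g b \<in> carrier M" using g b unfolding lin_def by blast
  have "g b \<in> Y" using sub_cancel'[OF Y(1), of c "g b"] h X y XY gb by blast
  moreover have "g b \<notin> X" using y h X sub_add[OF X(1)] by blast
  ultimately show "{u \<in> carrier M. g u \<in> X} \<inter> B \<subset> {u \<in> carrier M. g u \<in> Y} \<inter> B" using XY h b by blast
qed

lemma ql_self: assumes "sub A" shows "ql A A = 0"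
proof -
  have "\<not> enat 1 \<le> ql A A"
  proof
    assume "enat 1 \<le> ql A A"
    then obtain Ns where h: "length Ns = Suc (Suc 0)" "ic A A Ns" using ql_ge_iff[OF assms assms] by auto
    then obtain X Y where "Ns = [X, Y]" by (auto simp: length_Suc_conv)
    thus False using h(2) unfolding ichain_def by auto
  qed
  thus ?thesis by (cases "ql A A") (auto simp: zero_enat_def)
qed

end

section \<open>Finiteness of lengths over a local ring\<close>

context local_rmodule
begin

text \<open>(N + R v)/N is a quotient of R/m: a submodule strictly above N contains r v for some r
  outside m, and r is a unit.\<close>

lemma ql_cyc_le:
  assumes N: "sub N" and v: "v \<in> carrier M" and mv: "\<And>a. a \<in> m \<Longrightarrow> a \<bullet> v \<in> N"
  shows "ql N (N \<uplus> cyc v) \<le> 1"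
proof -
  let ?V = "N \<uplus> cyc v"
  have V: "sub ?V" "N \<subseteq> ?V" using sub_sum[OF N sub_cyc[OF v]] sum_ub1[OF N sub_cyc[OF v]] by auto
  have two: "X = N \<or> X = ?V" if X: "sub X" "N \<subseteq> X" "X \<subseteq> ?V" for X
  proof (rule disjCI)
    assume "X \<noteq> ?V"
    show "X = N"
    proof (rule ccontr)
      assume "X \<noteq> N"
      then obtain x where x: "x \<in> X" "x \<notin> N" using X by blast
      then obtain a r where h: "a \<in> N" "r \<in> carrier R" "x = a +\<^sub>m r \<bullet> v" using X by (auto elim!: sum_memE)
      have "r \<notin> m" using h x mv sub_add[OF N] by blast
      moreover have "r \<bullet> v \<in> X" using sub_cancel[OF X(1), of a "r \<bullet> v"] h X x v by auto
      ultimately have "v \<in> X" using unit_cancel[OF X(1), of r v] h v by blast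
      hence "?V \<subseteq> X" using sum_least[OF X(1,2) cyc_least[OF X(1)]] by blast
      thus False using X \<open>X \<noteq> ?V\<close> by blast
    qed
  qed
  have "\<not> enat 2 \<le> ql N ?V"
  proof
    assume "enat 2 \<le> ql N ?V"
    then obtain Ns where h: "length Ns = Suc (Suc (Suc 0))" "ic N ?V Ns" using ql_ge_iff[OF N V, of 2] by (auto simp: numeral_2_eq_2)
    then obtain X Y Z where "Ns = [X, Y, Z]" by (auto simp: length_Suc_conv)
    hence XYZ: "X \<subset> Y" "Y \<subset> Z" "sub X" "sub Y" "sub Z" "N \<subseteq> X" "N \<subseteq> Y" "N \<subseteq> Z" "X \<subseteq> ?V" "Y \<subseteq> ?V" "Z \<subseteq> ?V"
      using h(2) unfolding ichain_def by auto
    thus False using two[of X] two[of Y] two[of Z] by blast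
  qed
  moreover have "enat 2 \<le> x" if "\<not> x \<le> 1" for x :: enat
    using that by (cases x) (auto simp: one_enat_def)
  ultimately show ?thesis by blast
qed

text \<open>Let W be maximal with infinite colength in U. If m^(i+1) U lies in W but m^i U does not,
  some v in m^i U outside W satisfies m v \<subseteq> W. Then W + R v is at most one step above W,
  so by additivity it has infinite colength too, against maximality.\<close>

lemma ql_fin:
  assumes N: "sub N" and U: "sub U" and NU: "N \<subseteq> U" and k: "ideal_pow R m k \<star> U \<subseteq> N"
  shows "ql N U \<noteq> \<infinity>"
proof
  assume inf: "ql N U = \<infinity>"
  obtain W where W: "sub W" and W': "N \<subseteq> W \<and> W \<subseteq> U \<and> ql W U = \<infinity>"
    and mx: "\<And>V. sub V \<Longrightarrow> N \<subseteq> V \<and> V \<subseteq> U \<and> ql V U = \<infinity> \<Longrightarrow> W \<subseteq> V \<Longrightarrow> V = W"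
    by (rule sub_maxE[of N "\<lambda>W. N \<subseteq> W \<and> W \<subseteq> U \<and> ql W U = \<infinity>"]) (use N NU inf in auto)
  have "W \<noteq> U" using W' ql_self[OF U] by auto
  hence z: "\<not> ideal_pow R m 0 \<star> U \<subseteq> W" using ism_carrier[OF U] W' by auto
  define i where "i = (LEAST i. ideal_pow R m (Suc i) \<star> U \<subseteq> W)"
  have ex: "\<exists>i. ideal_pow R m (Suc i) \<star> U \<subseteq> W"
  proof (cases k)
    case 0 thus ?thesis using k W' z by auto
  next
    case (Suc k') thus ?thesis using k W' by blast
  qed
  have i1: "ideal_pow R m (Suc i) \<star> U \<subseteq> W" using LeastI_ex[OF ex] unfolding i_def .
  have i2: "\<not> ideal_pow R m i \<star> U \<subseteq> W"
  proof (cases i)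
    case (Suc i')
    show ?thesis using not_less_Least[of i' "\<lambda>i. ideal_pow R m (Suc i) \<star> U \<subseteq> W"] Suc unfolding i_def by simp
  qed (use z in simp)
  then obtain v where v: "v \<in> ideal_pow R m i \<star> U" "v \<notin> W" by blast
  have vU: "v \<in> U" using v ism_subset[OF ideal_pow_carr[OF m_ideal] U] by blast
  have vc: "v \<in> carrier M" using vU sub_carr[OF U] by blast
  have mv: "a \<bullet> v \<in> W" if "a \<in> m" for a
    using subsetD[OF i1] ism_pow_Suc[OF m_ideal U, of i] ism_memI[OF that v(1)] by simp
  let ?V = "W \<uplus> cyc v"
  have V: "sub ?V" "W \<subseteq> ?V" "v \<in> ?V" "?V \<subseteq> U"
    using sub_sum[OF W sub_cyc[OF vc]] sum_ub1[OF W sub_cyc[OF vc]] sum_ub2[OF W sub_cyc[OF vc]] cyc_self[OF vc]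
      sum_least[OF U _ cyc_least[OF U vU]] W' by auto
  have NV: "N \<subseteq> ?V" using V(2) W' by blast
  have "ql ?V U \<noteq> \<infinity>" using mx[OF V(1) _ V(2)] NV V(3,4) v(2) by metis
  moreover have "ql W ?V \<le> 1" using ql_cyc_le[OF W vc mv] .
  moreover have "ql W U = ql W ?V + ql ?V U" using ql_add[OF W V(1) U V(2,4)] .
  ultimately show False using W' by (metis enat_ord_code(3) infinity_ileE one_enat_def plus_eq_infty_iff_enat)
qed

end

section \<open>The principal ideal theorem\<close>

context cring
begin

lemmas idl_carr = ideal.Icarr
lemmas idl_add = rmodule.sub_add[OF rmodule_ring_mod, simplified]
lemmas idl_zero = rmodule.sub_zero[OF rmodule_ring_mod, simplified]
lemmas idl_mult = rmodule.sub_smult[OF rmodule_ring_mod, simplified]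
lemmas idl_cancel = rmodule.sub_cancel[OF rmodule_ring_mod, simplified]
lemmas idl_cancel' = rmodule.sub_cancel'[OF rmodule_ring_mod, simplified]
lemmas isum_ub1 = rmodule.sum_ub1[OF rmodule_ring_mod, simplified]
lemmas isum_ub2 = rmodule.sum_ub2[OF rmodule_ring_mod, simplified]
lemmas isum_least = rmodule.sum_least[OF rmodule_ring_mod, simplified]
lemmas isum_memE = rmodule.sum_memE[OF rmodule_ring_mod, simplified]
lemmas isum_memI = rmodule.sum_memI[OF rmodule_ring_mod, simplified]
lemmas isum_mono = rmodule.sum_mono[OF rmodule_ring_mod, simplified]

abbreviation isat :: "'a set \<Rightarrow> 'a set \<Rightarrow> 'a set" where "isat P I \<equiv> sat R (ring_mod R) P I"

lemma isat_def: "isat P I = {v \<in> carrier R. \<exists>s \<in> carrier R - P. s \<otimes> v \<in> I}"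
  by (simp add: sat_def)

lemmas isat_ub = rmodule.sat_ub[OF rmodule_ring_mod, simplified]
lemmas isat_mono = rmodule.sat_mono[OF rmodule_ring_mod, simplified]
lemmas isat_idem = rmodule.sat_idem[OF rmodule_ring_mod, simplified]
lemmas ideal_isat = rmodule.sub_sat[OF rmodule_ring_mod, simplified]

lemma prime_ideal: "primeideal P R \<Longrightarrow> ideal P R"
  by (rule primeideal.axioms(1))

lemma prime_mult: "primeideal P R \<Longrightarrow> a \<in> carrier R \<Longrightarrow> b \<in> carrier R \<Longrightarrow> a \<otimes> b \<in> P \<Longrightarrow> a \<in> P \<or> b \<in> P"
  by (rule primeideal.I_prime)

lemma prime_one: "primeideal P R \<Longrightarrow> \<one> \<notin> P"
  using rmodule.compl_prime(1)[OF rmodule_ring_mod] by blast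

lemma ideal_PIdl_sum: "ideal K R \<Longrightarrow> a \<in> carrier R \<Longrightarrow> ideal (K +\<^sub>i PIdl a) R"
  by (intro add_ideals cgenideal_ideal)

lemma PIdl_sum_ub: assumes "ideal K R" "a \<in> carrier R" shows "K \<subseteq> K +\<^sub>i PIdl a" "a \<in> K +\<^sub>i PIdl a"
  using isum_ub1[OF assms(1) cgenideal_ideal[OF assms(2)]] isum_ub2[OF assms(1) cgenideal_ideal[OF assms(2)]]
    cgenideal_self[OF assms(2)] by auto

lemma PIdl_sumE: assumes "v \<in> K +\<^sub>i PIdl a" obtains k r where "k \<in> K" "r \<in> carrier R" "v = k \<oplus> r \<otimes> a"
  using assms unfolding PIdl_eq_cyc by (auto elim!: isum_memE)

lemma PIdl_sum_least: assumes "ideal J R" "K \<subseteq> J" "a \<in> J" shows "K +\<^sub>i PIdl a \<subseteq> J"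
  using isum_least[OF assms(1,2)] cgenideal_minimal[OF assms(1,3)] by blast

lemma prime_pow_subset: "primeideal P R \<Longrightarrow> ideal I R \<Longrightarrow> ideal_pow R I k \<subseteq> P \<Longrightarrow> I \<subseteq> P"
proof (induction k)
  case 0
  thus ?case using prime_one[OF 0(1)] by auto
next
  case (Suc k)
  thus ?case using primeideal_divides_ideal_prod[OF Suc(2) Suc(3) pow_ideal[OF Suc(3)], of k] by auto
qed

end

section \<open>Primes below P and chain conditions at P\<close>

context nring
begin

text \<open>An element that is not nilpotent in the localization of R/I at P is avoided by some
  prime there. The prime is an ideal J over I, maximal among those whose saturation contains no
  power of a; J lies in P, since an element of J outside P would put a^0 = 1 into the
  saturation.\<close>

lemma prime_avoiding:
  assumes P: "primeideal P R" and I: "ideal I R" and a: "a \<in> carrier R" and no: "\<And>j::nat. a [^] j \<notin> isat P I"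
  shows "\<exists>J. primeideal J R \<and> I \<subseteq> J \<and> J \<subseteq> P \<and> a \<notin> J"
proof -
  obtain J where J: "ideal J R" and J': "I \<subseteq> J \<and> (\<forall>j::nat. a [^] j \<notin> isat P J)"
    and mx: "\<And>V. ideal V R \<Longrightarrow> I \<subseteq> V \<and> (\<forall>j::nat. a [^] j \<notin> isat P V) \<Longrightarrow> J \<subseteq> V \<Longrightarrow> V = J"
    by (rule ideal_maxE[of I "\<lambda>J. I \<subseteq> J \<and> (\<forall>j::nat. a [^] j \<notin> isat P J)"]) (use I no in auto)
  have JP: "J \<subseteq> P"
  proof (rule ccontr)
    assume "\<not> J \<subseteq> P"
    then obtain s where s: "s \<in> J" "s \<notin> P" by blast
    have "s \<in> carrier R" using s idl_carr[OF J] by blast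
    hence "a [^] (0::nat) \<in> isat P J" using s unfolding isat_def by auto
    thus False using J' by blast
  qed
  have "primeideal J R"
  proof (rule primeideal_criterion[OF J])
    show "J \<noteq> carrier R" using JP prime_one[OF P] by auto
    fix b c assume b: "b \<in> carrier R - J" and c: "c \<in> carrier R - J"
    have *: "\<exists>j::nat. a [^] j \<in> isat P (J +\<^sub>i PIdl d)" if d: "d \<in> carrier R - J" for d
    proof -
      have "ideal (J +\<^sub>i PIdl d) R" "J \<subseteq> J +\<^sub>i PIdl d" "d \<in> J +\<^sub>i PIdl d"
        using ideal_PIdl_sum[OF J] PIdl_sum_ub[OF J] d by auto
      thus ?thesis using mx[of "J +\<^sub>i PIdl d"] J' d by blast
    qed
    obtain i j :: nat and s t where h: "s \<in> carrier R - P" "t \<in> carrier R - P"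
      "s \<otimes> a [^] i \<in> J +\<^sub>i PIdl b" "t \<otimes> a [^] j \<in> J +\<^sub>i PIdl c"
      using *[OF b] *[OF c] unfolding isat_def by blast
    show "b \<otimes> c \<notin> J"
    proof
      assume "b \<otimes> c \<in> J"
      hence "(s \<otimes> a [^] i) \<otimes> (t \<otimes> a [^] j) \<in> J" using prod_sum_PIdl[OF J _ _ _ h(3,4)] b c by blast
      moreover have "(s \<otimes> a [^] i) \<otimes> (t \<otimes> a [^] j) = (s \<otimes> t) \<otimes> a [^] (i + j)"
        using h a by (simp add: nat_pow_mult[symmetric] m_ac)
      moreover have "s \<otimes> t \<in> carrier R - P" using h prime_mult[OF P, of s t] by auto
      ultimately have "a [^] (i + j) \<in> isat P J" using a unfolding isat_def by auto
      thus False using J' by blast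
    qed
  qed
  moreover have "a \<notin> J"
  proof
    assume "a \<in> J"
    hence "a [^] (1::nat) \<in> isat P J" using isat_ub[OF P J] a by auto
    thus False using J' by blast
  qed
  ultimately show ?thesis using J' JP by blast
qed

text \<open>The descending chain condition for the Artinian ring obtained by localizing \<open>R / I\<close> at \<open>P\<close>.\<close>
lemma dcc_sat:
  assumes P: "primeideal P R" and I: "ideal I R" and N: "ideal_pow R P N \<subseteq> isat P I"
    and J: "\<And>k::nat. ideal (J k) R" "\<And>k. J (Suc k) \<subseteq> J k" "\<And>k. I \<subseteq> J k"
  shows "\<exists>k. \<forall>j\<ge>k. J k \<subseteq> isat P (J j)"
proof (rule ccontr)
  \<comment> \<open>\<open>good W\<close> is the descending chain condition above W, up to
    saturation. For W maximal among the ideals over I that fail it, a one-step extension W + (c)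
    satisfies it, and the condition is carried back to W.\<close>
  define good where "good W \<longleftrightarrow> (\<forall>J. (\<forall>k::nat. ideal (J k) R) \<longrightarrow> (\<forall>k. J (Suc k) \<subseteq> J k) \<longrightarrow> (\<forall>k. W \<subseteq> J k)
     \<longrightarrow> (\<exists>k. \<forall>j\<ge>k. J k \<subseteq> isat P (J j)))" for W
  assume "\<not> ?thesis"
  hence ng: "\<not> good I" using J unfolding good_def by blast
  obtain W where W: "ideal W R" and W': "I \<subseteq> W \<and> \<not> good W"
    and mx: "\<And>V. ideal V R \<Longrightarrow> I \<subseteq> V \<and> \<not> good V \<Longrightarrow> W \<subseteq> V \<Longrightarrow> V = W"
    by (rule ideal_maxE[of I "\<lambda>W. I \<subseteq> W \<and> \<not> good W"]) (use I ng in auto)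
  have WP: "W \<subseteq> P"
  proof (rule ccontr)
    assume "\<not> W \<subseteq> P"
    then obtain s where s: "s \<in> W" "s \<notin> P" by blast
    have sc: "s \<in> carrier R" using s W idl_carr by metis
    have "good W" unfolding good_def
    proof (intro allI impI exI[of _ 0])
      fix J j assume J: "\<forall>k::nat. ideal (J k) R" "\<forall>k. W \<subseteq> J k"
      show "J 0 \<subseteq> isat P (J j)"
      proof
        fix v assume "v \<in> J 0"
        hence v: "v \<in> carrier R" using idl_carr J(1) by metis
        hence "v \<otimes> s \<in> J j" using idl_mult[of "J j" v s] J s by auto
        hence "s \<otimes> v \<in> J j" using sc v m_comm[of s v] by simp
        thus "v \<in> isat P (J j)" unfolding isat_def using sc s v by blast
      qed
    qed
    thus False using W' by blast
  qed
  have Pi: "ideal P R" using prime_ideal[OF P] .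
  have sW: "ideal (isat P W) R" using ideal_isat[OF P W] .
  have IW: "isat P I \<subseteq> isat P W" using W' isat_mono by blast
  have z: "\<not> ideal_pow R P 0 \<subseteq> isat P W"
  proof
    assume "ideal_pow R P 0 \<subseteq> isat P W"
    hence "\<one> \<in> isat P W" by auto
    then obtain s where "s \<in> carrier R - P" "s \<otimes> \<one> \<in> W" unfolding isat_def by blast
    thus False using WP by auto
  qed
  define i where "i = (LEAST i. ideal_pow R P (Suc i) \<subseteq> isat P W)"
  have ex: "\<exists>i. ideal_pow R P (Suc i) \<subseteq> isat P W"
  proof (cases N)
    case 0 thus ?thesis using N IW z by auto
  next
    case (Suc k') thus ?thesis using N IW by blast
  qed
  have i1: "ideal_pow R P (Suc i) \<subseteq> isat P W" using LeastI_ex[OF ex] unfolding i_def .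
  have i2: "\<not> ideal_pow R P i \<subseteq> isat P W"
  proof (cases i)
    case (Suc i')
    show ?thesis using not_less_Least[of i' "\<lambda>i. ideal_pow R P (Suc i) \<subseteq> isat P W"] Suc unfolding i_def by simp
  qed (use z in simp)
  \<comment> \<open>Taken from the last power of P that escapes the saturation of W, so that P c
    lies in that saturation: locally, W + (c) is one step above W.\<close>
  then obtain c where c: "c \<in> ideal_pow R P i" "c \<notin> isat P W" by blast
  have cc: "c \<in> carrier R" using c idl_carr[OF pow_ideal[OF Pi]] by blast
  have Pc: "p \<otimes> c \<in> isat P W" if "p \<in> P" for p
    using subsetD[OF i1] ideal_prod.prod[OF that c(1), of R] by simp
  let ?V = "W +\<^sub>i PIdl c"
  have V: "ideal ?V R" "W \<subseteq> ?V" "c \<in> ?V" using ideal_PIdl_sum[OF W cc] PIdl_sum_ub[OF W cc] by auto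
  have "?V \<noteq> W" using V(3) c isat_ub[OF P W] by blast
  hence gV: "good ?V" using mx[OF V(1) _ V(2)] V W' by blast
  have "good W" unfolding good_def
  proof (intro allI impI)
    fix J assume J: "\<forall>k::nat. ideal (J k) R" "\<forall>k. J (Suc k) \<subseteq> J k" "\<forall>k. W \<subseteq> J k"
    have anti: "J j \<subseteq> J k" if "k \<le> j" for k j using lift_Suc_antimono_le[of J k j] J(2) that by blast
    define J' where "J' k = J k +\<^sub>i PIdl c" for k
    have "\<exists>k. \<forall>j\<ge>k. J' k \<subseteq> isat P (J' j)"
    proof (rule gV[unfolded good_def, rule_format])
      show "ideal (J' k) R" for k unfolding J'_def using ideal_PIdl_sum J(1) cc by blast
      show "J' (Suc k) \<subseteq> J' k" for k unfolding J'_def using isum_mono J(2) by blast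
      show "?V \<subseteq> J' k" for k unfolding J'_def using isum_mono J(3) by blast
    qed
    then obtain k0 where k0: "\<And>j. j \<ge> k0 \<Longrightarrow> J' k0 \<subseteq> isat P (J' j)" by blast
    have dec: "\<exists>s b r. s \<in> carrier R - P \<and> b \<in> J j \<and> r \<in> carrier R \<and> s \<otimes> a = b \<oplus> r \<otimes> c"
      if a: "a \<in> J k0" and j: "j \<ge> k0" for a j
    proof -
      have "a \<in> isat P (J' j)" using k0[OF j] a PIdl_sum_ub(1)[of "J k0" c] J(1) cc unfolding J'_def by blast
      thus ?thesis unfolding isat_def J'_def by (auto elim!: PIdl_sumE)
    qed
    \<comment> \<open>Up to a factor outside P, a = b + r c with b in J j. Either c belongs to all J
      k locally, and the term r c is absorbed after another factor outside P; or c leaves at some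
      k1, and then r c in J k1 forces r into P, so r c lies in the saturation of W.\<close>
    show "\<exists>k. \<forall>j\<ge>k. J k \<subseteq> isat P (J j)"
    proof (cases "\<forall>k. \<exists>s \<in> carrier R - P. s \<otimes> c \<in> J k")
      case True
      show ?thesis
      proof (intro exI[of _ k0] allI impI subsetI)
        fix j a assume j: "k0 \<le> j" and a: "a \<in> J k0"
        obtain s b r where h: "s \<in> carrier R - P" "b \<in> J j" "r \<in> carrier R" "s \<otimes> a = b \<oplus> r \<otimes> c" using dec[OF a j] by blast
        obtain t where t: "t \<in> carrier R - P" "t \<otimes> c \<in> J j" using True by blast
        have jj: "ideal (J j) R" using J(1) by blast
        have ac: "a \<in> carrier R" "b \<in> carrier R" using idl_carr[OF jj] idl_carr[of "J k0" R a] J(1) a h by auto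
        have "(t \<otimes> s) \<otimes> a = t \<otimes> b \<oplus> r \<otimes> (t \<otimes> c)"
        proof -
          have "(t \<otimes> s) \<otimes> a = t \<otimes> (s \<otimes> a)" using ac t h(1) by (simp add: m_assoc)
          also have "\<dots> = t \<otimes> b \<oplus> r \<otimes> (t \<otimes> c)" unfolding h(4) using ac t h(3) cc by (simp add: r_distr m_lcomm)
          finally show ?thesis .
        qed
        hence "(t \<otimes> s) \<otimes> a \<in> J j" using idl_add[OF jj] idl_mult[OF jj] t h by auto
        moreover have "t \<otimes> s \<in> carrier R - P" using t h prime_mult[OF P, of t s] by auto
        ultimately show "a \<in> isat P (J j)" unfolding isat_def using ac by blast
      qed
    next
      case False
      then obtain k1 where k1: "\<And>s. s \<in> carrier R \<Longrightarrow> s \<otimes> c \<in> J k1 \<Longrightarrow> s \<in> P" by blast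
      show ?thesis
      proof (intro exI[of _ "max k0 k1"] allI impI subsetI)
        fix j a assume j: "max k0 k1 \<le> j" and a: "a \<in> J (max k0 k1)"
        have a0: "a \<in> J k0" "a \<in> J k1" using a anti[of k0 "max k0 k1"] anti[of k1 "max k0 k1"] by auto
        obtain s b r where h: "s \<in> carrier R - P" "b \<in> J j" "r \<in> carrier R" "s \<otimes> a = b \<oplus> r \<otimes> c" using dec[OF a0(1), of j] j by auto
        have jj: "ideal (J j) R" "ideal (J k1) R" using J(1) by auto
        have ac: "a \<in> carrier R" "b \<in> carrier R" using idl_carr[OF jj(1)] idl_carr[OF jj(2)] a0 h by auto
        have "s \<otimes> a \<in> J k1" using idl_mult[OF jj(2) _ a0(2)] h(1) by blast
        moreover have "b \<in> J k1" using h anti[of k1 j] j by auto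
        ultimately have "r \<otimes> c \<in> J k1" using idl_cancel[OF jj(2), of b "r \<otimes> c"] h cc by auto
        hence "r \<otimes> c \<in> isat P W" using k1 h Pc by blast
        hence "r \<otimes> c \<in> isat P (J j)" using isat_mono[of W "J j" P] J(3) by blast
        hence "s \<otimes> a \<in> isat P (J j)" using h(4) idl_add[OF ideal_isat[OF P jj(1)]] isat_ub[OF P jj(1)] h(2) by auto
        hence "a \<in> isat P (isat P (J j))" unfolding isat_def[of P "isat P (J j)"] using ac h by blast
        thus "a \<in> isat P (J j)" using isat_idem[OF P jj(1)] by blast
      qed
    qed
  qed
  thus False using W' by blast
qed

text \<open>Krull's principal ideal theorem in the form in which chains of primes are shortened:
  symbolic powers of \<open>P\<^sub>1\<close> stabilize modulo \<open>x\<close>.\<close>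
theorem principal_ideal_theorem:
  assumes P0: "primeideal P0 R" and P1: "primeideal P1 R" and P: "primeideal P R"
    and l01: "P0 \<subset> P1" and l1: "P1 \<subset> P" and x: "x \<in> P"
  shows "\<exists>P'. primeideal P' R \<and> P0 \<subseteq> P' \<and> P' \<subset> P \<and> x \<in> P'"
proof (rule ccontr)
  assume no: "\<not> ?thesis"
  have xP1: "x \<notin> P1" using no P1 l01 l1 by blast
  note i = prime_ideal[OF P0] prime_ideal[OF P1] prime_ideal[OF P]
  have xc: "x \<in> carrier R" using x i idl_carr by metis
  interpret rm: noeth_rmodule R "ring_mod R" by (rule noeth_rmodule_ring_mod)
  let ?I = "P0 +\<^sub>i PIdl x"
  have I: "ideal ?I R" "P0 \<subseteq> ?I" "x \<in> ?I" using ideal_PIdl_sum[OF i(1) xc] PIdl_sum_ub[OF i(1) xc] by auto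
  \<comment> \<open>By assumption no prime between P0 + (x) and P is smaller than P, so all elements
    of P are nilpotent in the localization of R/(P0 + (x)) at P. This is the Artinian situation of
    \<open>dcc_sat\<close>.\<close>
  have "\<exists>j::nat. a [^] j \<in> isat P ?I" if a: "a \<in> P" for a
  proof (rule ccontr)
    assume n: "\<nexists>j::nat. a [^] j \<in> isat P ?I"
    have "a \<in> carrier R" using a i idl_carr by metis
    then obtain J where "primeideal J R" "?I \<subseteq> J" "J \<subseteq> P" "a \<notin> J" using prime_avoiding[OF P I(1)] n by blast
    thus False using no I a by blast
  qed
  then obtain N where N: "ideal_pow R P N \<subseteq> isat P ?I" using rad_pow[OF i(3) ideal_isat[OF P I(1)]] by blast
  \<comment> \<open>The symbolic powers of P1 modulo P0.\<close>
  define q where "q k = isat P1 (ideal_pow R P1 k +\<^sub>i P0)" for k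
  have pk: "ideal (ideal_pow R P1 k +\<^sub>i P0) R" for k using add_ideals[OF pow_ideal[OF i(2)] i(1)] .
  have q: "ideal (q k) R" for k unfolding q_def using ideal_isat[OF P1 pk] .
  have qd: "q (Suc k) \<subseteq> q k" for k
    unfolding q_def using isat_mono[OF isum_mono[OF pow_Suc_subset[OF i(2)]]] by blast
  have qP0: "P0 \<subseteq> q k" for k unfolding q_def using isat_ub[OF P1 pk] isum_ub2[OF pow_ideal[OF i(2)] i(1)] by blast
  have "\<exists>k. \<forall>j\<ge>k. q k +\<^sub>i PIdl x \<subseteq> isat P (q j +\<^sub>i PIdl x)"
  proof (rule dcc_sat[OF P I(1) N])
    show "ideal (q k +\<^sub>i PIdl x) R" for k using ideal_PIdl_sum[OF q xc] .
    show "q (Suc k) +\<^sub>i PIdl x \<subseteq> q k +\<^sub>i PIdl x" for k using isum_mono[OF qd] by blast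
    show "?I \<subseteq> q k +\<^sub>i PIdl x" for k using isum_mono[OF qP0] by blast
  qed
  then obtain k where k: "q k +\<^sub>i PIdl x \<subseteq> isat P (q (Suc k) +\<^sub>i PIdl x)" by (metis le_SucI order_refl)
  \<comment> \<open>Up to a factor outside P, an element of q k is b + r x with b in q (k + 1).
    Since x is outside P1, r itself lies in q k; as x is in P, Nakayama at P removes the term x
    r.\<close>
  have "q k \<subseteq> isat P (q (Suc k) +\<^sub>i ideal_smult R (ring_mod R) P (q k))"
  proof
    fix a assume a: "a \<in> q k"
    have ac: "a \<in> carrier R" using a q idl_carr by metis
    have "a \<in> isat P (q (Suc k) +\<^sub>i PIdl x)" using k a PIdl_sum_ub(1)[OF q xc, of k] by blast
    then obtain s b r where h: "s \<in> carrier R - P" "b \<in> q (Suc k)" "r \<in> carrier R" "s \<otimes> a = b \<oplus> r \<otimes> x"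
      unfolding isat_def by (auto elim!: PIdl_sumE)
    have bc: "b \<in> carrier R" using h q idl_carr by metis
    have "s \<otimes> a \<in> q k" using idl_mult[OF q _ a] h by blast
    hence "r \<otimes> x \<in> q k" using idl_cancel[OF q, of b k "r \<otimes> x"] h qd[of k] xc by auto
    then obtain u where u: "u \<in> carrier R - P1" "u \<otimes> (r \<otimes> x) \<in> ideal_pow R P1 k +\<^sub>i P0"
      unfolding q_def isat_def by blast
    have "u \<otimes> (r \<otimes> x) = (u \<otimes> x) \<otimes> r" using u h xc by (simp add: m_ac)
    moreover have "u \<otimes> x \<in> carrier R - P1" using u xP1 xc prime_mult[OF P1, of u x] by auto
    ultimately have "r \<in> q k" using u h unfolding q_def isat_def by auto
    hence "x \<otimes> r \<in> ideal_smult R (ring_mod R) P (q k)" using rm.ism_memI[OF x, of r] by simp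
    hence "s \<otimes> a \<in> q (Suc k) +\<^sub>i ideal_smult R (ring_mod R) P (q k)"
      using isum_memI[OF h(2)] h(3,4) xc m_comm by auto
    thus "a \<in> isat P (q (Suc k) +\<^sub>i ideal_smult R (ring_mod R) P (q k))" unfolding isat_def using ac h by blast
  qed
  hence "q k \<subseteq> isat P (q (Suc k))" using rm.nakayama_sat[OF P, of "q k" "q (Suc k)"] q by simp
  moreover have "isat P (q (Suc k)) \<subseteq> isat P1 (q (Suc k))" using l1 unfolding isat_def by blast
  moreover have "isat P1 (q (Suc k)) = q (Suc k)" unfolding q_def using isat_idem[OF P1 pk] .
  moreover have "ideal_pow R P1 k \<subseteq> q k" unfolding q_def using isat_ub[OF P1 pk] isum_ub1[OF pow_ideal[OF i(2)] i(1)] by blast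
  ultimately have pq: "ideal_pow R P1 k \<subseteq> isat P1 (ideal_pow R P1 (Suc k) +\<^sub>i P0)" unfolding q_def by blast
  \<comment> \<open>A second use of Nakayama, now at P1: locally P1^k lies in P0 + P1 P1^k, hence in
    P0, and so does P1.\<close>
  have "ideal_pow R P1 (Suc k) = ideal_prod R P1 (ideal_pow R P1 k)" by simp
  also have "\<dots> \<subseteq> ideal_smult R (ring_mod R) P1 (ideal_pow R P1 k)"
  proof (rule ideal_prod_least)
    show "ideal (ideal_smult R (ring_mod R) P1 (ideal_pow R P1 k)) R"
      using rm.sub_ism[of P1 "ideal_pow R P1 k"] pow_ideal[OF i(2)] idl_carr[OF i(2)] by auto
    show "\<And>a b. a \<in> P1 \<Longrightarrow> b \<in> ideal_pow R P1 k \<Longrightarrow> a \<otimes> b \<in> ideal_smult R (ring_mod R) P1 (ideal_pow R P1 k)"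
      using rm.ism_memI by simp
  qed
  finally have "ideal_pow R P1 (Suc k) +\<^sub>i P0 \<subseteq> P0 +\<^sub>i ideal_smult R (ring_mod R) P1 (ideal_pow R P1 k)"
    using isum_mono set_add_comm[of "ideal_pow R P1 (Suc k)" P0] idl_carr[OF pow_ideal[OF i(2)]] idl_carr[OF i(1)] by (metis order_refl subsetI)
  hence "ideal_pow R P1 k \<subseteq> isat P1 (P0 +\<^sub>i ideal_smult R (ring_mod R) P1 (ideal_pow R P1 k))"
    using pq isat_mono by blast
  hence "ideal_pow R P1 k \<subseteq> isat P1 P0" using rm.nakayama_sat[OF P1, of "ideal_pow R P1 k" P0] pow_ideal[OF i(2)] i(1) by simp
  moreover have "isat P1 P0 \<subseteq> P0"
    unfolding isat_def using prime_mult[OF P0] l01 by blast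
  ultimately have "ideal_pow R P1 k \<subseteq> P0" by blast
  hence "P1 \<subseteq> P0" using prime_pow_subset[OF P0 i(2)] by blast
  thus False using l01 by blast
qed

end

section \<open>Regular parameters\<close>

declare ideal_pow.simps(2) [simp del]

text \<open>For a prime P this says dim R/P \<ge> l. Chains are counted from their smallest member
  because the principal ideal theorem pushes that member upward.\<close>

primrec coheight_ge :: "('a, 'e) ring_scheme \<Rightarrow> nat \<Rightarrow> 'a set \<Rightarrow> bool" where
  "coheight_ge R 0 P \<longleftrightarrow> primeideal P R"
| "coheight_ge R (Suc l) P \<longleftrightarrow> primeideal P R \<and> (\<exists>P'. P \<subset> P' \<and> coheight_ge R l P')"

lemma coheight_ge_prime: "coheight_ge R l P \<Longrightarrow> primeideal P R"
  by (cases l) auto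

section \<open>Powers of ideals generated by independent parameters\<close>

context cring
begin

lemma pow_Suc_mem: "a \<in> I \<Longrightarrow> b \<in> ideal_pow R I k \<Longrightarrow> a \<otimes> b \<in> ideal_pow R I (Suc k)"
  by (simp add: ideal_pow.simps(2) ideal_prod.prod)

lemma idl_self: "S \<subseteq> carrier R \<Longrightarrow> S \<subseteq> Idl S"
  by (rule genideal_self)
lemma idl_ideal: "S \<subseteq> carrier R \<Longrightarrow> ideal (Idl S) R"
  by (rule genideal_ideal)
lemma idl_least: "ideal I R \<Longrightarrow> S \<subseteq> I \<Longrightarrow> Idl S \<subseteq> I"
  by (rule genideal_minimal)

lemma idl_insert: assumes "x \<in> carrier R" "S \<subseteq> carrier R" shows "Idl (insert x S) = Idl S +\<^sub>i PIdl x"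
proof
  note s = idl_ideal[OF assms(2)]
  show "Idl (insert x S) \<subseteq> Idl S +\<^sub>i PIdl x"
    using idl_self[OF assms(2)] PIdl_sum_ub[OF s assms(1)] ideal_PIdl_sum[OF s assms(1)] by (intro idl_least) auto
  have "ideal (Idl (insert x S)) R" "insert x S \<subseteq> Idl (insert x S)" using assms idl_ideal[of "insert x S"] idl_self[of "insert x S"] by auto
  thus "Idl S +\<^sub>i PIdl x \<subseteq> Idl (insert x S)" by (intro PIdl_sum_least idl_least) auto
qed

lemma idl_Un: assumes "S \<subseteq> carrier R" "T \<subseteq> carrier R" shows "Idl (S \<union> T) = Idl S +\<^sub>i Idl T"
proof
  note s = idl_ideal[OF assms(1)] idl_ideal[OF assms(2)]
  show "Idl (S \<union> T) \<subseteq> Idl S +\<^sub>i Idl T"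
    using idl_self[OF assms(1)] idl_self[OF assms(2)] isum_ub1[OF s] isum_ub2[OF s] add_ideals[OF s] by (intro idl_least) auto
  have "ideal (Idl (S \<union> T)) R" "S \<union> T \<subseteq> Idl (S \<union> T)" using assms idl_ideal[of "S \<union> T"] idl_self[of "S \<union> T"] by auto
  thus "Idl S +\<^sub>i Idl T \<subseteq> Idl (S \<union> T)" by (intro isum_least idl_least) auto
qed

lemma idl_empty: "Idl {} = {\<zero>}"
  using idl_least[OF zeroideal, of "{}"] idl_zero[OF idl_ideal[of "{}"]] by auto

lemma pow_sum_subset:
  assumes I: "ideal I R" and K: "ideal K R" shows "ideal_pow R (I +\<^sub>i K) k \<subseteq> ideal_pow R I k +\<^sub>i K"
proof (induction k)
  case 0
  show ?case using isum_ub1[OF oneideal K] by simp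
next
  case (Suc k)
  note p = pow_ideal[OF I, of k] pow_ideal[OF I, of "Suc k"]
  have IK: "ideal (ideal_pow R I (Suc k) +\<^sub>i K) R" using add_ideals[OF p(2) K] .
  have "ideal_prod R (I +\<^sub>i K) (ideal_pow R (I +\<^sub>i K) k) \<subseteq> ideal_pow R I (Suc k) +\<^sub>i K"
  proof (rule ideal_prod_least[OF IK])
    fix a b assume a: "a \<in> I +\<^sub>i K" and "b \<in> ideal_pow R (I +\<^sub>i K) k"
    hence "b \<in> ideal_pow R I k +\<^sub>i K" using Suc by blast
    then obtain b1 b2 where b: "b1 \<in> ideal_pow R I k" "b2 \<in> K" "b = b1 \<oplus> b2" by (meson isum_memE)
    obtain a1 a2 where a': "a1 \<in> I" "a2 \<in> K" "a = a1 \<oplus> a2" using a by (meson isum_memE)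
    have c: "a1 \<in> carrier R" "a2 \<in> carrier R" "b1 \<in> carrier R" "b2 \<in> carrier R"
      using a' b idl_carr[OF I] idl_carr[OF K] idl_carr[OF p(1)] by auto
    have "a \<otimes> b = a1 \<otimes> b1 \<oplus> (a1 \<otimes> b2 \<oplus> (b1 \<otimes> a2 \<oplus> b2 \<otimes> a2))"
      using a' b c by (simp add: l_distr r_distr m_ac a_ac)
    moreover have "a1 \<otimes> b1 \<in> ideal_pow R I (Suc k)" using pow_Suc_mem[OF a'(1) b(1)] .
    moreover have "a1 \<otimes> b2 \<oplus> (b1 \<otimes> a2 \<oplus> b2 \<otimes> a2) \<in> K" using idl_add[OF K] idl_mult[OF K] a' b c by auto
    ultimately show "a \<otimes> b \<in> ideal_pow R I (Suc k) +\<^sub>i K" using isum_memI by auto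
  qed
  thus ?case by (simp add: ideal_pow.simps(2))
qed

text \<open>Products of k + 1 factors are sorted by whether x occurs: without x they stay in
  I^(k+1), otherwise one x is split off.\<close>

lemma pow_sum_PIdl:
  assumes I: "ideal I R" and x: "x \<in> carrier R" and v: "v \<in> ideal_pow R (I +\<^sub>i PIdl x) (Suc k)"
  shows "\<exists>a w. a \<in> ideal_pow R I (Suc k) \<and> w \<in> ideal_pow R (I +\<^sub>i PIdl x) k \<and> v = a \<oplus> x \<otimes> w"
proof -
  let ?J = "I +\<^sub>i PIdl x"
  have J: "ideal ?J R" using ideal_PIdl_sum[OF I x] .
  interpret rm: rmodule R "ring_mod R" by (rule rmodule_ring_mod)
  have sc: "ideal ((\<lambda>v. x \<otimes> v) ` ideal_pow R ?J k) R" for k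
    using rm.sub_scl[OF x, of "ideal_pow R ?J k"] pow_ideal[OF J] by simp
  have "ideal_pow R ?J (Suc k) \<subseteq> ideal_pow R I (Suc k) +\<^sub>i (\<lambda>v. x \<otimes> v) ` ideal_pow R ?J k"
  proof (induction k)
    case 0
    have "ideal_pow R ?J (Suc 0) = I +\<^sub>i PIdl x" using pow_one[OF J] .
    moreover have "PIdl x = (\<lambda>v. x \<otimes> v) ` carrier R" unfolding PIdl_eq_cyc using x m_comm by (auto intro!: image_cong)
    ultimately show ?case using pow_one[OF I] by simp
  next
    case (Suc k)
    note p = pow_ideal[OF I, of "Suc k"] pow_ideal[OF I, of "Suc (Suc k)"] pow_ideal[OF J, of "Suc k"] pow_ideal[OF J, of k]
    let ?K = "ideal_pow R I (Suc (Suc k)) +\<^sub>i (\<lambda>v. x \<otimes> v) ` ideal_pow R ?J (Suc k)"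
    have K: "ideal ?K R" using add_ideals[OF p(2) sc] .
    have "ideal_prod R ?J (ideal_pow R ?J (Suc k)) \<subseteq> ?K"
    proof (rule ideal_prod_least[OF K])
      fix a b assume a: "a \<in> ?J" and b: "b \<in> ideal_pow R ?J (Suc k)"
      then obtain a1 r where a': "a1 \<in> I" "r \<in> carrier R" "a = a1 \<oplus> r \<otimes> x" by (meson PIdl_sumE)
      obtain b1 w where b': "b1 \<in> ideal_pow R I (Suc k)" "w \<in> ideal_pow R ?J k" "b = b1 \<oplus> x \<otimes> w"
        using b Suc by (auto elim!: isum_memE)
      have c: "a1 \<in> carrier R" "b1 \<in> carrier R" "w \<in> carrier R" "b \<in> carrier R"
        using a' b b' idl_carr[OF I] idl_carr[OF p(1)] idl_carr[OF p(4)] idl_carr[OF p(3)] by auto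
      have e: "a \<otimes> b = a1 \<otimes> b1 \<oplus> x \<otimes> (a1 \<otimes> w \<oplus> r \<otimes> b)"
      proof -
        have "a \<otimes> b = a1 \<otimes> b \<oplus> x \<otimes> (r \<otimes> b)" using a' c x by (simp add: l_distr m_assoc m_lcomm[of r x b])
        also have "\<dots> = a1 \<otimes> b1 \<oplus> x \<otimes> (a1 \<otimes> w) \<oplus> x \<otimes> (r \<otimes> b)" using b'(3) a' c x by (simp add: r_distr m_ac)
        also have "\<dots> = a1 \<otimes> b1 \<oplus> x \<otimes> (a1 \<otimes> w \<oplus> r \<otimes> b)" using a' c x by (simp add: r_distr a_assoc)
        finally show ?thesis .
      qed
      have "a1 \<otimes> b1 \<in> ideal_pow R I (Suc (Suc k))" using pow_Suc_mem[OF a'(1) b'(1)] .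
      moreover have "a1 \<otimes> w \<in> ideal_pow R ?J (Suc k)"
        using pow_Suc_mem[OF subsetD[OF PIdl_sum_ub(1)[OF I x] a'(1)] b'(2)] .
      hence "a1 \<otimes> w \<oplus> r \<otimes> b \<in> ideal_pow R ?J (Suc k)" using idl_add[OF p(3)] idl_mult[OF p(3)] a' b by auto
      ultimately show "a \<otimes> b \<in> ?K" unfolding e by (intro isum_memI) auto
    qed
    thus ?case by (simp add: ideal_pow.simps(2))
  qed
  thus ?thesis using v by (auto elim!: isum_memE)
qed

lemma pow_mono: assumes "ideal I R" "ideal J R" "I \<subseteq> J" shows "ideal_pow R I k \<subseteq> ideal_pow R J k"
proof (induction k)
  case (Suc k)
  have "ideal_prod R I (ideal_pow R I k) \<subseteq> ideal_pow R J (Suc k)"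
    by (rule ideal_prod_least[OF pow_ideal[OF assms(2)]]) (use Suc assms(3) pow_Suc_mem in blast)
  thus ?case by (simp add: ideal_pow.simps(2))
qed simp

text \<open>What is used of a regular system of parameters: the condition on all subsets makes S a
  regular sequence in every order.\<close>

definition indep_params :: "'a set \<Rightarrow> bool" where
  "indep_params S \<longleftrightarrow> finite S \<and> S \<subseteq> carrier R \<and> (\<forall>B\<subseteq>S. primeideal (Idl B) R \<and> (\<forall>y\<in>S - B. y \<notin> Idl B))"

text \<open>Writing J for (C, x), split the component of x u in J^(k+1) as a + x w with a in
  (C)^(k+1) and w in J^k. Then x (u - w) lies in (C)^(k+1) + (B), where x can be cancelled.\<close>

lemma colon_step:
  assumes S: "insert x C \<subseteq> carrier R" "B \<subseteq> carrier R"
    and reg: "\<And>v k. v \<in> carrier R \<Longrightarrow> x \<otimes> v \<in> ideal_pow R (Idl C) k +\<^sub>i Idl B \<Longrightarrow> v \<in> ideal_pow R (Idl C) k +\<^sub>i Idl B"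
    and u: "u \<in> carrier R" and h: "x \<otimes> u \<in> ideal_pow R (Idl (insert x C)) (Suc k) +\<^sub>i Idl B"
  shows "u \<in> ideal_pow R (Idl (insert x C)) k +\<^sub>i Idl B"
proof -
  have c: "C \<subseteq> carrier R" "x \<in> carrier R" using S by auto
  let ?J = "Idl (insert x C)" and ?J' = "Idl C" and ?I = "Idl B"
  note i = idl_ideal[OF c(1)] idl_ideal[OF S(1)] idl_ideal[OF S(2)]
  have J: "?J = ?J' +\<^sub>i PIdl x" using idl_insert[OF c(2,1)] .
  have sJ: "ideal (ideal_pow R ?J k +\<^sub>i ?I) R" using add_ideals[OF pow_ideal[OF i(2)] i(3)] .
  have sJ': "ideal (ideal_pow R ?J' (Suc k) +\<^sub>i ?I) R" using add_ideals[OF pow_ideal[OF i(1)] i(3)] .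
  obtain a' b where h1: "a' \<in> ideal_pow R ?J (Suc k)" "b \<in> ?I" "x \<otimes> u = a' \<oplus> b" using h by (meson isum_memE)
  obtain a w where h2: "a \<in> ideal_pow R ?J' (Suc k)" "w \<in> ideal_pow R ?J k" "a' = a \<oplus> x \<otimes> w"
    using pow_sum_PIdl[OF i(1) c(2), of a' k] h1(1) J by auto
  have cc: "a \<in> carrier R" "w \<in> carrier R" "b \<in> carrier R"
    using h1 h2 idl_carr[OF i(3)] idl_carr[OF pow_ideal[OF i(1)]] idl_carr[OF pow_ideal[OF i(2)]] by blast+
  have "x \<otimes> (u \<ominus> w) = a \<oplus> b"
  proof -
    have "x \<otimes> (u \<ominus> w) = (a \<oplus> x \<otimes> w \<oplus> b) \<ominus> x \<otimes> w" using h1 h2 cc u c by (simp add: a_minus_def r_distr r_minus)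
    also have "\<dots> = a \<oplus> b" using cc c by algebra
    finally show ?thesis .
  qed
  hence "x \<otimes> (u \<ominus> w) \<in> ideal_pow R ?J' (Suc k) +\<^sub>i ?I" using isum_memI[OF h2(1) h1(2)] by simp
  hence "u \<ominus> w \<in> ideal_pow R ?J' (Suc k) +\<^sub>i ?I" using reg u cc by simp
  moreover have "ideal_pow R ?J' (Suc k) \<subseteq> ideal_pow R ?J k"
    using pow_mono[OF i(1,2)] pow_Suc_subset[OF i(2), of k] idl_least[OF i(2), of C] idl_self[OF S(1)] by blast
  ultimately have "u \<ominus> w \<in> ideal_pow R ?J k +\<^sub>i ?I" using isum_mono by blast
  moreover have "w \<in> ideal_pow R ?J k +\<^sub>i ?I" using isum_ub1[OF pow_ideal[OF i(2)] i(3)] h2(2) by blast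
  ultimately have "(u \<ominus> w) \<oplus> w \<in> ideal_pow R ?J k +\<^sub>i ?I" using idl_add[OF sJ] by blast
  moreover have "(u \<ominus> w) \<oplus> w = u" using u cc by algebra
  ultimately show ?thesis by simp
qed

text \<open>That y is a nonzerodivisor modulo (C)^k + (B) is primality of (B) when C is empty.
  Otherwise some x is moved from C to B: this gives v = a + b + x w with a in (C)^k and b in (B);
  cancelling x by \<open>colon_step\<close> leaves y w in (C, x)^(k-1) + (B), and the inner
  induction on k treats w.\<close>

lemma indep_params_power:
  assumes S: "indep_params S" and "finite C"
  shows "C \<subseteq> S \<Longrightarrow> B \<subseteq> S \<Longrightarrow> y \<in> S \<Longrightarrow> C \<inter> B = {} \<Longrightarrow> y \<notin> C \<union> B \<Longrightarrow> v \<in> carrier R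
    \<Longrightarrow> y \<otimes> v \<in> ideal_pow R (Idl C) k +\<^sub>i Idl B \<Longrightarrow> v \<in> ideal_pow R (Idl C) k +\<^sub>i Idl B"
  using assms(2)
proof (induction C arbitrary: B y v k rule: finite_induct)
  case empty
  have Bc: "B \<subseteq> carrier R" and yc: "y \<in> carrier R" using empty S unfolding indep_params_def by auto
  have P: "primeideal (Idl B) R" "y \<notin> Idl B" using empty S unfolding indep_params_def by auto
  note i = prime_ideal[OF P(1)]
  show ?case
  proof (cases k)
    case 0
    thus ?thesis using isum_ub1[OF oneideal i] empty by auto
  next
    case (Suc k')
    have z: "ideal (Idl {}) R" using idl_empty zeroideal by simp
    have "ideal_pow R (Idl {}) k \<subseteq> {\<zero>}" using pow_antimono[OF z, of "Suc 0" k] pow_one[OF z] Suc idl_empty by simp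
    hence "ideal_pow R (Idl {}) k +\<^sub>i Idl B \<subseteq> Idl B" using isum_least[OF i, of "ideal_pow R (Idl {}) k" "Idl B"] idl_zero[OF i] by blast
    hence "y \<otimes> v \<in> Idl B" using empty by blast
    hence "v \<in> Idl B" using prime_mult[OF P(1) yc empty(6)] P(2) by blast
    thus ?thesis using isum_ub2[OF pow_ideal[OF z] i] by blast
  qed
next
  case (insert x C)
  have Bc: "B \<subseteq> carrier R" and yc: "y \<in> carrier R" and xc: "x \<in> carrier R" and Cc: "C \<subseteq> carrier R" and xC: "insert x C \<subseteq> carrier R" and xB: "insert x B \<subseteq> carrier R"
    using insert(4-6) S unfolding indep_params_def by auto
  let ?J = "Idl (insert x C)" and ?J' = "Idl C" and ?I = "Idl B"
  note i = idl_ideal[OF Cc] idl_ideal[OF xC] idl_ideal[OF Bc] idl_ideal[OF xB]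
  have J: "?J = ?J' +\<^sub>i PIdl x" using idl_insert[OF xc Cc] .
  have IB: "Idl (insert x B) = ?I +\<^sub>i PIdl x" using idl_insert[OF xc Bc] .
  have JJ: "?J' \<subseteq> ?J" using J PIdl_sum_ub[OF i(1) xc] by simp
  have xJ: "x \<in> ?J" using idl_self[OF xC] by blast
  have sJ: "ideal (ideal_pow R ?J k +\<^sub>i ?I) R" for k using add_ideals[OF pow_ideal[OF i(2)] i(3)] .
  have IJ: "?I \<subseteq> ideal_pow R ?J k +\<^sub>i ?I" for k using isum_ub2[OF pow_ideal[OF i(2)] i(3)] .
  have PJ: "ideal_pow R ?J k \<subseteq> ideal_pow R ?J k +\<^sub>i ?I" for k using isum_ub1[OF pow_ideal[OF i(2)] i(3)] .
  have colon: "u \<in> ideal_pow R ?J k +\<^sub>i ?I" if "u \<in> carrier R" "x \<otimes> u \<in> ideal_pow R ?J (Suc k) +\<^sub>i ?I" for u k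
  proof (rule colon_step[OF xC Bc _ that])
    fix v k assume "v \<in> carrier R" "x \<otimes> v \<in> ideal_pow R ?J' k +\<^sub>i ?I"
    thus "v \<in> ideal_pow R ?J' k +\<^sub>i ?I" using insert(3)[of B x v k] insert(2,4-8) by blast
  qed
  show ?case using insert(9,10)
  proof (induction k arbitrary: v)
    case 0
    thus ?case using isum_ub1[OF oneideal i(3)] by auto
  next
    case (Suc k)
    \<comment> \<open>Modulo x the powers of (C, x) become powers of (C), to which the outer
      induction applies with x adjoined to B.\<close>
    have "ideal_pow R ?J (Suc k) +\<^sub>i ?I \<subseteq> ideal_pow R ?J' (Suc k) +\<^sub>i Idl (insert x B)"
    proof (rule isum_least)
      show s: "ideal (ideal_pow R ?J' (Suc k) +\<^sub>i Idl (insert x B)) R" using add_ideals[OF pow_ideal[OF i(1)] i(4)] .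
      note ub = isum_ub1[OF pow_ideal[OF i(1), of "Suc k"] i(4)] isum_ub2[OF pow_ideal[OF i(1), of "Suc k"] i(4)]
      show "?I \<subseteq> ideal_pow R ?J' (Suc k) +\<^sub>i Idl (insert x B)"
        using ub(2) PIdl_sum_ub(1)[OF i(3) xc] IB by auto
      have "ideal_pow R ?J (Suc k) \<subseteq> ideal_pow R ?J' (Suc k) +\<^sub>i PIdl x"
        unfolding J using pow_sum_subset[OF i(1) cgenideal_ideal[OF xc]] .
      moreover have "PIdl x \<subseteq> Idl (insert x B)" using IB isum_ub2[OF i(3) cgenideal_ideal[OF xc]] by simp
      ultimately show "ideal_pow R ?J (Suc k) \<subseteq> ideal_pow R ?J' (Suc k) +\<^sub>i Idl (insert x B)"
        using isum_mono[OF order_refl, of "PIdl x" "Idl (insert x B)"] by blast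
    qed
    hence "v \<in> ideal_pow R ?J' (Suc k) +\<^sub>i Idl (insert x B)"
      using insert(3)[of "insert x B" y v "Suc k"] insert(2,4-8) Suc(2,3) by blast
    then obtain a d where h: "a \<in> ideal_pow R ?J' (Suc k)" "d \<in> Idl (insert x B)" "v = a \<oplus> d" by (meson isum_memE)
    obtain b w where h': "b \<in> ?I" "w \<in> carrier R" "d = b \<oplus> w \<otimes> x" using h(2) IB by (auto elim!: PIdl_sumE)
    have ab: "a \<oplus> b \<in> ideal_pow R ?J (Suc k) +\<^sub>i ?I" using h h' pow_mono[OF i(1,2) JJ] isum_memI by blast
    have cc: "a \<in> carrier R" "b \<in> carrier R" using h h' idl_carr[OF i(3)] idl_carr[OF pow_ideal[OF i(1)]] by blast+
    have ev: "v = (a \<oplus> b) \<oplus> x \<otimes> w" using h h' cc xc by (simp add: a_ac m_comm)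
    have "y \<otimes> v = y \<otimes> (a \<oplus> b) \<oplus> x \<otimes> (y \<otimes> w)" unfolding ev using cc xc yc h' by (simp add: r_distr m_ac)
    moreover have "y \<otimes> (a \<oplus> b) \<in> ideal_pow R ?J (Suc k) +\<^sub>i ?I" using idl_mult[OF sJ yc ab] .
    ultimately have "x \<otimes> (y \<otimes> w) \<in> ideal_pow R ?J (Suc k) +\<^sub>i ?I"
      using idl_cancel[OF sJ, of "y \<otimes> (a \<oplus> b)" "Suc k" "x \<otimes> (y \<otimes> w)"] Suc(3) xc yc h' by simp
    hence "y \<otimes> w \<in> ideal_pow R ?J k +\<^sub>i ?I" using colon yc h' by blast
    hence "w \<in> ideal_pow R ?J k +\<^sub>i ?I" using Suc(1) h' by blast
    then obtain w1 w2 where w: "w1 \<in> ideal_pow R ?J k" "w2 \<in> ?I" "w = w1 \<oplus> w2" by (meson isum_memE)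
    have wc: "w1 \<in> carrier R" "w2 \<in> carrier R" using w idl_carr[OF i(3)] idl_carr[OF pow_ideal[OF i(2)]] by blast+
    have "x \<otimes> w = x \<otimes> w1 \<oplus> x \<otimes> w2" using w wc xc by (simp add: r_distr)
    moreover have "x \<otimes> w1 \<in> ideal_pow R ?J (Suc k)" using pow_Suc_mem[OF xJ w(1)] .
    ultimately have "x \<otimes> w \<in> ideal_pow R ?J (Suc k) +\<^sub>i ?I" using isum_memI idl_mult[OF i(3) xc w(2)] by auto
    thus "v \<in> ideal_pow R ?J (Suc k) +\<^sub>i ?I" unfolding ev using idl_add[OF sJ ab] by blast
  qed
qed

text \<open>Regularity of the leading form of x on the associated graded ring of R/(B), in terms of
  colon ideals. Modulo (B) the ideal m is generated by x and the remaining parameters C;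
  \<open>indep_params_power\<close> supplies the hypothesis of \<open>colon_step\<close>.\<close>

lemma indep_params_colon:
  assumes S: "indep_params S" and m: "m = Idl S" and B: "B \<subseteq> S" and x: "x \<in> S - B"
    and u: "u \<in> carrier R" and h: "x \<otimes> u \<in> ideal_pow R m (Suc k) +\<^sub>i Idl B"
  shows "u \<in> ideal_pow R m k +\<^sub>i Idl B"
proof -
  define C where "C = S - B - {x}"
  have fin: "finite C" and Sc: "S \<subseteq> carrier R" using S unfolding indep_params_def C_def by auto
  have c: "insert x C \<subseteq> carrier R" "B \<subseteq> carrier R" using Sc x B unfolding C_def by auto
  note i = idl_ideal[OF c(1)] idl_ideal[OF c(2)] idl_ideal[OF Sc]
  have "S = insert x C \<union> B" using x B unfolding C_def by auto
  hence m': "m = Idl (insert x C) +\<^sub>i Idl B" using idl_Un[OF c] m by simp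
  have "ideal_pow R m (Suc k) +\<^sub>i Idl B \<subseteq> ideal_pow R (Idl (insert x C)) (Suc k) +\<^sub>i Idl B"
    unfolding m' using pow_sum_subset[OF i(1,2)] isum_ub2[OF pow_ideal[OF i(1)] i(2)]
    by (intro isum_least add_ideals pow_ideal i) auto
  hence "u \<in> ideal_pow R (Idl (insert x C)) k +\<^sub>i Idl B"
    using h
  proof (intro colon_step[OF c _ u])
    fix v k assume "v \<in> carrier R" "x \<otimes> v \<in> ideal_pow R (Idl C) k +\<^sub>i Idl B"
    thus "v \<in> ideal_pow R (Idl C) k +\<^sub>i Idl B"
      using indep_params_power[OF S fin, of B x v k] x B unfolding C_def by blast
  qed blast
  moreover have "Idl (insert x C) \<subseteq> m" unfolding m' using isum_ub1[OF i(1,2)] .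
  hence "ideal_pow R (Idl (insert x C)) k \<subseteq> ideal_pow R m k" using pow_mono[OF i(1)] i(3) m by simp
  ultimately show ?thesis using isum_mono by blast
qed

end

section \<open>Chains of primes in a local ring and systems of parameters\<close>

locale lring = nring R for R :: "('a, 'e) ring_scheme" (structure) +
  fixes m assumes loc: "local_ring R m"
begin

lemma local_rmodule_ring_mod: "local_rmodule R (ring_mod R) m"
  using noeth_rmodule_ring_mod loc by (simp add: local_rmodule_def local_rmodule_axioms_def)

lemma m_prime: "primeideal m R"
  using loc unfolding local_ring_def by (simp add: maximalideal_prime)
lemma m_ideal: "ideal m R"
  using prime_ideal[OF m_prime] .
lemma m_carr: "a \<in> m \<Longrightarrow> a \<in> carrier R"
  using m_ideal by (rule idl_carr)

lemma ideal_sub_m: assumes I: "ideal I R" and n: "I \<noteq> carrier R" shows "I \<subseteq> m"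
proof (rule ccontr)
  assume "\<not> I \<subseteq> m"
  then obtain a where a: "a \<in> I" "a \<notin> m" by blast
  have ac: "a \<in> carrier R" using a I idl_carr by metis
  have "a \<in> Units R" using local_unit[OF loc] a ac by blast
  hence "inv a \<otimes> a = \<one>" "inv a \<in> carrier R" by auto
  hence "\<one> \<in> I" using idl_mult[OF I _ a(1), of "inv a"] by simp
  thus False using ideal.one_imp_carrier[OF I] n by blast
qed

lemma prime_sub_m: "primeideal P R \<Longrightarrow> P \<subseteq> m"
  using ideal_sub_m[OF prime_ideal] prime_one by auto

text \<open>Dividing by one element of m costs at most one step of a chain. The element t is pushed
  down from the top: if P < P1 < P2 with t in P2 but not in P1, the principal ideal theorem replaces
  P1 by a prime that contains t.\<close>

lemma coheight_shift:
  assumes "coheight_ge R (Suc l) P" "t \<in> m"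
  shows "\<exists>P'. P \<subseteq> P' \<and> t \<in> P' \<and> coheight_ge R l P'"
  using assms(1)
proof (induction l arbitrary: P)
  case 0
  thus ?case using assms(2) m_prime prime_sub_m by auto
next
  case (Suc l)
  then obtain P1 where P: "primeideal P R" "P \<subset> P1" "coheight_ge R (Suc l) P1" by auto
  then obtain P2 where P2: "P1 \<subseteq> P2" "t \<in> P2" "coheight_ge R l P2" using Suc(1) by blast
  show ?case
  proof (cases "t \<in> P1")
    case True
    thus ?thesis using P by blast
  next
    case False
    hence "P1 \<subset> P2" using P2 by blast
    then obtain P' where "primeideal P' R" "P \<subseteq> P'" "P' \<subset> P2" "t \<in> P'"
      using principal_ideal_theorem[OF P(1) coheight_ge_prime[OF P(3)] coheight_ge_prime[OF P2(3)] P(2) _ P2(2)] by blast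
    moreover from this have "coheight_ge R (Suc l) P'" using P2(3) by (simp del: psubset_eq) blast
    ultimately show ?thesis by blast
  qed
qed

text \<open>Krull's bound dim R/(B) \<le> |S|: the elements of S are forced into the prime one after
  another, at the price of one step each, until it contains m.\<close>

lemma coheight_le:
  assumes "finite S"
  shows "B \<union> S \<subseteq> carrier R \<Longrightarrow> Idl (B \<union> S) = m \<Longrightarrow> coheight_ge R l P \<Longrightarrow> B \<subseteq> P \<Longrightarrow> l \<le> card S"
  using assms
proof (induction S arbitrary: B l P rule: finite_induct)
  case empty
  have P: "primeideal P R" using coheight_ge_prime[OF empty(3)] .
  have "m \<subseteq> P" using idl_least[OF prime_ideal[OF P]] empty by auto
  hence "l = 0" using empty(3) coheight_ge_prime prime_sub_m by (cases l) (auto, blast)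
  thus ?case by simp
next
  case (insert s S)
  show ?case
  proof (cases l)
    case (Suc l')
    have "s \<in> m" using idl_self[OF insert(4)] insert(5) by blast
    then obtain P' where P': "P \<subseteq> P'" "s \<in> P'" "coheight_ge R l' P'" using coheight_shift insert(6) Suc by blast
    have "l' \<le> card S" using insert(3)[of "insert s B" l' P'] insert(4-7) P' by auto
    thus ?thesis using Suc insert by simp
  qed simp
qed

text \<open>The extremal case of \<open>coheight_le\<close>. The shifted prime is (B, s) by
  induction, while s is outside P by the dimension bound. So every v in P is b + s r with r in P,
  and Nakayama turns P \<subseteq> (B) + s P into P \<subseteq> (B).\<close>

lemma regular_prime:
  assumes "finite S"
  shows "B \<union> S \<subseteq> carrier R \<Longrightarrow> Idl (B \<union> S) = m \<Longrightarrow> coheight_ge R (card S) P \<Longrightarrow> B \<subseteq> P \<Longrightarrow> P = Idl B"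
  using assms
proof (induction S arbitrary: B P rule: finite_induct)
  case empty
  have P: "primeideal P R" using coheight_ge_prime[OF empty(3)] .
  have "m \<subseteq> P" using idl_least[OF prime_ideal[OF P]] empty by auto
  thus ?case using prime_sub_m[OF P] empty by auto
next
  case (insert s S)
  have c: "s \<in> carrier R" "B \<subseteq> carrier R" "insert s B \<union> S \<subseteq> carrier R" using insert(4) by auto
  have sm: "s \<in> m" using idl_self[OF insert(4)] insert(5) by blast
  have hc: "coheight_ge R (Suc (card S)) P" using insert by simp
  have P: "primeideal P R" using coheight_ge_prime[OF hc] .
  have e: "Idl (insert s B \<union> S) = m" using insert(5) by simp
  obtain P' where P': "P \<subseteq> P'" "s \<in> P'" "coheight_ge R (card S) P'" using coheight_shift[OF hc sm] by blast
  have P'e: "P' = Idl (insert s B)" using insert(3)[OF c(3) e P'(3)] P' insert(7) by blast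
  have sP: "s \<notin> P"
  proof
    assume "s \<in> P"
    hence "Suc (card S) \<le> card S" using coheight_le[OF insert(1) c(3) e hc] insert(7) by blast
    thus False by simp
  qed
  interpret rm: local_rmodule R "ring_mod R" m by (rule local_rmodule_ring_mod)
  have BP: "Idl B \<subseteq> P" using idl_least[OF prime_ideal[OF P] insert(7)] .
  have "P \<subseteq> Idl B +\<^sub>i ideal_smult R (ring_mod R) m P"
  proof
    fix v assume v: "v \<in> P"
    hence "v \<in> Idl B +\<^sub>i PIdl s" using P' P'e idl_insert[OF c(1,2)] by blast
    then obtain b r where h: "b \<in> Idl B" "r \<in> carrier R" "v = b \<oplus> r \<otimes> s" by (meson PIdl_sumE)
    have "r \<otimes> s \<in> P" using idl_cancel[OF prime_ideal[OF P], of b "r \<otimes> s"] h v BP c by auto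
    hence "r \<in> P" using prime_mult[OF P h(2) c(1)] sP by blast
    hence "s \<otimes> r \<in> ideal_smult R (ring_mod R) m P" using rm.ism_memI[OF sm] by simp
    thus "v \<in> Idl B +\<^sub>i ideal_smult R (ring_mod R) m P" using h c m_comm isum_memI by auto
  qed
  hence "P \<subseteq> Idl B" using rm.nakayama[of P "Idl B"] prime_ideal[OF P] idl_ideal[OF c(2)] by simp
  thus ?case using BP by blast
qed

lemma coheight_shift_set:
  assumes "finite B" "B \<subseteq> m" "coheight_ge R (card B + l) P"
  shows "\<exists>P'. B \<subseteq> P' \<and> coheight_ge R l P'"
proof -
  have "\<exists>P'. P \<subseteq> P' \<and> B \<subseteq> P' \<and> coheight_ge R l P'" using assms
  proof (induction B arbitrary: P rule: finite_induct)
    case (insert b B)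
    hence "coheight_ge R (Suc (card B + l)) P" "b \<in> m" by auto
    then obtain P' where h: "P \<subseteq> P'" "b \<in> P'" "coheight_ge R (card B + l) P'" using coheight_shift by blast
    moreover obtain P'' where "P' \<subseteq> P''" "B \<subseteq> P''" "coheight_ge R l P''" using insert(3)[OF _ h(3)] insert(4) by blast
    ultimately show ?case by blast
  qed auto
  thus ?thesis by blast
qed

text \<open>Shifting B into a chain of full length yields a prime over B of coheight |S - B|, which
  can only be (B). If y in S - B belonged to (B), then m would have too few generators modulo (B)
  for such a chain.\<close>

lemma regular_indep_params:
  assumes S: "finite S" "S \<subseteq> carrier R" "Idl S = m" and hc: "coheight_ge R (card S) P"
  shows "indep_params S"
proof -
  have "primeideal (Idl B) R \<and> (\<forall>y\<in>S - B. y \<notin> Idl B)" if B: "B \<subseteq> S" for B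
  proof -
    have fB: "finite B" "B \<subseteq> m" using B S finite_subset idl_self[OF S(2)] by auto
    have cB: "card S = card B + card (S - B)" using card_Diff_subset[OF fB(1) B] card_mono[OF S(1) B] by simp
    obtain P' where P': "B \<subseteq> P'" "coheight_ge R (card (S - B)) P'"
      using coheight_shift_set[OF fB(1,2)] hc cB by metis
    have u: "B \<union> (S - B) = S" using B by blast
    have "P' = Idl B" using regular_prime[of "S - B" B P', unfolded u] S P' by simp
    moreover have "y \<notin> Idl B" if y: "y \<in> S - B" for y
    proof
      assume yB: "y \<in> Idl B"
      have c: "B \<union> (S - B - {y}) \<subseteq> carrier R" using S B by blast
      have Bc: "B \<subseteq> carrier R" using S B by blast
      have "S \<subseteq> Idl (B \<union> (S - B - {y}))"
        using idl_self[OF c] yB idl_least[OF idl_ideal[OF c], of B] by blast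
      hence "m \<subseteq> Idl (B \<union> (S - B - {y}))" using idl_least[OF idl_ideal[OF c]] S(3) by blast
      moreover have "Idl (B \<union> (S - B - {y})) \<subseteq> m" using idl_least[OF m_ideal, of "B \<union> (S - B - {y})"] idl_self[OF S(2)] S(3) B by blast
      ultimately have "card (S - B) \<le> card (S - B - {y})"
        using coheight_le[of "S - B - {y}" B "card (S - B)" P'] S(1) P' c by blast
      thus False using y S(1) by (metis card_Diff1_less finite_Diff not_le)
    qed
    ultimately show ?thesis using coheight_ge_prime[OF P'(2)] by blast
  qed
  thus ?thesis unfolding indep_params_def using S by blast
qed

end

section \<open>Growth of the Hilbert-Samuel function and Krull dimension\<close>

text \<open>h = O(k^c); the shift to k + 1 keeps the bound from vanishing at k = 0.\<close>

definition poly_bounded :: "nat \<Rightarrow> (nat \<Rightarrow> nat) \<Rightarrow> bool" where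
  "poly_bounded c h \<longleftrightarrow> (\<exists>C. \<forall>k. h k \<le> C * (k + 1) ^ c)"

lemma poly_bounded_add: "poly_bounded c g \<Longrightarrow> poly_bounded c h \<Longrightarrow> poly_bounded c (\<lambda>k. g k + h k)"
  unfolding poly_bounded_def
proof (elim exE)
  fix C D assume h: "\<forall>k. g k \<le> C * (k + 1) ^ c" "\<forall>k. h k \<le> D * (k + 1) ^ c"
  have "g k + h k \<le> (C + D) * (k + 1) ^ c" for k using add_mono[OF h(1)[rule_format, of k] h(2)[rule_format, of k]] by (simp add: algebra_simps)
  thus "\<exists>E. \<forall>k. g k + h k \<le> E * (k + 1) ^ c" by blast
qed

lemma poly_bounded_mono: "poly_bounded c h \<Longrightarrow> (\<And>k. g k \<le> h k) \<Longrightarrow> poly_bounded c g"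
  unfolding poly_bounded_def by (meson order_trans)

text \<open>Increments of order k^c add up to order k^(c+1).\<close>

lemma poly_bounded_sum:
  assumes "poly_bounded c g" "h 0 = 0" "\<And>k. h (Suc k) \<le> g (Suc k) + h k"
  shows "poly_bounded (Suc c) h"
proof -
  obtain C where C: "\<And>k. g k \<le> C * (k + 1) ^ c" using assms(1) unfolding poly_bounded_def by blast
  have "h k \<le> k * (C * (k + 1) ^ c)" for k
  proof (induction k)
    case (Suc k)
    have "h (Suc k) \<le> C * (Suc k + 1) ^ c + k * (C * (k + 1) ^ c)" using assms(3)[of k] C[of "Suc k"] Suc by linarith
    also have "\<dots> \<le> C * (Suc k + 1) ^ c + k * (C * (Suc k + 1) ^ c)"
      by (intro add_left_mono mult_left_mono power_mono) auto
    also have "\<dots> = Suc k * (C * (Suc k + 1) ^ c)" by simp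
    finally show ?case .
  qed (simp add: assms(2))
  moreover have "k * (C * (k + 1) ^ c) \<le> C * (k + 1) ^ Suc c" for k by (simp add: algebra_simps)
  ultimately show ?thesis unfolding poly_bounded_def by (meson order_trans)
qed

lemma poly_bounded_const: "(\<And>k. h k \<le> C) \<Longrightarrow> poly_bounded c h"
proof -
  assume h: "\<And>k. h k \<le> C"
  have "h k \<le> C * (k + 1) ^ c" for k
  proof -
    have "C * 1 \<le> C * (k + 1) ^ c" by (rule mult_le_mono2) simp
    thus ?thesis using h[of k] by linarith
  qed
  thus ?thesis unfolding poly_bounded_def by blast
qed

text \<open>The discrete counterpart of the derivative of t^(j+1); it drives the summation in
  \<open>hs_lower_bound\<close>.\<close>

lemma power_Suc_le: "(k + 1) ^ Suc j \<le> k ^ Suc j + Suc j * (k + 1) ^ j" for k j :: nat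
proof (induction j)
  case (Suc j)
  have "(k + 1) ^ Suc (Suc j) = k * (k + 1) ^ Suc j + (k + 1) ^ Suc j" by simp
  also have "\<dots> \<le> k * (k ^ Suc j + Suc j * (k + 1) ^ j) + (k + 1) ^ Suc j" using Suc by (simp del: power_Suc)
  also have "\<dots> = k ^ Suc (Suc j) + (Suc j * (k * (k + 1) ^ j) + (k + 1) ^ Suc j)" by (simp add: algebra_simps)
  also have "\<dots> \<le> k ^ Suc (Suc j) + (Suc j * (k + 1) ^ Suc j + (k + 1) ^ Suc j)"
    by (intro add_left_mono add_right_mono mult_left_mono) auto
  finally show ?case by simp
qed simp

lemma not_poly_bounded:
  assumes "\<And>k. (k + 1) ^ Suc c \<le> F * g (Suc k)" shows "\<not> poly_bounded c g"
proof
  assume "poly_bounded c g"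
  then obtain C where C: "\<And>k. g k \<le> C * (k + 1) ^ c" unfolding poly_bounded_def by blast
  \<comment> \<open>The point where the bounds collide: since D + 2 \<le> 2 (D + 1), the assumed
    upper bound at D + 1 turns into (D + 1)^(c+1) \<le> D (D + 1)^c.\<close>
  define D where "D = F * (C * 2 ^ c)"
  have "(D + 1) ^ Suc c \<le> F * (C * (Suc D + 1) ^ c)" using assms[of D] C[of "Suc D"] by (meson mult_le_mono2 order_trans)
  also have "\<dots> \<le> F * (C * (2 * (D + 1)) ^ c)" by (intro mult_left_mono power_mono) auto
  also have "\<dots> = D * (D + 1) ^ c" unfolding D_def power_mult_distrib by (simp add: algebra_simps)
  finally have "(D + 1) * (D + 1) ^ c \<le> D * (D + 1) ^ c" by simp
  thus False by simp
qed

section \<open>Krull dimension in terms of coheights\<close>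

lemma prime_chain_coheight:
  "coheight_ge R l P \<longleftrightarrow> (\<exists>Ps. prime_chain R Ps \<and> length Ps = Suc l \<and> hd Ps = P)"
proof (induction l arbitrary: P)
  case 0
  show ?case
  proof
    assume "coheight_ge R 0 P"
    thus "\<exists>Ps. prime_chain R Ps \<and> length Ps = Suc 0 \<and> hd Ps = P" by (intro exI[of _ "[P]"]) (simp add: prime_chain_def)
  next
    assume "\<exists>Ps. prime_chain R Ps \<and> length Ps = Suc 0 \<and> hd Ps = P"
    thus "coheight_ge R 0 P" unfolding prime_chain_def by (auto simp: length_Suc_conv)
  qed
next
  case (Suc l)
  show ?case
  proof
    assume "coheight_ge R (Suc l) P"
    then obtain P' where P': "primeideal P R" "P \<subset> P'" "coheight_ge R l P'" by auto
    then obtain Ps where Ps: "prime_chain R Ps" "length Ps = Suc l" "hd Ps = P'" using Suc by blast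
    have "P \<subset> X" if "X \<in> set Ps" for X
      using sorted_hd_least[of Ps X] that Ps P'(2) unfolding prime_chain_def by blast
    hence "prime_chain R (P # Ps)" using Ps(1) P'(1) unfolding prime_chain_def by simp
    thus "\<exists>Ps. prime_chain R Ps \<and> length Ps = Suc (Suc l) \<and> hd Ps = P" using Ps(2) by (intro exI[of _ "P # Ps"]) simp
  next
    assume "\<exists>Ps. prime_chain R Ps \<and> length Ps = Suc (Suc l) \<and> hd Ps = P"
    then obtain P' Ps where h: "prime_chain R (P # P' # Ps)" "length Ps = l" by (auto simp: length_Suc_conv)
    hence "prime_chain R (P' # Ps)" unfolding prime_chain_def by simp
    hence "coheight_ge R l P'" unfolding Suc using h(2) by (intro exI[of _ "P' # Ps"]) simp
    thus "coheight_ge R (Suc l) P" using h(1) unfolding prime_chain_def by (auto intro!: exI[of _ P'])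
  qed
qed

text \<open>For l = 0 the left side always holds, even in a ring without primes; hence l >
  0.\<close>

lemma krull_dim_ge_iff:
  assumes "l > 0" shows "enat l \<le> krull_dim R \<longleftrightarrow> (\<exists>P. coheight_ge R l P)"
proof
  assume "enat l \<le> krull_dim R"
  hence "enat (l - 1) < krull_dim R" using assms by (metis Suc_ile_eq Suc_pred')
  then obtain Ps where Ps: "prime_chain R Ps" "enat (l - 1) < enat (length Ps - 1)"
    unfolding krull_dim_def less_SUP_iff by blast
  define Qs where "Qs = take (Suc l) Ps"
  have "prime_chain R Qs" using Ps(1) sorted_wrt_take[of "(\<subset>)" Ps "Suc l"] unfolding prime_chain_def Qs_def by (auto dest: in_set_takeD)
  moreover have "length Qs = Suc l" using Ps(2) unfolding Qs_def by simp
  ultimately show "\<exists>P. coheight_ge R l P" unfolding prime_chain_coheight by blast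
next
  assume "\<exists>P. coheight_ge R l P"
  then obtain Ps where "prime_chain R Ps" "length Ps = Suc l" unfolding prime_chain_coheight by blast
  thus "enat l \<le> krull_dim R" unfolding krull_dim_def by (intro SUP_upper2[of Ps]) auto
qed

section \<open>The Hilbert-Samuel function of an ideal\<close>

context lring
begin

abbreviation qlen :: "'a set \<Rightarrow> 'a set \<Rightarrow> enat" where "qlen I J \<equiv> quotient_length R (ring_mod R) I J"

text \<open>Meaningful for ideals containing a power of m, whose colength is finite by
  \<open>qlen_fin\<close>. The function \<open>hs I\<close> is then the Hilbert-Samuel function of
  R/I.\<close>

definition len :: "'a set \<Rightarrow> nat" where "len I = the_enat (qlen I (carrier R))"
definition hs :: "'a set \<Rightarrow> nat \<Rightarrow> nat" where "hs I k = len (I +\<^sub>i ideal_pow R m k)"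

lemma ism_ring: "ideal I R \<Longrightarrow> ideal_smult R (ring_mod R) I (carrier R) = I"
proof
  interpret rm: rmodule R "ring_mod R" by (rule rmodule_ring_mod)
  assume I: "ideal I R"
  show "ideal_smult R (ring_mod R) I (carrier R) \<subseteq> I"
    by (rule rm.ism_least) (use I ideal.I_r_closed[OF I] in auto)
  show "I \<subseteq> ideal_smult R (ring_mod R) I (carrier R)"
  proof
    fix a assume a: "a \<in> I"
    have "a \<otimes> \<one> \<in> ideal_smult R (ring_mod R) I (carrier R)" using rm.ism_memI[OF a, of \<one> "carrier R"] by simp
    thus "a \<in> ideal_smult R (ring_mod R) I (carrier R)" using a idl_carr[OF I] by simp
  qed
qed

lemma qlen_fin:
  assumes I: "ideal I R" and k: "ideal_pow R m k \<subseteq> I" shows "qlen I (carrier R) = enat (len I)"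
proof -
  interpret rm: local_rmodule R "ring_mod R" m by (rule local_rmodule_ring_mod)
  have "qlen I (carrier R) \<noteq> \<infinity>"
    by (rule rm.ql_fin[of I "carrier R" k])
      (use I k idl_carr[OF I] oneideal ism_ring[OF pow_ideal[OF m_ideal]] in auto)
  thus ?thesis unfolding len_def by auto
qed

lemma qlen_split:
  assumes "ideal I R" "ideal J R" "I \<subseteq> J" shows "qlen I (carrier R) = qlen I J + qlen J (carrier R)"
proof -
  interpret rm: rmodule R "ring_mod R" by (rule rmodule_ring_mod)
  show ?thesis using rm.ql_add[of I J "carrier R"] assms oneideal idl_carr[OF assms(2)] by auto
qed

lemma len_antimono:
  assumes "ideal I R" "ideal J R" "I \<subseteq> J" "ideal_pow R m k \<subseteq> I" shows "len J \<le> len I"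
proof -
  have "qlen J (carrier R) \<le> qlen I (carrier R)" using qlen_split[OF assms(1-3)] by simp
  thus ?thesis using qlen_fin[OF assms(1,4)] qlen_fin[OF assms(2), of k] assms(3,4) by simp
qed

abbreviation colon :: "'a set \<Rightarrow> 'a \<Rightarrow> 'a set" where "colon I x \<equiv> {v \<in> carrier R. x \<otimes> v \<in> I}"

lemma ideal_colon: "ideal I R \<Longrightarrow> x \<in> carrier R \<Longrightarrow> ideal (colon I x) R"
  using rmodule.sub_colon[OF rmodule_ring_mod, of x I] by simp

text \<open>Multiplication by x identifies R/(I : x) with (I + (x))/I.\<close>

lemma len_colon:
  assumes I: "ideal I R" and x: "x \<in> carrier R" and k: "ideal_pow R m k \<subseteq> I"
  shows "len I = len (I +\<^sub>i PIdl x) + len (colon I x)"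
proof -
  interpret rm: rmodule R "ring_mod R" by (rule rmodule_ring_mod)
  let ?J = "I +\<^sub>i PIdl x"
  have J: "ideal ?J R" "I \<subseteq> ?J" using ideal_PIdl_sum[OF I x] PIdl_sum_ub[OF I x] by auto
  have c: "ideal (colon I x) R" using ideal_colon[OF I x] .
  have Ic: "I \<subseteq> colon I x" using I idl_mult[OF I x] idl_carr[OF I] by blast
  have lin: "rm.lin (\<lambda>v. x \<otimes> v)" using rm.lin_smult[of x] x by simp
  have xJ: "x \<otimes> u \<in> ?J" if "u \<in> carrier R" for u
    using idl_mult[OF J(1) that PIdl_sum_ub(2)[OF I x]] x that m_comm by simp
  have "qlen (colon I x) (carrier R) \<le> qlen I ?J"
    by (rule rm.ql_inj[OF lin]) (use c I J oneideal xJ in auto)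
  moreover have "qlen I ?J \<le> qlen (colon I x) (carrier R)"
  proof (rule rm.ql_surj[OF lin])
    show "?J \<subseteq> (\<lambda>v. x \<otimes> v) ` carrier R <+>\<^bsub>ring_mod R\<^esub> I"
    proof
      fix v assume "v \<in> ?J"
      then obtain a r where "a \<in> I" "r \<in> carrier R" "v = a \<oplus> r \<otimes> x" by (meson PIdl_sumE)
      moreover have "v = x \<otimes> r \<oplus> a" using calculation idl_carr[OF I] x by (simp add: a_comm m_comm)
      ultimately show "v \<in> (\<lambda>v. x \<otimes> v) ` carrier R <+>\<^bsub>ring_mod R\<^esub> I" using isum_memI[of "x \<otimes> r" "(\<lambda>v. x \<otimes> v) ` carrier R" a I] by simp
    qed
  qed (use c I J oneideal in auto)
  ultimately have e: "qlen I ?J = qlen (colon I x) (carrier R)" by simp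
  have "enat (len I) = qlen I ?J + enat (len ?J)"
    using qlen_split[OF I J] qlen_fin[OF I k] qlen_fin[OF J(1), of k] k J(2) by simp
  also have "\<dots> = enat (len (colon I x)) + enat (len ?J)" using e qlen_fin[OF c, of k] k Ic by auto
  finally show ?thesis by simp
qed

lemma ideal_hs: "ideal I R \<Longrightarrow> ideal (I +\<^sub>i ideal_pow R m k) R"
  using add_ideals pow_ideal[OF m_ideal] by blast

lemma pow_sub_hs: "ideal I R \<Longrightarrow> ideal_pow R m k \<subseteq> I +\<^sub>i ideal_pow R m k"
  using isum_ub2[OF _ pow_ideal[OF m_ideal]] .

lemma sub_hs: "ideal I R \<Longrightarrow> I \<subseteq> I +\<^sub>i ideal_pow R m k"
  using isum_ub1[OF _ pow_ideal[OF m_ideal]] .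

lemma hs_PIdl:
  assumes I: "ideal I R" and x: "x \<in> carrier R"
  shows "(I +\<^sub>i ideal_pow R m k) +\<^sub>i PIdl x = (I +\<^sub>i PIdl x) +\<^sub>i ideal_pow R m k"
proof -
  interpret rm: rmodule R "ring_mod R" by (rule rmodule_ring_mod)
  note p = pow_ideal[OF m_ideal, of k] cgenideal_ideal[OF x]
  show ?thesis using rm.sum_assoc[of I "ideal_pow R m k" "PIdl x"] rm.sum_assoc[of I "PIdl x" "ideal_pow R m k"]
      rm.sum_comm[of "ideal_pow R m k" "PIdl x"] I p by simp
qed

lemma hs_split:
  assumes I: "ideal I R" and x: "x \<in> carrier R"
  shows "hs I k = hs (I +\<^sub>i PIdl x) k + len (colon (I +\<^sub>i ideal_pow R m k) x)"
  unfolding hs_def using len_colon[OF ideal_hs[OF I] x pow_sub_hs[OF I]] hs_PIdl[OF I x] by simp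

lemma hs_carrier: "hs (carrier R) k = 0"
proof -
  interpret rm: rmodule R "ring_mod R" by (rule rmodule_ring_mod)
  have "carrier R +\<^sub>i ideal_pow R m k = carrier R"
    using isum_ub1[OF oneideal pow_ideal[OF m_ideal]] idl_carr[OF ideal_hs[OF oneideal]] by blast
  thus ?thesis unfolding hs_def len_def using rm.ql_self[of "carrier R"] oneideal by (simp add: zero_enat_def)
qed

text \<open>The colon ideal of I + m^k contains (I : x) + m^k, so the remainder in
  \<open>hs_split\<close> is at most the function of (I : x).\<close>

lemma hs_le_colon:
  assumes I: "ideal I R" and x: "x \<in> carrier R"
  shows "hs I k \<le> hs (I +\<^sub>i PIdl x) k + hs (colon I x) k"
proof -
  have "colon I x +\<^sub>i ideal_pow R m k \<subseteq> colon (I +\<^sub>i ideal_pow R m k) x"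
    using sub_hs[OF I, of k] pow_sub_hs[OF I, of k] idl_mult[OF ideal_hs[OF I] x] idl_carr[OF pow_ideal[OF m_ideal]]
    by (intro isum_least ideal_colon ideal_hs I x) blast+
  hence "len (colon (I +\<^sub>i ideal_pow R m k) x) \<le> hs (colon I x) k"
    unfolding hs_def using pow_sub_hs[OF ideal_colon[OF I x]]
    by (intro len_antimono[of _ _ k] ideal_hs ideal_colon I x) auto
  thus ?thesis using hs_split[OF I x, of k] by simp
qed

text \<open>Since x m^k lies in m^(k+1), the colon ideal contains I + m^k. Thus adding one element
  of m lowers the order of growth by at most one.\<close>

lemma hs_Suc_le:
  assumes I: "ideal I R" and x: "x \<in> m"
  shows "hs I (Suc k) \<le> hs (I +\<^sub>i PIdl x) (Suc k) + hs I k"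
proof -
  have xc: "x \<in> carrier R" using m_carr x by blast
  have "I +\<^sub>i ideal_pow R m k \<subseteq> colon (I +\<^sub>i ideal_pow R m (Suc k)) x"
  proof (rule isum_least[OF ideal_colon[OF ideal_hs[OF I] xc]])
    show "I \<subseteq> colon (I +\<^sub>i ideal_pow R m (Suc k)) x" using sub_hs[OF I] idl_mult[OF I xc] idl_carr[OF I] by blast
    show "ideal_pow R m k \<subseteq> colon (I +\<^sub>i ideal_pow R m (Suc k)) x"
      using pow_Suc_mem[OF x] pow_sub_hs[OF I, of "Suc k"] idl_carr[OF pow_ideal[OF m_ideal]] by blast
  qed
  hence "len (colon (I +\<^sub>i ideal_pow R m (Suc k)) x) \<le> hs I k"
    unfolding hs_def using pow_sub_hs[OF I]
    by (intro len_antimono[of _ _ k] ideal_hs ideal_colon I xc) auto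
  thus ?thesis using hs_split[OF I xc, of "Suc k"] by simp
qed

lemma hs_zero: "ideal I R \<Longrightarrow> hs I 0 = 0"
proof -
  assume I: "ideal I R"
  have "I +\<^sub>i carrier R = carrier R" using isum_ub2[OF I oneideal] idl_carr[OF add_ideals[OF I oneideal]] by blast
  moreover have "carrier R +\<^sub>i carrier R = carrier R" using isum_ub2[OF oneideal oneideal] idl_carr[OF add_ideals[OF oneideal oneideal]] by blast
  ultimately show ?thesis using hs_carrier[of 0] by (simp add: hs_def)
qed

lemma hs_m: "poly_bounded c (hs m)"
proof (rule poly_bounded_const)
  fix k show "hs m k \<le> len m"
    unfolding hs_def using len_antimono[OF m_ideal ideal_hs[OF m_ideal] sub_hs[OF m_ideal], of 1 k] pow_one[OF m_ideal] by simp
qed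

text \<open>An ideal that is maximal among those of large growth is prime, because \<open>hs\<close> is subadditive
  along colon ideals.\<close>
lemma prime_of_growth:
  assumes I: "ideal I R" and n: "\<not> poly_bounded c (hs I)"
  shows "\<exists>P. primeideal P R \<and> I \<subseteq> P \<and> \<not> poly_bounded c (hs P)"
proof -
  obtain J where J: "ideal J R" and J': "I \<subseteq> J \<and> \<not> poly_bounded c (hs J)"
    and mx: "\<And>V. ideal V R \<Longrightarrow> I \<subseteq> V \<and> \<not> poly_bounded c (hs V) \<Longrightarrow> J \<subseteq> V \<Longrightarrow> V = J"
    by (rule ideal_maxE[of I "\<lambda>J. I \<subseteq> J \<and> \<not> poly_bounded c (hs J)"]) (use I n in auto)
  have "primeideal J R"
  proof (rule primeideal_criterion[OF J])
    show "J \<noteq> carrier R" using J' hs_carrier poly_bounded_const[of "hs (carrier R)" 0 c] by auto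
    fix a b assume a: "a \<in> carrier R - J" and b: "b \<in> carrier R - J"
    show "a \<otimes> b \<notin> J"
    proof
      assume ab: "a \<otimes> b \<in> J"
      have ac: "a \<in> carrier R" using a by blast
      have 1: "ideal (J +\<^sub>i PIdl a) R" "J \<subseteq> J +\<^sub>i PIdl a" "a \<in> J +\<^sub>i PIdl a" using ideal_PIdl_sum[OF J ac] PIdl_sum_ub[OF J ac] by auto
      have 2: "ideal (colon J a) R" "J \<subseteq> colon J a" "b \<in> colon J a"
        using ideal_colon[OF J ac] idl_mult[OF J ac] idl_carr[OF J] ab b by auto
      have "poly_bounded c (hs (J +\<^sub>i PIdl a))" using mx[OF 1(1) _ 1(2)] 1 J' a by blast
      moreover have "poly_bounded c (hs (colon J a))" using mx[OF 2(1) _ 2(2)] 2(2,3) J' b by blast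
      ultimately have "poly_bounded c (hs J)"
        by (intro poly_bounded_mono[OF poly_bounded_add, of c "hs (J +\<^sub>i PIdl a)" "hs (colon J a)" "hs J"] hs_le_colon[OF J ac])
      thus False using J' by blast
    qed
  qed
  thus ?thesis using J' by blast
qed

text \<open>Pass to a prime P over I with the same growth. As \<open>hs m\<close> is bounded, P is
  not m; for x in m outside P, the ideal P + (x) loses at most one order of growth, and the chain
  found above it by induction starts strictly above P.\<close>

lemma coheight_of_growth:
  "ideal I R \<Longrightarrow> \<not> poly_bounded c (hs I) \<Longrightarrow> \<exists>P. I \<subseteq> P \<and> coheight_ge R (Suc c) P"
proof (induction c arbitrary: I)
  case 0
  obtain P where P: "primeideal P R" "I \<subseteq> P" "\<not> poly_bounded 0 (hs P)" using prime_of_growth[OF 0] by blast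
  have "P \<subset> m" using prime_sub_m[OF P(1)] P(3) hs_m by blast
  hence "coheight_ge R (Suc 0) P" using P(1) m_prime by auto
  thus ?case using P by blast
next
  case (Suc c)
  obtain P where P: "primeideal P R" "I \<subseteq> P" "\<not> poly_bounded (Suc c) (hs P)" using prime_of_growth[OF Suc(2,3)] by blast
  have "P \<subset> m" using prime_sub_m[OF P(1)] P(3) hs_m by blast
  then obtain x where x: "x \<in> m" "x \<notin> P" by blast
  note Pi = prime_ideal[OF P(1)]
  have "\<not> poly_bounded c (hs (P +\<^sub>i PIdl x))"
    using poly_bounded_sum[OF _ hs_zero[OF Pi] hs_Suc_le[OF Pi x(1)]] P(3) by blast
  then obtain P' where P': "P +\<^sub>i PIdl x \<subseteq> P'" "coheight_ge R (Suc c) P'"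
    using Suc(1)[OF ideal_PIdl_sum[OF Pi m_carr[OF x(1)]]] by blast
  have "P \<subset> P'" using P'(1) PIdl_sum_ub[OF Pi m_carr[OF x(1)]] x by blast
  hence "coheight_ge R (Suc (Suc c)) P" using P(1) P'(2) by (meson coheight_ge.simps(2))
  thus ?case using P by blast
qed

text \<open>For independent parameters \<open>hs_Suc_le\<close> is sharp, because
  \<open>indep_params_colon\<close> determines the colon ideal exactly.\<close>

lemma hs_indep_params:
  assumes S: "indep_params S" and m: "m = Idl S" and B: "B \<subseteq> S" and x: "x \<in> S - B"
  shows "hs (Idl B) (Suc k) = hs (Idl (insert x B)) (Suc k) + hs (Idl B) k"
proof -
  have c: "S \<subseteq> carrier R" "B \<subseteq> carrier R" "x \<in> carrier R" using S B x unfolding indep_params_def by auto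
  note I = idl_ideal[OF c(2)]
  have comm: "Idl B +\<^sub>i ideal_pow R m j = ideal_pow R m j +\<^sub>i Idl B" for j
    using rmodule.sum_comm[OF rmodule_ring_mod, of "Idl B" "ideal_pow R m j"] I pow_ideal[OF m_ideal] by simp
  have xm: "x \<in> m" using idl_self[OF c(1)] x m by blast
  have "colon (Idl B +\<^sub>i ideal_pow R m (Suc k)) x \<subseteq> Idl B +\<^sub>i ideal_pow R m k"
    using indep_params_colon[OF S m B x] unfolding comm by blast
  moreover have "Idl B +\<^sub>i ideal_pow R m k \<subseteq> colon (Idl B +\<^sub>i ideal_pow R m (Suc k)) x"
  proof (rule isum_least[OF ideal_colon[OF ideal_hs[OF I] c(3)]])
    show "Idl B \<subseteq> colon (Idl B +\<^sub>i ideal_pow R m (Suc k)) x" using sub_hs[OF I] idl_mult[OF I c(3)] idl_carr[OF I] by blast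
    show "ideal_pow R m k \<subseteq> colon (Idl B +\<^sub>i ideal_pow R m (Suc k)) x"
      using pow_Suc_mem[OF xm] pow_sub_hs[OF I, of "Suc k"] idl_carr[OF pow_ideal[OF m_ideal]] by blast
  qed
  ultimately have "colon (Idl B +\<^sub>i ideal_pow R m (Suc k)) x = Idl B +\<^sub>i ideal_pow R m k" by blast
  thus ?thesis using hs_split[OF I c(3), of "Suc k"] idl_insert[OF c(3,2)] by (simp add: hs_def)
qed

text \<open>The exact length is the binomial coefficient of k + j over j. The weaker bound with j!
  follows from the recursion \<open>hs_indep_params\<close> and \<open>power_Suc_le\<close>.\<close>

lemma hs_lower_bound:
  assumes S: "indep_params S" and m: "m = Idl S"
  shows "B \<subseteq> S \<Longrightarrow> card (S - B) = j \<Longrightarrow> (k + 1) ^ j \<le> fact j * hs (Idl B) (Suc k)"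
proof (induction j arbitrary: B k)
  case 0
  have "finite S" using S unfolding indep_params_def by blast
  hence "B = S" using 0 by auto
  hence "Idl B = m" using m by simp
  moreover have "m +\<^sub>i ideal_pow R m (Suc k) = m"
    using isum_least[OF m_ideal order_refl] sub_hs[OF m_ideal] pow_antimono[OF m_ideal, of 1 "Suc k"] pow_one[OF m_ideal] by (simp add: subset_antisym)
  moreover have "len m \<noteq> 0"
  proof
    interpret rm: rmodule R "ring_mod R" by (rule rmodule_ring_mod)
    assume "len m = 0"
    moreover have "qlen m (carrier R) = enat (len m)" using qlen_fin[OF m_ideal, of 1] pow_one[OF m_ideal] by simp
    moreover have mc: "m \<subset> carrier R" using m_carr prime_one[OF m_prime] by auto
    have "ichain R (ring_mod R) m (carrier R) [m, carrier R]" using mc m_ideal oneideal unfolding ichain_def by auto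
    hence "enat 1 \<le> qlen m (carrier R)"
      using rm.ql_ge_iff[of m "carrier R" 1] m_ideal oneideal mc by (auto intro!: exI[of _ "[m, carrier R]"])
    ultimately show False by simp
  qed
  ultimately show ?case unfolding hs_def by simp
next
  case (Suc j)
  note BS = Suc.prems(1)
  have "S - B \<noteq> {}"
  proof
    assume "S - B = {}"
    hence "card (S - B) = 0" by (simp only: card.empty)
    thus False using Suc(3) by simp
  qed
  then obtain x where x: "x \<in> S - B" by blast
  have "S - insert x B = (S - B) - {x}" by blast
  hence "card (S - insert x B) = j" using Suc(3) card_Diff_singleton[OF x] by simp
  hence IH: "(i + 1) ^ j \<le> fact j * hs (Idl (insert x B)) (Suc i)" for i using Suc(1)[of "insert x B" i] Suc(2) x by blast
  show ?case
  proof (induction k)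
    case 0
    have "1 \<le> fact j * hs (Idl (insert x B)) (Suc 0)" using IH[of 0] by simp
    also have "\<dots> \<le> fact (Suc j) * hs (Idl B) (Suc 0)"
      using hs_indep_params[OF S m Suc(2) x, of 0] by (intro mult_mono) (auto intro: fact_mono_nat)
    finally show ?case by simp
  next
    case (Suc k)
    have "(Suc k + 1) ^ Suc j \<le> Suc k ^ Suc j + Suc j * (Suc k + 1) ^ j" using power_Suc_le[of "Suc k" j] .
    also have "\<dots> \<le> fact (Suc j) * hs (Idl B) (Suc k) + Suc j * (fact j * hs (Idl (insert x B)) (Suc (Suc k)))"
      by (rule add_mono[OF _ mult_le_mono2[OF IH]]) (use Suc in simp)
    also have "\<dots> = fact (Suc j) * hs (Idl B) (Suc (Suc k))"
      using hs_indep_params[OF S m BS x, of "Suc k"] by (simp add: algebra_simps)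
    finally show ?case .
  qed
qed

text \<open>Dividing by f in m shortens at least as little as dividing by a parameter x: the value
  for (x) equals the increment of the function of 0, and by \<open>hs_Suc_le\<close> the value for
  (f) is no smaller.\<close>

lemma hypersurface_growth:
  assumes S: "indep_params S" and m: "m = Idl S" and card: "card S = Suc (Suc c)" and f: "f \<in> m"
  shows "\<not> poly_bounded c (hs (PIdl f))"
proof (rule not_poly_bounded)
  fix k
  obtain x where x: "x \<in> S" using card by fastforce
  have fin: "finite S" using S unfolding indep_params_def by blast
  have z: "ideal {\<zero>} R" using zeroideal .
  have "(k + 1) ^ Suc c \<le> fact (Suc c) * hs (Idl {x}) (Suc k)"
    using hs_lower_bound[OF S m, of "{x}" "Suc c" k] x card fin by simp
  also have "hs (Idl {x}) (Suc k) + hs {\<zero>} k = hs {\<zero>} (Suc k)"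
    using hs_indep_params[OF S m, of "{}" x k] x by (simp add: idl_empty)
  hence "hs (Idl {x}) (Suc k) \<le> hs ({\<zero>} +\<^sub>i PIdl f) (Suc k)" using hs_Suc_le[OF z f, of k] by linarith
  also have "{\<zero>} +\<^sub>i PIdl f = PIdl f"
    using PIdl_sum_least[OF cgenideal_ideal[OF m_carr[OF f]], of "{\<zero>}" f] isum_ub2[OF z cgenideal_ideal[OF m_carr[OF f]]]
      idl_zero[OF cgenideal_ideal[OF m_carr[OF f]]] cgenideal_self[OF m_carr[OF f]] by blast
  finally show "(k + 1) ^ Suc c \<le> fact (Suc c) * hs (PIdl f) (Suc k)" by simp
qed

end

section \<open>Free modules and depth\<close>

context rmodule
begin

primrec lc :: "(nat \<Rightarrow> 'b) \<Rightarrow> (nat \<Rightarrow> 'a) \<Rightarrow> nat \<Rightarrow> 'b" where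
  "lc g u 0 = \<zero>\<^bsub>M\<^esub>"
| "lc g u (Suc k) = lc g u k +\<^sub>m u k \<bullet> g k"

lemma lc_sub: "sub N \<Longrightarrow> (\<And>i. i < k \<Longrightarrow> u i \<in> carrier R) \<Longrightarrow> (\<And>i. i < k \<Longrightarrow> g i \<in> N) \<Longrightarrow> lc g u k \<in> N"
  by (induction k) (auto intro: sub_zero sub_add sub_smult)

lemma lc_closed: "(\<And>i. i < k \<Longrightarrow> u i \<in> carrier R) \<Longrightarrow> (\<And>i. i < k \<Longrightarrow> g i \<in> carrier M) \<Longrightarrow> lc g u k \<in> carrier M"
  using lc_sub[OF carrier_is_submodule] by blast

lemma lc_cong: "(\<And>i. i < k \<Longrightarrow> u i = v i) \<Longrightarrow> lc g u k = lc g v k"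
  by (induction k) auto

lemma lc_add:
  assumes "\<And>i. i < k \<Longrightarrow> u i \<in> carrier R" "\<And>i. i < k \<Longrightarrow> v i \<in> carrier R" "\<And>i. i < k \<Longrightarrow> g i \<in> carrier M"
  shows "lc g (\<lambda>i. u i \<oplus> v i) k = lc g u k +\<^sub>m lc g v k"
  using assms
proof (induction k)
  case (Suc k)
  have c: "lc g u k \<in> carrier M" "lc g v k \<in> carrier M" "u k \<bullet> g k \<in> carrier M" "v k \<bullet> g k \<in> carrier M"
    using Suc lc_closed by auto
  have "lc g (\<lambda>i. u i \<oplus> v i) (Suc k) = (lc g u k +\<^sub>m lc g v k) +\<^sub>m (u k \<bullet> g k +\<^sub>m v k \<bullet> g k)"
    using Suc by (simp add: smult_l_distr)
  thus ?case using c by (simp add: M.a_ac)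
qed simp

lemma lc_smult:
  assumes "a \<in> carrier R" "\<And>i. i < k \<Longrightarrow> u i \<in> carrier R" "\<And>i. i < k \<Longrightarrow> g i \<in> carrier M"
  shows "lc g (\<lambda>i. a \<otimes> u i) k = a \<bullet> lc g u k"
  using assms
proof (induction k)
  case (Suc k)
  have c: "lc g u k \<in> carrier M" "u k \<bullet> g k \<in> carrier M" using Suc lc_closed by auto
  thus ?case using Suc by (simp add: smult_assoc1 smult_r_distr)
qed simp

lemma lc_unit:
  assumes "\<And>i. i < k \<Longrightarrow> g i \<in> carrier M"
  shows "lc g (\<lambda>j. if j = i then \<one> else \<zero>) k = (if i < k then g i else \<zero>\<^bsub>M\<^esub>)"
  using assms by (induction k) (auto simp: less_Suc_eq)

lemma gen_lc:
  assumes g: "\<And>i. i < k \<Longrightarrow> g i \<in> carrier M"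
  shows "gen_submodule R M (g ` {..<k}) = {lc g u k |u. \<forall>i<k. u i \<in> carrier R}" (is "?G = ?L")
proof
  have "sub ?L"
  proof (rule subI)
    show "?L \<subseteq> carrier M" using lc_closed g by blast
    have "lc g (\<lambda>_. \<zero>) k = \<zero>\<^bsub>M\<^esub>" using g by (induction k) auto
    hence "\<zero>\<^bsub>M\<^esub> = lc g (\<lambda>_. \<zero>) k" by simp
    thus "\<zero>\<^bsub>M\<^esub> \<in> ?L" by auto
  next
    fix x y assume "x \<in> ?L" "y \<in> ?L"
    then obtain u v where h: "x = lc g u k" "y = lc g v k" "\<forall>i<k. u i \<in> carrier R" "\<forall>i<k. v i \<in> carrier R" by blast
    hence "x +\<^sub>m y = lc g (\<lambda>i. u i \<oplus> v i) k" using lc_add[of k u v g] g by simp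
    thus "x +\<^sub>m y \<in> ?L" using h by auto
  next
    fix a x assume "a \<in> carrier R" "x \<in> ?L"
    then obtain u where h: "a \<in> carrier R" "x = lc g u k" "\<forall>i<k. u i \<in> carrier R" by blast
    hence "a \<bullet> x = lc g (\<lambda>i. a \<otimes> u i) k" using lc_smult[of a k u g] g by simp
    thus "a \<bullet> x \<in> ?L" using h by auto
  qed
  moreover have "g ` {..<k} \<subseteq> ?L"
  proof
    fix x assume "x \<in> g ` {..<k}"
    then obtain i where i: "i < k" "x = g i" by blast
    have "x = lc g (\<lambda>j. if j = i then \<one> else \<zero>) k" using lc_unit[of k g i] g i by simp
    thus "x \<in> ?L" by auto
  qed
  ultimately show "?G \<subseteq> ?L" by (rule gen_least)
  have c: "g ` {..<k} \<subseteq> carrier M" using g by auto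
  show "?L \<subseteq> ?G" using lc_sub[OF gen_sub[OF c], of k _ g] gen_self[of "g ` {..<k}"] by blast
qed

end

text \<open>Extensional functions on the indices below r, so that vectors with equal coordinates are
  equal. The multiplication and the unit come with the module record and carry no meaning
  here.\<close>

definition free_mod :: "('a, 'e) ring_scheme \<Rightarrow> nat \<Rightarrow> ('a, nat \<Rightarrow> 'a) module" where
  "free_mod R r = \<lparr>carrier = {..<r} \<rightarrow>\<^sub>E carrier R, monoid.mult = (\<lambda>u v. undefined), one = undefined,
     zero = (\<lambda>i\<in>{..<r}. zero R), add = (\<lambda>u v. \<lambda>i\<in>{..<r}. add R (u i) (v i)),
     smult = (\<lambda>a u. \<lambda>i\<in>{..<r}. monoid.mult R a (u i))\<rparr>"

context cring
begin

lemma free_simps: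
  "carrier (free_mod R r) = {..<r} \<rightarrow>\<^sub>E carrier R" "zero (free_mod R r) = (\<lambda>i\<in>{..<r}. \<zero>)"
  "u \<oplus>\<^bsub>free_mod R r\<^esub> v = (\<lambda>i\<in>{..<r}. u i \<oplus> v i)" "a \<odot>\<^bsub>free_mod R r\<^esub> u = (\<lambda>i\<in>{..<r}. a \<otimes> u i)"
  by (auto simp: free_mod_def)

lemma free_mem: "u \<in> carrier (free_mod R r) \<Longrightarrow> i < r \<Longrightarrow> u i \<in> carrier R"
  by (auto simp: free_simps)

lemma free_eqI: "u \<in> carrier (free_mod R r) \<Longrightarrow> v \<in> carrier (free_mod R r) \<Longrightarrow> (\<And>i. i < r \<Longrightarrow> u i = v i) \<Longrightarrow> u = v"
  unfolding free_simps by (rule PiE_ext) auto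

lemma rmodule_free: "rmodule R (free_mod R r)"
proof -
  have "abelian_group (free_mod R r)"
  proof (rule abelian_groupI)
    fix x y z assume x: "x \<in> carrier (free_mod R r)"
    show "\<exists>y\<in>carrier (free_mod R r). y \<oplus>\<^bsub>free_mod R r\<^esub> x = \<zero>\<^bsub>free_mod R r\<^esub>"
    proof (rule bexI[of _ "\<lambda>i\<in>{..<r}. \<ominus> x i"])
      show n: "(\<lambda>i\<in>{..<r}. \<ominus> x i) \<in> carrier (free_mod R r)" using x by (auto simp: free_simps)
      show "(\<lambda>i\<in>{..<r}. \<ominus> x i) \<oplus>\<^bsub>free_mod R r\<^esub> x = \<zero>\<^bsub>free_mod R r\<^esub>"
        by (rule free_eqI[of _ r]) (use free_mem[OF x] in \<open>auto simp: free_simps l_neg\<close>)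
    qed
    show "\<zero>\<^bsub>free_mod R r\<^esub> \<oplus>\<^bsub>free_mod R r\<^esub> x = x"
      by (rule free_eqI[of _ r]) (use free_mem[OF x] x in \<open>auto simp: free_simps\<close>)
    assume y: "y \<in> carrier (free_mod R r)"
    show "x \<oplus>\<^bsub>free_mod R r\<^esub> y \<in> carrier (free_mod R r)" using x y by (auto simp: free_simps)
    show "x \<oplus>\<^bsub>free_mod R r\<^esub> y = y \<oplus>\<^bsub>free_mod R r\<^esub> x"
      by (rule free_eqI[of _ r]) (use free_mem[OF x] free_mem[OF y] in \<open>auto simp: free_simps a_comm\<close>)
    assume z: "z \<in> carrier (free_mod R r)"
    show "x \<oplus>\<^bsub>free_mod R r\<^esub> y \<oplus>\<^bsub>free_mod R r\<^esub> z = x \<oplus>\<^bsub>free_mod R r\<^esub> (y \<oplus>\<^bsub>free_mod R r\<^esub> z)"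
      by (rule free_eqI[of _ r]) (use free_mem[OF x] free_mem[OF y] free_mem[OF z] in \<open>auto simp: free_simps a_assoc\<close>)
  qed (auto simp: free_simps)
  thus ?thesis unfolding rmodule_def
  proof (intro moduleI is_cring)
    fix a b x y assume a: "a \<in> carrier R" and x: "x \<in> carrier (free_mod R r)"
    show "a \<odot>\<^bsub>free_mod R r\<^esub> x \<in> carrier (free_mod R r)" using a x by (auto simp: free_simps)
    assume y: "y \<in> carrier (free_mod R r)"
    show "a \<odot>\<^bsub>free_mod R r\<^esub> (x \<oplus>\<^bsub>free_mod R r\<^esub> y) = a \<odot>\<^bsub>free_mod R r\<^esub> x \<oplus>\<^bsub>free_mod R r\<^esub> a \<odot>\<^bsub>free_mod R r\<^esub> y"
      by (rule free_eqI[of _ r]) (use a free_mem[OF x] free_mem[OF y] in \<open>auto simp: free_simps r_distr\<close>)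
  next
    fix a b x assume a: "a \<in> carrier R" "b \<in> carrier R" and x: "x \<in> carrier (free_mod R r)"
    show "(a \<oplus> b) \<odot>\<^bsub>free_mod R r\<^esub> x = a \<odot>\<^bsub>free_mod R r\<^esub> x \<oplus>\<^bsub>free_mod R r\<^esub> b \<odot>\<^bsub>free_mod R r\<^esub> x"
      by (rule free_eqI[of _ r]) (use a free_mem[OF x] in \<open>auto simp: free_simps l_distr\<close>)
    show "(a \<otimes> b) \<odot>\<^bsub>free_mod R r\<^esub> x = a \<odot>\<^bsub>free_mod R r\<^esub> (b \<odot>\<^bsub>free_mod R r\<^esub> x)"
      by (rule free_eqI[of _ r]) (use a free_mem[OF x] in \<open>auto simp: free_simps m_assoc\<close>)
  next
    fix x assume x: "x \<in> carrier (free_mod R r)"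
    show "\<one> \<odot>\<^bsub>free_mod R r\<^esub> x = x"
      by (rule free_eqI[of _ r]) (use free_mem[OF x] x in \<open>auto simp: free_simps\<close>)
  qed
qed

definition unit_vec :: "nat \<Rightarrow> nat \<Rightarrow> nat \<Rightarrow> 'a" where
  "unit_vec r i = (\<lambda>j\<in>{..<r}. if j = i then \<one> else \<zero>)"

lemma unit_vec_closed: "unit_vec r i \<in> carrier (free_mod R r)"
  by (auto simp: free_simps unit_vec_def)

lemma lc_unit_vec:
  assumes u: "u \<in> carrier (free_mod R r)" and "k \<le> r"
  shows "rmodule.lc (free_mod R r) (unit_vec r) u k = (\<lambda>i\<in>{..<r}. if i < k then u i else \<zero>)"
  using assms(2)
proof (induction k)
  interpret f: rmodule R "free_mod R r" by (rule rmodule_free)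
  case 0
  show ?case by (auto simp: free_simps)
next
  interpret f: rmodule R "free_mod R r" by (rule rmodule_free)
  case (Suc k)
  have uk: "u i \<in> carrier R" if "i < r" for i using u that by (auto simp: free_simps)
  show ?case using Suc uk by (auto simp: free_simps unit_vec_def less_Suc_eq intro!: ext)
qed

lemma free_gen: "gen_submodule R (free_mod R r) (unit_vec r ` {..<r}) = carrier (free_mod R r)"
proof
  interpret f: rmodule R "free_mod R r" by (rule rmodule_free)
  have c: "unit_vec r ` {..<r} \<subseteq> carrier (free_mod R r)" using unit_vec_closed by blast
  show "gen_submodule R (free_mod R r) (unit_vec r ` {..<r}) \<subseteq> carrier (free_mod R r)"
    using f.gen_least[OF f.carrier_is_submodule c] .
  show "carrier (free_mod R r) \<subseteq> gen_submodule R (free_mod R r) (unit_vec r ` {..<r})"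
  proof
    fix u assume u: "u \<in> carrier (free_mod R r)"
    hence uk: "u i \<in> carrier R" if "i < r" for i using that by (auto simp: free_simps)
    have "f.lc (unit_vec r) u r = u" unfolding lc_unit_vec[OF u order_refl] by (rule free_eqI[of _ r]) (use u uk in \<open>auto simp: free_simps\<close>)
    moreover have "f.lc (unit_vec r) u r \<in> gen_submodule R (free_mod R r) (unit_vec r ` {..<r})"
      unfolding f.gen_lc[OF unit_vec_closed] using uk by blast
    ultimately show "u \<in> gen_submodule R (free_mod R r) (unit_vec r ` {..<r})" by simp
  qed
qed

text \<open>The expression is the product of the matrix with columns g and the vector u.\<close>

lemma free_lin:
  assumes g: "\<And>i. i < r \<Longrightarrow> g i \<in> carrier (free_mod R r)"
  shows "rmodule.lin R (free_mod R r) (\<lambda>u. rmodule.lc (free_mod R r) g u r)"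
proof -
  interpret f: rmodule R "free_mod R r" by (rule rmodule_free)
  have c: "u i \<in> carrier R" if "u \<in> carrier (free_mod R r)" "i < r" for u i using that by (auto simp: free_simps)
  have "f.lc g (u \<oplus>\<^bsub>free_mod R r\<^esub> v) r = f.lc g u r \<oplus>\<^bsub>free_mod R r\<^esub> f.lc g v r"
    if "u \<in> carrier (free_mod R r)" "v \<in> carrier (free_mod R r)" for u v
    using f.lc_add[of r u v g] f.lc_cong[of r "u \<oplus>\<^bsub>free_mod R r\<^esub> v" "\<lambda>i. u i \<oplus> v i" g] that c g by (simp add: free_simps(3))
  moreover have "f.lc g (a \<odot>\<^bsub>free_mod R r\<^esub> u) r = a \<odot>\<^bsub>free_mod R r\<^esub> f.lc g u r"
    if "a \<in> carrier R" "u \<in> carrier (free_mod R r)" for a u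
    using f.lc_smult[of a r u g] f.lc_cong[of r "a \<odot>\<^bsub>free_mod R r\<^esub> u" "\<lambda>i. a \<otimes> u i" g] that c g by (simp add: free_simps(4))
  moreover have "f.lc g u r \<in> carrier (free_mod R r)" if "u \<in> carrier (free_mod R r)" for u
    using f.lc_closed[of r u g] that c g by simp
  ultimately show ?thesis unfolding f.lin_def by blast
qed

lemma free_lin_image:
  assumes g: "\<And>i. i < r \<Longrightarrow> g i \<in> carrier (free_mod R r)"
  shows "(\<lambda>u. rmodule.lc (free_mod R r) g u r) ` carrier (free_mod R r) = gen_submodule R (free_mod R r) (g ` {..<r})"
proof -
  interpret f: rmodule R "free_mod R r" by (rule rmodule_free)
  have "f.lc g u r \<in> (\<lambda>u. f.lc g u r) ` carrier (free_mod R r)" if "\<forall>i<r. u i \<in> carrier R" for u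
  proof (rule image_eqI)
    show "f.lc g u r = f.lc g (restrict u {..<r}) r" by (rule f.lc_cong) simp
    show "restrict u {..<r} \<in> carrier (free_mod R r)" using that by (auto simp: free_simps)
  qed
  moreover have "\<forall>i<r. u i \<in> carrier R" if "u \<in> carrier (free_mod R r)" for u using that by (auto simp: free_simps)
  ultimately show ?thesis using f.gen_lc[of r g] g by (intro equalityI) (simp_all, blast+)
qed

lemma free_ism:
  assumes T: "ideal T R"
  shows "ideal_smult R (free_mod R r) T (carrier (free_mod R r)) = {u \<in> carrier (free_mod R r). \<forall>i<r. u i \<in> T}" (is "?A = ?B")
proof
  interpret f: rmodule R "free_mod R r" by (rule rmodule_free)
  have "f.sub ?B"
    by (rule f.subI) (auto simp: free_simps idl_zero[OF T] idl_add[OF T] idl_mult[OF T])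
  thus "?A \<subseteq> ?B" by (rule f.ism_least) (auto simp: free_simps ideal.I_r_closed[OF T] idl_carr[OF T] PiE_iff)
  have Tc: "T \<subseteq> carrier R" using idl_carr[OF T] by blast
  show "?B \<subseteq> ?A"
  proof
    fix u assume u: "u \<in> ?B"
    have s: "f.sub ?A" using f.sub_ism[OF Tc f.carrier_is_submodule] .
    have "f.lc (unit_vec r) u k \<in> ?A" if "k \<le> r" for k using that
    proof (induction k)
      case 0 show ?case using f.sub_zero[OF s] by simp
    next
      case (Suc k)
      have "u k \<odot>\<^bsub>free_mod R r\<^esub> unit_vec r k \<in> ?A" using f.ism_memI[OF _ unit_vec_closed] u Suc by auto
      thus ?case using Suc f.sub_add[OF s] by simp
    qed
    moreover have "f.lc (unit_vec r) u r = u"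
    proof -
      have uc: "u \<in> carrier (free_mod R r)" using u by blast
      show ?thesis unfolding lc_unit_vec[OF uc order_refl] by (rule free_eqI[of _ r]) (use uc free_mem[OF uc] in \<open>auto simp: free_simps\<close>)
    qed
    ultimately show "u \<in> ?A" using order_refl[of r] by metis
  qed
qed

end

lemma (in lring) local_rmodule_free: "local_rmodule R (free_mod R r) m"
proof -
  have "fin_gen_module R (free_mod R r)"
    unfolding fin_gen_module_def using free_gen unit_vec_closed by (intro exI[of _ "unit_vec r ` {..<r}"]) auto
  thus ?thesis using rmodule_free loc
    by (simp add: local_rmodule_def local_rmodule_axioms_def noeth_rmodule_def noeth_rmodule_axioms_def nring_axioms)
qed

section \<open>Associated primes and prime avoidance\<close>

context rmodule
begin

abbreviation ann :: "'b set \<Rightarrow> 'b \<Rightarrow> 'a set" where "ann N v \<equiv> {a \<in> carrier R. a \<bullet> v \<in> N}"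
text \<open>The associated primes of M/N. This notion, like \<open>rg\<close>, \<open>nosoc\<close>
  and \<open>dep\<close>, refers to M/N but is expressed in M.\<close>

definition ass :: "'b set \<Rightarrow> 'a set set" where "ass N = {P. primeideal P R \<and> (\<exists>v\<in>carrier M. P = ann N v)}"
definition rg :: "'a \<Rightarrow> 'b set \<Rightarrow> bool" where "rg x N \<longleftrightarrow> (\<forall>v\<in>carrier M. x \<bullet> v \<in> N \<longrightarrow> v \<in> N)"

lemma ideal_ann: assumes "sub N" "v \<in> carrier M" shows "ideal (ann N v) R"
proof -
  interpret rm: rmodule R "ring_mod R" by (rule rmodule_ring_mod)
  have "rm.sub (ann N v)"
    by (rule rm.subI) (use assms in \<open>auto simp: smult_l_distr smult_assoc1 sub_add sub_smult sub_zero\<close>)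
  thus ?thesis by simp
qed

end

context noeth_rmodule
begin

text \<open>An ideal that is maximal among annihilators of nonzero classes of M/N is prime. Hence
  every zero divisor on M/N lies in an associated prime.\<close>

lemma ann_in_ass:
  assumes N: "sub N" and v: "v \<in> carrier M" "v \<notin> N"
  shows "\<exists>P\<in>ass N. ann N v \<subseteq> P"
proof -
  let ?Q = "\<lambda>I. \<exists>w\<in>carrier M - N. I = ann N w \<and> ann N v \<subseteq> I"
  obtain P where P: "ideal P R" and P': "?Q P" and mx: "\<And>V. ideal V R \<Longrightarrow> ?Q V \<Longrightarrow> P \<subseteq> V \<Longrightarrow> V = P"
    by (rule ideal_maxE[of "ann N v" ?Q]) (use ideal_ann[OF N v(1)] v in auto)
  obtain w where w: "w \<in> carrier M" "w \<notin> N" "P = ann N w" "ann N v \<subseteq> P" using P' by blast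
  have "primeideal P R"
  proof (rule primeideal_criterion[OF P])
    show "P \<noteq> carrier R" using w smult_one[OF w(1)] by (metis (no_types, lifting) R.one_closed mem_Collect_eq)
    fix a b assume a: "a \<in> carrier R - P" and b: "b \<in> carrier R - P"
    have aw: "a \<bullet> w \<in> carrier M - N" using a w by auto
    have le: "P \<subseteq> ann N (a \<bullet> w)"
    proof
      fix p assume p: "p \<in> P"
      hence pc: "p \<in> carrier R" "p \<bullet> w \<in> N" using w(3) by auto
      have "p \<bullet> a \<bullet> w = a \<bullet> p \<bullet> w" using pc a w(1) smult_assoc1[of p a w] smult_assoc1[of a p w] R.m_comm[of a p] by simp
      thus "p \<in> ann N (a \<bullet> w)" using pc sub_smult[OF N, of a] a by simp
    qed
    have "ann N (a \<bullet> w) = P"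
      by (rule mx[OF ideal_ann[OF N] _ le]) (use aw le w(4) in auto)
    moreover have "b \<notin> P" using b by blast
    ultimately have "b \<bullet> a \<bullet> w \<notin> N" using b by blast
    thus "a \<otimes> b \<notin> P" using w(1,3) a b smult_assoc1[of b a w] R.m_comm[of a b] by auto
  qed
  thus ?thesis unfolding ass_def using w by blast
qed

text \<open>Let W be maximal with infinitely many associated primes, and let w have annihilator P
  modulo W. Then (W + R w)/W is a copy of R/P, whose nonzero classes all have annihilator P. So a
  class w' of M/W with prime annihilator either has a nonzero multiple in that copy, and its prime
  is P, or keeps its annihilator modulo W + R w.\<close>

lemma finite_ass: assumes N: "sub N" shows "finite (ass N)"
proof (rule ccontr)
  assume inf: "infinite (ass N)"
  obtain W where W: "sub W" "infinite (ass W)" and mx: "\<And>V. sub V \<Longrightarrow> infinite (ass V) \<Longrightarrow> W \<subseteq> V \<Longrightarrow> V = W"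
    by (rule sub_maxE[of N "\<lambda>W. infinite (ass W)"]) (use N inf in auto)
  then obtain P where "P \<in> ass W" by (metis finite.emptyI ex_in_conv)
  then obtain w where P: "primeideal P R" and w: "w \<in> carrier M" "P = ann W w" unfolding ass_def by blast
  have wW: "w \<notin> W" using w prime_one[OF P] by auto
  let ?V = "W \<uplus> cyc w"
  note c = sub_cyc[OF w(1)]
  have V: "sub ?V" "W \<subseteq> ?V" "w \<in> ?V" using sub_sum[OF W(1) c] sum_ub1[OF W(1) c] sum_ub2[OF W(1) c] cyc_self[OF w(1)] by auto
  have fV: "finite (ass ?V)" using mx[OF V(1) _ V(2)] V(3) wW by blast
  have "ass W \<subseteq> insert P (ass ?V)"
  proof
    fix P' assume "P' \<in> ass W"
    then obtain w' where P': "primeideal P' R" and w': "w' \<in> carrier M" "P' = ann W w'" unfolding ass_def by blast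
    show "P' \<in> insert P (ass ?V)"
    proof (cases "\<exists>r\<in>carrier R. r \<bullet> w' \<in> ?V \<and> r \<bullet> w' \<notin> W")
      case True
      then obtain r where r: "r \<in> carrier R" "r \<bullet> w' \<in> ?V" "r \<bullet> w' \<notin> W" by blast
      then obtain n s where h: "n \<in> W" "s \<in> carrier R" "r \<bullet> w' = n +\<^sub>m s \<bullet> w" by (auto elim!: sum_memE)
      have nc: "n \<in> carrier M" using h sub_carr W(1) by blast
      have sP: "s \<notin> P" using h r sub_add[OF W(1)] w by auto
      have rP: "r \<notin> P'" using r w' by auto
      have "a \<in> P' \<longleftrightarrow> a \<in> P" if a: "a \<in> carrier R" for a
      proof -
        have "a \<in> P' \<longleftrightarrow> a \<otimes> r \<in> P'"
          using prime_mult[OF P' a r(1)] rP ideal.I_r_closed[OF prime_ideal[OF P'], of a r] r(1) by blast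
        also have "\<dots> \<longleftrightarrow> a \<bullet> r \<bullet> w' \<in> W" unfolding w'(2) using a r w' by (simp add: smult_assoc1)
        also have "\<dots> \<longleftrightarrow> a \<bullet> n +\<^sub>m a \<bullet> s \<bullet> w \<in> W" using h(3) a nc w h(2) by (simp add: smult_r_distr)
        also have "\<dots> \<longleftrightarrow> a \<bullet> s \<bullet> w \<in> W"
          using sub_cancel[OF W(1), of "a \<bullet> n" "a \<bullet> s \<bullet> w"] sub_add[OF W(1), of "a \<bullet> n" "a \<bullet> s \<bullet> w"] sub_smult[OF W(1) a h(1)] a h(2) w(1) by auto
        also have "\<dots> \<longleftrightarrow> a \<otimes> s \<in> P" unfolding w(2) using a h(2) w(1) by (simp add: smult_assoc1)
        also have "\<dots> \<longleftrightarrow> a \<in> P"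
          using prime_mult[OF P a h(2)] sP ideal.I_r_closed[OF prime_ideal[OF P], of a s] h(2) by blast
        finally show ?thesis .
      qed
      hence "P' = P" using w w' by blast
      thus ?thesis by blast
    next
      case False
      hence "ann ?V w' = ann W w'" using V(2) by blast
      hence "P' \<in> ass ?V" unfolding ass_def using P' w' by blast
      thus ?thesis by blast
    qed
  qed
  thus False using W(2) fV finite_subset by blast
qed

end

lemma (in cring) prime_inter_avoid:
  assumes P: "primeideal P R" and "finite Q" "\<And>I. I \<in> Q \<Longrightarrow> ideal I R" "\<And>I. I \<in> Q \<Longrightarrow> \<not> I \<subseteq> P"
  shows "\<exists>z\<in>carrier R. z \<notin> P \<and> (\<forall>I\<in>Q. z \<in> I)"
  using assms(2-)
proof (induction Q rule: finite_induct)
  case empty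
  thus ?case using prime_one[OF P] by blast
next
  case (insert I Q)
  then obtain z where z: "z \<in> carrier R" "z \<notin> P" "\<forall>I\<in>Q. z \<in> I" by auto
  obtain i where i: "i \<in> I" "i \<notin> P" using insert by blast
  have ic: "i \<in> carrier R" using i insert idl_carr by (metis insertI1)
  have "i \<otimes> z \<notin> P" using prime_mult[OF P ic z(1)] i z by blast
  moreover have "i \<otimes> z \<in> I" using i z insert ideal.I_r_closed by (metis insertI1)
  moreover have "\<forall>K\<in>Q. i \<otimes> z \<in> K" using z idl_mult[OF insert(4) ic] by blast
  ultimately show ?case using ic z by (intro bexI[of _ "i \<otimes> z"]) auto
qed

text \<open>An ideal J that need not be prime may be avoided too: a prime containing J contains m^2
  and hence equals m. The empty set encodes that no such J is prescribed.\<close>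

lemma (in lring) prime_avoidance:
  assumes "finite Q" "\<And>P. P \<in> Q \<Longrightarrow> primeideal P R \<and> P \<noteq> m"
    and J: "J = {} \<or> (ideal J R \<and> J \<subset> m \<and> ideal_pow R m 2 \<subseteq> J)"
  shows "\<exists>t\<in>m. t \<notin> J \<and> (\<forall>P\<in>Q. t \<notin> P)"
  using assms(1,2)
proof (induction Q rule: finite_psubset_induct)
  case (psubset Q)
  show ?case
  proof (cases "Q = {}")
    case True
    have "\<exists>t\<in>m. t \<notin> J" using J idl_zero[OF m_ideal] by blast
    thus ?thesis using True by blast
  next
    case False
    obtain P where P: "P \<in> Q" and mn: "\<And>P'. P' \<in> Q \<Longrightarrow> P' \<subseteq> P \<Longrightarrow> P = P'"
      using finite_has_minimal[OF psubset(1) False] by blast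
    have Pp: "primeideal P R" "P \<noteq> m" using psubset(3) P by auto
    have "Q - {P} \<subset> Q" using P by blast
    then obtain t where t: "t \<in> m" "t \<notin> J" "\<forall>P'\<in>Q - {P}. t \<notin> P'" using psubset(2)[of "Q - {P}"] psubset(3) by blast
    show ?thesis
    proof (cases "t \<in> P")
      case False
      thus ?thesis using t by blast
    next
      case True
      \<comment> \<open>None of these ideals lies in P, the other primes because P is minimal. So
        some z lies in all of them but not in P; adding z to t expels t from P and spoils nothing
        else.\<close>
      let ?Q = "insert m ((Q - {P}) \<union> (if J = {} then {} else {J}))"
      have mP: "\<not> m \<subseteq> P" using prime_sub_m[OF Pp(1)] Pp(2) by blast
      have JP: "\<not> J \<subseteq> P" if "J \<noteq> {}" using J that prime_pow_subset[OF Pp(1) m_ideal, of 2] mP by blast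
      have "\<exists>z\<in>carrier R. z \<notin> P \<and> (\<forall>I\<in>?Q. z \<in> I)"
      proof (rule prime_inter_avoid[OF Pp(1)])
        show "finite ?Q" using psubset(1) by auto
        show "ideal I R" if "I \<in> ?Q" for I using that m_ideal psubset(3) prime_ideal J by (auto split: if_splits)
        show "\<not> I \<subseteq> P" if "I \<in> ?Q" for I using that mP JP mn by (auto split: if_splits)
      qed
      then obtain z where z: "z \<in> carrier R" "z \<notin> P" "z \<in> m" "\<forall>P'\<in>Q - {P}. z \<in> P'" "J \<noteq> {} \<longrightarrow> z \<in> J" by auto
      have tc: "t \<in> carrier R" using t m_carr by blast
      have "t \<oplus> z \<notin> P" using idl_cancel[OF prime_ideal[OF Pp(1)] True] z by blast
      moreover have "t \<oplus> z \<notin> P'" if "P' \<in> Q - {P}" for P'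
        using idl_cancel'[of P' z t] psubset(3)[of P'] that t(3) z(4) tc prime_ideal[of P'] by blast
      moreover have "t \<oplus> z \<notin> J" using J idl_cancel'[of J z t] t(2) z(5) tc by blast
      moreover have "t \<oplus> z \<in> m" using idl_add[OF m_ideal t(1) z(3)] .
      ultimately show ?thesis by blast
    qed
  qed
qed

section \<open>Regular sequences and depth relative to a submodule\<close>

context local_rmodule
begin

lemma lring: "lring R m"
  using loc nring_axioms by (simp add: lring_def lring_axioms_def)

text \<open>M/N has zero socle, that is, m is not associated to it.\<close>

definition nosoc :: "'b set \<Rightarrow> bool" where
  "nosoc N \<longleftrightarrow> (\<forall>v\<in>carrier M. (\<forall>a\<in>m. a \<bullet> v \<in> N) \<longrightarrow> v \<in> N)"

abbreviation quo :: "'b set \<Rightarrow> 'a \<Rightarrow> 'b set" where "quo N x \<equiv> N \<uplus> x \<bullet>\<bullet> carrier M"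

text \<open>Weakly regular sequences of length k on M/N: the last quotient is allowed to
  vanish.\<close>

primrec dep :: "nat \<Rightarrow> 'b set \<Rightarrow> bool" where
  "dep 0 N \<longleftrightarrow> True"
| "dep (Suc k) N \<longleftrightarrow> (\<exists>x\<in>m. rg x N \<and> dep k (quo N x))"

lemma rg_nosoc: "x \<in> m \<Longrightarrow> rg x N \<Longrightarrow> nosoc N"
  unfolding nosoc_def rg_def by blast

lemma sub_xM: "x \<in> m \<Longrightarrow> sub (x \<bullet>\<bullet> carrier M)"
  using sub_scl[OF m_carr carrier_is_submodule] .

lemma sub_quo: "sub N \<Longrightarrow> x \<in> m \<Longrightarrow> sub (quo N x)"
  using sub_sum[OF _ sub_xM] .

lemma quo_ub: "sub N \<Longrightarrow> x \<in> m \<Longrightarrow> N \<subseteq> quo N x"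
  using sum_ub1[OF _ sub_xM] .

lemma quo_mem: "sub N \<Longrightarrow> x \<in> m \<Longrightarrow> v \<in> carrier M \<Longrightarrow> x \<bullet> v \<in> quo N x"
  using sum_ub2[OF _ sub_xM] by blast

lemma quoE: assumes "v \<in> quo N x" obtains w u where "w \<in> N" "u \<in> carrier M" "v = w +\<^sub>m x \<bullet> u"
  using assms by (auto elim!: sum_memE)

lemma quo_comm: assumes "sub N" "x \<in> m" "y \<in> m" shows "quo (quo N x) y = quo (quo N y) x"
  using sum_assoc[OF assms(1) sub_xM[OF assms(2)] sub_xM[OF assms(3)]]
    sum_assoc[OF assms(1) sub_xM[OF assms(3)] sub_xM[OF assms(2)]] sum_comm[OF sub_xM[OF assms(2)] sub_xM[OF assms(3)]] by simp

lemma smult_comm: "a \<in> carrier R \<Longrightarrow> b \<in> carrier R \<Longrightarrow> v \<in> carrier M \<Longrightarrow> a \<bullet> b \<bullet> v = b \<bullet> a \<bullet> v"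
  by (metis R.m_comm smult_assoc1)

text \<open>Zero socle means that m is not an associated prime, so prime avoidance yields an element
  regular on both quotients at once. The set J serves \<open>free_gens\<close>, where t has to stay
  outside T + m^2.\<close>

lemma exists_regular:
  assumes N: "sub N1" "sub N2" "nosoc N1" "nosoc N2"
    and J: "J = {} \<or> (ideal J R \<and> J \<subset> m \<and> ideal_pow R m 2 \<subseteq> J)"
  shows "\<exists>t\<in>m. t \<notin> J \<and> rg t N1 \<and> rg t N2"
proof -
  interpret l: lring R m by (rule lring)
  have ne: "P \<noteq> m" if N: "nosoc N" and P: "P \<in> ass N" for N P
  proof
    assume "P = m"
    then obtain v where v: "primeideal m R" "v \<in> carrier M" "m = ann N v" using P unfolding ass_def by auto
    hence "v \<in> N" using N unfolding nosoc_def by blast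
    hence "\<one> \<in> m" using v by auto
    thus False using prime_one[OF m_prime] by blast
  qed
  have "\<exists>t\<in>m. t \<notin> J \<and> (\<forall>P\<in>ass N1 \<union> ass N2. t \<notin> P)"
  proof (rule l.prime_avoidance[OF _ _ J])
    show "finite (ass N1 \<union> ass N2)" using finite_ass N by blast
    show "primeideal P R \<and> P \<noteq> m" if "P \<in> ass N1 \<union> ass N2" for P using that ne N unfolding ass_def by blast
  qed
  then obtain t where t: "t \<in> m" "t \<notin> J" "\<forall>P\<in>ass N1 \<union> ass N2. t \<notin> P" by blast
  have "rg t N" if "sub N" "\<forall>P\<in>ass N. t \<notin> P" for N
    unfolding rg_def using ann_in_ass[OF that(1)] that(2) m_carr[OF t(1)] by blast
  thus ?thesis using t N by blast
qed

text \<open>Two-term regular sequences can be permuted in the local case: the kernel U of z on M/N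
  satisfies U \<subseteq> N + x U, and Nakayama applies.\<close>

lemma rg_swap:
  assumes N: "sub N" and x: "x \<in> m" and z: "z \<in> m" and rx: "rg x N" and rz: "rg z (quo N x)"
  shows "rg z N" "rg x (quo N z)"
proof -
  have xc: "x \<in> carrier R" and zc: "z \<in> carrier R" using x z m_carr by auto
  define U where "U = {v \<in> carrier M. z \<bullet> v \<in> N}"
  have U: "sub U" unfolding U_def using sub_colon[OF zc N] .
  have "U \<subseteq> N \<uplus> m \<star> U"
  proof
    fix v assume v: "v \<in> U"
    hence vc: "v \<in> carrier M" and zv: "z \<bullet> v \<in> N" unfolding U_def by auto
    have "v \<in> quo N x" using rz zv vc quo_ub[OF N x] unfolding rg_def by blast
    then obtain w u where h: "w \<in> N" "u \<in> carrier M" "v = w +\<^sub>m x \<bullet> u" by (rule quoE)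
    have wc: "w \<in> carrier M" using h N sub_carr by blast
    have "z \<bullet> w +\<^sub>m z \<bullet> x \<bullet> u \<in> N" using zv h wc zc xc by (simp add: smult_r_distr)
    hence "z \<bullet> x \<bullet> u \<in> N" using sub_cancel[OF N sub_smult[OF N zc h(1)]] h xc zc by simp
    hence "x \<bullet> z \<bullet> u \<in> N" using smult_comm[OF zc xc h(2)] by simp
    hence "z \<bullet> u \<in> N" using rx h zc unfolding rg_def by blast
    hence "u \<in> U" unfolding U_def using h by blast
    thus "v \<in> N \<uplus> m \<star> U" using h sum_memI ism_memI[OF x] by blast
  qed
  hence "U \<subseteq> N" using nakayama[OF U N] by blast
  thus "rg z N" unfolding rg_def U_def by blast
  show "rg x (quo N z)" unfolding rg_def
  proof (intro ballI impI)
    fix v assume v: "v \<in> carrier M" and "x \<bullet> v \<in> quo N z"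
    then obtain w u where h: "w \<in> N" "u \<in> carrier M" "x \<bullet> v = w +\<^sub>m z \<bullet> u" by (meson quoE)
    have wc: "w \<in> carrier M" using h N sub_carr by blast
    have "z \<bullet> u \<in> quo N x" using sub_cancel[OF sub_quo[OF N x], of w "z \<bullet> u"] h quo_ub[OF N x] quo_mem[OF N x v] zc by auto
    hence "u \<in> quo N x" using rz h unfolding rg_def by blast
    then obtain w' u' where h': "w' \<in> N" "u' \<in> carrier M" "u = w' +\<^sub>m x \<bullet> u'" by (rule quoE)
    have wc': "w' \<in> carrier M" using h' N sub_carr by blast
    have e: "x \<bullet> v = (w +\<^sub>m z \<bullet> w') +\<^sub>m x \<bullet> z \<bullet> u'"
      using h h' wc wc' xc zc smult_comm[OF xc zc h'(2)] by (simp add: smult_r_distr M.a_assoc)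
    have "x \<bullet> (v \<ominus>\<^bsub>M\<^esub> z \<bullet> u') = w +\<^sub>m z \<bullet> w'"
    proof -
      have "x \<bullet> (v \<ominus>\<^bsub>M\<^esub> z \<bullet> u') = x \<bullet> v \<ominus>\<^bsub>M\<^esub> x \<bullet> z \<bullet> u'" using v h' xc zc by (simp add: a_minus_def smult_r_distr smult_r_minus)
      also have "\<dots> = w +\<^sub>m z \<bullet> w'" unfolding e using wc wc' h' xc zc by (simp add: a_minus_def M.a_assoc M.r_neg)
      finally show ?thesis .
    qed
    also have "\<dots> \<in> N" using h h' N zc sub_add sub_smult by blast
    finally have "v \<ominus>\<^bsub>M\<^esub> z \<bullet> u' \<in> N" using rx v h' zc unfolding rg_def by simp
    thus "v \<in> quo N z" using sub_minus_cancel[OF sub_quo[OF N z] _ quo_mem[OF N z h'(2)] v] quo_ub[OF N z] by blast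
  qed
qed

text \<open>For every x in m that is regular on M/N, the socle of M/(N + x M) is Ext^1 of the
  residue field with values in M/N, hence independent of x. In elements: if v is a socle class
  modulo y, then x v = w + y u, and u is a socle class modulo x.\<close>

lemma nosoc_swap:
  assumes N: "sub N" and x: "x \<in> m" and y: "y \<in> m" and rx: "rg x N" and ry: "rg y N" and ns: "nosoc (quo N x)"
  shows "nosoc (quo N y)"
  unfolding nosoc_def
proof (intro ballI impI)
  fix v assume v: "v \<in> carrier M" and s: "\<forall>a\<in>m. a \<bullet> v \<in> quo N y"
  have xc: "x \<in> carrier R" and yc: "y \<in> carrier R" using x y m_carr by auto
  have "x \<bullet> v \<in> quo N y" using s x by blast
  then obtain w u where h: "w \<in> N" "u \<in> carrier M" "x \<bullet> v = w +\<^sub>m y \<bullet> u" by (rule quoE)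
  have wc: "w \<in> carrier M" using h N sub_carr by blast
  have "a \<bullet> u \<in> quo N x" if a: "a \<in> m" for a
  proof -
    have ac: "a \<in> carrier R" using a m_carr by blast
    have "a \<bullet> v \<in> quo N y" using s a by blast
    then obtain w' u' where h': "w' \<in> N" "u' \<in> carrier M" "a \<bullet> v = w' +\<^sub>m y \<bullet> u'" by (rule quoE)
    have wc': "w' \<in> carrier M" using h' N sub_carr by blast
    have e: "a \<bullet> w +\<^sub>m y \<bullet> a \<bullet> u = x \<bullet> w' +\<^sub>m y \<bullet> x \<bullet> u'"
    proof -
      have "a \<bullet> w +\<^sub>m y \<bullet> a \<bullet> u = a \<bullet> x \<bullet> v" using h wc ac yc smult_comm[OF ac yc h(2)] by (simp add: smult_r_distr)
      also have "\<dots> = x \<bullet> a \<bullet> v" using smult_comm[OF ac xc v] .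
      also have "\<dots> = x \<bullet> w' +\<^sub>m y \<bullet> x \<bullet> u'" using h' wc' xc yc smult_comm[OF xc yc h'(2)] by (simp add: smult_r_distr)
      finally show ?thesis .
    qed
    have "y \<bullet> (a \<bullet> u \<ominus>\<^bsub>M\<^esub> x \<bullet> u') \<in> N"
    proof -
      have c: "a \<bullet> w \<in> carrier M" "y \<bullet> a \<bullet> u \<in> carrier M" "x \<bullet> w' \<in> carrier M" "y \<bullet> x \<bullet> u' \<in> carrier M"
        using wc wc' h h' xc yc ac by auto
      have "a \<bullet> w +\<^sub>m y \<bullet> (a \<bullet> u \<ominus>\<^bsub>M\<^esub> x \<bullet> u') = (a \<bullet> w +\<^sub>m y \<bullet> a \<bullet> u) \<ominus>\<^bsub>M\<^esub> y \<bullet> x \<bullet> u'"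
        using c h h' xc yc ac by (simp add: a_minus_def smult_r_distr smult_r_minus M.a_assoc)
      also have "\<dots> = x \<bullet> w'" unfolding e using c by (simp add: a_minus_def M.a_assoc M.r_neg)
      finally have "a \<bullet> w +\<^sub>m y \<bullet> (a \<bullet> u \<ominus>\<^bsub>M\<^esub> x \<bullet> u') \<in> N" using sub_smult[OF N xc h'(1)] by simp
      thus ?thesis using sub_cancel[OF N sub_smult[OF N ac h(1)]] h h' xc yc ac by simp
    qed
    hence "a \<bullet> u \<ominus>\<^bsub>M\<^esub> x \<bullet> u' \<in> N" using ry h h' xc ac unfolding rg_def by simp
    thus "a \<bullet> u \<in> quo N x" using sub_minus_cancel[OF sub_quo[OF N x] _ quo_mem[OF N x h'(2)]] quo_ub[OF N x] ac h by blast
  qed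
  hence "u \<in> quo N x" using ns h unfolding nosoc_def by blast
  then obtain w' u' where h': "w' \<in> N" "u' \<in> carrier M" "u = w' +\<^sub>m x \<bullet> u'" by (rule quoE)
  have wc': "w' \<in> carrier M" using h' N sub_carr by blast
  have e: "x \<bullet> v = (w +\<^sub>m y \<bullet> w') +\<^sub>m x \<bullet> y \<bullet> u'"
    using h h' wc wc' xc yc smult_comm[OF xc yc h'(2)] by (simp add: smult_r_distr M.a_assoc)
  have "x \<bullet> (v \<ominus>\<^bsub>M\<^esub> y \<bullet> u') = w +\<^sub>m y \<bullet> w'"
  proof -
    have "x \<bullet> (v \<ominus>\<^bsub>M\<^esub> y \<bullet> u') = x \<bullet> v \<ominus>\<^bsub>M\<^esub> x \<bullet> y \<bullet> u'" using v h' xc yc by (simp add: a_minus_def smult_r_distr smult_r_minus)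
    also have "\<dots> = w +\<^sub>m y \<bullet> w'" unfolding e using wc wc' h' xc yc by (simp add: a_minus_def M.a_assoc M.r_neg)
    finally show ?thesis .
  qed
  also have "\<dots> \<in> N" using h h' N yc sub_add sub_smult by blast
  finally have "v \<ominus>\<^bsub>M\<^esub> y \<bullet> u' \<in> N" using rx v h' yc unfolding rg_def by simp
  thus "v \<in> quo N y" using sub_minus_cancel[OF sub_quo[OF N y] _ quo_mem[OF N y h'(2)] v] quo_ub[OF N y] by blast
qed

text \<open>Any regular y may start the sequence. By \<open>nosoc_swap\<close> some z is regular
  modulo both x and y; the induction hypothesis replaces x by z and then z by y, each time over a
  quotient of smaller depth.\<close>

lemma dep_swap:
  assumes "sub N" "dep (Suc k) N" "y \<in> m" "rg y N"
  shows "dep k (quo N y)"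
  using assms
proof (induction k arbitrary: N y)
  case (Suc k)
  note N = Suc(2) and y = Suc(4) and ry = Suc(5)
  obtain x where x: "x \<in> m" "rg x N" "dep (Suc k) (quo N x)" using Suc(3) by auto
  have nx: "nosoc (quo N x)" using x(3) rg_nosoc by auto
  have ny: "nosoc (quo N y)" using nosoc_swap[OF N x(1) y x(2) ry nx] .
  obtain z where z: "z \<in> m" "rg z (quo N x)" "rg z (quo N y)"
    using exists_regular[OF sub_quo[OF N x(1)] sub_quo[OF N y] nx ny, of "{}"] by blast
  have "dep k (quo (quo N x) z)" using Suc(1)[OF sub_quo[OF N x(1)] x(3) z(1,2)] .
  hence "dep k (quo (quo N z) x)" using quo_comm[OF N x(1) z(1)] by simp
  hence "dep (Suc k) (quo N z)" using rg_swap(2)[OF N x(1) z(1) x(2) z(2)] x(1) by auto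
  hence "dep k (quo (quo N z) y)" using Suc(1)[OF sub_quo[OF N z(1)] _ y rg_swap(2)[OF N y z(1) ry z(3)]] by blast
  hence "dep k (quo (quo N y) z)" using quo_comm[OF N y z(1)] by simp
  thus ?case using z by auto
qed simp

end

section \<open>Modules of almost maximal depth over a regular local ring\<close>

context lring
begin

text \<open>Modulo T the maximal ideal is (t), so I is generated by the first power of t that it
  contains: as long as no smaller power lies in I, the coefficients that occur are nonunits and
  yield another factor t. If I contains no power of t, it lies in all T + m^k, hence in T.\<close>

lemma principal_mod:
  assumes T: "ideal T R" and t: "t \<in> carrier R" and mT: "m = T +\<^sub>i PIdl t" and I: "ideal I R" and TI: "T \<subseteq> I"
  shows "\<exists>a\<in>I. I \<subseteq> T +\<^sub>i PIdl a"
proof -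
  have step: "v \<in> T +\<^sub>i PIdl (t [^] i)" if v: "v \<in> I" and n: "\<forall>j<i. t [^] j \<notin> I" for v and i :: nat
    using n
  proof (induction i)
    case 0
    have "v = v \<otimes> \<one>" "v \<in> carrier R" using v idl_carr[OF I] by auto
    hence "v \<in> PIdl \<one>" unfolding PIdl_eq_cyc by blast
    thus ?case using isum_ub2[OF T cgenideal_ideal[of \<one>]] by auto
  next
    case (Suc i)
    then obtain \<tau> u where h: "\<tau> \<in> T" "u \<in> carrier R" "v = \<tau> \<oplus> u \<otimes> t [^] i" by (auto elim!: PIdl_sumE)
    have tc: "t [^] i \<in> carrier R" using t by simp
    have ut: "u \<otimes> t [^] i \<in> I" using idl_cancel[OF I, of \<tau> "u \<otimes> t [^] i"] h TI v tc by auto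
    have "u \<in> m"
    proof (rule ccontr)
      assume "u \<notin> m"
      hence U: "u \<in> Units R" using local_unit[OF loc] h by blast
      hence "inv u \<otimes> (u \<otimes> t [^] i) \<in> I" using idl_mult[OF I _ ut] by blast
      moreover have "inv u \<otimes> (u \<otimes> t [^] i) = t [^] i" using U tc h(2) by (simp add: m_assoc[symmetric])
      ultimately show False using Suc(2) by auto
    qed
    then obtain \<tau>' u' where h': "\<tau>' \<in> T" "u' \<in> carrier R" "u = \<tau>' \<oplus> u' \<otimes> t" using mT by (auto elim!: PIdl_sumE)
    have c: "\<tau> \<in> carrier R" "\<tau>' \<in> carrier R" using h h' idl_carr[OF T] by auto
    have "v = (\<tau> \<oplus> t [^] i \<otimes> \<tau>') \<oplus> u' \<otimes> t [^] Suc i"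
    proof -
      have "u \<otimes> t [^] i = t [^] i \<otimes> \<tau>' \<oplus> u' \<otimes> t [^] Suc i"
        unfolding h'(3) using h'(2) c tc t by (simp add: l_distr m_assoc m_comm[of \<tau>'] m_comm[of t])
      thus ?thesis unfolding h(3) using c tc t h'(2) by (simp add: a_assoc)
    qed
    moreover have "\<tau> \<oplus> t [^] i \<otimes> \<tau>' \<in> T" using idl_add[OF T h(1) idl_mult[OF T tc h'(1)]] .
    moreover have "u' \<otimes> t [^] Suc i \<in> PIdl (t [^] Suc i)" unfolding PIdl_eq_cyc using h' by blast
    ultimately show ?case using isum_memI by blast
  qed
  show ?thesis
  proof (cases "\<exists>j::nat. t [^] j \<in> I")
    case True
    define j where "j = (LEAST j::nat. t [^] j \<in> I)"
    have j: "t [^] j \<in> I" "\<forall>i<j. t [^] i \<notin> I" unfolding j_def using LeastI_ex[OF True] not_less_Least by blast+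
    show ?thesis using step[OF _ j(2)] j(1) by blast
  next
    case False
    interpret rm: local_rmodule R "ring_mod R" m by (rule local_rmodule_ring_mod)
    have tm: "t \<in> m" using mT PIdl_sum_ub(2)[OF T t] by simp
    have "v \<in> T" if v: "v \<in> I" for v
    proof -
      have "v \<in> T +\<^sub>i ideal_pow R m k" for k
      proof -
        have "v \<in> T +\<^sub>i PIdl (t [^] k)" using step[OF v] False by blast
        moreover have "PIdl (t [^] k) \<subseteq> ideal_pow R m k" using cgenideal_minimal[OF pow_ideal[OF m_ideal] pow_mem[OF m_ideal tm]] .
        ultimately show ?thesis using isum_mono[of T T "PIdl (t [^] k)" "ideal_pow R m k"] by blast
      qed
      thus ?thesis using rm.krull_intersection[of T v] T ism_ring[OF pow_ideal[OF m_ideal]] by simp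
    qed
    hence "I \<subseteq> T" by blast
    thus ?thesis using isum_ub1[OF T cgenideal_ideal[OF zero_closed]] idl_zero[OF I] by (intro bexI[of _ \<zero>]) blast+
  qed
qed

text \<open>Steinitz exchange in the vector space m/(T + m^2). For a minimal subset B of S whose
  span contains t, the coefficient of any s in B is a unit, so s can be recovered from t. Nakayama
  lifts the result from m/m^2 to m.\<close>

lemma exchange:
  assumes T: "ideal T R" and S: "finite S" "S \<subseteq> carrier R" and mS: "m = T +\<^sub>i Idl S"
    and t: "t \<in> m" "t \<notin> T +\<^sub>i ideal_pow R m 2"
  shows "\<exists>s\<in>S. m = (T +\<^sub>i PIdl t) +\<^sub>i Idl (S - {s})"
proof -
  let ?J = "T +\<^sub>i ideal_pow R m 2"
  have J: "ideal ?J R" using add_ideals[OF T pow_ideal[OF m_ideal]] .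
  have tc: "t \<in> carrier R" using t m_carr by blast
  define Q where "Q = {B. B \<subseteq> S \<and> t \<in> ?J +\<^sub>i Idl B}"
  have "T \<subseteq> ?J" using isum_ub1[OF T pow_ideal[OF m_ideal]] .
  hence "m \<subseteq> ?J +\<^sub>i Idl S" using mS isum_mono by blast
  hence "S \<in> Q" using t unfolding Q_def by blast
  moreover have "finite Q" unfolding Q_def using S(1) by simp
  ultimately obtain B where B: "B \<in> Q" and mn: "\<And>B'. B' \<in> Q \<Longrightarrow> B' \<subseteq> B \<Longrightarrow> B = B'"
    using finite_has_minimal[of Q] by blast
  have Bs: "B \<subseteq> S" "t \<in> ?J +\<^sub>i Idl B" using B unfolding Q_def by auto
  have "B \<noteq> {}"
  proof
    assume "B = {}"
    hence "t \<in> ?J +\<^sub>i {\<zero>}" using Bs idl_empty by simp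
    hence "t \<in> ?J" using isum_least[OF J order_refl, of "{\<zero>}"] idl_zero[OF J] by blast
    thus False using t by blast
  qed
  then obtain s where s: "s \<in> B" by blast
  have sc: "s \<in> carrier R" using s Bs S by blast
  have Bc: "B - {s} \<subseteq> carrier R" "S - {s} \<subseteq> carrier R" using Bs S by blast+
  have sm: "s \<in> m" using mS isum_ub2[OF T idl_ideal[OF S(2)]] idl_self[OF S(2)] s Bs by blast
  have K: "ideal (?J +\<^sub>i Idl (B - {s})) R" using add_ideals[OF J idl_ideal[OF Bc(1)]] .
  have "Idl B = Idl (B - {s}) +\<^sub>i PIdl s" using idl_insert[OF sc Bc(1)] s by (simp add: insert_absorb)
  hence "t \<in> ?J +\<^sub>i (Idl (B - {s}) +\<^sub>i PIdl s)" using Bs by simp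
  hence "t \<in> (?J +\<^sub>i Idl (B - {s})) +\<^sub>i PIdl s"
    using rmodule.sum_assoc[OF rmodule_ring_mod, of ?J "Idl (B - {s})" "PIdl s"] J idl_ideal[OF Bc(1)] cgenideal_ideal[OF sc] by simp
  then obtain a r where h: "a \<in> ?J +\<^sub>i Idl (B - {s})" "r \<in> carrier R" "t = a \<oplus> r \<otimes> s" by (meson PIdl_sumE)
  have ac: "a \<in> carrier R" using h idl_carr[OF K] by blast
  have "r \<notin> m"
  proof
    assume "r \<in> m"
    hence "r \<otimes> s \<in> ideal_pow R m 2" using pow_Suc_mem[of r m s 1] sm pow_one[OF m_ideal] by (simp add: numeral_2_eq_2)
    hence "r \<otimes> s \<in> ?J +\<^sub>i Idl (B - {s})" using isum_ub2[OF T pow_ideal[OF m_ideal, of 2]] isum_ub1[OF J idl_ideal[OF Bc(1)]] by blast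
    hence "t \<in> ?J +\<^sub>i Idl (B - {s})" using h idl_add[OF K] by blast
    hence "B - {s} \<in> Q" unfolding Q_def using Bs by blast
    thus False using mn[of "B - {s}"] s by blast
  qed
  hence U: "r \<in> Units R" using local_unit[OF loc] h by blast
  let ?L = "(T +\<^sub>i PIdl t) +\<^sub>i Idl (S - {s})"
  have T': "ideal (T +\<^sub>i PIdl t) R" using ideal_PIdl_sum[OF T tc] .
  have L: "ideal ?L R" using add_ideals[OF T' idl_ideal[OF Bc(2)]] .
  have tL: "t \<in> ?L" "T \<subseteq> ?L" using isum_ub1[OF T' idl_ideal[OF Bc(2)]] PIdl_sum_ub[OF T tc] by auto
  have SL: "Idl (S - {s}) \<subseteq> ?L" using isum_ub2[OF T' idl_ideal[OF Bc(2)]] .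
  let ?LL = "?L +\<^sub>i ideal_pow R m 2"
  have LL: "ideal ?LL R" "?L \<subseteq> ?LL" "ideal_pow R m 2 \<subseteq> ?LL"
    using add_ideals[OF L pow_ideal[OF m_ideal]] isum_ub1[OF L pow_ideal[OF m_ideal]] isum_ub2[OF L pow_ideal[OF m_ideal]] by auto
  have "?J +\<^sub>i Idl (B - {s}) \<subseteq> ?LL"
  proof (intro isum_least LL(1))
    show "T \<subseteq> ?LL" using tL LL by blast
    have "Idl (B - {s}) \<subseteq> Idl (S - {s})" using idl_least[OF idl_ideal[OF Bc(2)]] idl_self[OF Bc(2)] Bs by blast
    thus "Idl (B - {s}) \<subseteq> ?LL" using SL LL by blast
  qed (use LL in auto)
  hence "a \<in> ?LL" using h by blast
  hence "r \<otimes> s \<in> ?LL" using idl_cancel[OF LL(1), of a "r \<otimes> s"] h tL LL sc by auto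
  hence "inv r \<otimes> (r \<otimes> s) \<in> ?LL" using idl_mult[OF LL(1)] U by blast
  moreover have "inv r \<otimes> (r \<otimes> s) = s" using U sc h(2) by (simp add: m_assoc[symmetric])
  ultimately have sL: "s \<in> ?LL" by simp
  have mLL: "m \<subseteq> ?LL"
  proof -
    have "S \<subseteq> ?LL" using sL idl_self[OF Bc(2)] SL LL by blast
    hence "Idl S \<subseteq> ?LL" using idl_least[OF LL(1)] by blast
    moreover have "T \<subseteq> ?LL" using tL(2) LL(2) by blast
    ultimately have "T +\<^sub>i Idl S \<subseteq> ?LL" by (intro isum_least[OF LL(1)])
    thus ?thesis using mS by simp
  qed
  have p2: "ideal_pow R m 2 \<subseteq> ideal_smult R (ring_mod R) m m"
  proof -
    interpret rm: rmodule R "ring_mod R" by (rule rmodule_ring_mod)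
    have "ideal (ideal_smult R (ring_mod R) m m) R" using rm.sub_ism[of m m] m_carr m_ideal by auto
    hence "ideal_prod R m m \<subseteq> ideal_smult R (ring_mod R) m m" using ideal_prod_least rm.ism_memI[of _ m _ m] by simp
    thus ?thesis using pow_one[OF m_ideal] by (simp add: numeral_2_eq_2 ideal_pow.simps(2))
  qed
  have "m \<subseteq> ?L +\<^sub>i ideal_smult R (ring_mod R) m m"
    using order_trans[OF mLL isum_mono[OF order_refl p2]] .
  hence "m \<subseteq> ?L" using local_rmodule.nakayama[OF local_rmodule_ring_mod, of m ?L] m_ideal L by simp
  moreover have "?L \<subseteq> m"
  proof (rule isum_least[OF m_ideal PIdl_sum_least[OF m_ideal _ t(1)]])
    show "T \<subseteq> m" using mS isum_ub1[OF T idl_ideal[OF S(2)]] by simp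
    have "S \<subseteq> m" using mS isum_ub2[OF T idl_ideal[OF S(2)]] idl_self[OF S(2)] by simp
    thus "Idl (S - {s}) \<subseteq> m" by (intro idl_least[OF m_ideal]) blast
  qed
  ultimately show ?thesis using s Bs by blast
qed

text \<open>Echelon form over a ring whose ideals are principal modulo T. The set G k consists of
  the vectors with coordinates in T from index k on. One generator is added per index: its
  coordinate k generates, modulo T, the ideal of all k-th coordinates of N \<inter> G (k +
  1).\<close>

lemma free_gens_base:
  assumes T: "ideal T R" and t: "t \<in> carrier R" and mT: "m = T +\<^sub>i PIdl t"
    and N: "submodule N R (free_mod R r)" and TN: "ideal_smult R (free_mod R r) T (carrier (free_mod R r)) \<subseteq> N"
  shows "\<exists>g. (\<forall>i<r. g i \<in> N) \<and> N \<subseteq> ideal_smult R (free_mod R r) T (carrier (free_mod R r)) <+>\<^bsub>free_mod R r\<^esub> gen_submodule R (free_mod R r) (g ` {..<r})"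
proof -
  let ?F = "free_mod R r"
  interpret f: local_rmodule R ?F m by (rule local_rmodule_free)
  define TF where "TF = ideal_smult R ?F T (carrier ?F)"
  have TFe: "TF = {u \<in> carrier ?F. \<forall>i<r. u i \<in> T}" unfolding TF_def using free_ism[OF T] .
  have TFs: "f.sub TF" unfolding TF_def using f.sub_ism[OF _ f.carrier_is_submodule, of T] idl_carr[OF T] by blast
  define G where "G k = {v \<in> carrier ?F. \<forall>i. k \<le> i \<and> i < r \<longrightarrow> v i \<in> T}" for k
  have "\<exists>g. (\<forall>i<k. g i \<in> N) \<and> N \<inter> G k \<subseteq> f.msum TF (gen_submodule R ?F (g ` {..<k}))" if "k \<le> r" for k
    using that
  proof (induction k)
    case 0
    have "N \<inter> G 0 \<subseteq> TF" unfolding G_def TFe by auto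
    hence "N \<inter> G 0 \<subseteq> f.msum TF (gen_submodule R ?F {})" using f.sum_ub1[OF TFs f.gen_sub[of "{}"]] by auto
    thus ?case by simp
  next
    case (Suc k)
    hence k: "k < r" by simp
    obtain g where g: "\<forall>i<k. g i \<in> N" "N \<inter> G k \<subseteq> f.msum TF (gen_submodule R ?F (g ` {..<k}))" using Suc by auto
    define I where "I = (\<lambda>v. v k) ` (N \<inter> G (Suc k))"
    have vc: "v i \<in> carrier R" if "v \<in> N" "i < r" for v i using free_mem f.sub_carr[OF N] that by blast
    have I: "ideal I R"
    proof -
      interpret rm: rmodule R "ring_mod R" by (rule rmodule_ring_mod)
      have "rm.sub I"
      proof (rule rm.subI)
        show "I \<subseteq> carrier (ring_mod R)" unfolding I_def using vc k by auto
        have "\<zero>\<^bsub>?F\<^esub> \<in> N \<inter> G (Suc k)" unfolding G_def using f.sub_zero[OF N] idl_zero[OF T] f.sub_carr[OF N] by (auto simp: free_simps)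
        moreover have "(\<zero>\<^bsub>?F\<^esub>) k = \<zero>" using k by (simp add: free_simps)
        ultimately have "\<zero> \<in> I" unfolding I_def by (metis (no_types, lifting) imageI)
        thus "\<zero>\<^bsub>ring_mod R\<^esub> \<in> I" by simp
      next
        fix a b assume "a \<in> I" "b \<in> I"
        then obtain u v where h: "u \<in> N" "u \<in> G (Suc k)" "a = u k" "v \<in> N" "v \<in> G (Suc k)" "b = v k" unfolding I_def by blast
        have "u \<oplus>\<^bsub>?F\<^esub> v \<in> N \<inter> G (Suc k)" using h f.sub_add[OF N] f.sub_carr[OF N, of "u \<oplus>\<^bsub>?F\<^esub> v"] idl_add[OF T]
          unfolding G_def by (auto simp: free_simps)
        moreover have "(u \<oplus>\<^bsub>?F\<^esub> v) k = a \<oplus> b" using h k by (simp add: free_simps)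
        ultimately have "a \<oplus> b \<in> I" unfolding I_def by (metis (no_types, lifting) imageI)
        thus "a \<oplus>\<^bsub>ring_mod R\<^esub> b \<in> I" by simp
      next
        fix c a assume c: "c \<in> carrier R" and "a \<in> I"
        then obtain u where h: "u \<in> N" "u \<in> G (Suc k)" "a = u k" unfolding I_def by blast
        have "c \<odot>\<^bsub>?F\<^esub> u \<in> N \<inter> G (Suc k)" using h c f.sub_smult[OF N] f.sub_carr[OF N, of "c \<odot>\<^bsub>?F\<^esub> u"] idl_mult[OF T]
          unfolding G_def by (auto simp: free_simps)
        moreover have "(c \<odot>\<^bsub>?F\<^esub> u) k = c \<otimes> a" using h k by (simp add: free_simps)
        ultimately have "c \<otimes> a \<in> I" unfolding I_def by (metis (no_types, lifting) imageI)
        thus "c \<odot>\<^bsub>ring_mod R\<^esub> a \<in> I" by simp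
      qed
      thus ?thesis by simp
    qed
    have TI: "T \<subseteq> I"
    proof
      fix \<tau> assume \<tau>: "\<tau> \<in> T"
      have c: "\<tau> \<in> carrier R" using \<tau> idl_carr[OF T] by blast
      define v where "v = \<tau> \<odot>\<^bsub>?F\<^esub> unit_vec r k"
      have "v \<in> TF" unfolding v_def TF_def using f.ism_memI[OF \<tau> unit_vec_closed] .
      hence "v \<in> N \<inter> G (Suc k)" using TN unfolding G_def TFe TF_def[symmetric] by (auto simp: TFe)
      moreover have "v k = \<tau>" unfolding v_def using k c by (simp add: free_simps unit_vec_def)
      ultimately show "\<tau> \<in> I" unfolding I_def by (metis (no_types, lifting) imageI)
    qed
    obtain a where a: "a \<in> I" "I \<subseteq> T +\<^sub>i PIdl a" using principal_mod[OF T t mT I TI] by blast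
    obtain gk where gk: "gk \<in> N" "gk \<in> G (Suc k)" "a = gk k" using a(1) unfolding I_def by blast
    define g' where "g' = g(k := gk)"
    have im: "g' ` {..<k} = g ` {..<k}" unfolding g'_def by auto
    have g'N: "\<forall>i<Suc k. g' i \<in> N" using g gk unfolding g'_def by (auto simp: less_Suc_eq)
    have sc: "g' ` {..<Suc k} \<subseteq> carrier ?F" using g'N f.sub_carr[OF N] by blast
    let ?K = "f.msum TF (gen_submodule R ?F (g' ` {..<Suc k}))"
    note gs = f.gen_sub[OF sc]
    have K: "f.sub ?K" using f.sub_sum[OF TFs gs] .
    have le: "f.msum TF (gen_submodule R ?F (g ` {..<k})) \<subseteq> ?K"
    proof (rule f.sum_mono[OF order_refl])
      show "gen_submodule R ?F (g ` {..<k}) \<subseteq> gen_submodule R ?F (g' ` {..<Suc k})"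
      proof (rule f.gen_least[OF gs])
        have "g ` {..<k} \<subseteq> g' ` {..<Suc k}" unfolding im[symmetric] by (rule image_mono) auto
        thus "g ` {..<k} \<subseteq> gen_submodule R ?F (g' ` {..<Suc k})" using f.gen_self by (rule order_trans)
      qed
    qed
    have gkK: "gk \<in> ?K"
    proof -
      have "g' k \<in> g' ` {..<Suc k}" by simp
      hence "gk \<in> gen_submodule R ?F (g' ` {..<Suc k})" using f.gen_self unfolding g'_def by fastforce
      thus ?thesis using f.sum_ub2[OF TFs gs] by blast
    qed
    have "N \<inter> G (Suc k) \<subseteq> ?K"
    proof
      fix v assume v: "v \<in> N \<inter> G (Suc k)"
      hence "v k \<in> T +\<^sub>i PIdl a" using a(2) unfolding I_def by blast
      then obtain \<tau> \<rho> where h: "\<tau> \<in> T" "\<rho> \<in> carrier R" "v k = \<tau> \<oplus> \<rho> \<otimes> a" by (meson PIdl_sumE)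
      define w where "w = v \<oplus>\<^bsub>?F\<^esub> (\<ominus> \<rho>) \<odot>\<^bsub>?F\<^esub> gk"
      have wN: "w \<in> N" unfolding w_def using v gk h f.sub_add[OF N] f.sub_smult[OF N] by auto
      have ac: "a \<in> carrier R" "\<tau> \<in> carrier R" using a idl_carr[OF I] h idl_carr[OF T] by auto
      have wi: "w i = v i \<oplus> (\<ominus> \<rho>) \<otimes> gk i" if "i < r" for i unfolding w_def using that by (simp add: free_simps)
      have "w k = \<tau>" unfolding wi[OF k] h(3) using gk(3) ac h(2) by (simp add: l_minus a_assoc r_neg)
      moreover have "w i \<in> T" if "Suc k \<le> i" "i < r" for i
        unfolding wi[OF that(2)] using v gk(2) that h(2) idl_add[OF T] idl_mult[OF T] unfolding G_def by auto
      ultimately have "w i \<in> T" if "k \<le> i" "i < r" for i using that h(1) by (cases "i = k") auto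
      hence "w \<in> G k" unfolding G_def using wN f.sub_carr[OF N] by blast
      hence "w \<in> ?K" using g(2) le wN by blast
      hence "w \<oplus>\<^bsub>?F\<^esub> \<rho> \<odot>\<^bsub>?F\<^esub> gk \<in> ?K" using f.sub_add[OF K] f.sub_smult[OF K h(2) gkK] by blast
      moreover have "w \<oplus>\<^bsub>?F\<^esub> \<rho> \<odot>\<^bsub>?F\<^esub> gk = v"
      proof (rule free_eqI[of _ r])
        show "v \<in> carrier ?F" "w \<oplus>\<^bsub>?F\<^esub> \<rho> \<odot>\<^bsub>?F\<^esub> gk \<in> carrier ?F" using v wN gk h(2) f.sub_carr[OF N] by auto
        show "(w \<oplus>\<^bsub>?F\<^esub> \<rho> \<odot>\<^bsub>?F\<^esub> gk) i = v i" if "i < r" for i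
          using that wi[OF that] vc[of v i] vc[of gk i] v gk(1) h(2) by (simp add: free_simps l_minus a_assoc l_neg)
      qed
      ultimately show "v \<in> ?K" by simp
    qed
    thus ?case using g'N by blast
  qed
  from this[of r] have "\<exists>g. (\<forall>i<r. g i \<in> N) \<and> N \<inter> G r \<subseteq> f.msum TF (gen_submodule R ?F (g ` {..<r}))" by simp
  moreover have "G r = carrier ?F" unfolding G_def by auto
  moreover have "N \<inter> carrier ?F = N" using f.sub_subset[OF N] by blast
  ultimately show ?thesis unfolding TF_def by simp
qed

text \<open>A special case of the Auslander-Buchsbaum formula. Each step of the induction moves a regular
  parameter into \<open>T\<close>, until the maximal ideal is principal modulo \<open>T\<close>.\<close>
lemma free_gens:
  assumes "ideal T R" "finite S" "S \<subseteq> carrier R" "card S \<le> Suc j" "m = T +\<^sub>i Idl S"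
    "submodule N R (free_mod R r)" "ideal_smult R (free_mod R r) T (carrier (free_mod R r)) \<subseteq> N"
    "local_rmodule.dep (free_mod R r) m j N"
  shows "\<exists>g. (\<forall>i<r. g i \<in> N) \<and> N \<subseteq> ideal_smult R (free_mod R r) T (carrier (free_mod R r)) <+>\<^bsub>free_mod R r\<^esub> gen_submodule R (free_mod R r) (g ` {..<r})"
  using assms
proof (induction j arbitrary: T S N)
  case 0
  have "\<exists>t\<in>carrier R. Idl S = PIdl t"
  proof (cases "S = {}")
    case True
    have "PIdl \<zero> = {\<zero>}" unfolding PIdl_eq_cyc by (auto intro!: image_eqI[of _ _ \<zero>])
    thus ?thesis using True idl_empty by auto
  next
    case False
    then obtain t where "S = {t}" using 0(2,4) by (metis card_0_eq card_1_singletonE le_Suc_eq le_zero_eq One_nat_def)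
    thus ?thesis using 0(3) cgenideal_eq_genideal[of t] by auto
  qed
  thus ?case using free_gens_base[OF 0(1) _ _ 0(6,7)] 0(5) by auto
next
  case (Suc j)
  let ?F = "free_mod R r"
  interpret f: local_rmodule R ?F m by (rule local_rmodule_free)
  note T = Suc(2) and N = Suc(7)
  let ?J = "T +\<^sub>i ideal_pow R m 2"
  have J: "ideal ?J R" using add_ideals[OF T pow_ideal[OF m_ideal]] .
  have Tm: "T \<subseteq> m" using Suc(6) isum_ub1[OF T idl_ideal[OF Suc(4)]] by simp
  have m2: "ideal_pow R m 2 \<subseteq> m" using pow_antimono[OF m_ideal, of 1 2] pow_one[OF m_ideal] by simp
  have Jm: "?J \<subseteq> m" using isum_least[OF m_ideal Tm m2] .
  show ?case
  proof (cases "?J = m")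
    case True
    interpret rm: local_rmodule R "ring_mod R" m by (rule local_rmodule_ring_mod)
    have "ideal (ideal_smult R (ring_mod R) m m) R" using rm.sub_ism[of m m] m_carr m_ideal by auto
    hence "ideal_prod R m m \<subseteq> ideal_smult R (ring_mod R) m m" using ideal_prod_least rm.ism_memI[of _ m _ m] by simp
    hence "ideal_pow R m 2 \<subseteq> ideal_smult R (ring_mod R) m m" using pow_one[OF m_ideal] by (simp add: numeral_2_eq_2 ideal_pow.simps(2))
    \<comment> \<open>Here T + m^2 = m, so T = m by Nakayama, and the base case applies with t =
      0.\<close>
    hence "m \<subseteq> T +\<^sub>i ideal_smult R (ring_mod R) m m" using True isum_mono[of T T] by blast
    hence "m \<subseteq> T" using rm.nakayama[of m T] m_ideal T by simp
    hence "m = T" using Tm by blast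
    moreover have "T +\<^sub>i PIdl \<zero> = T"
      using PIdl_sum_least[OF T order_refl idl_zero[OF T]] PIdl_sum_ub(1)[OF T zero_closed] by blast
    ultimately show ?thesis using free_gens_base[OF T zero_closed _ N Suc(8)] by simp
  next
    case False
    have ns: "f.nosoc N" using Suc(9) f.rg_nosoc by auto
    have "ideal_pow R m 2 \<subseteq> ?J" using isum_ub2[OF T pow_ideal[OF m_ideal]] .
    \<comment> \<open>Outside T + m^2, t can replace a parameter by \<open>exchange\<close>; being
      regular on F/N, it lowers the depth by exactly one by \<open>dep_swap\<close>.\<close>
    hence "\<exists>t\<in>m. t \<notin> ?J \<and> f.rg t N \<and> f.rg t N" using f.exists_regular[OF N N ns ns, of ?J] J Jm False by blast
    then obtain t where t: "t \<in> m" "t \<notin> ?J" "f.rg t N" by blast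
    have tc: "t \<in> carrier R" using t m_carr by blast
    have dj: "f.dep j (f.quo N t)" using f.dep_swap[OF N Suc(9) t(1,3)] .
    obtain s where s: "s \<in> S" "m = (T +\<^sub>i PIdl t) +\<^sub>i Idl (S - {s})" using exchange[OF T Suc(3,4,6) t(1,2)] by blast
    let ?T = "T +\<^sub>i PIdl t"
    define TF where "TF = ideal_smult R ?F T (carrier ?F)"
    define TF' where "TF' = ideal_smult R ?F ?T (carrier ?F)"
    have T': "ideal ?T R" using ideal_PIdl_sum[OF T tc] .
    have TFs: "f.sub TF" "f.sub TF'" unfolding TF_def TF'_def
      using f.sub_ism[OF _ f.carrier_is_submodule, of T] f.sub_ism[OF _ f.carrier_is_submodule, of ?T] idl_carr[OF T] idl_carr[OF T'] by blast+
    note N' = f.sub_quo[OF N t(1)]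
    have TF'q: "TF' \<subseteq> f.quo TF t" unfolding TF'_def
    proof (rule f.ism_least[OF f.sub_quo[OF TFs(1) t(1)]])
      fix a x assume a: "a \<in> ?T" and x: "x \<in> carrier ?F"
      then obtain \<tau> \<rho> where h: "\<tau> \<in> T" "\<rho> \<in> carrier R" "a = \<tau> \<oplus> \<rho> \<otimes> t" by (meson PIdl_sumE)
      have \<tau>: "\<tau> \<in> carrier R" using h idl_carr[OF T] by blast
      have "a \<odot>\<^bsub>?F\<^esub> x = \<tau> \<odot>\<^bsub>?F\<^esub> x \<oplus>\<^bsub>?F\<^esub> t \<odot>\<^bsub>?F\<^esub> (\<rho> \<odot>\<^bsub>?F\<^esub> x)"
        using h \<tau> x tc by (simp add: f.smult_l_distr f.smult_assoc1 f.smult_comm[of \<rho> t x])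
      moreover have "\<tau> \<odot>\<^bsub>?F\<^esub> x \<in> TF" unfolding TF_def using f.ism_memI[OF h(1) x] .
      ultimately show "a \<odot>\<^bsub>?F\<^esub> x \<in> f.quo TF t" using f.sum_memI h(2) x by auto
    qed
    have TFN: "TF \<subseteq> N" using Suc(8) unfolding TF_def .
    have T'N: "TF' \<subseteq> f.quo N t" using TF'q f.sum_mono[OF TFN order_refl] by blast
    have "card (S - {s}) \<le> Suc j" using s(1) Suc(3,5) by simp
    then obtain g where g: "\<forall>i<r. g i \<in> f.quo N t" "f.quo N t \<subseteq> f.msum TF' (gen_submodule R ?F (g ` {..<r}))"
      using Suc(1)[OF T' _ _ _ s(2) N' _ dj] T'N Suc(3,4) unfolding TF'_def by blast
    \<comment> \<open>The induction yields generators of N + t F. Only their components n i in N are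
      kept; they turn out to generate N modulo T F.\<close>
    have "\<forall>i. \<exists>n. i < r \<longrightarrow> n \<in> N \<and> (\<exists>u\<in>carrier ?F. g i = n \<oplus>\<^bsub>?F\<^esub> t \<odot>\<^bsub>?F\<^esub> u)" using g(1) by (metis f.quoE)
    then obtain n where n: "\<And>i. i < r \<Longrightarrow> n i \<in> N \<and> (\<exists>u\<in>carrier ?F. g i = n i \<oplus>\<^bsub>?F\<^esub> t \<odot>\<^bsub>?F\<^esub> u)" by metis
    have nc: "n ` {..<r} \<subseteq> carrier ?F" using n f.sub_carr[OF N] by blast
    let ?G = "gen_submodule R ?F (n ` {..<r})"
    have G: "f.sub ?G" using f.gen_sub[OF nc] .
    have "n ` {..<r} \<subseteq> N" using n by blast
    hence GN: "?G \<subseteq> N" by (rule f.gen_least[OF N])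
    let ?K = "f.quo (f.msum TF ?G) t"
    have TG: "f.sub (f.msum TF ?G)" using f.sub_sum[OF TFs(1) G] .
    have K: "f.sub ?K" using f.sub_quo[OF TG t(1)] .
    have gK: "g ` {..<r} \<subseteq> ?K"
    proof
      fix v assume "v \<in> g ` {..<r}"
      then obtain i where i: "i < r" "v = g i" by blast
      then obtain u where u: "u \<in> carrier ?F" "v = n i \<oplus>\<^bsub>?F\<^esub> t \<odot>\<^bsub>?F\<^esub> u" using n by blast
      have "n i \<in> f.msum TF ?G" using f.gen_self[of "n ` {..<r}"] i f.sum_ub2[OF TFs(1) G] by blast
      thus "v \<in> ?K" using u f.sum_memI by blast
    qed
    have sg: "g ` {..<r} \<subseteq> carrier ?F" using g(1) f.sub_carr[OF N'] by blast
    have TFK: "TF' \<subseteq> ?K" using TF'q f.sum_mono[OF f.sum_ub1[OF TFs(1) G] order_refl] by blast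
    have NK: "N \<subseteq> ?K" using g(2) f.sum_least[OF K TFK f.gen_least[OF K gK]] f.quo_ub[OF N t(1)] by blast
    have TGN: "f.msum TF ?G \<subseteq> N" using f.sum_least[OF N TFN GN] .
    \<comment> \<open>For u in N write u = w + t v with w in T F + G, which lies in N. Regularity of
      t puts v into N, so the term t v lies in m N and Nakayama applies.\<close>
    have "N \<subseteq> f.msum (f.msum TF ?G) (ideal_smult R ?F m N)"
    proof
      fix u assume u: "u \<in> N"
      then obtain w v where h: "w \<in> f.msum TF ?G" "v \<in> carrier ?F" "u = w \<oplus>\<^bsub>?F\<^esub> t \<odot>\<^bsub>?F\<^esub> v" using NK f.quoE by blast
      have "t \<odot>\<^bsub>?F\<^esub> v \<in> N" using f.sub_cancel[OF N, of w "t \<odot>\<^bsub>?F\<^esub> v"] h TGN u tc by blast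
      hence "v \<in> N" using t(3) h unfolding f.rg_def by blast
      thus "u \<in> f.msum (f.msum TF ?G) (ideal_smult R ?F m N)" using h f.sum_memI f.ism_memI[OF t(1)] by blast
    qed
    hence "N \<subseteq> f.msum TF ?G" using f.nakayama[OF N TG] by blast
    thus ?thesis unfolding TF_def using n by blast
  qed
qed

end

section \<open>The Hilbert function of the cokernel of a square matrix\<close>

context lring
begin

text \<open>F/W k is the cokernel of the matrix modulo m^k, so two consecutive values of its Hilbert
  function are compared.\<close>

lemma hilbert_coker_mono:
  assumes S: "indep_params S" and mS: "m = Idl S" and x: "x \<in> S" and y: "y \<in> S" and xy: "x \<noteq> y"
    and g: "\<And>i. i < r \<Longrightarrow> g i \<in> carrier (free_mod R r)"
  defines "F \<equiv> free_mod R r"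
  defines "N \<equiv> gen_submodule R F (g ` {..<r})"
  defines "W \<equiv> \<lambda>k. N <+>\<^bsub>F\<^esub> ideal_smult R F (ideal_pow R m k) (carrier F)"
  shows "quotient_length R F (W (Suc k)) (W k) \<le> quotient_length R F (W (Suc (Suc k))) (W (Suc k))"
proof -
  interpret f: local_rmodule R F m unfolding F_def by (rule local_rmodule_free)
  define \<phi> where "\<phi> u = f.lc g u r" for u
  have lin: "f.lin \<phi>" unfolding \<phi>_def using free_lin[OF g] unfolding F_def by simp
  have im: "\<phi> ` carrier F = N" unfolding \<phi>_def N_def using free_lin_image[OF g] unfolding F_def by simp
  have Sc: "S \<subseteq> carrier R" using S unfolding indep_params_def by blast
  have xc: "x \<in> carrier R" and yc: "y \<in> carrier R" using x y Sc by auto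
  have xm: "x \<in> m" and ym: "y \<in> m" using x y idl_self[OF Sc] mS by auto
  have fil: "f.fil k = {u \<in> carrier F. \<forall>i<r. u i \<in> ideal_pow R m k}" for k
    unfolding F_def using free_ism[OF pow_ideal[OF m_ideal]] .
  have Fm: "u i \<in> carrier R" if "u \<in> carrier F" "i < r" for u i using that free_mem unfolding F_def by blast
  have \<phi>c: "\<phi> u \<in> carrier F" if "u \<in> carrier F" for u using lin that unfolding f.lin_def by blast
  have \<phi>a: "\<phi> (u \<oplus>\<^bsub>F\<^esub> v) = \<phi> u \<oplus>\<^bsub>F\<^esub> \<phi> v" if "u \<in> carrier F" "v \<in> carrier F" for u v using lin that unfolding f.lin_def by blast
  have \<phi>s: "\<phi> (a \<odot>\<^bsub>F\<^esub> u) = a \<odot>\<^bsub>F\<^esub> \<phi> u" if "a \<in> carrier R" "u \<in> carrier F" for a u using lin that unfolding f.lin_def by blast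
  define V where "V k = {u \<in> carrier F. \<phi> u \<in> f.fil k}" for k
  have V: "f.sub (V k)" for k unfolding V_def using f.sub_vimage[OF lin f.sub_fil] .
  have filV: "f.fil k \<subseteq> V k" for k
  proof -
    have "f.fil k \<subseteq> {u \<in> carrier F. \<phi> u \<in> f.fil k}"
    proof (rule f.ism_least[OF f.sub_vimage[OF lin f.sub_fil]])
      fix a u assume "a \<in> ideal_pow R m k" "u \<in> carrier F"
      moreover have "a \<in> carrier R" using calculation idl_carr[OF pow_ideal[OF m_ideal]] by blast
      ultimately show "a \<odot>\<^bsub>F\<^esub> u \<in> {u \<in> carrier F. \<phi> u \<in> f.fil k}" using f.ism_memI \<phi>c \<phi>s by auto
    qed
    thus ?thesis unfolding V_def .
  qed
  have Ns: "f.sub N" using f.sub_image[OF lin f.carrier_is_submodule] im by simp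
  have Ws: "f.sub (W k)" "f.fil k \<subseteq> W k" "N \<subseteq> W k" for k
    unfolding W_def using f.sub_sum[OF Ns f.sub_fil] f.sum_ub2[OF Ns f.sub_fil] f.sum_ub1[OF Ns f.sub_fil] by auto
  have WW: "W (Suc k) \<subseteq> W k" for k unfolding W_def using f.sum_mono[OF order_refl f.fil_antimono] by simp
  note FF = f.carrier_is_submodule
  have fin: "f.ql A (carrier F) \<noteq> \<infinity>" if "f.sub A" "f.fil k \<subseteq> A" for A k
    using f.ql_fin[OF that(1) FF f.sub_subset[OF that(1)], of k] that(2) by blast
  have fin': "f.ql A B \<noteq> \<infinity>" if "f.sub A" "f.sub B" "f.fil k \<subseteq> A" "A \<subseteq> B" for A B k
  proof -
    have "f.ql A B \<le> f.ql A (carrier F)" using f.ql_mono[OF that(1,2,4) that(1) FF] f.sub_subset[OF that(2)] by blast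
    thus ?thesis using fin[OF that(1,3)] by (cases "f.ql A B") auto
  qed
  \<comment> \<open>Regularity of x on the associated graded ring: \<open>indep_params_colon\<close>
    with B = {}, coordinate by coordinate.\<close>
  have colx: "u \<in> f.fil k" if u: "u \<in> carrier F" and h: "x \<odot>\<^bsub>F\<^esub> u \<in> f.fil (Suc k)" for u k
  proof -
    have z: "ideal_pow R m k +\<^sub>i Idl {} \<subseteq> ideal_pow R m k" for k
      using isum_least[OF pow_ideal[OF m_ideal, of k] order_refl, of "{\<zero>}"] idl_zero[OF pow_ideal[OF m_ideal, of k]] idl_empty by simp
    have "u i \<in> ideal_pow R m k" if i: "i < r" for i
    proof -
      have "(x \<odot>\<^bsub>F\<^esub> u) i \<in> ideal_pow R m (Suc k)" using h i unfolding fil by blast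
      hence "x \<otimes> u i \<in> ideal_pow R m (Suc k)" using i unfolding F_def by (simp add: free_simps)
      hence "x \<otimes> u i \<in> ideal_pow R m (Suc k) +\<^sub>i Idl {}" using isum_ub1[OF pow_ideal[OF m_ideal] idl_ideal[of "{}"]] by blast
      hence "u i \<in> ideal_pow R m k +\<^sub>i Idl {}" using indep_params_colon[OF S mS, of "{}" x "u i" k] x Fm[OF u i] by blast
      thus ?thesis using z by blast
    qed
    thus ?thesis unfolding fil using u by blast
  qed
  have xfil: "a \<odot>\<^bsub>F\<^esub> u \<in> f.fil (Suc k)" if "a \<in> m" "u \<in> f.fil k" for a u k
    unfolding f.fil_Suc using f.ism_memI[OF that] .
  \<comment> \<open>X k / m^(k+1) F is the image of V k / m^k F under x, so V (k + 1) / X k is the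
    cokernel of that embedding.\<close>
  define X where "X k = (\<lambda>v. x \<odot>\<^bsub>F\<^esub> v) ` V k <+>\<^bsub>F\<^esub> f.fil (Suc k)" for k
  have xV: "f.sub ((\<lambda>v. x \<odot>\<^bsub>F\<^esub> v) ` V k)" for k using f.sub_scl[OF xc V] .
  have X: "f.sub (X k)" "f.fil (Suc k) \<subseteq> X k" for k
    unfolding X_def using f.sub_sum[OF xV f.sub_fil] f.sum_ub2[OF xV f.sub_fil] by auto
  have mV: "a \<odot>\<^bsub>F\<^esub> v \<in> V (Suc k)" if "a \<in> m" "v \<in> V k" for a v k
  proof -
    have "v \<in> carrier F" "\<phi> v \<in> f.fil k" "a \<in> carrier R" using that m_carr unfolding V_def by auto
    thus ?thesis unfolding V_def using xfil[OF that(1), of "\<phi> v" k] \<phi>s[of a v] by simp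
  qed
  have XV: "X k \<subseteq> V (Suc k)" for k
    unfolding X_def by (rule f.sum_least[OF V _ filV]) (use mV[OF xm] in auto)
  \<comment> \<open>The matrix identifies F/V k with W k / m^k F. Removing this common finite length
    from F/m^k F leaves the two sides.\<close>
  have eq1: "f.ql (W k) (carrier F) = f.ql (f.fil k) (V k)" for k
  proof -
    have "f.ql (V k) (carrier F) = f.ql (f.fil k) (W k)"
    proof (rule antisym)
      show "f.ql (V k) (carrier F) \<le> f.ql (f.fil k) (W k)"
        by (rule f.ql_inj[OF lin V FF f.sub_subset[OF V] f.sub_fil Ws(1,2)]) (use im Ws(3) in \<open>auto simp: V_def\<close>)
      show "f.ql (f.fil k) (W k) \<le> f.ql (V k) (carrier F)"
        by (rule f.ql_surj[OF lin V FF f.sub_subset[OF V] f.sub_fil Ws(1,2)]) (use im in \<open>auto simp: V_def W_def\<close>)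
    qed
    moreover have "f.ql (f.fil k) (carrier F) = f.ql (f.fil k) (W k) + f.ql (W k) (carrier F)"
      using f.ql_add[OF f.sub_fil Ws(1) FF Ws(2) f.sub_subset[OF Ws(1)]] .
    moreover have "f.ql (f.fil k) (carrier F) = f.ql (f.fil k) (V k) + f.ql (V k) (carrier F)"
      using f.ql_add[OF f.sub_fil V FF filV f.sub_subset[OF V]] .
    moreover have "f.ql (f.fil k) (W k) \<noteq> \<infinity>" using fin'[OF f.sub_fil Ws(1) order_refl Ws(2)] .
    ultimately show ?thesis by (metis add.commute enat_add_left_cancel)
  qed
  have eq2: "f.ql (f.fil k) (V k) = f.ql (f.fil (Suc k)) (X k)" for k
  proof (rule antisym)
    note l = f.lin_smult[OF xc]
    have xVX: "x \<odot>\<^bsub>F\<^esub> u \<in> X k" if "u \<in> V k" for u using f.sum_ub1[OF xV f.sub_fil] that unfolding X_def by blast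
    show "f.ql (f.fil k) (V k) \<le> f.ql (f.fil (Suc k)) (X k)"
      by (rule f.ql_inj[OF l f.sub_fil V filV f.sub_fil X]) (use xVX xfil[OF xm] colx f.sub_carr[OF V] in auto)
    show "f.ql (f.fil (Suc k)) (X k) \<le> f.ql (f.fil k) (V k)"
      by (rule f.ql_surj[OF l f.sub_fil V filV f.sub_fil X]) (use xfil[OF xm] in \<open>auto simp: X_def\<close>)
  qed
  \<comment> \<open>Both sides are what has to be added to the finite length of F/W k to reach that
    of F/W (k + 1); on the right this uses \<open>eq1\<close> and \<open>eq2\<close>.\<close>
  have H: "f.ql (W (Suc k)) (W k) = f.ql (X k) (V (Suc k))" for k
  proof -
    have "f.ql (W (Suc k)) (W k) + f.ql (W k) (carrier F) = f.ql (W (Suc k)) (carrier F)"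
      using f.ql_add[OF Ws(1) Ws(1) FF WW f.sub_subset[OF Ws(1)], symmetric] .
    also have "\<dots> = f.ql (f.fil (Suc k)) (V (Suc k))" using eq1 .
    also have "\<dots> = f.ql (f.fil (Suc k)) (X k) + f.ql (X k) (V (Suc k))" using f.ql_add[OF f.sub_fil X(1) V X(2) XV] .
    also have "f.ql (f.fil (Suc k)) (X k) = f.ql (W k) (carrier F)" using eq1 eq2 by simp
    finally have "f.ql (W k) (carrier F) + f.ql (W (Suc k)) (W k) = f.ql (W k) (carrier F) + f.ql (X k) (V (Suc k))"
      by (simp add: add.commute)
    moreover have "f.ql (W k) (carrier F) \<noteq> \<infinity>" using fin[OF Ws(1,2)] .
    ultimately show ?thesis by (metis enat_add_left_cancel)
  qed
  have "f.ql (X k) (V (Suc k)) \<le> f.ql (X (Suc k)) (V (Suc (Suc k)))"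
  proof (rule f.ql_inj[OF f.lin_smult[OF yc] X(1) V XV X(1) V XV])
    show "y \<odot>\<^bsub>F\<^esub> u \<in> V (Suc (Suc k))" if "u \<in> V (Suc k)" for u using mV[OF ym that] .
    show "y \<odot>\<^bsub>F\<^esub> u \<in> X (Suc k)" if "u \<in> X k" for u
    proof -
      obtain v w where h: "v \<in> V k" "w \<in> f.fil (Suc k)" "u = x \<odot>\<^bsub>F\<^esub> v \<oplus>\<^bsub>F\<^esub> w" using \<open>u \<in> X k\<close> unfolding X_def by (auto elim!: f.sum_memE)
      have c: "v \<in> carrier F" "w \<in> carrier F" using h f.sub_carr[OF V] f.sub_carr[OF f.sub_fil] by auto
      have "y \<odot>\<^bsub>F\<^esub> u = x \<odot>\<^bsub>F\<^esub> (y \<odot>\<^bsub>F\<^esub> v) \<oplus>\<^bsub>F\<^esub> y \<odot>\<^bsub>F\<^esub> w"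
        unfolding h(3) using c xc yc f.smult_comm[OF yc xc c(1)] by (simp add: f.smult_r_distr)
      moreover have "x \<odot>\<^bsub>F\<^esub> (y \<odot>\<^bsub>F\<^esub> v) \<in> (\<lambda>v. x \<odot>\<^bsub>F\<^esub> v) ` V (Suc k)" using mV[OF ym h(1)] by blast
      ultimately show ?thesis unfolding X_def using f.sum_memI xfil[OF ym h(2)] by simp
    qed
    show "u \<in> X k" if u: "u \<in> V (Suc k)" and yu: "y \<odot>\<^bsub>F\<^esub> u \<in> X (Suc k)" for u
    proof -
      have uc: "u \<in> carrier F" using u f.sub_carr[OF V] by blast
      obtain v w where h: "v \<in> V (Suc k)" "w \<in> f.fil (Suc (Suc k))" "y \<odot>\<^bsub>F\<^esub> u = x \<odot>\<^bsub>F\<^esub> v \<oplus>\<^bsub>F\<^esub> w"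
        using yu unfolding X_def by (auto elim!: f.sum_memE)
      have c: "v \<in> carrier F" "w \<in> carrier F" using h f.sub_carr[OF V] f.sub_carr[OF f.sub_fil] by auto
      have Ix: "Idl {x} = PIdl x" using cgenideal_eq_genideal[OF xc] by simp
      \<comment> \<open>Each y u_i lies in m^(k+2) + (x), so u_i lies in m^(k+1) + (x), by
        \<open>indep_params_colon\<close> with B = {x}. Collecting coordinates gives u = x a' + b'
        with b' in m^(k+1) F.\<close>
      have "\<exists>a b. i < r \<longrightarrow> a \<in> carrier R \<and> b \<in> ideal_pow R m (Suc k) \<and> u i = x \<otimes> a \<oplus> b" for i
      proof (cases "i < r")
        case True
        have e: "y \<otimes> u i = w i \<oplus> v i \<otimes> x"
          using arg_cong[OF h(3), of "\<lambda>u. u i"] True Fm[OF c(1) True] Fm[OF c(2) True] xc unfolding F_def by (simp add: free_simps a_comm m_comm)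
        have "w i \<in> ideal_pow R m (Suc (Suc k))" using h(2) True unfolding fil by blast
        moreover have "v i \<otimes> x \<in> Idl {x}" unfolding Ix PIdl_eq_cyc using Fm[OF c(1) True] by blast
        ultimately have "y \<otimes> u i \<in> ideal_pow R m (Suc (Suc k)) +\<^sub>i Idl {x}" unfolding e using isum_memI by blast
        hence "u i \<in> ideal_pow R m (Suc k) +\<^sub>i PIdl x"
          using indep_params_colon[OF S mS, of "{x}" y "u i" "Suc k"] x y xy Fm[OF uc True] Ix by auto
        then obtain b a where "b \<in> ideal_pow R m (Suc k)" "a \<in> carrier R" "u i = b \<oplus> a \<otimes> x" by (meson PIdl_sumE)
        moreover have "b \<in> carrier R" using calculation idl_carr[OF pow_ideal[OF m_ideal]] by blast
        ultimately show ?thesis using xc by (intro exI[of _ a] exI[of _ b]) (simp add: a_comm m_comm)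
      qed blast
      then obtain a b where ab: "\<And>i. i < r \<Longrightarrow> a i \<in> carrier R \<and> b i \<in> ideal_pow R m (Suc k) \<and> u i = x \<otimes> a i \<oplus> b i" by metis
      define a' where "a' = restrict a {..<r}"
      define b' where "b' = restrict b {..<r}"
      have a': "a' \<in> carrier F" unfolding a'_def F_def using ab by (auto simp: free_simps)
      have b'c: "b' \<in> carrier F" unfolding b'_def F_def using ab idl_carr[OF pow_ideal[OF m_ideal]] by (fastforce simp: free_simps)
      have b': "b' \<in> f.fil (Suc k)" unfolding fil using b'c ab unfolding b'_def by auto
      have e: "u = x \<odot>\<^bsub>F\<^esub> a' \<oplus>\<^bsub>F\<^esub> b'"
      proof -
        have "x \<odot>\<^bsub>F\<^esub> a' \<oplus>\<^bsub>F\<^esub> b' \<in> carrier F" using a' b'c xc by simp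
        thus ?thesis using uc ab unfolding F_def by (intro free_eqI[of _ r]) (auto simp: free_simps a'_def b'_def)
      qed
      \<comment> \<open>The images of u and b' lie in m^(k+1) F, hence so does x \<phi> a'.
        Regularity of x brings \<phi> a' into m^k F, which is a' in V k.\<close>
      have "\<phi> u = \<phi> b' \<oplus>\<^bsub>F\<^esub> x \<odot>\<^bsub>F\<^esub> \<phi> a'" unfolding e using \<phi>a[of "x \<odot>\<^bsub>F\<^esub> a'" b'] \<phi>s[OF xc a'] a' b'c xc \<phi>c by (simp add: f.M.a_comm)
      moreover have "\<phi> u \<in> f.fil (Suc k)" "\<phi> b' \<in> f.fil (Suc k)" using u b' filV unfolding V_def by auto
      ultimately have "x \<odot>\<^bsub>F\<^esub> \<phi> a' \<in> f.fil (Suc k)" using f.sub_cancel[OF f.sub_fil, of "\<phi> b'" "Suc k" "x \<odot>\<^bsub>F\<^esub> \<phi> a'"] \<phi>c[OF a'] xc by simp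
      hence "\<phi> a' \<in> f.fil k" using colx \<phi>c[OF a'] by blast
      hence "a' \<in> V k" unfolding V_def using a' by blast
      hence "x \<odot>\<^bsub>F\<^esub> a' \<in> (\<lambda>v. x \<odot>\<^bsub>F\<^esub> v) ` V k" by blast
      thus ?thesis unfolding X_def using f.sum_memI[OF _ b'] e by simp
    qed
  qed
  thus ?thesis using H[of k] H[of "Suc k"] by simp
qed

end

section \<open>Rings whose completion is a quotient\<close>

text \<open>Makes m^k M and n^(k+j) concrete: over fixed generators the coefficients can be chosen
  in the ideal.\<close>

lemma (in rmodule) ism_gen_lc:
  assumes I: "ideal I R" and g: "\<And>i. i < k \<Longrightarrow> g i \<in> carrier M"
  shows "I \<star> gen_submodule R M (g ` {..<k}) = {lc g u k |u. \<forall>i<k. u i \<in> I}" (is "?A = ?L")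
proof
  have gc: "g ` {..<k} \<subseteq> carrier M" using g by auto
  have Ic: "\<And>a. a \<in> I \<Longrightarrow> a \<in> carrier R" using ideal.Icarr[OF I] .
  have "sub ?L"
  proof (rule subI)
    show "?L \<subseteq> carrier M" using lc_closed g Ic by blast
    have "lc g (\<lambda>_. \<zero>) k = \<zero>\<^bsub>M\<^esub>" using g by (induction k) auto
    hence "\<zero>\<^bsub>M\<^esub> = lc g (\<lambda>_. \<zero>) k" by simp
    thus "\<zero>\<^bsub>M\<^esub> \<in> ?L" using idl_zero[OF I] by blast
  next
    fix x y assume "x \<in> ?L" "y \<in> ?L"
    then obtain u v where h: "x = lc g u k" "y = lc g v k" "\<forall>i<k. u i \<in> I" "\<forall>i<k. v i \<in> I" by blast
    hence "x +\<^sub>m y = lc g (\<lambda>i. u i \<oplus> v i) k" using lc_add[of k u v g] g Ic by simp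
    thus "x +\<^sub>m y \<in> ?L" using h idl_add[OF I] by blast
  next
    fix a x assume "a \<in> carrier R" "x \<in> ?L"
    then obtain u where h: "a \<in> carrier R" "x = lc g u k" "\<forall>i<k. u i \<in> I" by blast
    hence "a \<bullet> x = lc g (\<lambda>i. a \<otimes> u i) k" using lc_smult[of a k u g] g Ic by simp
    thus "a \<bullet> x \<in> ?L" using h idl_mult[OF I] by blast
  qed
  thus "?A \<subseteq> ?L"
  proof (rule ism_least)
    fix a x assume a: "a \<in> I" and "x \<in> gen_submodule R M (g ` {..<k})"
    then obtain u where u: "x = lc g u k" "\<forall>i<k. u i \<in> carrier R" using gen_lc[of k g] g by blast
    hence "a \<bullet> x = lc g (\<lambda>i. a \<otimes> u i) k" using lc_smult[of a k u g] g Ic a by simp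
    thus "a \<bullet> x \<in> ?L" using u ideal.I_r_closed[OF I a] by blast
  qed
  have s: "sub ?A" using sub_ism[OF _ gen_sub[OF gc]] Ic by blast
  show "?L \<subseteq> ?A"
  proof
    fix x assume "x \<in> ?L"
    then obtain u where u: "x = lc g u k" "\<forall>i<k. u i \<in> I" by blast
    have "lc g u j \<in> ?A" if "j \<le> k" for j using that
    proof (induction j)
      case (Suc j)
      have "g j \<in> gen_submodule R M (g ` {..<k})" using gen_self[of "g ` {..<k}"] Suc(2) by auto
      hence "u j \<bullet> g j \<in> ?A" using ism_memI u(2) Suc(2) by simp
      thus ?case using Suc sub_add[OF s] by simp
    qed (simp add: sub_zero[OF s])
    thus "x \<in> ?A" using u by blast
  qed
qed

text \<open>\<open>p k q\<close> is the coset in \<open>A / m\<^sup>k\<close> that is the image of \<open>q\<close> under \<open>Q \<rightarrow> Q / (f)\<close>, the isomorphism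
  with the completion of \<open>A\<close>, and the projection.\<close>
locale complete_presentation = A: lring A m + Q: lring Q n
  for A :: "('a, 'e) ring_scheme" and m :: "'a set" and Q :: "('c, 'd) ring_scheme" and n :: "'c set" +
  fixes f :: 'c and p :: "nat \<Rightarrow> 'c \<Rightarrow> 'a set"
  assumes f: "f \<in> carrier Q"
    and p_coset: "q \<in> carrier Q \<Longrightarrow> \<exists>a\<in>carrier A. p k q = ideal_pow A m k +>\<^bsub>A\<^esub> a"
    and p_Suc: "q \<in> carrier Q \<Longrightarrow> p (Suc k) q \<subseteq> p k q"
    and p_add: "q \<in> carrier Q \<Longrightarrow> q' \<in> carrier Q \<Longrightarrow> a \<in> p k q \<Longrightarrow> b \<in> p k q' \<Longrightarrow> a \<oplus>\<^bsub>A\<^esub> b \<in> p k (q \<oplus>\<^bsub>Q\<^esub> q')"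
    and p_mult: "q \<in> carrier Q \<Longrightarrow> q' \<in> carrier Q \<Longrightarrow> a \<in> p k q \<Longrightarrow> b \<in> p k q' \<Longrightarrow> a \<otimes>\<^bsub>A\<^esub> b \<in> p k (q \<otimes>\<^bsub>Q\<^esub> q')"
    and p_one: "\<one>\<^bsub>A\<^esub> \<in> p k \<one>\<^bsub>Q\<^esub>"
    and p_lift: "a \<in> carrier A \<Longrightarrow> \<exists>q\<in>carrier Q. \<forall>k. a \<in> p k q"
    and p_ker: "q \<in> carrier Q \<Longrightarrow> (\<forall>k. \<zero>\<^bsub>A\<^esub> \<in> p k q) \<longleftrightarrow> q \<in> PIdl\<^bsub>Q\<^esub> f"
    and p_complete: "(\<And>k::nat. s k \<in> carrier Q) \<Longrightarrow> (\<And>k. p k (s (Suc k)) = p k (s k)) \<Longrightarrow> \<exists>q\<in>carrier Q. \<forall>k. p k q = p k (s k)"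
begin

abbreviation mp where "mp \<equiv> ideal_pow A m"
abbreviation np where "np \<equiv> ideal_pow Q n"

lemma mp: "ideal (mp k) A" using A.pow_ideal[OF A.m_ideal] .
lemma np: "ideal (np k) Q" using Q.pow_ideal[OF Q.m_ideal] .

lemma p_carr: "q \<in> carrier Q \<Longrightarrow> a \<in> p k q \<Longrightarrow> a \<in> carrier A"
  using p_coset[of q k] A.a_r_coset_subset_G[OF subsetI, of "mp k"] A.idl_carr[OF mp] by blast

lemma p_ex: "q \<in> carrier Q \<Longrightarrow> \<exists>a. a \<in> p k q"
  using p_coset[of q k] ideal.axioms(1)[OF mp, of k] additive_subgroup.zero_closed by (fastforce simp: a_r_coset_def')

lemma p_add_pow:
  assumes q: "q \<in> carrier Q" and a: "a \<in> p k q" and h: "h \<in> mp k" shows "h \<oplus>\<^bsub>A\<^esub> a \<in> p k q"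
proof -
  obtain b where b: "b \<in> carrier A" "p k q = mp k +>\<^bsub>A\<^esub> b" using p_coset[OF q] by blast
  then obtain h' where h': "h' \<in> mp k" "a = h' \<oplus>\<^bsub>A\<^esub> b" using a by (auto simp: a_r_coset_def')
  have "h \<oplus>\<^bsub>A\<^esub> a = (h \<oplus>\<^bsub>A\<^esub> h') \<oplus>\<^bsub>A\<^esub> b" using h h' b A.idl_carr[OF mp] by (simp add: A.a_assoc)
  thus ?thesis using b A.idl_add[OF mp h h'(1)] by (auto simp: a_r_coset_def')
qed

lemma p_sub:
  assumes q: "q \<in> carrier Q" and a: "a \<in> p k q" and b: "b \<in> p k q" shows "\<exists>h\<in>mp k. b = h \<oplus>\<^bsub>A\<^esub> a"
proof -
  obtain c where c: "c \<in> carrier A" "p k q = mp k +>\<^bsub>A\<^esub> c" using p_coset[OF q] by blast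
  then obtain h h' where h: "h \<in> mp k" "a = h \<oplus>\<^bsub>A\<^esub> c" "h' \<in> mp k" "b = h' \<oplus>\<^bsub>A\<^esub> c" using a b by (auto simp: a_r_coset_def')
  have hc: "h \<in> carrier A" "h' \<in> carrier A" using h A.idl_carr[OF mp] by auto
  have "b = (h' \<oplus>\<^bsub>A\<^esub> (\<ominus>\<^bsub>A\<^esub> h)) \<oplus>\<^bsub>A\<^esub> a" using h hc c by (simp add: A.a_assoc A.r_neg1)
  moreover have "h' \<oplus>\<^bsub>A\<^esub> (\<ominus>\<^bsub>A\<^esub> h) \<in> mp k" using A.idl_add[OF mp h(3)] additive_subgroup.a_inv_closed[OF ideal.axioms(1)[OF mp] h(1)] by blast
  ultimately show ?thesis by blast
qed

lemma p_eqI: assumes "q \<in> carrier Q" "q' \<in> carrier Q" "a \<in> p k q" "a \<in> p k q'" shows "p k q = p k q'"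
proof -
  have "p k r \<subseteq> p k r'" if "r \<in> carrier Q" "r' \<in> carrier Q" "a \<in> p k r" "a \<in> p k r'" for r r'
    using p_sub[OF that(1,3)] p_add_pow[OF that(2,4)] by blast
  thus ?thesis using assms by blast
qed

lemma p_antimono: "q \<in> carrier Q \<Longrightarrow> j \<le> k \<Longrightarrow> p k q \<subseteq> p j q"
  using lift_Suc_antimono_le[of "\<lambda>k. p k q" j k] p_Suc by blast

lemma p_zero: "\<zero>\<^bsub>A\<^esub> \<in> p k \<zero>\<^bsub>Q\<^esub>"
  using p_ker[of "\<zero>\<^bsub>Q\<^esub>"] Q.idl_zero[OF Q.cgenideal_ideal[OF f]] by blast

text \<open>The kernel of Q -> A/m^k.\<close>

definition K :: "nat \<Rightarrow> 'c set" where "K k = {q \<in> carrier Q. \<zero>\<^bsub>A\<^esub> \<in> p k q}"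

lemma K_iff: assumes q: "q \<in> carrier Q" and a: "a \<in> p k q" shows "q \<in> K k \<longleftrightarrow> a \<in> mp k"
proof
  assume "q \<in> K k"
  then obtain h where "h \<in> mp k" "a = h \<oplus>\<^bsub>A\<^esub> \<zero>\<^bsub>A\<^esub>" using p_sub[OF q _ a] unfolding K_def by blast
  thus "a \<in> mp k" using A.idl_carr[OF mp] by simp
next
  assume h: "a \<in> mp k"
  have "\<ominus>\<^bsub>A\<^esub> a \<in> mp k" using additive_subgroup.a_inv_closed[OF ideal.axioms(1)[OF mp] h] .
  hence "(\<ominus>\<^bsub>A\<^esub> a) \<oplus>\<^bsub>A\<^esub> a \<in> p k q" using p_add_pow[OF q a] by blast
  thus "q \<in> K k" unfolding K_def using q p_carr[OF q a] by (simp add: A.l_neg)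
qed

lemma p_neg: assumes q: "q \<in> carrier Q" and a: "a \<in> p k q" shows "\<ominus>\<^bsub>A\<^esub> a \<in> p k (\<ominus>\<^bsub>Q\<^esub> q)"
proof -
  have nq: "\<ominus>\<^bsub>Q\<^esub> q \<in> carrier Q" using q by simp
  obtain b where b: "b \<in> p k (\<ominus>\<^bsub>Q\<^esub> q)" using p_ex[OF nq] by blast
  have c: "a \<in> carrier A" "b \<in> carrier A" using p_carr[OF q a] p_carr[OF nq b] by auto
  have "b \<oplus>\<^bsub>A\<^esub> a \<in> p k \<zero>\<^bsub>Q\<^esub>" using p_add[OF nq q b a] q by (simp add: Q.l_neg)
  then obtain h where h: "h \<in> mp k" "b \<oplus>\<^bsub>A\<^esub> a = h \<oplus>\<^bsub>A\<^esub> \<zero>\<^bsub>A\<^esub>" using p_sub[OF Q.zero_closed p_zero] by blast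
  have hc: "h \<in> carrier A" using h A.idl_carr[OF mp] by blast
  have e: "h = b \<oplus>\<^bsub>A\<^esub> a" using h hc by simp
  have "\<ominus>\<^bsub>A\<^esub> h \<in> mp k" using additive_subgroup.a_inv_closed[OF ideal.axioms(1)[OF mp] h(1)] .
  hence "\<ominus>\<^bsub>A\<^esub> h \<oplus>\<^bsub>A\<^esub> b \<in> p k (\<ominus>\<^bsub>Q\<^esub> q)" using p_add_pow[OF nq b] by blast
  moreover have "\<ominus>\<^bsub>A\<^esub> h \<oplus>\<^bsub>A\<^esub> b = \<ominus>\<^bsub>A\<^esub> a"
  proof -
    have "\<ominus>\<^bsub>A\<^esub> h \<oplus>\<^bsub>A\<^esub> b = \<ominus>\<^bsub>A\<^esub> a \<oplus>\<^bsub>A\<^esub> (\<ominus>\<^bsub>A\<^esub> b \<oplus>\<^bsub>A\<^esub> b)"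
      unfolding e A.minus_add[OF c(2,1)] using c by (simp add: A.a_ac)
    thus ?thesis using c by (simp add: A.l_neg)
  qed
  ultimately show ?thesis by simp
qed

lemma p_minus: "q \<in> carrier Q \<Longrightarrow> q' \<in> carrier Q \<Longrightarrow> a \<in> p k q \<Longrightarrow> b \<in> p k q' \<Longrightarrow> a \<ominus>\<^bsub>A\<^esub> b \<in> p k (q \<ominus>\<^bsub>Q\<^esub> q')"
  unfolding a_minus_def using p_add p_neg by simp

lemma K_ideal: "ideal (K k) Q"
proof -
  interpret rm: rmodule Q "ring_mod Q" by (rule Q.rmodule_ring_mod)
  have "rm.sub (K k)"
  proof (rule rm.subI)
    show "K k \<subseteq> carrier (ring_mod Q)" unfolding K_def by auto
    show "\<zero>\<^bsub>ring_mod Q\<^esub> \<in> K k" unfolding K_def using p_zero by simp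
  next
    fix x y assume "x \<in> K k" "y \<in> K k"
    thus "x \<oplus>\<^bsub>ring_mod Q\<^esub> y \<in> K k" unfolding K_def using p_add[of x y "\<zero>\<^bsub>A\<^esub>" k "\<zero>\<^bsub>A\<^esub>"] by simp
  next
    fix a x assume a: "a \<in> carrier Q" and x: "x \<in> K k"
    obtain b where b: "b \<in> p k a" using p_ex[OF a] by blast
    show "a \<odot>\<^bsub>ring_mod Q\<^esub> x \<in> K k" using a x p_mult[of a x b k "\<zero>\<^bsub>A\<^esub>"] b p_carr[OF a b] unfolding K_def by simp
  qed
  thus ?thesis by simp
qed

text \<open>K 1 is a proper ideal, so it lies in n. If q in n were outside K 1, its image would be
  represented by a unit of A whose inverse lifts to some r; then 1 - q r lies in K 1, hence in n,
  and 1 would be in n.\<close>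

lemma K_one: "K (Suc 0) = n"
proof -
  have m1: "mp (Suc 0) = m" using A.pow_one[OF A.m_ideal] .
  have "\<one>\<^bsub>Q\<^esub> \<notin> K (Suc 0)" using K_iff[OF Q.one_closed p_one, of "Suc 0"] m1 A.prime_one[OF A.m_prime] by blast
  hence sub: "K (Suc 0) \<subseteq> n" using Q.ideal_sub_m[OF K_ideal] by auto
  have "n \<subseteq> K (Suc 0)"
  proof (rule ccontr)
    assume "\<not> n \<subseteq> K (Suc 0)"
    then obtain q where q: "q \<in> n" "q \<notin> K (Suc 0)" by blast
    have qc: "q \<in> carrier Q" using q Q.m_carr by blast
    obtain a where a: "a \<in> p (Suc 0) q" using p_ex[OF qc] by blast
    have ac: "a \<in> carrier A - m" using p_carr[OF qc a] K_iff[OF qc a] q m1 by blast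
    hence u: "a \<in> Units A" using A.local_unit[OF A.loc] by blast
    obtain r where r: "r \<in> carrier Q" "\<forall>k. inv\<^bsub>A\<^esub> a \<in> p k r" using p_lift[of "inv\<^bsub>A\<^esub> a"] u by blast
    have "\<one>\<^bsub>A\<^esub> \<in> p (Suc 0) (q \<otimes>\<^bsub>Q\<^esub> r)" using p_mult[OF qc r(1) a] r(2) u by (metis A.Units_r_inv)
    hence "\<one>\<^bsub>A\<^esub> \<ominus>\<^bsub>A\<^esub> \<one>\<^bsub>A\<^esub> \<in> p (Suc 0) (\<one>\<^bsub>Q\<^esub> \<ominus>\<^bsub>Q\<^esub> q \<otimes>\<^bsub>Q\<^esub> r)" using p_minus[OF Q.one_closed _ p_one] qc r(1) by blast
    hence "\<one>\<^bsub>Q\<^esub> \<ominus>\<^bsub>Q\<^esub> q \<otimes>\<^bsub>Q\<^esub> r \<in> n" using sub qc r(1) unfolding K_def by (auto simp: A.r_neg a_minus_def)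
    moreover have "q \<otimes>\<^bsub>Q\<^esub> r \<in> n" using ideal.I_r_closed[OF Q.m_ideal q(1) r(1)] .
    ultimately have "(\<one>\<^bsub>Q\<^esub> \<ominus>\<^bsub>Q\<^esub> q \<otimes>\<^bsub>Q\<^esub> r) \<oplus>\<^bsub>Q\<^esub> q \<otimes>\<^bsub>Q\<^esub> r \<in> n" using Q.idl_add[OF Q.m_ideal] by blast
    moreover have "(\<one>\<^bsub>Q\<^esub> \<ominus>\<^bsub>Q\<^esub> q \<otimes>\<^bsub>Q\<^esub> r) \<oplus>\<^bsub>Q\<^esub> q \<otimes>\<^bsub>Q\<^esub> r = \<one>\<^bsub>Q\<^esub>" using qc r(1) by (simp add: a_minus_def Q.a_assoc Q.l_neg)
    ultimately show False using Q.prime_one[OF Q.m_prime] by simp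
  qed
  thus ?thesis using sub by blast
qed

text \<open>The index is a successor because \<open>p 0 q\<close> is all of A and says nothing about
  q.\<close>

lemma n_iff: assumes q: "q \<in> carrier Q" and a: "a \<in> p (Suc k) q" shows "q \<in> n \<longleftrightarrow> a \<in> m"
proof -
  have "a \<in> p (Suc 0) q" using p_antimono[OF q, of "Suc 0" "Suc k"] a by auto
  thus ?thesis using K_iff[OF q] K_one A.pow_one[OF A.m_ideal] by blast
qed

text \<open>Elements of m lift into n by \<open>n_iff\<close>, so products lift to products. One and
  the same q represents a modulo every m^k.\<close>

lemma lift_pow: "a \<in> mp j \<Longrightarrow> \<exists>q\<in>np j. \<forall>k. a \<in> p k q"
proof (induction j arbitrary: a)
  case 0
  thus ?case using p_lift by simp
next
  case (Suc j)
  have "a \<in> ideal_prod A m (mp j)" using Suc(2) by (simp add: ideal_pow.simps(2))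
  thus ?case
  proof (induction a rule: ideal_prod.induct)
    case (prod b c)
    obtain q where q: "q \<in> carrier Q" "\<forall>k. b \<in> p k q" using p_lift A.m_carr prod(1) by blast
    have qn: "q \<in> n" using n_iff[OF q(1), of b 0] q(2) prod(1) by blast
    obtain q' where q': "q' \<in> np j" "\<forall>k. c \<in> p k q'" using Suc(1)[OF prod(2)] by blast
    have "q \<otimes>\<^bsub>Q\<^esub> q' \<in> np (Suc j)" using Q.pow_Suc_mem[OF qn q'(1)] .
    moreover have "\<forall>k. b \<otimes>\<^bsub>A\<^esub> c \<in> p k (q \<otimes>\<^bsub>Q\<^esub> q')" using p_mult q q' Q.idl_carr[OF np] by blast
    ultimately show ?case by blast
  next
    case (sum b c)
    then obtain q q' where h: "q \<in> np (Suc j)" "\<forall>k. b \<in> p k q" "q' \<in> np (Suc j)" "\<forall>k. c \<in> p k q'" by blast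
    have "\<forall>k. b \<oplus>\<^bsub>A\<^esub> c \<in> p k (q \<oplus>\<^bsub>Q\<^esub> q')" using p_add h Q.idl_carr[OF np] by blast
    thus ?case using Q.idl_add[OF np h(1,3)] by blast
  qed
qed

lemma pow_p: "q \<in> np j \<Longrightarrow> \<exists>a\<in>mp j. a \<in> p (Suc k) q"
proof (induction j arbitrary: q)
  case 0
  hence "q \<in> carrier Q" by simp
  thus ?case using p_ex p_carr by fastforce
next
  case (Suc j)
  have "q \<in> ideal_prod Q n (np j)" using Suc(2) by (simp add: ideal_pow.simps(2))
  thus ?case
  proof (induction q rule: ideal_prod.induct)
    case (prod q r)
    have qc: "q \<in> carrier Q" using prod Q.m_carr by blast
    obtain a where a: "a \<in> p (Suc k) q" using p_ex[OF qc] by blast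
    have am: "a \<in> m" using n_iff[OF qc a] prod by blast
    obtain b where b: "b \<in> mp j" "b \<in> p (Suc k) r" using Suc(1)[OF prod(2)] by blast
    show ?case using A.pow_Suc_mem[OF am b(1)] p_mult[OF qc _ a b(2)] prod(2) Q.idl_carr[OF np] by blast
  next
    case (sum q r)
    then obtain a b where h: "a \<in> mp (Suc j)" "a \<in> p (Suc k) q" "b \<in> mp (Suc j)" "b \<in> p (Suc k) r" by blast
    have "q \<in> carrier Q" "r \<in> carrier Q" using sum Q.idl_carr[OF np[of "Suc j"]] by (simp_all add: ideal_pow.simps(2))
    thus ?case using A.idl_add[OF mp h(1,3)] p_add h by blast
  qed
qed

lemma np_sub_K: "np k \<subseteq> K k"
proof
  fix q assume q: "q \<in> np k"
  have qc: "q \<in> carrier Q" using q Q.idl_carr[OF np] by blast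
  obtain a where a: "a \<in> mp k" "a \<in> p (Suc k) q" using pow_p[OF q] by blast
  thus "q \<in> K k" using K_iff[OF qc, of a k] p_Suc[OF qc] by blast
qed

lemma K_antimono: "j \<le> k \<Longrightarrow> K k \<subseteq> K j"
  unfolding K_def using p_antimono by blast

text \<open>An element of K k maps into m^k, and its class modulo m^(k+1) lifts to n^k. This is one
  round of the successive approximation in \<open>K_eq\<close>.\<close>

lemma K_step: assumes "q \<in> K k" shows "\<exists>w\<in>np k. q \<ominus>\<^bsub>Q\<^esub> w \<in> K (Suc k)"
proof -
  have qc: "q \<in> carrier Q" using assms unfolding K_def by blast
  obtain a where a: "a \<in> p (Suc k) q" using p_ex[OF qc] by blast
  have "a \<in> mp k" using K_iff[OF qc, of a k] p_Suc[OF qc] a assms by blast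
  then obtain w where w: "w \<in> np k" "\<forall>k. a \<in> p k w" using lift_pow by blast
  have wc: "w \<in> carrier Q" using w Q.idl_carr[OF np] by blast
  have "a \<ominus>\<^bsub>A\<^esub> a \<in> p (Suc k) (q \<ominus>\<^bsub>Q\<^esub> w)" using p_minus[OF qc wc a] w by blast
  moreover have "a \<ominus>\<^bsub>A\<^esub> a = \<zero>\<^bsub>A\<^esub>" using p_carr[OF qc a] by (simp add: a_minus_def A.r_neg)
  ultimately show ?thesis using w qc wc unfolding K_def by auto
qed

lemma p_eq_of_diff:
  assumes q: "q \<in> carrier Q" "r \<in> carrier Q" and d: "q \<ominus>\<^bsub>Q\<^esub> r \<in> K k" shows "p k q = p k r"
proof -
  obtain a where a: "a \<in> p k r" using p_ex[OF q(2)] by blast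
  have "\<zero>\<^bsub>A\<^esub> \<oplus>\<^bsub>A\<^esub> a \<in> p k ((q \<ominus>\<^bsub>Q\<^esub> r) \<oplus>\<^bsub>Q\<^esub> r)" using p_add[of "q \<ominus>\<^bsub>Q\<^esub> r" r] d q a unfolding K_def by blast
  moreover have "(q \<ominus>\<^bsub>Q\<^esub> r) \<oplus>\<^bsub>Q\<^esub> r = q" using q by (simp add: a_minus_def Q.a_assoc Q.l_neg)
  ultimately have "a \<in> p k q" using p_carr[OF q(2) a] by simp
  thus ?thesis using p_eqI[OF q _ a] by blast
qed

text \<open>The completeness of the target is used here: a series with terms in the powers of \<open>n\<close>
  converges, coefficient by coefficient with respect to fixed generators of \<open>n\<^sup>k\<close>.\<close>
lemma K_eq: "K k = np k <+>\<^bsub>Q\<^esub> PIdl\<^bsub>Q\<^esub> f"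
proof
  have fK: "PIdl\<^bsub>Q\<^esub> f \<subseteq> K j" for j
  proof
    fix q assume q: "q \<in> PIdl\<^bsub>Q\<^esub> f"
    have "q \<in> carrier Q" using q Q.idl_carr[OF Q.cgenideal_ideal[OF f]] by blast
    thus "q \<in> K j" unfolding K_def using p_ker q by blast
  qed
  show "np k <+>\<^bsub>Q\<^esub> PIdl\<^bsub>Q\<^esub> f \<subseteq> K k" using Q.isum_least[OF K_ideal np_sub_K fK] .
  show "K k \<subseteq> np k <+>\<^bsub>Q\<^esub> PIdl\<^bsub>Q\<^esub> f"
  proof
    fix q assume q: "q \<in> K k"
    have qc: "q \<in> carrier Q" using q unfolding K_def by blast
    interpret rm: noeth_rmodule Q "ring_mod Q" by (rule Q.noeth_rmodule_ring_mod)
    obtain S where S: "finite S" "S \<subseteq> np k" "gen_submodule Q (ring_mod Q) S = np k" using rm.sub_fg[of "np k"] np by auto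
    obtain \<tau> where \<tau>: "S = \<tau> ` {..<card S}" using ex_bij_betw_nat_finite[OF S(1)] unfolding bij_betw_def by (metis lessThan_atLeast0)
    define s where "s = card S"
    have \<tau>k: "\<tau> i \<in> np k" if "i < s" for i using S(2) \<tau> that unfolding s_def by auto
    have \<tau>c: "\<tau> i \<in> carrier (ring_mod Q)" if "i < s" for i using \<tau>k[OF that] Q.idl_carr[OF np] by simp
    have gen: "gen_submodule Q (ring_mod Q) (\<tau> ` {..<s}) = np k" using S(3) \<tau> unfolding s_def by simp
    \<comment> \<open>Coefficients of elements of n^(k+j) over the fixed generators of n^k can be
      taken in n^j; this makes the partial sums of coefficients Cauchy.\<close>
    have plc: "\<exists>c. (\<forall>i<s. c i \<in> np j) \<and> w = rm.lc \<tau> c s" if w: "w \<in> np (k + j)" for w j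
    proof -
      have i: "ideal (ideal_smult Q (ring_mod Q) (np j) (np k)) Q" using rm.sub_ism[of "np j" "np k"] np Q.idl_carr[OF np] by auto
      have "np (k + j) = ideal_prod Q (np j) (np k)" using Q.pow_add[OF Q.m_ideal, of j k] by (simp add: add.commute)
      also have "\<dots> \<subseteq> ideal_smult Q (ring_mod Q) (np j) (np k)" using Q.ideal_prod_least[OF i] rm.ism_memI by simp
      also have "\<dots> = {rm.lc \<tau> c s |c. \<forall>i<s. c i \<in> np j}" using rm.ism_gen_lc[OF np[of j], of s \<tau>] \<tau>c gen by simp
      finally show ?thesis using w by blast
    qed
    have lcI: "rm.lc \<tau> d j \<in> I" if I: "ideal I Q" and d: "\<forall>i<s. d i \<in> I" and "j \<le> s" for I d j
      using that(3)
    proof (induction j)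
      case (Suc j)
      have "d j \<otimes>\<^bsub>Q\<^esub> \<tau> j \<in> I" using ideal.I_r_closed[OF I] d Suc(2) \<tau>c[of j] by simp
      thus ?case using Suc Q.idl_add[OF I] by simp
    qed (use Q.idl_zero[OF I] in simp)
    \<comment> \<open>Stage j: q is a combination with coefficients C up to an error in K (k + j),
      and the next stage changes the coefficients by elements of n^j only.\<close>
    let ?P = "\<lambda>j (C, u). (\<forall>i<s. C i \<in> carrier Q) \<and> u \<in> K (k + j) \<and> q = rm.lc \<tau> C s \<oplus>\<^bsub>Q\<^esub> u"
    let ?R = "\<lambda>j (C, u) (C', u'). \<forall>i<s. C' i \<ominus>\<^bsub>Q\<^esub> C i \<in> np j"
    have "\<exists>F. \<forall>j. ?P j (F j) \<and> ?R j (F j) (F (Suc j))"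
    proof (rule dependent_nat_choice)
      have "rm.lc \<tau> (\<lambda>_. \<zero>\<^bsub>Q\<^esub>) j = \<zero>\<^bsub>Q\<^esub>" if "j \<le> s" for j
        using that by (induction j) (use \<tau>c in auto)
      hence "rm.lc \<tau> (\<lambda>_. \<zero>\<^bsub>Q\<^esub>) s = \<zero>\<^bsub>Q\<^esub>" by blast
      thus "\<exists>x. ?P 0 x" using q qc by (intro exI[of _ "(\<lambda>_. \<zero>\<^bsub>Q\<^esub>, q)"]) simp
    next
      fix x j assume "?P j x"
      then obtain C u where x: "x = (C, u)" and h: "\<forall>i<s. C i \<in> carrier Q" "u \<in> K (k + j)" "q = rm.lc \<tau> C s \<oplus>\<^bsub>Q\<^esub> u" by (cases x) auto
      obtain w where w: "w \<in> np (k + j)" "u \<ominus>\<^bsub>Q\<^esub> w \<in> K (Suc (k + j))" using K_step[OF h(2)] by blast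
      obtain c where c: "\<forall>i<s. c i \<in> np j" "w = rm.lc \<tau> c s" using plc[OF w(1)] by blast
      have cc: "\<forall>i<s. c i \<in> carrier Q" using c Q.idl_carr[OF np] by blast
      have e: "rm.lc \<tau> (\<lambda>i. C i \<oplus>\<^bsub>Q\<^esub> c i) s = rm.lc \<tau> C s \<oplus>\<^bsub>Q\<^esub> w" using rm.lc_add[of s C c \<tau>] h(1) cc \<tau>c c(2) by simp
      have u: "u \<in> carrier Q" "w \<in> carrier Q" using h(2) w Q.idl_carr[OF np] unfolding K_def by auto
      have lc: "rm.lc \<tau> C s \<in> carrier Q" using rm.lc_closed[of s C \<tau>] h(1) \<tau>c by simp
      have "q = (rm.lc \<tau> C s \<oplus>\<^bsub>Q\<^esub> w) \<oplus>\<^bsub>Q\<^esub> (u \<ominus>\<^bsub>Q\<^esub> w)"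
      proof -
        have "u = w \<oplus>\<^bsub>Q\<^esub> (u \<ominus>\<^bsub>Q\<^esub> w)" using u Q.a_lcomm[of w u "\<ominus>\<^bsub>Q\<^esub> w"] by (simp add: a_minus_def Q.r_neg)
        thus ?thesis using h(3) lc u by (simp add: Q.a_assoc)
      qed
      moreover have "(C i \<oplus>\<^bsub>Q\<^esub> c i) \<ominus>\<^bsub>Q\<^esub> C i \<in> np j" if "i < s" for i
      proof -
        have "(C i \<oplus>\<^bsub>Q\<^esub> c i) \<ominus>\<^bsub>Q\<^esub> C i = c i" using h(1) cc that Q.a_lcomm[of "c i" "C i" "\<ominus>\<^bsub>Q\<^esub> C i"] Q.a_comm[of "C i" "c i"]
          by (simp add: a_minus_def Q.a_assoc Q.r_neg)
        thus ?thesis using c that by simp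
      qed
      ultimately show "\<exists>y. ?P (Suc j) y \<and> ?R j x y"
        using h(1) cc w(2) e unfolding x by (intro exI[of _ "(\<lambda>i. C i \<oplus>\<^bsub>Q\<^esub> c i, u \<ominus>\<^bsub>Q\<^esub> w)"]) simp
    qed
    then obtain F where F0: "\<forall>j. ?P j (F j) \<and> ?R j (F j) (F (Suc j))" ..
    note F = conjunct1[OF F0[rule_format]] conjunct2[OF F0[rule_format]]
    define C where "C j = fst (F j)" for j
    define U where "U j = snd (F j)" for j
    have FU: "F j = (C j, U j)" for j unfolding C_def U_def by simp
    have C: "C j i \<in> carrier Q" if "i < s" for i j using F(1)[of j] that unfolding FU by simp
    have U: "U j \<in> K (k + j)" "q = rm.lc \<tau> (C j) s \<oplus>\<^bsub>Q\<^esub> U j" for j using F(1)[of j] unfolding FU by simp_all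
    have R: "C (Suc j) i \<ominus>\<^bsub>Q\<^esub> C j i \<in> np j" if "i < s" for i j using F(2)[of j] that unfolding FU by simp
    \<comment> \<open>Q itself may fail to be complete. The limit c is taken in Q/(f), through its
      images in all A/m^j.\<close>
    have "\<exists>c\<in>carrier Q. i < s \<longrightarrow> (\<forall>j. p j c = p j (C j i))" for i
    proof (cases "i < s")
      case True
      have "p j (C (Suc j) i) = p j (C j i)" for j
        using p_eq_of_diff[OF C[OF True] C[OF True]] R[OF True] np_sub_K by blast
      thus ?thesis using p_complete[of "\<lambda>j. C j i"] C[OF True] by blast
    qed (use Q.zero_closed in blast)
    then obtain c where c: "\<And>i. c i \<in> carrier Q" "\<And>i j. i < s \<Longrightarrow> p j (c i) = p j (C j i)" by metis
    let ?w = "rm.lc \<tau> c s"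
    have wk: "?w \<in> np k"
    proof -
      have "?w \<in> {rm.lc \<tau> u s |u. \<forall>i<s. u i \<in> carrier Q}" using c(1) by blast
      thus ?thesis using rm.gen_lc[of s \<tau>] \<tau>c gen by simp
    qed
    have wc: "?w \<in> carrier Q" using wk Q.idl_carr[OF np] by blast
    \<comment> \<open>Replacing C j by its limit changes the combination by an element of K j, and
      the error U j is in K j as well. So q - w vanishes in every A/m^j and lies in (f).\<close>
    have "q \<ominus>\<^bsub>Q\<^esub> ?w \<in> K j" for j
    proof -
      define d where "d i = c i \<ominus>\<^bsub>Q\<^esub> C j i" for i
      have dK: "\<forall>i<s. d i \<in> K j"
      proof (intro allI impI)
        fix i assume i: "i < s"
        obtain a where a: "a \<in> p j (c i)" using p_ex[OF c(1)] by blast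
        have "a \<ominus>\<^bsub>A\<^esub> a \<in> p j (c i \<ominus>\<^bsub>Q\<^esub> C j i)" using p_minus[OF c(1) C[OF i] a] a c(2)[OF i] by blast
        moreover have "a \<ominus>\<^bsub>A\<^esub> a = \<zero>\<^bsub>A\<^esub>" using p_carr[OF c(1) a] by (simp add: a_minus_def A.r_neg)
        ultimately show "d i \<in> K j" unfolding d_def K_def using c(1) C[OF i] by simp
      qed
      have dc: "\<forall>i<s. d i \<in> carrier Q" using dK unfolding K_def by blast
      have "?w = rm.lc \<tau> (\<lambda>i. C j i \<oplus>\<^bsub>Q\<^esub> d i) s"
      proof (rule rm.lc_cong)
        fix i assume "i < s"
        thus "c i = C j i \<oplus>\<^bsub>Q\<^esub> d i" unfolding d_def using c(1)[of i] C[of i j] Q.a_lcomm[of "C j i" "c i" "\<ominus>\<^bsub>Q\<^esub> C j i"] by (simp add: a_minus_def Q.r_neg)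
      qed
      also have "\<dots> = rm.lc \<tau> (C j) s \<oplus>\<^bsub>Q\<^esub> rm.lc \<tau> d s" using rm.lc_add[of s "C j" d \<tau>] C dc \<tau>c by simp
      finally have e: "?w = rm.lc \<tau> (C j) s \<oplus>\<^bsub>Q\<^esub> rm.lc \<tau> d s" .
      have lK: "rm.lc \<tau> d s \<in> K j" using lcI[OF K_ideal dK order_refl] .
      have UK: "U j \<in> K j" using U(1)[of j] K_antimono[of j "k + j"] by auto
      have cc: "rm.lc \<tau> (C j) s \<in> carrier Q" "rm.lc \<tau> d s \<in> carrier Q" "U j \<in> carrier Q"
        using rm.lc_closed[of s "C j" \<tau>] C \<tau>c lK UK unfolding K_def by auto
      have "(q \<ominus>\<^bsub>Q\<^esub> ?w) \<oplus>\<^bsub>Q\<^esub> rm.lc \<tau> d s = U j"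
      proof -
        have "(q \<ominus>\<^bsub>Q\<^esub> ?w) \<oplus>\<^bsub>Q\<^esub> rm.lc \<tau> d s = (U j \<oplus>\<^bsub>Q\<^esub> rm.lc \<tau> (C j) s) \<oplus>\<^bsub>Q\<^esub> (\<ominus>\<^bsub>Q\<^esub> rm.lc \<tau> (C j) s \<oplus>\<^bsub>Q\<^esub> \<ominus>\<^bsub>Q\<^esub> rm.lc \<tau> d s) \<oplus>\<^bsub>Q\<^esub> rm.lc \<tau> d s"
          unfolding e U(2)[of j] a_minus_def using cc by (simp add: Q.minus_add Q.a_comm)
        also have "\<dots> = U j" using cc by (simp add: Q.a_assoc Q.r_neg Q.l_neg)
        finally show ?thesis .
      qed
      thus ?thesis using Q.idl_cancel'[OF K_ideal lK, of "q \<ominus>\<^bsub>Q\<^esub> ?w"] UK qc wc by simp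
    qed
    hence "q \<ominus>\<^bsub>Q\<^esub> ?w \<in> PIdl\<^bsub>Q\<^esub> f" using p_ker[of "q \<ominus>\<^bsub>Q\<^esub> ?w"] qc wc unfolding K_def by blast
    moreover have "q = ?w \<oplus>\<^bsub>Q\<^esub> (q \<ominus>\<^bsub>Q\<^esub> ?w)" using qc wc Q.a_lcomm[of ?w q "\<ominus>\<^bsub>Q\<^esub> ?w"] by (simp add: a_minus_def Q.r_neg)
    ultimately show "q \<in> np k <+>\<^bsub>Q\<^esub> PIdl\<^bsub>Q\<^esub> f" using Q.isum_memI[OF wk] by metis
  qed
qed

text \<open>An ideal Y of Q over K k is sent to the ideal of all a in A that have the same class
  modulo m^k as some element of Y. The kernel K k lies in Y, so strict inclusions are kept.\<close>

lemma qlen_K_le: "quotient_length Q (ring_mod Q) (K k) (carrier Q) \<le> quotient_length A (ring_mod A) (mp k) (carrier A)"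
proof -
  interpret rm: rmodule Q "ring_mod Q" by (rule Q.rmodule_ring_mod)
  interpret ra: rmodule A "ring_mod A" by (rule A.rmodule_ring_mod)
  define h where "h Y = {a \<in> carrier A. \<exists>q\<in>Y. a \<in> p k q}" for Y
  have hY: "ideal (h Y) A \<and> mp k \<subseteq> h Y" if Y: "ideal Y Q" for Y
  proof
    have "ra.sub (h Y)"
    proof (rule ra.subI)
      show "h Y \<subseteq> carrier (ring_mod A)" unfolding h_def by auto
      show "\<zero>\<^bsub>ring_mod A\<^esub> \<in> h Y" unfolding h_def using p_zero Q.idl_zero[OF Y] by auto
    next
      fix a b assume "a \<in> h Y" "b \<in> h Y"
      then obtain q r where "a \<in> carrier A" "b \<in> carrier A" "q \<in> Y" "r \<in> Y" "a \<in> p k q" "b \<in> p k r" unfolding h_def by blast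
      moreover from this have "a \<oplus>\<^bsub>A\<^esub> b \<in> p k (q \<oplus>\<^bsub>Q\<^esub> r)" using p_add Q.idl_carr[OF Y] by blast
      ultimately show "a \<oplus>\<^bsub>ring_mod A\<^esub> b \<in> h Y" unfolding h_def using Q.idl_add[OF Y] by auto
    next
      fix c a assume c: "c \<in> carrier A" and "a \<in> h Y"
      then obtain q where q: "a \<in> carrier A" "q \<in> Y" "a \<in> p k q" unfolding h_def by blast
      obtain r where r: "r \<in> carrier Q" "\<forall>k. c \<in> p k r" using p_lift[OF c] by blast
      have "c \<otimes>\<^bsub>A\<^esub> a \<in> p k (r \<otimes>\<^bsub>Q\<^esub> q)" using p_mult[OF r(1)] r(2) q Q.idl_carr[OF Y] by blast
      thus "c \<odot>\<^bsub>ring_mod A\<^esub> a \<in> h Y" unfolding h_def using c q Q.idl_mult[OF Y r(1) q(2)] by auto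
    qed
    thus "ideal (h Y) A" by simp
    show "mp k \<subseteq> h Y"
    proof
      fix a assume a: "a \<in> mp k"
      have ac: "a \<in> carrier A" using a A.idl_carr[OF mp] by blast
      have "a \<oplus>\<^bsub>A\<^esub> \<zero>\<^bsub>A\<^esub> \<in> p k \<zero>\<^bsub>Q\<^esub>" using p_add_pow[OF Q.zero_closed p_zero a] .
      thus "a \<in> h Y" unfolding h_def using ac Q.idl_zero[OF Y] by auto
    qed
  qed
  show ?thesis
  proof (rule rm.ql_transfer[OF A.rmodule_ring_mod, where h = h])
    show "rm.sub (K k)" "rm.sub (carrier Q)" "K k \<subseteq> carrier Q" using K_ideal Q.oneideal unfolding K_def by auto
    show "submodule (mp k) A (ring_mod A)" "submodule (carrier A) A (ring_mod A)" "mp k \<subseteq> carrier A"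
      using mp A.oneideal A.idl_carr[OF mp] by auto
    show "submodule (h X) A (ring_mod A) \<and> mp k \<subseteq> h X \<and> h X \<subseteq> carrier A" if "rm.sub X" for X
      using hY[of X] that unfolding h_def by auto
    show "h X \<subset> h Y" if X: "rm.sub X" "K k \<subseteq> X" and Y: "rm.sub Y" and XY: "X \<subset> Y" for X Y
    proof -
      obtain q where q: "q \<in> Y" "q \<notin> X" using XY by blast
      have Xi: "ideal X Q" "ideal Y Q" using X Y by auto
      have qc: "q \<in> carrier Q" using q Q.idl_carr[OF Xi(2)] by blast
      obtain a where a: "a \<in> p k q" using p_ex[OF qc] by blast
      have ac: "a \<in> carrier A" using p_carr[OF qc a] .
      have "a \<in> h Y" unfolding h_def using a ac q by blast
      moreover have "a \<notin> h X"
      proof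
        assume "a \<in> h X"
        then obtain r where r: "r \<in> X" "a \<in> p k r" unfolding h_def by blast
        have rc: "r \<in> carrier Q" using r Q.idl_carr[OF Xi(1)] by blast
        have "a \<ominus>\<^bsub>A\<^esub> a \<in> p k (q \<ominus>\<^bsub>Q\<^esub> r)" using p_minus[OF qc rc a r(2)] .
        hence "q \<ominus>\<^bsub>Q\<^esub> r \<in> K k" unfolding K_def using ac qc rc by (simp add: a_minus_def A.r_neg)
        hence "(q \<ominus>\<^bsub>Q\<^esub> r) \<oplus>\<^bsub>Q\<^esub> r \<in> X" using Q.idl_add[OF Xi(1)] X(2) r by blast
        moreover have "(q \<ominus>\<^bsub>Q\<^esub> r) \<oplus>\<^bsub>Q\<^esub> r = q" using qc rc by (simp add: a_minus_def Q.a_assoc Q.l_neg)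
        ultimately show False using q by simp
      qed
      moreover have "h X \<subseteq> h Y" unfolding h_def using XY by blast
      ultimately show ?thesis by blast
    qed
  qed
qed

end

section \<open>Presenting modules over the regular ring\<close>

lemma (in rmodule) minus_add_cancel: "x \<in> carrier M \<Longrightarrow> y \<in> carrier M \<Longrightarrow> y +\<^sub>m (x \<ominus>\<^bsub>M\<^esub> y) = x"
  using M.a_lcomm[of y x "\<ominus>\<^bsub>M\<^esub> y"] by (simp add: a_minus_def M.r_neg)

lemma (in rmodule) minus_zero: "x \<in> carrier M \<Longrightarrow> x \<ominus>\<^bsub>M\<^esub> \<zero>\<^bsub>M\<^esub> = x"
  using minus_add_cancel[of x "\<zero>\<^bsub>M\<^esub>"] by simp

lemma (in rmodule) minus_eq_smult: "x \<in> carrier M \<Longrightarrow> y \<in> carrier M \<Longrightarrow> x \<ominus>\<^bsub>M\<^esub> y = x +\<^sub>m (\<ominus> \<one>) \<bullet> y"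
  by (simp add: a_minus_def smult_l_minus)

lemma (in rmodule) ism_insert:
  assumes x: "x \<in> carrier R" and S: "S \<subseteq> carrier R"
  shows "Idl (insert x S) \<star> carrier M = (Idl S \<star> carrier M) \<uplus> (x \<bullet>\<bullet> carrier M)"
proof
  have c: "insert x S \<subseteq> carrier R" using x S by auto
  note i = idl_ideal[OF S] idl_ideal[OF c]
  have s1: "sub (Idl S \<star> carrier M)" using sub_ism[OF _ carrier_is_submodule] ideal.Icarr[OF i(1)] by blast
  have s2: "sub (x \<bullet>\<bullet> carrier M)" using sub_scl[OF x carrier_is_submodule] .
  have s3: "sub (Idl (insert x S) \<star> carrier M)" using sub_ism[OF _ carrier_is_submodule] ideal.Icarr[OF i(2)] by blast
  show "Idl (insert x S) \<star> carrier M \<subseteq> (Idl S \<star> carrier M) \<uplus> (x \<bullet>\<bullet> carrier M)"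
  proof (rule ism_least[OF sub_sum[OF s1 s2]])
    fix a v assume a: "a \<in> Idl (insert x S)" and v: "v \<in> carrier M"
    then obtain b t where h: "b \<in> Idl S" "t \<in> carrier R" "a = b \<oplus> t \<otimes> x" using idl_insert[OF x S] by (auto elim!: PIdl_sumE)
    have bc: "b \<in> carrier R" using h ideal.Icarr[OF i(1)] by blast
    have "a \<bullet> v = b \<bullet> v +\<^sub>m x \<bullet> (t \<bullet> v)" using h bc v x by (simp add: smult_l_distr smult_assoc1[symmetric] R.m_comm)
    moreover have "x \<bullet> (t \<bullet> v) \<in> x \<bullet>\<bullet> carrier M" using h v by blast
    ultimately show "a \<bullet> v \<in> (Idl S \<star> carrier M) \<uplus> (x \<bullet>\<bullet> carrier M)" using sum_memI ism_memI[OF h(1) v] by simp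
  qed
  have le: "Idl S \<subseteq> Idl (insert x S)" and xI: "x \<in> Idl (insert x S)" using idl_least[OF i(2), of S] idl_self[OF c] by auto
  show "(Idl S \<star> carrier M) \<uplus> (x \<bullet>\<bullet> carrier M) \<subseteq> Idl (insert x S) \<star> carrier M"
    using ism_mono[OF _ carrier_is_submodule carrier_is_submodule le order_refl] ideal.Icarr[OF i(2)] ism_memI[OF xI]
    by (intro sum_least[OF s3]) auto
qed

locale complete_presentation_module =
  complete_presentation A m Q n f p + M: local_rmodule A M m
  for A :: "('a, 'e) ring_scheme" and m :: "'a set" and Q :: "('c, 'd) ring_scheme" and n :: "'c set"
    and f :: 'c and p :: "nat \<Rightarrow> 'c \<Rightarrow> 'a set" and M :: "('a, 'b) module" +
  fixes g :: "nat \<Rightarrow> 'b" and r :: nat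
  assumes g: "i < r \<Longrightarrow> g i \<in> carrier M" and g_gen: "gen_submodule A M (g ` {..<r}) = carrier M"
begin

abbreviation F :: "('c, nat \<Rightarrow> 'c) module" where "F \<equiv> free_mod Q r"
abbreviation Ffil :: "nat \<Rightarrow> (nat \<Rightarrow> 'c) set" where "Ffil k \<equiv> ideal_smult Q F (np k) (carrier F)"

lemma F_local: "local_rmodule Q F n"
  by (rule Q.local_rmodule_free)

lemma fil_lc: "M.fil k = {M.lc g b r |b. \<forall>i<r. b i \<in> mp k}"
  using M.ism_gen_lc[OF mp[of k], of r g] g g_gen by simp

lemma Ffil_iff: "v \<in> Ffil k \<longleftrightarrow> v \<in> carrier F \<and> (\<forall>i<r. v i \<in> np k)"
  using Q.free_ism[OF np] by blast

text \<open>\<open>T k v x\<close>: modulo \<open>m\<^sup>k M\<close>, the element \<open>x\<close> is the combination of the generators with coefficients \<open>v\<close>.\<close>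
definition T :: "nat \<Rightarrow> (nat \<Rightarrow> 'c) \<Rightarrow> 'b \<Rightarrow> bool" where
  "T k v x \<longleftrightarrow> v \<in> carrier F \<and> (\<exists>a y. (\<forall>i<r. a i \<in> p k (v i)) \<and> y \<in> M.fil k \<and> x = M.lc g a r \<oplus>\<^bsub>M\<^esub> y)"

lemma T_I: "v \<in> carrier F \<Longrightarrow> (\<And>i. i < r \<Longrightarrow> a i \<in> p k (v i)) \<Longrightarrow> y \<in> M.fil k \<Longrightarrow> x = M.lc g a r \<oplus>\<^bsub>M\<^esub> y \<Longrightarrow> T k v x"
  unfolding T_def by blast

lemma F_mem: "v \<in> carrier F \<Longrightarrow> i < r \<Longrightarrow> v i \<in> carrier Q"
  by (rule Q.free_mem)

lemma lc_carr: "(\<forall>i<r. a i \<in> carrier A) \<Longrightarrow> M.lc g a r \<in> carrier M"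
  using M.lc_closed g by blast

lemma rep_carr: "v \<in> carrier F \<Longrightarrow> (\<forall>i<r. a i \<in> p k (v i)) \<Longrightarrow> \<forall>i<r. a i \<in> carrier A"
  using p_carr F_mem by blast

lemma fil_carr: "y \<in> M.fil k \<Longrightarrow> y \<in> carrier M"
  using M.sub_carr[OF M.sub_fil] .

lemma rep_ex: "v \<in> carrier F \<Longrightarrow> \<exists>a. \<forall>i<r. a i \<in> p k (v i)"
proof -
  assume v: "v \<in> carrier F"
  have "\<forall>i. \<exists>a. i < r \<longrightarrow> a \<in> p k (v i)" using p_ex F_mem[OF v] by blast
  thus ?thesis by metis
qed

lemma T_carr: "T k v x \<Longrightarrow> v \<in> carrier F \<and> x \<in> carrier M"
  unfolding T_def using lc_carr rep_carr fil_carr by blast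

text \<open>The choice of representatives does not matter: two of them differ by elements of m^k,
  which contribute an element of m^k M.\<close>

lemma T_rep:
  assumes T: "T k v x" and a: "\<forall>i<r. a i \<in> p k (v i)"
  shows "\<exists>y\<in>M.fil k. x = M.lc g a r \<oplus>\<^bsub>M\<^esub> y"
proof -
  obtain b y where h: "v \<in> carrier F" "\<forall>i<r. b i \<in> p k (v i)" "y \<in> M.fil k" "x = M.lc g b r \<oplus>\<^bsub>M\<^esub> y" using T unfolding T_def by blast
  have "\<forall>i. \<exists>d. i < r \<longrightarrow> d \<in> mp k \<and> b i = d \<oplus>\<^bsub>A\<^esub> a i" using p_sub[OF F_mem[OF h(1)]] a h(2) by blast
  then obtain d where d: "\<And>i. i < r \<Longrightarrow> d i \<in> mp k \<and> b i = d i \<oplus>\<^bsub>A\<^esub> a i" by metis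
  have c: "\<forall>i<r. a i \<in> carrier A" "\<forall>i<r. d i \<in> carrier A" using rep_carr[OF h(1) a] d A.idl_carr[OF mp] by auto
  have "M.lc g b r = M.lc g (\<lambda>i. d i \<oplus>\<^bsub>A\<^esub> a i) r" using d by (intro M.lc_cong) blast
  also have "\<dots> = M.lc g d r \<oplus>\<^bsub>M\<^esub> M.lc g a r" using M.lc_add[of r d a g] c g by simp
  finally have "x = M.lc g a r \<oplus>\<^bsub>M\<^esub> (M.lc g d r \<oplus>\<^bsub>M\<^esub> y)"
    using h(4) lc_carr[OF c(1)] lc_carr[OF c(2)] fil_carr[OF h(3)] by (simp add: M.M.a_ac)
  moreover have "M.lc g d r \<in> M.fil k" unfolding fil_lc using d by blast
  ultimately show ?thesis using M.sub_add[OF M.sub_fil _ h(3)] by blast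
qed

lemma T_lc: "v \<in> carrier F \<Longrightarrow> (\<forall>i<r. a i \<in> p k (v i)) \<Longrightarrow> T k v (M.lc g a r)"
  unfolding T_def using M.sub_zero[OF M.sub_fil] lc_carr[OF rep_carr] by (metis M.M.r_zero)

lemma T_ex: "v \<in> carrier F \<Longrightarrow> \<exists>x. T k v x"
  using rep_ex T_lc by blast

lemma T_fil: assumes "T k v x" "y \<in> M.fil k" shows "T k v (x \<oplus>\<^bsub>M\<^esub> y)"
proof -
  obtain a z where h: "v \<in> carrier F" "\<forall>i<r. a i \<in> p k (v i)" "z \<in> M.fil k" "x = M.lc g a r \<oplus>\<^bsub>M\<^esub> z" using assms(1) unfolding T_def by blast
  have "x \<oplus>\<^bsub>M\<^esub> y = M.lc g a r \<oplus>\<^bsub>M\<^esub> (z \<oplus>\<^bsub>M\<^esub> y)" using h lc_carr[OF rep_carr[OF h(1,2)]] fil_carr assms(2) by (simp add: M.M.a_assoc)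
  thus ?thesis unfolding T_def using h M.sub_add[OF M.sub_fil h(3) assms(2)] by blast
qed

lemma T_add: assumes "T k v x" "T k w y" shows "T k (v \<oplus>\<^bsub>F\<^esub> w) (x \<oplus>\<^bsub>M\<^esub> y)"
proof -
  interpret Fr: local_rmodule Q F n by (rule F_local)
  obtain a x' where a: "v \<in> carrier F" "\<forall>i<r. a i \<in> p k (v i)" "x' \<in> M.fil k" "x = M.lc g a r \<oplus>\<^bsub>M\<^esub> x'" using assms(1) unfolding T_def by blast
  obtain b y' where b: "w \<in> carrier F" "\<forall>i<r. b i \<in> p k (w i)" "y' \<in> M.fil k" "y = M.lc g b r \<oplus>\<^bsub>M\<^esub> y'" using assms(2) unfolding T_def by blast
  note c = rep_carr[OF a(1,2)] rep_carr[OF b(1,2)]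
  have "M.lc g (\<lambda>i. a i \<oplus>\<^bsub>A\<^esub> b i) r = M.lc g a r \<oplus>\<^bsub>M\<^esub> M.lc g b r" using M.lc_add[of r a b g] c g by simp
  hence "x \<oplus>\<^bsub>M\<^esub> y = M.lc g (\<lambda>i. a i \<oplus>\<^bsub>A\<^esub> b i) r \<oplus>\<^bsub>M\<^esub> (x' \<oplus>\<^bsub>M\<^esub> y')"
    using a b lc_carr[OF c(1)] lc_carr[OF c(2)] fil_carr by (simp add: M.M.a_ac)
  moreover have "a i \<oplus>\<^bsub>A\<^esub> b i \<in> p k ((v \<oplus>\<^bsub>F\<^esub> w) i)" if "i < r" for i
  proof -
    have "a i \<oplus>\<^bsub>A\<^esub> b i \<in> p k (v i \<oplus>\<^bsub>Q\<^esub> w i)" using p_add[OF F_mem[OF a(1) that] F_mem[OF b(1) that]] a(2) b(2) that by blast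
    thus ?thesis using that by (simp add: Q.free_simps)
  qed
  moreover have "v \<oplus>\<^bsub>F\<^esub> w \<in> carrier F" using a b by simp
  ultimately show ?thesis using M.sub_add[OF M.sub_fil a(3) b(3)] by (intro T_I[of _ "\<lambda>i. a i \<oplus>\<^bsub>A\<^esub> b i" k "x' \<oplus>\<^bsub>M\<^esub> y'"])
qed

lemma T_smult: assumes q: "q \<in> carrier Q" and b: "b \<in> p k q" and T: "T k v x" shows "T k (q \<odot>\<^bsub>F\<^esub> v) (b \<odot>\<^bsub>M\<^esub> x)"
proof -
  interpret Fr: local_rmodule Q F n by (rule F_local)
  obtain a y where a: "v \<in> carrier F" "\<forall>i<r. a i \<in> p k (v i)" "y \<in> M.fil k" "x = M.lc g a r \<oplus>\<^bsub>M\<^esub> y" using T unfolding T_def by blast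
  note c = rep_carr[OF a(1,2)]
  have bc: "b \<in> carrier A" using p_carr[OF q b] .
  have "M.lc g (\<lambda>i. b \<otimes>\<^bsub>A\<^esub> a i) r = b \<odot>\<^bsub>M\<^esub> M.lc g a r" using M.lc_smult[of b r a g] c g bc by simp
  hence "b \<odot>\<^bsub>M\<^esub> x = M.lc g (\<lambda>i. b \<otimes>\<^bsub>A\<^esub> a i) r \<oplus>\<^bsub>M\<^esub> b \<odot>\<^bsub>M\<^esub> y"
    using a lc_carr[OF c] fil_carr bc by (simp add: M.smult_r_distr)
  moreover have "b \<otimes>\<^bsub>A\<^esub> a i \<in> p k ((q \<odot>\<^bsub>F\<^esub> v) i)" if "i < r" for i
  proof -
    have "b \<otimes>\<^bsub>A\<^esub> a i \<in> p k (q \<otimes>\<^bsub>Q\<^esub> v i)" using p_mult[OF q F_mem[OF a(1) that] b] a(2) that by blast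
    thus ?thesis using that by (simp add: Q.free_simps)
  qed
  moreover have "q \<odot>\<^bsub>F\<^esub> v \<in> carrier F" using a q by simp
  ultimately show ?thesis using M.sub_smult[OF M.sub_fil bc a(3)] by (intro T_I[of _ "\<lambda>i. b \<otimes>\<^bsub>A\<^esub> a i" k "b \<odot>\<^bsub>M\<^esub> y"])
qed

lemma T_minus: assumes "T k v x" "T k w y" shows "T k (v \<ominus>\<^bsub>F\<^esub> w) (x \<ominus>\<^bsub>M\<^esub> y)"
proof -
  interpret Fr: local_rmodule Q F n by (rule F_local)
  have "T k (v \<oplus>\<^bsub>F\<^esub> (\<ominus>\<^bsub>Q\<^esub> \<one>\<^bsub>Q\<^esub>) \<odot>\<^bsub>F\<^esub> w) (x \<oplus>\<^bsub>M\<^esub> (\<ominus>\<^bsub>A\<^esub> \<one>\<^bsub>A\<^esub>) \<odot>\<^bsub>M\<^esub> y)"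
    using T_add[OF assms(1) T_smult[OF _ p_neg[OF Q.one_closed p_one] assms(2)]] by simp
  thus ?thesis using M.minus_eq_smult Fr.minus_eq_smult T_carr assms by metis
qed

text \<open>With \<open>T_ex\<close> this makes T k the graph of a map from F to M/m^k M.\<close>

lemma T_uniq: assumes "T k v x" "T k v y" shows "x \<ominus>\<^bsub>M\<^esub> y \<in> M.fil k"
proof -
  obtain a where a: "\<forall>i<r. a i \<in> p k (v i)" using rep_ex T_carr assms(1) by blast
  obtain x' y' where h: "x' \<in> M.fil k" "x = M.lc g a r \<oplus>\<^bsub>M\<^esub> x'" "y' \<in> M.fil k" "y = M.lc g a r \<oplus>\<^bsub>M\<^esub> y'"
    using T_rep[OF assms(1) a] T_rep[OF assms(2) a] by blast
  have lc: "M.lc g a r \<in> carrier M" using lc_carr[OF rep_carr[OF _ a]] T_carr assms(1) by blast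
  have c: "x' \<in> carrier M" "y' \<in> carrier M" using fil_carr h by auto
  have "y \<oplus>\<^bsub>M\<^esub> (x' \<ominus>\<^bsub>M\<^esub> y') = x"
  proof -
    have "y \<oplus>\<^bsub>M\<^esub> (x' \<ominus>\<^bsub>M\<^esub> y') = M.lc g a r \<oplus>\<^bsub>M\<^esub> (y' \<oplus>\<^bsub>M\<^esub> (x' \<ominus>\<^bsub>M\<^esub> y'))" using h lc c by (simp add: M.M.a_assoc)
    thus ?thesis using M.minus_add_cancel[OF c] h by simp
  qed
  moreover have "y \<oplus>\<^bsub>M\<^esub> (x \<ominus>\<^bsub>M\<^esub> y) = x" using M.minus_add_cancel T_carr assms by blast
  ultimately have "x \<ominus>\<^bsub>M\<^esub> y = x' \<ominus>\<^bsub>M\<^esub> y'" using T_carr assms c by (metis M.M.add.l_cancel M.M.minus_closed)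
  thus ?thesis using M.sub_minus[OF M.sub_fil h(1,3)] by simp
qed

lemma T_antimono: assumes "T k v x" "j \<le> k" shows "T j v x"
  using assms M.fil_antimono[OF assms(2)] p_antimono[OF F_mem assms(2)] unfolding T_def by blast

lemma T_zero: "T k \<zero>\<^bsub>F\<^esub> \<zero>\<^bsub>M\<^esub>"
proof -
  interpret Fr: local_rmodule Q F n by (rule F_local)
  have "M.lc g (\<lambda>_. \<zero>\<^bsub>A\<^esub>) j = \<zero>\<^bsub>M\<^esub>" if "j \<le> r" for j using that by (induction j) (use g in auto)
  hence "M.lc g (\<lambda>_. \<zero>\<^bsub>A\<^esub>) r = \<zero>\<^bsub>M\<^esub>" by blast
  moreover have "\<forall>i<r. \<zero>\<^bsub>A\<^esub> \<in> p k (\<zero>\<^bsub>F\<^esub> i)" using p_zero by (simp add: Q.free_simps)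
  ultimately show ?thesis using T_lc[of "\<zero>\<^bsub>F\<^esub>" "\<lambda>_. \<zero>\<^bsub>A\<^esub>" k] by simp
qed

text \<open>A single v serves all k, because elements of A lift to Q exactly and not merely modulo a
  power of m.\<close>

lemma T_lift: assumes "\<forall>i<r. a i \<in> carrier A" shows "\<exists>v\<in>carrier F. (\<forall>i<r. \<forall>k. a i \<in> p k (v i)) \<and> (\<forall>k. T k v (M.lc g a r))"
proof -
  have "\<forall>i. \<exists>q. i < r \<longrightarrow> q \<in> carrier Q \<and> (\<forall>k. a i \<in> p k q)" using p_lift assms by blast
  then obtain q where q: "\<And>i. i < r \<Longrightarrow> q i \<in> carrier Q \<and> (\<forall>k. a i \<in> p k (q i))" by metis
  define v where "v = restrict q {..<r}"
  have v: "v \<in> carrier F" unfolding v_def using q by (auto simp: Q.free_simps)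
  have "\<forall>i<r. \<forall>k. a i \<in> p k (v i)" unfolding v_def using q by simp
  thus ?thesis using v T_lc[OF v] by blast
qed

lemma T_surj: assumes "x \<in> carrier M" shows "\<exists>v\<in>carrier F. \<forall>k. T k v x"
proof -
  obtain a where "x = M.lc g a r" "\<forall>i<r. a i \<in> carrier A" using assms g_gen M.gen_lc[of r g] g by blast
  thus ?thesis using T_lift by blast
qed

text \<open>The preimage in F of the image of U in M/m^k M. In particular PT k {0} is the kernel of
  F -> M/m^k M.\<close>

definition PT :: "nat \<Rightarrow> 'b set \<Rightarrow> (nat \<Rightarrow> 'c) set" where "PT k U = {v. \<exists>x\<in>U. T k v x}"

lemma sub_PT: assumes U: "submodule U A M" shows "submodule (PT k U) Q F"
proof -
  interpret Fr: local_rmodule Q F n by (rule F_local)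
  show ?thesis
  proof (rule Fr.subI)
    show "PT k U \<subseteq> carrier F" unfolding PT_def using T_carr by blast
    show "\<zero>\<^bsub>F\<^esub> \<in> PT k U" unfolding PT_def using T_zero M.sub_zero[OF U] by blast
    show "v \<oplus>\<^bsub>F\<^esub> w \<in> PT k U" if "v \<in> PT k U" "w \<in> PT k U" for v w
      using that T_add M.sub_add[OF U] unfolding PT_def by blast
    show "q \<odot>\<^bsub>F\<^esub> v \<in> PT k U" if q: "q \<in> carrier Q" and v: "v \<in> PT k U" for q v
    proof -
      obtain x where x: "x \<in> U" "T k v x" using v unfolding PT_def by blast
      obtain b where b: "b \<in> p k q" using p_ex[OF q] by blast
      have "b \<odot>\<^bsub>M\<^esub> x \<in> U" using M.sub_smult[OF U p_carr[OF q b] x(1)] .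
      thus ?thesis unfolding PT_def using T_smult[OF q b x(2)] by blast
    qed
  qed
qed

lemma sub_TP: assumes Y: "submodule Y Q F" shows "submodule {x. \<exists>v\<in>Y. T k v x} A M"
proof -
  interpret Fr: local_rmodule Q F n by (rule F_local)
  show ?thesis
  proof (rule M.subI)
    show "{x. \<exists>v\<in>Y. T k v x} \<subseteq> carrier M" using T_carr by blast
    show "\<zero>\<^bsub>M\<^esub> \<in> {x. \<exists>v\<in>Y. T k v x}" using T_zero Fr.sub_zero[OF Y] by blast
    show "x \<oplus>\<^bsub>M\<^esub> y \<in> {x. \<exists>v\<in>Y. T k v x}" if "x \<in> {x. \<exists>v\<in>Y. T k v x}" "y \<in> {x. \<exists>v\<in>Y. T k v x}" for x y
      using that T_add Fr.sub_add[OF Y] by blast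
    show "a \<odot>\<^bsub>M\<^esub> x \<in> {x. \<exists>v\<in>Y. T k v x}" if a: "a \<in> carrier A" and x: "x \<in> {x. \<exists>v\<in>Y. T k v x}" for a x
    proof -
      obtain v where v: "v \<in> Y" "T k v x" using x by blast
      obtain q where q: "q \<in> carrier Q" "a \<in> p k q" using p_lift[OF a] by blast
      thus ?thesis using T_smult[OF q v(2)] Fr.sub_smult[OF Y q(1) v(1)] by blast
    qed
  qed
qed

text \<open>Here a does not depend on k, so v is an exact lift of a relation over A. The choice a =
  0 shows that all vectors with coordinates in (f) belong to this set.\<close>

definition rels :: "(nat \<Rightarrow> 'c) set" where
  "rels = {v \<in> carrier F. \<exists>a. (\<forall>i<r. \<forall>k. a i \<in> p k (v i)) \<and> M.lc g a r = \<zero>\<^bsub>M\<^esub>}"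
definition N :: "(nat \<Rightarrow> 'c) set" where "N = gen_submodule Q F rels"

lemma sub_N: "submodule N Q F"
proof -
  interpret Fr: local_rmodule Q F n by (rule F_local)
  show ?thesis unfolding N_def by (rule Fr.gen_sub) (auto simp: rels_def)
qed

text \<open>If the combination with coefficients a lies in m^k M, it equals one with coefficients b
  in m^k. Then a - b is a relation and lifts into N, b lifts to n^k F, and the remaining discrepancy
  has coordinates in K k, which is n^k + (f) by \<open>K_eq\<close>.\<close>

lemma PT_zero: "PT k {\<zero>\<^bsub>M\<^esub>} = N <+>\<^bsub>F\<^esub> Ffil k"
proof
  interpret Fr: local_rmodule Q F n by (rule F_local)
  have W: "Fr.sub (PT k {\<zero>\<^bsub>M\<^esub>})" using sub_PT[OF M.sub_zero_set] .
  have NF: "Fr.sub (N <+>\<^bsub>F\<^esub> Ffil k)" using Fr.sub_sum[OF sub_N Fr.sub_fil] .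
  note ub = Fr.sum_ub1[OF sub_N Fr.sub_fil, of k] Fr.sum_ub2[OF sub_N Fr.sub_fil, of k]
  show "N <+>\<^bsub>F\<^esub> Ffil k \<subseteq> PT k {\<zero>\<^bsub>M\<^esub>}"
  proof (rule Fr.sum_least[OF W])
    have "rels \<subseteq> PT k {\<zero>\<^bsub>M\<^esub>}"
    proof
      fix v assume "v \<in> rels"
      then obtain a where "v \<in> carrier F" "\<forall>i<r. a i \<in> p k (v i)" "M.lc g a r = \<zero>\<^bsub>M\<^esub>" unfolding rels_def by blast
      thus "v \<in> PT k {\<zero>\<^bsub>M\<^esub>}" unfolding PT_def using T_lc by fastforce
    qed
    thus "N \<subseteq> PT k {\<zero>\<^bsub>M\<^esub>}" unfolding N_def by (rule Fr.gen_least[OF W])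
    show "Ffil k \<subseteq> PT k {\<zero>\<^bsub>M\<^esub>}"
    proof
      fix v assume "v \<in> Ffil k"
      hence v: "v \<in> carrier F" "\<forall>i<r. v i \<in> np k" using Ffil_iff by auto
      have "\<forall>i<r. \<zero>\<^bsub>A\<^esub> \<in> p k (v i)" using np_sub_K v(2) unfolding K_def by blast
      moreover have "M.lc g (\<lambda>_. \<zero>\<^bsub>A\<^esub>) j = \<zero>\<^bsub>M\<^esub>" if "j \<le> r" for j using that by (induction j) (use g in auto)
      ultimately have "T k v \<zero>\<^bsub>M\<^esub>" using T_lc[OF v(1), of "\<lambda>_. \<zero>\<^bsub>A\<^esub>" k] by simp
      thus "v \<in> PT k {\<zero>\<^bsub>M\<^esub>}" unfolding PT_def by blast
    qed
  qed
  have Kin: "v \<in> N <+>\<^bsub>F\<^esub> Ffil k" if v: "v \<in> carrier F" and K: "\<forall>i<r. v i \<in> K k" for v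
  proof -
    have "\<forall>i. \<exists>b c. i < r \<longrightarrow> b \<in> np k \<and> c \<in> PIdl\<^bsub>Q\<^esub> f \<and> v i = b \<oplus>\<^bsub>Q\<^esub> c" using K unfolding K_eq by (meson Q.isum_memE)
    then obtain b c where bc: "\<And>i. i < r \<Longrightarrow> b i \<in> np k \<and> c i \<in> PIdl\<^bsub>Q\<^esub> f \<and> v i = b i \<oplus>\<^bsub>Q\<^esub> c i" by metis
    define b' where "b' = restrict b {..<r}"
    define c' where "c' = restrict c {..<r}"
    have cc: "c i \<in> carrier Q" "b i \<in> carrier Q" if "i < r" for i
      using bc[OF that] Q.idl_carr[OF np] Q.idl_carr[OF Q.cgenideal_ideal[OF f]] by auto
    have c': "c' \<in> carrier F" "b' \<in> carrier F" unfolding c'_def b'_def using cc by (auto simp: Q.free_simps)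
    have "v = c' \<oplus>\<^bsub>F\<^esub> b'"
      by (rule Q.free_eqI[OF v]) (use c' bc cc in \<open>auto simp: Q.free_simps c'_def b'_def Q.a_comm\<close>)
    moreover have "c' \<in> rels"
    proof -
      have "\<forall>i<r. \<forall>k. \<zero>\<^bsub>A\<^esub> \<in> p k (c' i)" unfolding c'_def using bc p_ker cc by auto
      moreover have "M.lc g (\<lambda>_. \<zero>\<^bsub>A\<^esub>) j = \<zero>\<^bsub>M\<^esub>" if "j \<le> r" for j using that by (induction j) (use g in auto)
      hence "M.lc g (\<lambda>_. \<zero>\<^bsub>A\<^esub>) r = \<zero>\<^bsub>M\<^esub>" by blast
      ultimately show ?thesis unfolding rels_def using c'(1) by (auto intro!: exI[of _ "\<lambda>_. \<zero>\<^bsub>A\<^esub>"])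
    qed
    hence "c' \<in> N" unfolding N_def using Fr.gen_self by blast
    moreover have "b' \<in> Ffil k" unfolding Ffil_iff using c' bc unfolding b'_def by simp
    ultimately show ?thesis using Fr.sum_memI by blast
  qed
  show "PT k {\<zero>\<^bsub>M\<^esub>} \<subseteq> N <+>\<^bsub>F\<^esub> Ffil k"
  proof
    fix v assume "v \<in> PT k {\<zero>\<^bsub>M\<^esub>}"
    hence T: "T k v \<zero>\<^bsub>M\<^esub>" unfolding PT_def by blast
    have v: "v \<in> carrier F" using T_carr[OF T] by blast
    obtain a where a: "\<forall>i<r. a i \<in> p k (v i)" using rep_ex[OF v] by blast
    note ac = rep_carr[OF v a]
    have "M.lc g a r \<ominus>\<^bsub>M\<^esub> \<zero>\<^bsub>M\<^esub> \<in> M.fil k" using T_uniq[OF T_lc[OF v a] T] .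
    hence "M.lc g a r \<in> M.fil k" using lc_carr[OF ac] M.minus_zero by simp
    then obtain b where b: "\<forall>i<r. b i \<in> mp k" "M.lc g a r = M.lc g b r" unfolding fil_lc by blast
    have bc: "\<forall>i<r. b i \<in> carrier A" using b A.idl_carr[OF mp] by blast
    obtain w where w: "w \<in> carrier F" "\<forall>i<r. w i \<in> np k" "\<forall>i<r. b i \<in> p k (w i)"
    proof -
      have "\<forall>i. \<exists>q. i < r \<longrightarrow> q \<in> np k \<and> b i \<in> p k q" using lift_pow b(1) by blast
      then obtain q where q: "\<And>i. i < r \<Longrightarrow> q i \<in> np k \<and> b i \<in> p k (q i)" by metis
      show ?thesis by (rule that[of "restrict q {..<r}"]) (use q Q.idl_carr[OF np] in \<open>auto simp: Q.free_simps\<close>)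
    qed
    define d where "d i = a i \<ominus>\<^bsub>A\<^esub> b i" for i
    have dc: "\<forall>i<r. d i \<in> carrier A" unfolding d_def using ac bc by simp
    obtain u where u: "u \<in> carrier F" "\<forall>i<r. \<forall>k. d i \<in> p k (u i)" using T_lift[OF dc] by blast
    have e: "a i = d i \<oplus>\<^bsub>A\<^esub> b i" if "i < r" for i unfolding d_def using ac bc that by (simp add: a_minus_def A.a_assoc A.l_neg)
    have "M.lc g d r \<oplus>\<^bsub>M\<^esub> M.lc g b r = M.lc g (\<lambda>i. d i \<oplus>\<^bsub>A\<^esub> b i) r" using M.lc_add[of r d b g] dc bc g by simp
    also have "\<dots> = M.lc g a r" using e by (intro M.lc_cong) simp
    finally have "M.lc g d r \<oplus>\<^bsub>M\<^esub> M.lc g b r = M.lc g b r" using b by simp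
    hence "M.lc g d r = \<zero>\<^bsub>M\<^esub>" using lc_carr[OF dc] lc_carr[OF bc] M.M.l_zero M.M.add.r_cancel by (metis M.M.zero_closed)
    hence uN: "u \<in> N" unfolding N_def rels_def using u Fr.gen_self[of rels] unfolding rels_def by blast
    have wF: "w \<in> Ffil k" unfolding Ffil_iff using w by blast
    define z where "z = v \<ominus>\<^bsub>F\<^esub> (u \<oplus>\<^bsub>F\<^esub> w)"
    have zc: "z \<in> carrier F" "u \<oplus>\<^bsub>F\<^esub> w \<in> carrier F" unfolding z_def using v u w by auto
    have "\<forall>i<r. z i \<in> K k"
    proof (intro allI impI)
      fix i assume i: "i < r"
      have vi: "v i \<in> carrier Q" "u i \<in> carrier Q" "w i \<in> carrier Q" using F_mem v u w i by auto
      have "z = v \<oplus>\<^bsub>F\<^esub> (\<ominus>\<^bsub>Q\<^esub> \<one>\<^bsub>Q\<^esub>) \<odot>\<^bsub>F\<^esub> (u \<oplus>\<^bsub>F\<^esub> w)" unfolding z_def using Fr.minus_eq_smult[OF v zc(2)] .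
      hence "z i = v i \<ominus>\<^bsub>Q\<^esub> (u i \<oplus>\<^bsub>Q\<^esub> w i)" using i vi by (simp add: Q.free_simps a_minus_def Q.l_minus)
      moreover have "a i \<ominus>\<^bsub>A\<^esub> (d i \<oplus>\<^bsub>A\<^esub> b i) \<in> p k (v i \<ominus>\<^bsub>Q\<^esub> (u i \<oplus>\<^bsub>Q\<^esub> w i))"
        using p_minus p_add vi a u w i by simp
      moreover have "a i \<ominus>\<^bsub>A\<^esub> (d i \<oplus>\<^bsub>A\<^esub> b i) = \<zero>\<^bsub>A\<^esub>" unfolding e[OF i, symmetric] a_minus_def using ac i by (simp add: A.r_neg)
      ultimately show "z i \<in> K k" unfolding K_def using F_mem[OF zc(1) i] by simp
    qed
    hence "z \<in> N <+>\<^bsub>F\<^esub> Ffil k" using Kin zc by blast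
    moreover have "u \<oplus>\<^bsub>F\<^esub> w \<in> N <+>\<^bsub>F\<^esub> Ffil k" using Fr.sum_memI uN wF by blast
    ultimately show "v \<in> N <+>\<^bsub>F\<^esub> Ffil k" using Fr.sub_minus_cancel[OF NF _ _ v] unfolding z_def by blast
  qed
qed

text \<open>Submodules between m^(k+1) M and m^k M and submodules between the two kernels are
  matched in both directions by \<open>T (Suc k)\<close>.\<close>

lemma hilbert_eq:
  "quotient_length A M (M.fil (Suc k)) (M.fil k) = quotient_length Q F (N <+>\<^bsub>F\<^esub> Ffil (Suc k)) (N <+>\<^bsub>F\<^esub> Ffil k)"
  unfolding PT_zero[symmetric]
proof (rule antisym)
  interpret Fr: local_rmodule Q F n by (rule F_local)
  let ?W = "\<lambda>k. PT k {\<zero>\<^bsub>M\<^esub>}"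
  have W: "Fr.sub (?W k)" for k using sub_PT[OF M.sub_zero_set] .
  have WW: "?W (Suc k) \<subseteq> ?W k" unfolding PT_def using T_antimono[of "Suc k"] by auto
  have fs: "M.fil (Suc k) \<subseteq> M.fil k" using M.fil_antimono by simp
  show "quotient_length A M (M.fil (Suc k)) (M.fil k) \<le> quotient_length Q F (?W (Suc k)) (?W k)"
  proof (rule M.ql_transfer[OF Fr.rmodule_axioms M.sub_fil M.sub_fil fs W W WW, where h = "PT (Suc k)"])
    fix X assume X: "M.sub X" "M.fil (Suc k) \<subseteq> X" "X \<subseteq> M.fil k"
    have "PT (Suc k) X \<subseteq> ?W k"
    proof
      fix v assume "v \<in> PT (Suc k) X"
      then obtain x where x: "x \<in> X" "T (Suc k) v x" unfolding PT_def by blast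
      have xf: "x \<in> M.fil k" using x X by blast
      have "T k v x" using T_antimono[OF x(2), of k] by simp
      hence "T k v (x \<oplus>\<^bsub>M\<^esub> \<ominus>\<^bsub>M\<^esub> x)" using T_fil M.sub_neg[OF M.sub_fil xf] by blast
      thus "v \<in> ?W k" unfolding PT_def using fil_carr[OF xf] by (simp add: M.M.r_neg)
    qed
    thus "Fr.sub (PT (Suc k) X) \<and> ?W (Suc k) \<subseteq> PT (Suc k) X \<and> PT (Suc k) X \<subseteq> ?W k"
      using sub_PT[OF X(1)] M.sub_zero[OF X(1)] unfolding PT_def by blast
  next
    fix X Y assume X: "M.sub X" "M.fil (Suc k) \<subseteq> X" and Y: "M.sub Y" and XY: "X \<subset> Y"
    obtain y where y: "y \<in> Y" "y \<notin> X" using XY by blast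
    have yc: "y \<in> carrier M" using y M.sub_carr[OF Y] by blast
    obtain v where v: "T (Suc k) v y" using T_surj[OF yc] by blast
    have "v \<notin> PT (Suc k) X"
    proof
      assume "v \<in> PT (Suc k) X"
      then obtain x where x: "x \<in> X" "T (Suc k) v x" unfolding PT_def by blast
      have "y \<ominus>\<^bsub>M\<^esub> x \<in> X" using T_uniq[OF v x(2)] X by blast
      thus False using M.sub_minus_cancel[OF X(1) _ x(1) yc] y by blast
    qed
    moreover have "v \<in> PT (Suc k) Y" "PT (Suc k) X \<subseteq> PT (Suc k) Y" unfolding PT_def using y v XY by auto
    ultimately show "PT (Suc k) X \<subset> PT (Suc k) Y" by blast
  qed
  show "quotient_length Q F (?W (Suc k)) (?W k) \<le> quotient_length A M (M.fil (Suc k)) (M.fil k)"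
  proof (rule Fr.ql_transfer[OF M.rmodule_axioms W W WW M.sub_fil M.sub_fil fs, where h = "\<lambda>Y. {x. \<exists>v\<in>Y. T (Suc k) v x}"])
    fix Y assume Y: "Fr.sub Y" "?W (Suc k) \<subseteq> Y" "Y \<subseteq> ?W k"
    have "{x. \<exists>v\<in>Y. T (Suc k) v x} \<subseteq> M.fil k"
    proof
      fix x assume "x \<in> {x. \<exists>v\<in>Y. T (Suc k) v x}"
      then obtain v where v: "v \<in> Y" "T (Suc k) v x" by blast
      have "T k v \<zero>\<^bsub>M\<^esub>" using v Y unfolding PT_def by blast
      hence "x \<ominus>\<^bsub>M\<^esub> \<zero>\<^bsub>M\<^esub> \<in> M.fil k" using T_uniq T_antimono[OF v(2), of k] by simp
      thus "x \<in> M.fil k" using T_carr[OF v(2)] M.minus_zero by simp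
    qed
    moreover have "M.fil (Suc k) \<subseteq> {x. \<exists>v\<in>Y. T (Suc k) v x}"
    proof
      fix x assume x: "x \<in> M.fil (Suc k)"
      have "T (Suc k) \<zero>\<^bsub>F\<^esub> (\<zero>\<^bsub>M\<^esub> \<oplus>\<^bsub>M\<^esub> x)" using T_fil[OF T_zero x] .
      thus "x \<in> {x. \<exists>v\<in>Y. T (Suc k) v x}" using fil_carr[OF x] Fr.sub_zero[OF Y(1)] by auto
    qed
    ultimately show "M.sub {x. \<exists>v\<in>Y. T (Suc k) v x} \<and> M.fil (Suc k) \<subseteq> {x. \<exists>v\<in>Y. T (Suc k) v x} \<and> {x. \<exists>v\<in>Y. T (Suc k) v x} \<subseteq> M.fil k"
      using sub_TP[OF Y(1)] by blast
  next
    fix X Y assume X: "Fr.sub X" "?W (Suc k) \<subseteq> X" and Y: "Fr.sub Y" and XY: "X \<subset> Y"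
    obtain v where v: "v \<in> Y" "v \<notin> X" using XY by blast
    have vc: "v \<in> carrier F" using v Fr.sub_carr[OF Y] by blast
    obtain x where x: "T (Suc k) v x" using T_ex[OF vc] by blast
    have "x \<notin> {x. \<exists>v\<in>X. T (Suc k) v x}"
    proof
      assume "x \<in> {x. \<exists>v\<in>X. T (Suc k) v x}"
      then obtain w where w: "w \<in> X" "T (Suc k) w x" by blast
      have "T (Suc k) (v \<ominus>\<^bsub>F\<^esub> w) \<zero>\<^bsub>M\<^esub>" using T_minus[OF x w(2)] T_carr[OF x] by (simp add: a_minus_def M.M.r_neg)
      hence "v \<ominus>\<^bsub>F\<^esub> w \<in> X" using X(2) unfolding PT_def by blast
      thus False using Fr.sub_minus_cancel[OF X(1) _ w(1) vc] v by blast
    qed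
    thus "{x. \<exists>v\<in>X. T (Suc k) v x} \<subset> {x. \<exists>v\<in>Y. T (Suc k) v x}" using x v XY by blast
  qed
qed

text \<open>Dividing M by x amounts to dividing F by a lift q of x: a preimage of u + x y is q times
  a preimage of y plus a preimage of u.\<close>

lemma PT_quo:
  assumes U: "submodule U A M" and x: "x \<in> m" and q: "q \<in> n" "\<forall>k. x \<in> p k q"
  shows "PT k (U <+>\<^bsub>M\<^esub> (\<lambda>v. x \<odot>\<^bsub>M\<^esub> v) ` carrier M) = PT k U <+>\<^bsub>F\<^esub> (\<lambda>v. q \<odot>\<^bsub>F\<^esub> v) ` carrier F"
proof
  interpret Fr: local_rmodule Q F n by (rule F_local)
  have qc: "q \<in> carrier Q" using q Q.m_carr by blast
  have U': "M.sub (U <+>\<^bsub>M\<^esub> (\<lambda>v. x \<odot>\<^bsub>M\<^esub> v) ` carrier M)" using M.sub_quo[OF U x] .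
  show "PT k (U <+>\<^bsub>M\<^esub> (\<lambda>v. x \<odot>\<^bsub>M\<^esub> v) ` carrier M) \<subseteq> PT k U <+>\<^bsub>F\<^esub> (\<lambda>v. q \<odot>\<^bsub>F\<^esub> v) ` carrier F"
  proof
    fix v assume "v \<in> PT k (U <+>\<^bsub>M\<^esub> (\<lambda>v. x \<odot>\<^bsub>M\<^esub> v) ` carrier M)"
    then obtain z where "z \<in> U <+>\<^bsub>M\<^esub> (\<lambda>v. x \<odot>\<^bsub>M\<^esub> v) ` carrier M" and T: "T k v z" unfolding PT_def by blast
    then obtain u y where h: "u \<in> U" "y \<in> carrier M" "z = u \<oplus>\<^bsub>M\<^esub> x \<odot>\<^bsub>M\<^esub> y" by (meson M.quoE)
    obtain w where w: "w \<in> carrier F" "T k w y" using T_surj[OF h(2)] by blast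
    have "T k (q \<odot>\<^bsub>F\<^esub> w) (x \<odot>\<^bsub>M\<^esub> y)" using T_smult[OF qc _ w(2)] q by blast
    hence "T k (v \<ominus>\<^bsub>F\<^esub> q \<odot>\<^bsub>F\<^esub> w) (z \<ominus>\<^bsub>M\<^esub> x \<odot>\<^bsub>M\<^esub> y)" using T_minus[OF T] by blast
    moreover have "z \<ominus>\<^bsub>M\<^esub> x \<odot>\<^bsub>M\<^esub> y = u" using h M.sub_carr[OF U] M.m_carr[OF x] by (simp add: a_minus_def M.M.a_assoc M.M.r_neg)
    ultimately have "v \<ominus>\<^bsub>F\<^esub> q \<odot>\<^bsub>F\<^esub> w \<in> PT k U" unfolding PT_def using h(1) by auto
    moreover have "v = (v \<ominus>\<^bsub>F\<^esub> q \<odot>\<^bsub>F\<^esub> w) \<oplus>\<^bsub>F\<^esub> q \<odot>\<^bsub>F\<^esub> w"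
      using T_carr[OF T] w qc by (simp add: a_minus_def Fr.M.a_assoc Fr.M.l_neg)
    moreover have "q \<odot>\<^bsub>F\<^esub> w \<in> (\<lambda>v. q \<odot>\<^bsub>F\<^esub> v) ` carrier F" using w by blast
    ultimately show "v \<in> PT k U <+>\<^bsub>F\<^esub> (\<lambda>v. q \<odot>\<^bsub>F\<^esub> v) ` carrier F" using Fr.sum_memI by metis
  qed
  show "PT k U <+>\<^bsub>F\<^esub> (\<lambda>v. q \<odot>\<^bsub>F\<^esub> v) ` carrier F \<subseteq> PT k (U <+>\<^bsub>M\<^esub> (\<lambda>v. x \<odot>\<^bsub>M\<^esub> v) ` carrier M)"
  proof (rule Fr.sum_least[OF sub_PT[OF U']])
    show "PT k U \<subseteq> PT k (U <+>\<^bsub>M\<^esub> (\<lambda>v. x \<odot>\<^bsub>M\<^esub> v) ` carrier M)" unfolding PT_def using M.quo_ub[OF U x] by blast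
    show "(\<lambda>v. q \<odot>\<^bsub>F\<^esub> v) ` carrier F \<subseteq> PT k (U <+>\<^bsub>M\<^esub> (\<lambda>v. x \<odot>\<^bsub>M\<^esub> v) ` carrier M)"
    proof
      fix v assume "v \<in> (\<lambda>v. q \<odot>\<^bsub>F\<^esub> v) ` carrier F"
      then obtain w where w: "w \<in> carrier F" "v = q \<odot>\<^bsub>F\<^esub> w" by blast
      obtain y where y: "T k w y" using T_ex[OF w(1)] by blast
      have "T k v (x \<odot>\<^bsub>M\<^esub> y)" unfolding w(2) using T_smult[OF qc _ y] q by blast
      thus "v \<in> PT k (U <+>\<^bsub>M\<^esub> (\<lambda>v. x \<odot>\<^bsub>M\<^esub> v) ` carrier M)" unfolding PT_def using M.quo_mem[OF U x] T_carr[OF y] by blast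
    qed
  qed
qed

text \<open>The Artin-Rees lemma over \<open>A\<close> and Krull's intersection theorem over \<open>Q\<close> replace flatness of the completion.\<close>
lemma rg_lift:
  assumes U: "submodule U A M" and x: "x \<in> m" and q: "q \<in> n" "\<forall>k. x \<in> p k q"
    and L: "submodule L Q F" and LU: "\<And>k. L <+>\<^bsub>F\<^esub> Ffil k = PT k U" and reg: "M.rg x U"
  shows "rmodule.rg F q L"
proof -
  interpret Fr: local_rmodule Q F n by (rule F_local)
  have qc: "q \<in> carrier Q" using q Q.m_carr by blast
  have xc: "x \<in> carrier A" using x A.m_carr by blast
  let ?U = "M.quo U x"
  \<comment> \<open>A uniform version of the regularity of x on M/U, from Artin-Rees for U + x M: an
    element of this module that is small enough in M is, modulo U, x times an element of m^l
    M.\<close>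
  have ar: "\<exists>k\<ge>l. \<forall>y\<in>carrier M. x \<odot>\<^bsub>M\<^esub> y \<in> U <+>\<^bsub>M\<^esub> M.fil k \<longrightarrow> y \<in> U <+>\<^bsub>M\<^esub> M.fil l" for l
  proof -
    let ?X = "(\<lambda>v. x \<odot>\<^bsub>M\<^esub> v) ` M.fil l"
    let ?L = "U <+>\<^bsub>M\<^esub> ?X"
    have X: "M.sub ?X" using M.sub_scl[OF xc M.sub_fil] .
    have Ls: "M.sub ?L" using M.sub_sum[OF U X] .
    have le: "?L \<subseteq> ?U" using fil_carr by (intro M.sum_mono) auto
    have "ideal_smult A M (mp l) ?U \<subseteq> ?L"
    proof (rule M.ism_least[OF Ls])
      fix a z assume a: "a \<in> mp l" and "z \<in> ?U"
      then obtain u y where h: "u \<in> U" "y \<in> carrier M" "z = u \<oplus>\<^bsub>M\<^esub> x \<odot>\<^bsub>M\<^esub> y" by (meson M.quoE)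
      have ac: "a \<in> carrier A" using a A.idl_carr[OF mp] by blast
      have "a \<odot>\<^bsub>M\<^esub> z = a \<odot>\<^bsub>M\<^esub> u \<oplus>\<^bsub>M\<^esub> x \<odot>\<^bsub>M\<^esub> (a \<odot>\<^bsub>M\<^esub> y)"
        using h ac xc M.sub_carr[OF U] M.smult_comm[OF ac xc h(2)] by (simp add: M.smult_r_distr)
      moreover have "a \<odot>\<^bsub>M\<^esub> y \<in> M.fil l" using M.ism_memI[OF a h(2)] .
      ultimately show "a \<odot>\<^bsub>M\<^esub> z \<in> ?L" using M.sum_memI M.sub_smult[OF U ac h(1)] by simp
    qed
    then obtain k where k: "M.fil k \<inter> ?U \<subseteq> ?L" using M.artin_rees[OF A.m_ideal M.sub_quo[OF U x] Ls le] by blast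
    define k' where "k' = max k l"
    have k': "M.fil k' \<subseteq> M.fil k" using M.fil_antimono unfolding k'_def by simp
    have "y \<in> U <+>\<^bsub>M\<^esub> M.fil l" if y: "y \<in> carrier M" and h: "x \<odot>\<^bsub>M\<^esub> y \<in> U <+>\<^bsub>M\<^esub> M.fil k'" for y
    proof -
      obtain u w where uw: "u \<in> U" "w \<in> M.fil k'" "x \<odot>\<^bsub>M\<^esub> y = u \<oplus>\<^bsub>M\<^esub> w" using h by (meson M.sum_memE)
      have "w \<in> ?U" using M.sub_cancel[OF M.sub_quo[OF U x], of u w] uw M.quo_ub[OF U x] M.quo_mem[OF U x y] fil_carr by auto
      hence "w \<in> ?L" using k k' uw by blast
      then obtain u' z where h': "u' \<in> U" "z \<in> M.fil l" "w = u' \<oplus>\<^bsub>M\<^esub> x \<odot>\<^bsub>M\<^esub> z" by (auto elim!: M.sum_memE)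
      have c: "u \<in> carrier M" "u' \<in> carrier M" "z \<in> carrier M" using uw h' M.sub_carr[OF U] fil_carr by auto
      have "x \<odot>\<^bsub>M\<^esub> (y \<ominus>\<^bsub>M\<^esub> z) = u \<oplus>\<^bsub>M\<^esub> u'"
      proof -
        have "x \<odot>\<^bsub>M\<^esub> (y \<ominus>\<^bsub>M\<^esub> z) = x \<odot>\<^bsub>M\<^esub> y \<ominus>\<^bsub>M\<^esub> x \<odot>\<^bsub>M\<^esub> z" using y c xc by (simp add: a_minus_def M.smult_r_distr M.smult_r_minus)
        also have "\<dots> = u \<oplus>\<^bsub>M\<^esub> u'" unfolding uw(3) h'(3) using c xc by (simp add: a_minus_def M.M.a_assoc M.M.r_neg)
        finally show ?thesis .
      qed
      hence "y \<ominus>\<^bsub>M\<^esub> z \<in> U" using reg y c M.sub_add[OF U uw(1) h'(1)] unfolding M.rg_def by simp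
      moreover have "y = (y \<ominus>\<^bsub>M\<^esub> z) \<oplus>\<^bsub>M\<^esub> z" using y c by (simp add: a_minus_def M.M.a_assoc M.M.l_neg)
      ultimately show ?thesis using M.sum_memI[OF _ h'(2)] by metis
    qed
    thus ?thesis unfolding k'_def by (intro exI[of _ "max k l"]) auto
  qed
  show ?thesis unfolding Fr.rg_def
  proof (intro ballI impI)
    fix v assume v: "v \<in> carrier F" and qv: "q \<odot>\<^bsub>F\<^esub> v \<in> L"
    show "v \<in> L"
    proof (rule Fr.krull_intersection[OF L])
      fix l
      \<comment> \<open>Cancelling x loses precision: the class of v has to be read modulo m^k in
        order to be controlled modulo m^l.\<close>
      obtain k where k: "k \<ge> l" "\<forall>y\<in>carrier M. x \<odot>\<^bsub>M\<^esub> y \<in> U <+>\<^bsub>M\<^esub> M.fil k \<longrightarrow> y \<in> U <+>\<^bsub>M\<^esub> M.fil l" using ar by blast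
      obtain y where y: "T k v y" using T_ex[OF v] by blast
      have yc: "y \<in> carrier M" using T_carr[OF y] by blast
      have "q \<odot>\<^bsub>F\<^esub> v \<in> PT k U" using LU[of k] Fr.sum_ub1[OF L Fr.sub_fil, of k] qv by blast
      then obtain u where u: "u \<in> U" "T k (q \<odot>\<^bsub>F\<^esub> v) u" unfolding PT_def by blast
      have "x \<odot>\<^bsub>M\<^esub> y \<ominus>\<^bsub>M\<^esub> u \<in> M.fil k" using T_uniq[OF T_smult[OF qc _ y] u(2)] q by blast
      moreover have "x \<odot>\<^bsub>M\<^esub> y = u \<oplus>\<^bsub>M\<^esub> (x \<odot>\<^bsub>M\<^esub> y \<ominus>\<^bsub>M\<^esub> u)" using M.minus_add_cancel[of "x \<odot>\<^bsub>M\<^esub> y" u] yc xc u M.sub_carr[OF U] by simp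
      ultimately have "x \<odot>\<^bsub>M\<^esub> y \<in> U <+>\<^bsub>M\<^esub> M.fil k" using M.sum_memI[OF u(1)] by metis
      hence "y \<in> U <+>\<^bsub>M\<^esub> M.fil l" using k yc by blast
      then obtain u' w where h: "u' \<in> U" "w \<in> M.fil l" "y = u' \<oplus>\<^bsub>M\<^esub> w" by (meson M.sum_memE)
      have "T l v (y \<oplus>\<^bsub>M\<^esub> \<ominus>\<^bsub>M\<^esub> w)" using T_fil[OF T_antimono[OF y k(1)]] M.sub_neg[OF M.sub_fil h(2)] by blast
      moreover have "y \<oplus>\<^bsub>M\<^esub> \<ominus>\<^bsub>M\<^esub> w = u'" using h M.sub_carr[OF U] fil_carr by (simp add: M.M.a_assoc M.M.r_neg)
      ultimately have "v \<in> PT l U" unfolding PT_def using h(1) by auto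
      thus "v \<in> L <+>\<^bsub>F\<^esub> Ffil l" using LU by blast
    qed
  qed
qed

text \<open>The first j elements of xs have been divided out and d remain. The lifted submodule L
  enters only through its sums with all n^k F, which is what \<open>rg_lift\<close> asks
  for.\<close>

lemma dep_lift:
  assumes "submodule L Q F" "\<And>k. L <+>\<^bsub>F\<^esub> Ffil k = PT k (ideal_smult A M (Idl\<^bsub>A\<^esub> (set (take j xs))) (carrier M))"
    and xs: "set xs \<subseteq> m"
    and reg: "\<And>i. i < length xs \<Longrightarrow> M.rg (xs ! i) (ideal_smult A M (Idl\<^bsub>A\<^esub> (set (take i xs))) (carrier M))"
    and "d + j = length xs"
  shows "local_rmodule.dep F n d L"
  using assms(1,2,5)
proof (induction d arbitrary: L j)
  interpret Fr: local_rmodule Q F n by (rule F_local)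
  case 0
  show ?case by simp
next
  interpret Fr: local_rmodule Q F n by (rule F_local)
  case (Suc d)
  let ?U = "\<lambda>i. ideal_smult A M (Idl\<^bsub>A\<^esub> (set (take i xs))) (carrier M)"
  have j: "j < length xs" using Suc(4) by simp
  have xsc: "set xs \<subseteq> carrier A" using xs A.m_carr by blast
  have tc: "set (take i xs) \<subseteq> carrier A" for i using xsc set_take_subset[of i xs] by blast
  have U: "M.sub (?U i)" for i using M.sub_ism[OF _ M.carrier_is_submodule] A.idl_carr[OF A.idl_ideal[OF tc]] by blast
  let ?x = "xs ! j"
  have x: "?x \<in> m" using xs j by auto
  have xc: "?x \<in> carrier A" using x A.m_carr by blast
  obtain q where q: "q \<in> carrier Q" "\<forall>k. ?x \<in> p k q" using p_lift[OF xc] by blast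
  have qn: "q \<in> n" using n_iff[OF q(1), of ?x 0] q(2) x by blast
  have rq: "Fr.rg q L" using rg_lift[OF U x qn q(2) Suc(2) Suc(3) reg[OF j]] .
  have "set (take (Suc j) xs) = insert ?x (set (take j xs))" using j by (simp add: take_Suc_conv_app_nth)
  hence Us: "?U (Suc j) = M.quo (?U j) ?x" using M.ism_insert[OF xc tc] by simp
  have "Fr.dep d (Fr.quo L q)"
  proof (rule Suc(1)[of _ "Suc j"])
    show "Fr.sub (Fr.quo L q)" using Fr.sub_quo[OF Suc(2) qn] .
    show "d + Suc j = length xs" using Suc(4) by simp
    fix k
    have "Fr.quo L q <+>\<^bsub>F\<^esub> Ffil k = (L <+>\<^bsub>F\<^esub> Ffil k) <+>\<^bsub>F\<^esub> (\<lambda>v. q \<odot>\<^bsub>F\<^esub> v) ` carrier F"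
      using Fr.sum_assoc[OF Suc(2) Fr.sub_xM[OF qn] Fr.sub_fil, of k] Fr.sum_assoc[OF Suc(2) Fr.sub_fil Fr.sub_xM[OF qn], of k]
        Fr.sum_comm[OF Fr.sub_xM[OF qn] Fr.sub_fil, of k] by simp
    also have "\<dots> = PT k (?U (Suc j))" unfolding Suc(3) Us using PT_quo[OF U x qn q(2)] by simp
    finally show "Fr.quo L q <+>\<^bsub>F\<^esub> Ffil k = PT k (?U (Suc j))" .
  qed
  thus ?case using rq qn by auto
qed

end

section \<open>Hypersurface rings\<close>

lemma lring_of_local_ring: "local_ring R m \<Longrightarrow> lring R m"
  unfolding local_ring_def lring_def lring_axioms_def nring_def by (auto simp: local_ring_def)

section \<open>The completion as an inverse limit\<close>

context lring
begin

abbreviation cC :: "(nat \<Rightarrow> 'a set) set" where "cC \<equiv> compl_carrier R m"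

lemma mpow_ideal: "ideal (ideal_pow R m k) R"
  using pow_ideal[OF m_ideal] .

lemma coset_mono: "I \<subseteq> J \<Longrightarrow> I +> a \<subseteq> J +> a"
  by (auto simp: a_r_coset_def')

lemma quot_carrier: "carrier (R Quot I) = (\<lambda>a. I +> a) ` carrier R"
  by (auto simp: FactRing_def A_RCOSETS_def')

lemma cC_add: assumes "x \<in> cC" "y \<in> cC" shows "compl_add R m x y \<in> cC"
proof -
  have "x k \<oplus>\<^bsub>R Quot ideal_pow R m k\<^esub> y k \<in> carrier (R Quot ideal_pow R m k)" for k
  proof -
    interpret S: ring "R Quot ideal_pow R m k" using ideal.quotient_is_ring[OF mpow_ideal] .
    show ?thesis using assms unfolding compl_carrier_def by simp
  qed
  moreover have "x (Suc k) <+>\<^bsub>R\<^esub> y (Suc k) \<subseteq> x k <+>\<^bsub>R\<^esub> y k" for k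
    using assms by (intro isum_mono) (auto simp: compl_carrier_def)
  ultimately show ?thesis unfolding compl_carrier_def compl_add_def by (auto simp: FactRing_def)
qed

lemma cC_mult: assumes "x \<in> cC" "y \<in> cC" shows "compl_mult R m x y \<in> cC"
proof -
  have "x k \<otimes>\<^bsub>R Quot ideal_pow R m k\<^esub> y k \<in> carrier (R Quot ideal_pow R m k)" for k
  proof -
    interpret S: ring "R Quot ideal_pow R m k" using ideal.quotient_is_ring[OF mpow_ideal] .
    show ?thesis using assms unfolding compl_carrier_def by simp
  qed
  moreover have "rcoset_mult R (ideal_pow R m (Suc k)) (x (Suc k)) (y (Suc k)) \<subseteq> rcoset_mult R (ideal_pow R m k) (x k) (y k)" for k
    using assms coset_mono[OF pow_Suc_subset[OF m_ideal]] unfolding compl_carrier_def rcoset_mult_def by fastforce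
  ultimately show ?thesis unfolding compl_carrier_def compl_mult_def by (auto simp: FactRing_def)
qed

lemma cC_const: assumes "a \<in> carrier R" shows "(\<lambda>k. ideal_pow R m k +> a) \<in> cC"
  unfolding compl_carrier_def quot_carrier using assms coset_mono[OF pow_Suc_subset[OF m_ideal]] by blast

lemma cC_one: "compl_one R m \<in> cC"
  using cC_const[OF one_closed] unfolding compl_one_def[abs_def] by (simp add: FactRing_def)

lemma compl_zero_eq: "compl_zero R m = (\<lambda>k. ideal_pow R m k)"
  unfolding compl_zero_def[abs_def] by (simp add: FactRing_def)

lemma cC_zero: "compl_zero R m \<in> cC"
proof -
  have "(\<lambda>k. ideal_pow R m k +> \<zero>) = compl_zero R m"
    unfolding compl_zero_eq using a_coset_add_zero[OF subsetI] idl_carr[OF mpow_ideal] by blast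
  thus ?thesis using cC_const[OF zero_closed] by simp
qed

lemma coset_self: "a \<in> carrier R \<Longrightarrow> a \<in> ideal_pow R m k +> a"
  using idl_zero[OF mpow_ideal] by (force simp: a_r_coset_def')

lemma coset_zero: assumes a: "a \<in> carrier R" and z: "\<zero> \<in> ideal_pow R m k +> a" shows "ideal_pow R m k +> a = ideal_pow R m k"
proof -
  obtain h where h: "h \<in> ideal_pow R m k" "\<zero> = h \<oplus> a" using z by (auto simp: a_r_coset_def')
  have "a \<in> ideal_pow R m k" using idl_cancel[OF mpow_ideal h(1)] h(2) a idl_zero[OF mpow_ideal] by simp
  thus ?thesis using a_rcos_zero[OF mpow_ideal] by blast
qed

end

text \<open>The element \<pi> q of the completion corresponds to the coset of q under the
  isomorphism, and p k q is its k-th component. The completeness axiom holds because a compatible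
  sequence of cosets is an element of the inverse limit by definition.\<close>

lemma complete_presentation_of_iso:
  assumes A: "lring A m" and Q: "lring Q n" and f: "f \<in> carrier Q" and iso: "completion A m \<simeq> (Q Quot (PIdl\<^bsub>Q\<^esub> f))"
  shows "\<exists>p. complete_presentation A m Q n f p"
proof -
  interpret A: lring A m by fact
  interpret Q: lring Q n by fact
  let ?I = "PIdl\<^bsub>Q\<^esub> f"
  let ?B = "Q Quot ?I"
  interpret I: ideal ?I Q using Q.cgenideal_ideal[OF f] .
  interpret B: ring ?B using I.quotient_is_ring .
  obtain h where h: "h \<in> ring_iso (completion A m) ?B" using iso unfolding is_ring_iso_def by blast
  have bij: "bij_betw h A.cC (carrier ?B)" using h unfolding ring_iso_def completion_def by simp
  have hom: "h \<in> ring_hom (completion A m) ?B" using h unfolding ring_iso_def by simp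
  have h_add: "h (compl_add A m x y) = h x \<oplus>\<^bsub>?B\<^esub> h y" if "x \<in> A.cC" "y \<in> A.cC" for x y
    using ring_hom_memE(3)[OF hom, of x y] that unfolding completion_def by simp
  have h_mult: "h (compl_mult A m x y) = h x \<otimes>\<^bsub>?B\<^esub> h y" if "x \<in> A.cC" "y \<in> A.cC" for x y
    using ring_hom_memE(2)[OF hom, of x y] that unfolding completion_def by simp
  have h_one: "h (compl_one A m) = \<one>\<^bsub>?B\<^esub>" using ring_hom_memE(4)[OF hom] unfolding completion_def by simp
  \<comment> \<open>The completion has not been shown to be a ring, so that zero goes to zero is
    derived from z + z = z.\<close>
  have h_zero: "h (compl_zero A m) = ?I"
  proof -
    let ?z = "compl_zero A m"
    have "compl_add A m ?z ?z = ?z"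
    proof
      fix k
      interpret S: ring "A Quot ideal_pow A m k" using ideal.quotient_is_ring[OF A.mpow_ideal] .
      show "compl_add A m ?z ?z k = ?z k" unfolding compl_add_def compl_zero_def using S.l_zero[OF S.zero_closed] .
    qed
    hence "h ?z \<oplus>\<^bsub>?B\<^esub> h ?z = h ?z" using h_add[OF A.cC_zero A.cC_zero] by simp
    moreover have "h ?z \<in> carrier ?B" using bij A.cC_zero unfolding bij_betw_def by blast
    ultimately have "h ?z = \<zero>\<^bsub>?B\<^esub>" using B.add.r_cancel_one' by metis
    thus ?thesis by (simp add: FactRing_def)
  qed
  have rc: "?I +>\<^bsub>Q\<^esub> q \<in> carrier ?B" if "q \<in> carrier Q" for q unfolding Q.quot_carrier using that by blast
  define \<pi> where "\<pi> q = inv_into A.cC h (?I +>\<^bsub>Q\<^esub> q)" for q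
  have \<pi>: "\<pi> q \<in> A.cC" "h (\<pi> q) = ?I +>\<^bsub>Q\<^esub> q" if "q \<in> carrier Q" for q
    unfolding \<pi>_def using bij rc[OF that] by (metis bij_betw_def inv_into_into, metis bij_betw_inv_into_right)
  have \<pi>I: "\<pi> q = c" if "q \<in> carrier Q" "c \<in> A.cC" "h c = ?I +>\<^bsub>Q\<^esub> q" for q c
    using \<pi>[OF that(1)] that bij unfolding bij_betw_def by (metis inj_onD)
  have hr: "((+>\<^bsub>Q\<^esub>) ?I) \<in> ring_hom Q ?B" using I.rcos_ring_hom .
  have \<pi>_add: "\<pi> (q \<oplus>\<^bsub>Q\<^esub> r) = compl_add A m (\<pi> q) (\<pi> r)" if "q \<in> carrier Q" "r \<in> carrier Q" for q r
    by (rule \<pi>I) (use that A.cC_add \<pi> h_add ring_hom_memE(3)[OF hr that] in auto)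
  have \<pi>_mult: "\<pi> (q \<otimes>\<^bsub>Q\<^esub> r) = compl_mult A m (\<pi> q) (\<pi> r)" if "q \<in> carrier Q" "r \<in> carrier Q" for q r
    by (rule \<pi>I) (use that A.cC_mult \<pi> h_mult ring_hom_memE(2)[OF hr that] in auto)
  have \<pi>_one: "\<pi> \<one>\<^bsub>Q\<^esub> = compl_one A m"
    by (rule \<pi>I) (use A.cC_one h_one ring_hom_memE(4)[OF hr] in auto)
  have \<pi>_surj: "\<exists>q\<in>carrier Q. \<pi> q = c" if c: "c \<in> A.cC" for c
  proof -
    have "h c \<in> carrier ?B" using bij c unfolding bij_betw_def by blast
    then obtain q where q: "q \<in> carrier Q" "h c = ?I +>\<^bsub>Q\<^esub> q" unfolding Q.quot_carrier by blast
    thus ?thesis using \<pi>I[OF q(1) c q(2)] by blast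
  qed
  have \<pi>k: "\<exists>a\<in>carrier A. \<pi> q k = ideal_pow A m k +>\<^bsub>A\<^esub> a" if "q \<in> carrier Q" for q k
    using \<pi>(1)[OF that] unfolding compl_carrier_def A.quot_carrier by blast
  have "complete_presentation A m Q n f (\<lambda>k q. \<pi> q k)"
  proof (intro complete_presentation.intro A Q complete_presentation_axioms.intro)
    show "f \<in> carrier Q" by (rule f)
    show "\<exists>a\<in>carrier A. \<pi> q k = ideal_pow A m k +>\<^bsub>A\<^esub> a" if "q \<in> carrier Q" for q k using \<pi>k[OF that] .
    show "\<pi> q (Suc k) \<subseteq> \<pi> q k" if "q \<in> carrier Q" for q k using \<pi>(1)[OF that] unfolding compl_carrier_def by blast
    show "a \<oplus>\<^bsub>A\<^esub> b \<in> \<pi> (q \<oplus>\<^bsub>Q\<^esub> r) k" if "q \<in> carrier Q" "r \<in> carrier Q" "a \<in> \<pi> q k" "b \<in> \<pi> r k" for q r a k b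
      unfolding \<pi>_add[OF that(1,2)] compl_add_def using that by (auto simp: FactRing_def set_add_def')
    show "a \<otimes>\<^bsub>A\<^esub> b \<in> \<pi> (q \<otimes>\<^bsub>Q\<^esub> r) k" if "q \<in> carrier Q" "r \<in> carrier Q" "a \<in> \<pi> q k" "b \<in> \<pi> r k" for q r a k b
    proof -
      have "a \<in> carrier A" "b \<in> carrier A"
        using \<pi>k[OF that(1), of k] \<pi>k[OF that(2), of k] that A.idl_carr[OF A.mpow_ideal] by (auto simp: a_r_coset_def')
      hence "a \<otimes>\<^bsub>A\<^esub> b \<in> ideal_pow A m k +>\<^bsub>A\<^esub> (a \<otimes>\<^bsub>A\<^esub> b)" using A.coset_self by simp
      thus ?thesis unfolding \<pi>_mult[OF that(1,2)] compl_mult_def using that by (auto simp: FactRing_def rcoset_mult_def)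
    qed
    show "\<one>\<^bsub>A\<^esub> \<in> \<pi> \<one>\<^bsub>Q\<^esub> k" for k unfolding \<pi>_one compl_one_def using A.coset_self[OF A.one_closed] by (simp add: FactRing_def)
    show "\<exists>q\<in>carrier Q. \<forall>k. a \<in> \<pi> q k" if a: "a \<in> carrier A" for a
    proof -
      obtain q where "q \<in> carrier Q" "\<pi> q = (\<lambda>k. ideal_pow A m k +>\<^bsub>A\<^esub> a)" using \<pi>_surj[OF A.cC_const[OF a]] by blast
      thus ?thesis using A.coset_self[OF a] by (intro bexI[of _ q]) auto
    qed
    show "(\<forall>k. \<zero>\<^bsub>A\<^esub> \<in> \<pi> q k) \<longleftrightarrow> q \<in> ?I" if q: "q \<in> carrier Q" for q
    proof
      assume z: "\<forall>k. \<zero>\<^bsub>A\<^esub> \<in> \<pi> q k"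
      have "\<pi> q k = compl_zero A m k" for k
        using \<pi>k[OF q, of k] z A.coset_zero unfolding A.compl_zero_eq by metis
      hence "\<pi> q = compl_zero A m" by blast
      hence "?I +>\<^bsub>Q\<^esub> q = ?I" using \<pi>(2)[OF q] h_zero by simp
      moreover have "q \<in> ?I +>\<^bsub>Q\<^esub> q" using I.a_rcos_self[OF q] .
      ultimately show "q \<in> ?I" by simp
    next
      assume "q \<in> ?I"
      hence "?I +>\<^bsub>Q\<^esub> q = ?I" using Q.a_rcos_zero[OF I.is_ideal] by blast
      hence "\<pi> q = compl_zero A m" using \<pi>I[OF q A.cC_zero] h_zero by simp
      thus "\<forall>k. \<zero>\<^bsub>A\<^esub> \<in> \<pi> q k" using A.idl_zero[OF A.mpow_ideal] by (simp add: A.compl_zero_eq)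
    qed
    show "\<exists>q\<in>carrier Q. \<forall>k. \<pi> q k = \<pi> (s k) k" if s: "\<And>k::nat. s k \<in> carrier Q" "\<And>k. \<pi> (s (Suc k)) k = \<pi> (s k) k" for s
    proof -
      have "(\<lambda>k. \<pi> (s k) k) \<in> A.cC"
        using \<pi>(1)[OF s(1)] s(2) unfolding compl_carrier_def by blast
      then obtain q where "q \<in> carrier Q" "\<pi> q = (\<lambda>k. \<pi> (s k) k)" using \<pi>_surj by blast
      thus ?thesis by (intro bexI[of _ q]) auto
    qed
  qed
  thus ?thesis by blast
qed

section \<open>Comparing A with Q/(f)\<close>

context complete_presentation
begin

lemma K_eq': "K k = PIdl\<^bsub>Q\<^esub> f <+>\<^bsub>Q\<^esub> np k"
  unfolding K_eq using rmodule.sum_comm[OF Q.rmodule_ring_mod, of "np k" "PIdl\<^bsub>Q\<^esub> f"] np Q.cgenideal_ideal[OF f] by simp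

text \<open>By \<open>K_eq\<close>, Q/K k is Q/((f) + n^k); \<open>qlen_K_le\<close> bounds its
  length by that of A/m^k.\<close>

lemma hs_le: "Q.hs (PIdl\<^bsub>Q\<^esub> f) k \<le> A.hs {\<zero>\<^bsub>A\<^esub>} k"
proof -
  have "quotient_length Q (ring_mod Q) (K k) (carrier Q) = enat (Q.len (K k))" using Q.qlen_fin[OF K_ideal np_sub_K] .
  moreover have "quotient_length A (ring_mod A) (mp k) (carrier A) = enat (A.len (mp k))" using A.qlen_fin[OF mp order_refl] .
  ultimately have "Q.len (K k) \<le> A.len (mp k)" using qlen_K_le[of k] by simp
  moreover have "{\<zero>\<^bsub>A\<^esub>} <+>\<^bsub>A\<^esub> mp k = mp k"
    using A.isum_least[OF mp _ order_refl, of "{\<zero>\<^bsub>A\<^esub>}" k] A.isum_ub2[OF A.zeroideal mp] A.idl_zero[OF mp] by blast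
  ultimately show ?thesis unfolding Q.hs_def A.hs_def K_eq'[symmetric] by simp
qed

text \<open>Elements of m^l lift to n^l, hence into (f), so they vanish modulo m^(l+1). Thus m^l =
  m^(l+1), and Nakayama applies.\<close>

lemma nilpotent_case:
  assumes l: "np l \<subseteq> PIdl\<^bsub>Q\<^esub> f" shows "mp l \<subseteq> {\<zero>\<^bsub>A\<^esub>}"
proof -
  interpret ra: local_rmodule A "ring_mod A" m by (rule A.local_rmodule_ring_mod)
  have i: "ideal (ideal_smult A (ring_mod A) m (mp l)) A" using ra.sub_ism[of m "mp l"] mp A.m_carr by auto
  have "mp l \<subseteq> mp (Suc l)"
  proof
    fix a assume "a \<in> mp l"
    then obtain q where q: "q \<in> np l" "\<forall>k. a \<in> p k q" using lift_pow by blast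
    have qc: "q \<in> carrier Q" using q Q.idl_carr[OF np] by blast
    have "q \<in> K (Suc l)" unfolding K_eq' using q l Q.isum_ub1[OF Q.cgenideal_ideal[OF f] np] by blast
    thus "a \<in> mp (Suc l)" using K_iff[OF qc] q(2) by blast
  qed
  also have "\<dots> \<subseteq> ideal_smult A (ring_mod A) m (mp l)"
    unfolding ideal_pow.simps(2) using A.ideal_prod_least[OF i] ra.ism_memI by simp
  also have "\<dots> \<subseteq> {\<zero>\<^bsub>A\<^esub>} <+>\<^bsub>A\<^esub> ideal_smult A (ring_mod A) m (mp l)" using A.isum_ub2[OF A.zeroideal i] .
  finally show ?thesis using ra.nakayama[of "mp l" "{\<zero>\<^bsub>A\<^esub>}"] mp A.zeroideal by simp
qed

end

text \<open>For a generating set of least size, regularity says that its size is the dimension. This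
  provides a chain of full length, from which independence follows by
  \<open>regular_indep_params\<close>.\<close>

lemma (in lring) regular_params:
  assumes "regular_local_ring R m"
  obtains S where "finite S" "S \<subseteq> carrier R" "Idl S = m" "indep_params S" "\<And>l P. coheight_ge R l P \<Longrightarrow> l \<le> card S"
proof -
  let ?P = "\<lambda>k. \<exists>S. finite S \<and> S \<subseteq> carrier R \<and> card S = k \<and> Idl S = m"
  have "\<exists>k. ?P k" using finetely_gen[OF m_ideal] by metis
  hence "?P (LEAST k. ?P k)" by (rule LeastI_ex)
  then obtain S where S: "finite S" "S \<subseteq> carrier R" "card S = (LEAST k. ?P k)" "Idl S = m" by blast
  have dim: "krull_dim R = enat (card S)" using assms S(3) unfolding regular_local_ring_def by simp
  obtain P where P: "coheight_ge R (card S) P"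
  \<comment> \<open>\<open>krull_dim_ge_iff\<close> covers positive lengths; for length 0 the prime
    m alone is a chain.\<close>
  proof (cases "card S = 0")
    case True
    thus ?thesis using that[of m] m_prime by simp
  next
    case False
    thus ?thesis using that krull_dim_ge_iff[of "card S" R] dim by auto
  qed
  have "l \<le> card S" if "coheight_ge R l P'" for l P'
    using coheight_le[OF S(1), of "{}" l P'] that S by simp
  thus ?thesis using that[OF S(1,2,4) regular_indep_params[OF S(1,2,4) P]] by blast
qed

theorem theorem1:
  fixes A :: "('a, 'e) ring_scheme" and m :: "'a set"
    and Q :: "('c, 'd) ring_scheme" and n :: "'c set" and f :: 'c
    and M :: "('a, 'b) module"
  assumes "local_ring A m"
    and "hypersurface_presentation A m Q n f"
    and "krull_dim A > 0"
    and "maximal_CM A m M"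
  shows "mono (hilbert_fn A m M)"
proof -
  have hp: "regular_local_ring Q n" "f \<in> ideal_pow Q n 2" "f \<noteq> \<zero>\<^bsub>Q\<^esub>" "completion A m \<simeq> (Q Quot (PIdl\<^bsub>Q\<^esub> f))"
    using assms(2) unfolding hypersurface_presentation_def by auto
  interpret A: lring A m using lring_of_local_ring[OF assms(1)] .
  interpret Q: lring Q n using hp(1) lring_of_local_ring unfolding regular_local_ring_def by blast
  have fn: "f \<in> n" using hp(2) Q.pow_antimono[OF Q.m_ideal, of 1 2] Q.pow_one[OF Q.m_ideal] by auto
  have fc: "f \<in> carrier Q" using Q.m_carr[OF fn] .
  obtain p where "complete_presentation A m Q n f p"
    using complete_presentation_of_iso[OF A.lring_axioms Q.lring_axioms fc hp(4)] by blast
  then interpret cp: complete_presentation A m Q n f p .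
  obtain S where S: "finite S" "S \<subseteq> carrier Q" "genideal Q S = n" "Q.indep_params S" and dim: "\<And>l P. coheight_ge Q l P \<Longrightarrow> l \<le> card S"
    using Q.regular_params[OF hp(1)] by metis
  have "2 \<le> card S"
  proof (rule ccontr)
    assume small: "\<not> 2 \<le> card S"
    note fi = Q.cgenideal_ideal[OF fc]
    interpret rq: local_rmodule Q "ring_mod Q" n by (rule Q.local_rmodule_ring_mod)
    \<comment> \<open>A prime J over f that avoids some a in n would lie strictly between n and 0,
      which is prime by independence of S. Such a chain of length 2 contradicts the bound by card
      S.\<close>
    have "\<exists>j::nat. a [^]\<^bsub>Q\<^esub> j \<in> PIdl\<^bsub>Q\<^esub> f" if a: "a \<in> n" for a
    proof (rule ccontr)
      assume "\<nexists>j::nat. a [^]\<^bsub>Q\<^esub> j \<in> PIdl\<^bsub>Q\<^esub> f"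
      moreover have "Q.isat n (PIdl\<^bsub>Q\<^esub> f) = PIdl\<^bsub>Q\<^esub> f" using rq.sat_m[of "PIdl\<^bsub>Q\<^esub> f"] fi by simp
      ultimately obtain J where J: "primeideal J Q" "PIdl\<^bsub>Q\<^esub> f \<subseteq> J" "J \<subseteq> n" "a \<notin> J"
        using Q.prime_avoiding[OF Q.m_prime fi Q.m_carr[OF a]] by auto
      have z: "primeideal {\<zero>\<^bsub>Q\<^esub>} Q" using S(4) Q.idl_empty unfolding Q.indep_params_def by (metis empty_subsetI)
      have "f \<in> J" using J(2) Q.cgenideal_self[OF fc] by blast
      hence "{\<zero>\<^bsub>Q\<^esub>} \<subset> J" using hp(3) Q.idl_zero[OF Q.prime_ideal[OF J(1)]] by blast
      moreover have "J \<subset> n" using J a by blast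
      ultimately have "coheight_ge Q (Suc (Suc 0)) {\<zero>\<^bsub>Q\<^esub>}" using z J(1) Q.m_prime by (meson coheight_ge.simps)
      thus False using dim small by fastforce
    qed
    then obtain l where "cp.np l \<subseteq> PIdl\<^bsub>Q\<^esub> f" using Q.rad_pow[OF Q.m_ideal fi] by blast
    hence nil: "cp.mp l \<subseteq> {\<zero>\<^bsub>A\<^esub>}" by (rule cp.nilpotent_case)
    have "enat 1 \<le> krull_dim A" using assms(3) by (metis One_nat_def Suc_ile_eq zero_enat_def)
    then obtain P where "coheight_ge A (Suc 0) P" using krull_dim_ge_iff[of 1 A] by auto
    then obtain P' where P: "primeideal P A" "P \<subset> P'" "primeideal P' A" by auto
    have "m \<subseteq> P" using A.prime_pow_subset[OF P(1) A.m_ideal, of l] nil A.idl_zero[OF A.prime_ideal[OF P(1)]] by blast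
    thus False using P A.prime_sub_m[OF P(3)] by blast
  qed
  then obtain c where c: "card S = Suc (Suc c)" by (metis add_2_eq_Suc le_Suc_ex)
  \<comment> \<open>Growth of Q/(f) beyond order c passes to A and forces dim A \<ge> c + 1, one
    less than the number of parameters.\<close>
  have "\<not> poly_bounded c (Q.hs (PIdl\<^bsub>Q\<^esub> f))" using Q.hypersurface_growth[OF S(4) S(3)[symmetric] c fn] .
  hence "\<not> poly_bounded c (A.hs {\<zero>\<^bsub>A\<^esub>})" using poly_bounded_mono[of c "A.hs {\<zero>\<^bsub>A\<^esub>}" "Q.hs (PIdl\<^bsub>Q\<^esub> f)"] cp.hs_le by blast
  then obtain P where "coheight_ge A (Suc c) P" using A.coheight_of_growth[OF A.zeroideal] by blast
  hence dA: "enat (Suc c) \<le> krull_dim A" using krull_dim_ge_iff[of "Suc c" A] by blast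
  have Mm: "module A M" "fin_gen_module A M" "depth A m M = krull_dim A" using assms(4) unfolding maximal_CM_def by auto
  have "enat c < depth A m M" using dA Mm(3) by (metis Suc_ile_eq)
  then obtain ys where ys: "regular_sequence A m M ys" "enat c < enat (length ys)"
    unfolding depth_def less_SUP_iff by blast
  \<comment> \<open>The depth is a supremum, so a regular sequence longer than c is picked and then
    cut to c + 1 elements, the depth that \<open>free_gens\<close> expects for c + 2
    parameters.\<close>
  define xs where "xs = take (Suc c) ys"
  have lxs: "length xs = Suc c" unfolding xs_def using ys(2) by simp
  have LM: "local_rmodule A M m"
    using Mm A.loc A.nring_axioms unfolding local_rmodule_def local_rmodule_axioms_def noeth_rmodule_def noeth_rmodule_axioms_def rmodule_def by blast
  then interpret M: local_rmodule A M m .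
  obtain G where G: "finite G" "G \<subseteq> carrier M" "gen_submodule A M G = carrier M" using Mm(2) unfolding fin_gen_module_def by blast
  obtain g where g: "G = g ` {..<card G}" using ex_bij_betw_nat_finite[OF G(1)] unfolding bij_betw_def by (metis lessThan_atLeast0)
  define r where "r = card G"
  interpret cm: complete_presentation_module A m Q n f p M g r
    by unfold_locales (use G g in \<open>auto simp: r_def\<close>)
  interpret Fr: local_rmodule Q "free_mod Q r" n by (rule cm.F_local)
  have xsm: "set xs \<subseteq> m" using ys(1) set_take_subset[of "Suc c" ys] unfolding regular_sequence_def xs_def by blast
  have rg: "M.rg (xs ! i) (ideal_smult A M (Idl\<^bsub>A\<^esub> (set (take i xs))) (carrier M))" if "i < length xs" for i
  proof -
    have "i < length ys" "xs ! i = ys ! i" "take i xs = take i ys" using that lxs ys(2) unfolding xs_def by (auto simp: min_def)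
    thus ?thesis using ys(1) unfolding regular_sequence_def M.rg_def by auto
  qed
  have U0: "ideal_smult A M {\<zero>\<^bsub>A\<^esub>} (carrier M) = {\<zero>\<^bsub>M\<^esub>}"
    using M.ism_least[OF M.sub_zero_set, of "{\<zero>\<^bsub>A\<^esub>}" "carrier M"] M.sub_zero[OF M.sub_ism[OF _ M.carrier_is_submodule, of "{\<zero>\<^bsub>A\<^esub>}"]] by auto
  \<comment> \<open>The lifting starts from the empty initial segment of xs: its ideal is 0, so the
    hypothesis on the lifted submodule is \<open>PT_zero\<close>.\<close>
  have dep: "Fr.dep (Suc c) cm.N"
    by (rule cm.dep_lift[OF cm.sub_N _ xsm rg, of 0]) (use lxs cm.PT_zero U0 A.idl_empty in auto)
  have zF: "ideal_smult Q (free_mod Q r) {\<zero>\<^bsub>Q\<^esub>} (carrier (free_mod Q r)) = {\<zero>\<^bsub>free_mod Q r\<^esub>}"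
    using Fr.ism_least[OF Fr.sub_zero_set, of "{\<zero>\<^bsub>Q\<^esub>}" "carrier (free_mod Q r)"] Fr.sub_zero[OF Fr.sub_ism[OF _ Fr.carrier_is_submodule, of "{\<zero>\<^bsub>Q\<^esub>}"]] by auto
  have nS: "n = {\<zero>\<^bsub>Q\<^esub>} <+>\<^bsub>Q\<^esub> genideal Q S"
    using Q.isum_least[OF Q.m_ideal, of "{\<zero>\<^bsub>Q\<^esub>}" n] Q.isum_ub2[OF Q.zeroideal Q.m_ideal] Q.idl_zero[OF Q.m_ideal] S(3) by auto
  have cS: "card S \<le> Suc (Suc c)" using c by simp
  have zN: "ideal_smult Q (free_mod Q r) {\<zero>\<^bsub>Q\<^esub>} (carrier (free_mod Q r)) \<subseteq> cm.N" using zF Fr.sub_zero[OF cm.sub_N] by simp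
  \<comment> \<open>With T = 0 the inclusion modulo T F is a genuine one, so N is generated by r
    vectors. They are the columns of the square matrix.\<close>
  obtain b where b: "\<forall>i<r. b i \<in> cm.N" "cm.N \<subseteq> {\<zero>\<^bsub>free_mod Q r\<^esub>} <+>\<^bsub>free_mod Q r\<^esub> gen_submodule Q (free_mod Q r) (b ` {..<r})"
    using Q.free_gens[OF Q.zeroideal S(1,2) cS nS cm.sub_N zN dep] unfolding zF by blast
  have bc: "b i \<in> carrier (free_mod Q r)" if "i < r" for i using b(1) that Fr.sub_carr[OF cm.sub_N] by blast
  have bs: "b ` {..<r} \<subseteq> carrier (free_mod Q r)" using bc by auto
  note gs = Fr.gen_sub[OF bs]
  have "cm.N \<subseteq> gen_submodule Q (free_mod Q r) (b ` {..<r})"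
    using b(2) Fr.sum_least[OF gs _ order_refl, of "{\<zero>\<^bsub>free_mod Q r\<^esub>}"] Fr.sub_zero[OF gs] by blast
  moreover have "gen_submodule Q (free_mod Q r) (b ` {..<r}) \<subseteq> cm.N" using Fr.gen_least[OF cm.sub_N, of "b ` {..<r}"] b(1) by blast
  ultimately have N: "cm.N = gen_submodule Q (free_mod Q r) (b ` {..<r})" by blast
  have "\<not> card S \<le> Suc 0" using c by simp
  then obtain x y where xy: "x \<in> S" "y \<in> S" "x \<noteq> y" using card_le_Suc0_iff_eq[OF S(1)] by blast
  have "hilbert_fn A m M k \<le> hilbert_fn A m M (Suc k)" for k
    unfolding hilbert_fn_def cm.hilbert_eq N
    using Q.hilbert_coker_mono[OF S(4) S(3)[symmetric] xy bc] .
  thus ?thesis by (simp add: mono_iff_le_Suc)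
qed

end
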